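(* Fix $u\in[0,1]$ and $\theta\in\mathbb N$ with $\theta>1$. Put $c_{\theta,u}:=1+\theta\max\{u,1-u\}$ and, for real $m>2c_{\theta,u}$, $$T_{\theta,u}(m):=\frac{\theta\log\theta}{(\theta-1)\bigl(\frac m2-c_{\theta,u}\bigr)}.$$ (i) (Random regular graphs) Let $d\ge3$ be an integer and let $G_n$ be the uniformly random simple $d$-regular graph on $[n]$, with law $p_{d,n}$. If $d>2c_{\theta,u}$, then for every $\delta>0$ there exist $\eta>0$ and $c>0$ such that for every $t\ge T_{\theta,u}(d)+\delta$, $$p_{d,n}\left(\mathbb P^{G_n}_{\theta,t,u}(A_\eta)\ge c\right)\xrightarrow[n\to\infty]{}1.$$ (ii) (Sparse Erdős–Rényi graphs) Let $\lambda>0$ and $G_n\sim G(n,\lambda/n)$. If $\lambda>2c_{\theta,u}$, then for every $\delta>0$ there exist $\eta>0$ and $c>0$ such that for every $t\ge T_{\theta,u}(\lambda)+\delta$, $$\mathbb P\left(\mathbb P^{G_n}_{\theta,t,u}(A_\eta)\ge c\right)\xrightarrow[n\to\infty]{}1.$$ (iii) (Simple bounded-degree configuration model) Let $G_n$ be the simple graph obtained from the configuration model with deterministic degree sequence $(d_i^{(n)})_{i=1}^n$. Assume that there is $\Delta$ with $1\le d_i^{(n)}\le\Delta$ for all $i,n$, and that $\frac1n\sum_{i=1}^n d_i^{(n)}\to\rho$. If $\rho>2c_{\theta,u}$, then for every $\delta>0$ there exist $\eta>0$ and $c>0$ such that for every $t\ge T_{\theta,u}(\rho)+\delta$, $$\mathbb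 P\left(\mathbb P^{G_n}_{\theta,t,u}(A_\eta)\ge c\right)\xrightarrow[n\to\infty]{}1.$$
   Context: Random graph ensembles on $[n]=\{1,\dots,n\}$. The random $d$-regular graph is uniform among simple graphs on $[n]$ with all degrees equal to $d$ (only $n$ with $nd$ even are considered). In $G(n,\lambda/n)$ each edge $\{i,j\}$, $i<j$, is present independently with probability $\lambda/n$. In the configuration model with deterministic degree sequence $(d_i^{(n)})_{i=1}^n$ of even total degree, one attaches $d_i^{(n)}$ half-edges to vertex $i$ and chooses a uniformly random pairing of all half-edges, giving a random multigraph $\widetilde G_n$ (self-loops and multiple edges allowed); the simple graph $G_n$ has the law of $\widetilde G_n$ conditioned on being simple. $\mathbb P$ denotes the law of the random graph. Random loop model. Let $G=(V,E)$ be a finite simple graph with $|V|=n$, and $S^1=\mathbb R/\mathbb Z$. For $t\ge0$ and $u\in[0,1]$, let $\omega=(\omega_e)_{e\in E}$ be independent marked Poisson point processes on $S^1\times\{\times,\mid\}$ with intensity measure $t\,\mathrm ds\otimes(u\,\delta_\times+(1-u)\,\delta_\mid)$; the law of $\omega$ is $\rho^G_{t,u}$. A point $(s,\times)\in\omega_e$ is a cross, and a point $(s,\mid)\in\omega_e$ a bar, on the edge $e$ at time $s$. Almost surely there are finitely many marks, at distinct times. Loops: a particle moves in $G\times S^1\times\{-1,+1\}$, the third coordinate being its vertical direction. Between marks it moves vertically (in the $S^1$ coordinate) at unit speed in its current direction; when at vertex $x$ it meets a mark on an edge $\{x,y\}$, it jumps instantaneously from $x$ to $y$, keeping its direction if the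 mark is a cross and reversing it if the mark is a bar. All trajectories are closed; the resulting closed trajectories, regarded as (unoriented) subsets of $V\times S^1$, are the loops. $\mathcal L(\omega)$ is the set of loops and $\lambda(\omega)=|\mathcal L(\omega)|$. For a loop $\gamma$, $\operatorname{supp}_V(\gamma)=\{x\in V:\exists s\in S^1,\ (x,s)\in\gamma\}$. For $\theta>0$, the weighted measure is $\mathbb P^G_{\theta,t,u}(\mathrm d\omega)=Z_G(\theta,t,u)^{-1}\theta^{\lambda(\omega)}\rho^G_{t,u}(\mathrm d\omega)$ with $Z_G(\theta,t,u)=\int\theta^{\lambda(\omega)}\rho^G_{t,u}(\mathrm d\omega)$. For $\eta>0$, $A_\eta=\{\exists\gamma\in\mathcal L(\omega):|\operatorname{supp}_V(\gamma)|>\eta n\}$. For a random graph $G_n$, $\mathbb P^{G_n}_{\theta,t,u}$ is the loop measure conditional on $G_n$, so $\mathbb P^{G_n}_{\theta,t,u}(A_\eta)$ is a random variable depending on $G_n$. *)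

theory Defs
  imports "HOL-Probability.Probability" "HOL-Library.Multiset" "HOL-Library.Disjoint_Sets"
begin

section \<open>Poisson point processes with finite intensity\<close>

definition poisson_law :: "real \<Rightarrow> nat measure" where
  "poisson_law c = density (count_space UNIV) (\<lambda>k. ennreal (c ^ k / fact k * exp (- c)))"

text \<open>Sample space carrying a Poisson point process of intensity \<open>c \<cdot> P\<close>, for a probability measure
  \<open>P\<close> and \<open>c \<ge> 0\<close>: in a sample \<open>(k, x)\<close> the points are \<open>x 0, \<dots>, x (k - 1)\<close>, where \<open>k\<close> is
  Poisson and the \<open>x i\<close> are i.i.d. with law \<open>P\<close>.  That the numbers of points in the cells of a
  measurable partition are independent Poisson variables is \<open>poisson_space_counts\<close> below.\<close>

definition poisson_space :: "real \<Rightarrow> 'a measure \<Rightarrow> (nat \<times> (nat \<Rightarrow> 'a)) measure" where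
  "poisson_space c P = poisson_law c \<Otimes>\<^sub>M PiM UNIV (\<lambda>_. P)"

definition points :: "nat \<times> (nat \<Rightarrow> 'a) \<Rightarrow> 'a set" where
  "points = (\<lambda>(k, x). x ` {..<k})"

lemma prob_space_poisson_law:
  assumes "0 \<le> c"
  shows "prob_space (poisson_law c)"
proof
  have "(\<lambda>k. c ^ k / fact k * exp (- c)) sums (exp c * exp (- c))"
    using exp_converges[of c] by (intro sums_mult2) (simp add: field_simps)
  then have "(\<Sum>k. ennreal (c ^ k / fact k * exp (- c))) = ennreal (exp c * exp (- c))"
    using assms by (intro suminf_ennreal_eq) auto
  then show "emeasure (poisson_law c) (space (poisson_law c)) = 1"
    by (simp add: poisson_law_def emeasure_density nn_integral_count_space_nat exp_minus)
qed

lemma measure_pair_measure_Times: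
  assumes "sigma_finite_measure N" "A \<in> sets M" "B \<in> sets N"
  shows "measure (M \<Otimes>\<^sub>M N) (A \<times> B) = measure M A * measure N B"
  using assms by (simp add: measure_def sigma_finite_measure.emeasure_pair_measure_Times enn2real_mult)

lemma multinomial_recurrence:
  fixes m :: "'j \<Rightarrow> nat" and p :: "'j \<Rightarrow> real"
  assumes J: "finite J"
  shows "(\<Sum>j\<in>{j\<in>J. 0 < m j}. p j * (if sum (m(j := m j - 1)) J = k
      then fact k * (\<Prod>i\<in>J. p i ^ (m(j := m j - 1)) i / fact ((m(j := m j - 1)) i)) else 0)) =
    (if sum m J = Suc k then fact (Suc k) * (\<Prod>i\<in>J. p i ^ m i / fact (m i)) else 0)"
proof -
  let ?Q = "\<Prod>i\<in>J. p i ^ m i / fact (m i)"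
  have "(\<Sum>j\<in>{j\<in>J. 0 < m j}. p j * (if sum (m(j := m j - 1)) J = k
      then fact k * (\<Prod>i\<in>J. p i ^ (m(j := m j - 1)) i / fact ((m(j := m j - 1)) i)) else 0)) =
    (\<Sum>j\<in>{j\<in>J. 0 < m j}. if sum m J = Suc k then fact k * (real (m j) * ?Q) else 0)"
  proof (rule sum.cong[OF refl])
    fix j assume "j \<in> {j\<in>J. 0 < m j}"
    then have j: "j \<in> J" "0 < m j" by auto
    then obtain r where r: "m j = Suc r" by (cases "m j") auto
    have s: "sum (m(j := m j - 1)) J + 1 = sum m J"
      using j J r by (simp add: sum.remove[of J j] fun_upd_def)
    have q: "?Q = p j ^ m j / fact (m j) * (\<Prod>i\<in>J - {j}. p i ^ m i / fact (m i))"
      using j J by (simp add: prod.remove[of J j])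
    have "(\<Prod>i\<in>J. p i ^ (m(j := m j - 1)) i / fact ((m(j := m j - 1)) i)) =
        p j ^ r / fact r * (\<Prod>i\<in>J - {j}. p i ^ m i / fact (m i))"
      using j J r by (subst prod.remove[of J j]) (auto intro!: prod.cong)
    then have "p j * (\<Prod>i\<in>J. p i ^ (m(j := m j - 1)) i / fact ((m(j := m j - 1)) i)) =
        real (m j) * ?Q"
      unfolding q by (simp add: r field_simps del: of_nat_Suc)
    then show "p j * (if sum (m(j := m j - 1)) J = k
        then fact k * (\<Prod>i\<in>J. p i ^ (m(j := m j - 1)) i / fact ((m(j := m j - 1)) i)) else 0) =
      (if sum m J = Suc k then fact k * (real (m j) * ?Q) else 0)"
      using s by (auto simp: mult.left_commute)
  qed
  also have "\<dots> = (if sum m J = Suc k then fact k * (real (sum m {j\<in>J. 0 < m j}) * ?Q) else 0)"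
    by (auto simp: sum_distrib_left sum_distrib_right)
  also have "sum m {j\<in>J. 0 < m j} = sum m J"
    using J by (intro sum.mono_neutral_left) auto
  finally show ?thesis by (simp add: mult.assoc)
qed

text \<open>The multinomial law of the occupation numbers of \<open>k\<close> i.i.d. points.\<close>

lemma multinomial_counts:
  fixes B :: "'j \<Rightarrow> 'a set" and m :: "'j \<Rightarrow> nat"
  assumes P: "prob_space P" and J: "finite J"
    and B: "\<And>j. j \<in> J \<Longrightarrow> B j \<in> sets P" and disj: "disjoint_family_on B J"
    and cover: "(\<Union>j\<in>J. B j) = space P"
  defines "S \<equiv> PiM UNIV (\<lambda>_::nat. P)"
  shows "{x \<in> space S. \<forall>j\<in>J. card {i. i < k \<and> x i \<in> B j} = m j} \<in> sets S"
    and "measure S {x \<in> space S. \<forall>j\<in>J. card {i. i < k \<and> x i \<in> B j} = m j} =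
      (if sum m J = k then fact k * (\<Prod>j\<in>J. measure P (B j) ^ m j / fact (m j)) else 0)"
proof -
  interpret P: prob_space P by fact
  interpret SS: sequence_space P by unfold_locales
  have pS: "prob_space S" unfolding S_def by unfold_locales
  then interpret S: prob_space S .
  interpret PS: pair_prob_space P S by unfold_locales
  have meas: "{x \<in> space S. \<forall>j\<in>J. card {i. i < k \<and> x i \<in> B j} = m j} \<in> sets S" for k m
  proof -
    have "Measurable.pred S (\<lambda>x. x i \<in> B j)" if "j \<in> J" for i j
      unfolding S_def using B[OF that] by measurable
    then have "(\<lambda>x. \<Sum>i<k. if x i \<in> B j then 1 else 0 :: nat) \<in> measurable S (count_space UNIV)"
      if "j \<in> J" for j using that by measurable
    moreover have "card {i. i < k \<and> x i \<in> B j} = (\<Sum>i<k. if x i \<in> B j then 1 else 0)"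
      for j and x :: "nat \<Rightarrow> 'a"
      by (simp add: sum.If_cases Int_def)
    ultimately show ?thesis using J by simp
  qed
  show "{x \<in> space S. \<forall>j\<in>J. card {i. i < k \<and> x i \<in> B j} = m j} \<in> sets S" by (rule meas)
  show "measure S {x \<in> space S. \<forall>j\<in>J. card {i. i < k \<and> x i \<in> B j} = m j} =
      (if sum m J = k then fact k * (\<Prod>j\<in>J. measure P (B j) ^ m j / fact (m j)) else 0)"
  proof (induction k arbitrary: m)
    case 0
    have "{x \<in> space S. \<forall>j\<in>J. card {i. i < 0 \<and> x i \<in> B j} = m j} =
        (if sum m J = 0 then space S else {})"
      using J by (auto simp: sum_eq_0_iff)
    moreover have "(\<Prod>j\<in>J. measure P (B j) ^ m j / fact (m j)) = 1" if "sum m J = 0"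
      using J that by (auto intro!: prod.neutral)
    ultimately show ?case by (simp add: S.prob_space)
  next
    case (Suc k)
    let ?A = "\<lambda>k m. {x \<in> space S. \<forall>j\<in>J. card {i. i < k \<and> x i \<in> B j} = m j}"
    let ?R = "\<lambda>j. B j \<times> ?A k (m(j := m j - 1))"
    let ?f = "\<lambda>(s, w). case_nat s w"
    have f: "?f \<in> measurable (P \<Otimes>\<^sub>M S) S" unfolding S_def by measurable
    have count: "card {i. i < Suc k \<and> case_nat s w i \<in> B j} =
        (if s \<in> B j then 1 else 0) + card {i. i < k \<and> w i \<in> B j}" for s w j
    proof -
      have "{i. i < Suc k \<and> case_nat s w i \<in> B j} =
          (if s \<in> B j then {0} else {}) \<union> Suc ` {i. i < k \<and> w i \<in> B j}"
        by (auto simp: less_Suc_eq_0_disj)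
      moreover have "card (Suc ` {i. i < k \<and> w i \<in> B j}) = card {i. i < k \<and> w i \<in> B j}"
        by (rule card_image) simp
      ultimately show ?thesis by (auto simp: card_insert_if)
    qed
    have eq: "?f -` ?A (Suc k) m \<inter> space (P \<Otimes>\<^sub>M S) = (\<Union>j\<in>{j\<in>J. 0 < m j}. ?R j)"
    proof -
      have "(s, w) \<in> ?f -` ?A (Suc k) m \<inter> space (P \<Otimes>\<^sub>M S) \<longleftrightarrow>
          (\<exists>j\<in>{j\<in>J. 0 < m j}. (s, w) \<in> ?R j)" for s w
      proof (cases "s \<in> space P \<and> w \<in> space S")
        case True
        then obtain j where j: "j \<in> J" "s \<in> B j" using cover by auto
        have o: "s \<in> B i \<longleftrightarrow> i = j" if "i \<in> J" for i
          using disj j that by (auto simp: disjoint_family_on_def)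
        have sp: "case_nat s w \<in> space S"
          using measurable_space[OF f, of "(s, w)"] True by (simp add: space_pair_measure)
        have "(s, w) \<in> ?f -` ?A (Suc k) m \<inter> space (P \<Otimes>\<^sub>M S) \<longleftrightarrow>
            (\<forall>l\<in>J. (if l = j then 1 else 0) + card {i. i < k \<and> w i \<in> B l} = m l)"
          using True sp o by (simp add: space_pair_measure count cong: if_cong ball_cong)
        also have "\<dots> \<longleftrightarrow> 0 < m j \<and> (\<forall>l\<in>J. card {i. i < k \<and> w i \<in> B l} = (m(j := m j - 1)) l)"
          using j by (intro iffI conjI ballI) (auto split: if_splits)
        also have "\<dots> \<longleftrightarrow> (\<exists>j\<in>{j\<in>J. 0 < m j}. (s, w) \<in> ?R j)"
          using True j o by blast
        finally show ?thesis .
      next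
        case False
        then show ?thesis
          using B[THEN sets.sets_into_space] by (auto simp: space_pair_measure)
      qed
      then show ?thesis unfolding set_eq_iff split_paired_All UN_iff by blast
    qed
    have "measure S (?A (Suc k) m) = measure (distr (P \<Otimes>\<^sub>M S) S ?f) (?A (Suc k) m)"
      using SS.PiM_iter by (simp add: S_def)
    also have "\<dots> = measure (P \<Otimes>\<^sub>M S) (\<Union>j\<in>{j\<in>J. 0 < m j}. ?R j)"
      by (subst measure_distr[OF f meas]) (simp only: eq)
    also have "\<dots> = (\<Sum>j\<in>{j\<in>J. 0 < m j}. measure (P \<Otimes>\<^sub>M S) (?R j))"
    proof (rule PS.P.finite_measure_finite_Union)
      show "finite {j\<in>J. 0 < m j}" using J by simp
      show "?R ` {j\<in>J. 0 < m j} \<subseteq> sets (P \<Otimes>\<^sub>M S)"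
        by (intro image_subsetI pair_measureI B meas) simp
      show "disjoint_family_on ?R {j\<in>J. 0 < m j}"
        using disj unfolding disjoint_family_on_def by blast
    qed
    also have "\<dots> = (\<Sum>j\<in>{j\<in>J. 0 < m j}. measure P (B j) * measure S (?A k (m(j := m j - 1))))"
      by (intro sum.cong refl B meas
          measure_pair_measure_Times[OF prob_space_imp_sigma_finite[OF pS]]) simp
    also have "\<dots> = (if sum m J = Suc k
        then fact (Suc k) * (\<Prod>j\<in>J. measure P (B j) ^ m j / fact (m j)) else 0)"
      unfolding Suc.IH by (rule multinomial_recurrence[OF J])
    finally show ?case .
  qed
qed

lemma poisson_space_counts:
  fixes B :: "'j \<Rightarrow> 'a set" and m :: "'j \<Rightarrow> nat"
  assumes P: "prob_space P" and c: "0 \<le> c" and J: "finite J"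
    and B: "\<And>j. j \<in> J \<Longrightarrow> B j \<in> sets P" and disj: "disjoint_family_on B J"
    and cover: "(\<Union>j\<in>J. B j) = space P"
  shows "measure (poisson_space c P)
      {(k, x) \<in> space (poisson_space c P). \<forall>j\<in>J. card {i. i < k \<and> x i \<in> B j} = m j} =
    (\<Prod>j\<in>J. (c * measure P (B j)) ^ m j / fact (m j) * exp (- (c * measure P (B j))))"
proof -
  interpret P: prob_space P by fact
  let ?S = "PiM UNIV (\<lambda>_::nat. P)"
  interpret SS: sequence_space P by unfold_locales
  have pS: "prob_space ?S" by unfold_locales
  then interpret S: prob_space ?S .
  interpret L: prob_space "poisson_law c" by (rule prob_space_poisson_law[OF c])
  interpret LS: pair_prob_space "poisson_law c" ?S by unfold_locales
  let ?A = "\<lambda>k. {x \<in> space ?S. \<forall>j\<in>J. card {i. i < k \<and> x i \<in> B j} = m j}"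
  let ?E = "{(k, x) \<in> space (poisson_space c P). \<forall>j\<in>J. card {i. i < k \<and> x i \<in> B j} = m j}"
  let ?K = "sum m J"
  have sets_L: "sets (poisson_law c) = UNIV" by (simp add: poisson_law_def)
  have space_L: "space (poisson_law c) = UNIV" by (simp add: poisson_law_def)
  note A = multinomial_counts[OF P J B disj cover]
  have empty: "measure ?S (?A k) = 0" if "k \<noteq> ?K" for k
    using that by (subst A(2)) auto
  have "?E = (\<Union>k. {k} \<times> ?A k)"
    by (auto simp: poisson_space_def space_pair_measure space_L)
  then have "measure (poisson_space c P) ?E = measure (poisson_law c \<Otimes>\<^sub>M ?S) (\<Union>k. {k} \<times> ?A k)"
    by (simp add: poisson_space_def)
  also have "\<dots> = (\<Sum>k. measure (poisson_law c \<Otimes>\<^sub>M ?S) ({k} \<times> ?A k))"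
    using A(1)
    by (intro sums_unique LS.P.finite_measure_UNION) (auto simp: disjoint_family_on_def sets_L)
  also have "\<dots> = (\<Sum>k. measure (poisson_law c) {k} * measure ?S (?A k))"
    using A(1)
    by (intro suminf_cong measure_pair_measure_Times[OF prob_space_imp_sigma_finite[OF pS]])
      (auto simp: sets_L)
  also have "\<dots> = (\<Sum>k\<in>{?K}. measure (poisson_law c) {k} * measure ?S (?A k))"
    by (intro suminf_finite) (auto simp: empty)
  also have "\<dots> = c ^ ?K / fact ?K * exp (- c) *
      (fact ?K * (\<Prod>j\<in>J. measure P (B j) ^ m j / fact (m j)))"
    using A(2)[of ?K m] c
    by (simp add: poisson_law_def measure_def emeasure_density nn_integral_indicator_singleton)
  also have "\<dots> = (\<Prod>j\<in>J. c ^ m j * (measure P (B j) ^ m j / fact (m j))) * exp (- c)"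
    by (simp add: power_sum flip: prod.distrib)
  also have "exp (- c) = (\<Prod>j\<in>J. exp (- (c * measure P (B j))))"
  proof -
    have "(\<Sum>j\<in>J. measure P (B j)) = measure P (\<Union>j\<in>J. B j)"
      using J B disj by (intro P.finite_measure_finite_Union[symmetric]) auto
    then have "(\<Sum>j\<in>J. - (c * measure P (B j))) = - c"
      by (simp add: cover P.prob_space sum_negf flip: sum_distrib_left)
    then show ?thesis using J by (metis exp_sum)
  qed
  finally show ?thesis by (simp add: prod.distrib[symmetric] power_mult_distrib mult.assoc)
qed

section \<open>The random loop model on a finite simple graph\<close>

text \<open>A graph is given by its vertex set \<open>V\<close> and its edge set \<open>E\<close>, whose elements are two-element
  subsets of \<open>V\<close>.  The circle \<open>\<real>/\<int>\<close> is represented by \<open>{0..<1}\<close>.\<close>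

datatype mark = Cross | Bar

type_synonym 'v config = "'v set \<Rightarrow> (real \<times> mark) set"

text \<open>The mark intensity of an edge is \<open>t \<cdot> mark_law u\<close>.\<close>

definition mark_law :: "real \<Rightarrow> (real \<times> mark) measure" where
  "mark_law u = uniform_measure lborel {0..<1} \<Otimes>\<^sub>M
     measure_pmf (map_pmf (\<lambda>b. if b then Cross else Bar) (bernoulli_pmf u))"

type_synonym 'v sample = "'v set \<Rightarrow> nat \<times> (nat \<Rightarrow> real \<times> mark)"

text \<open>Completing the measure makes the choice of conventions for the null set of configurations
  with coinciding mark times irrelevant for measurability.\<close>

definition rho :: "'v set set \<Rightarrow> real \<Rightarrow> real \<Rightarrow> 'v sample measure" where
  "rho E t u = completion (PiM E (\<lambda>_. poisson_space t (mark_law u)))"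

definition config_of :: "'v sample \<Rightarrow> 'v config" where
  "config_of w = (\<lambda>e. points (w e))"

definition marked :: "'v set set \<Rightarrow> 'v config \<Rightarrow> 'v \<Rightarrow> real \<Rightarrow> bool" where
  "marked E \<omega> x s \<longleftrightarrow> (\<exists>e\<in>E. x \<in> e \<and> (\<exists>a. (s, a) \<in> \<omega> e))"

text \<open>A state \<open>(x, s, \<sigma>)\<close> is a particle at \<open>(x, s)\<close> about to move vertically in direction
  \<open>\<sigma> \<in> {-1, 1}\<close>; if \<open>s\<close> is the time of a mark at \<open>x\<close>, the jump has already taken place.  One step
  is a vertical motion of some duration \<open>r\<close> during which no mark is met, except possibly at its
  end, in which case the step includes the jump.\<close>

definition particle_step ::
    "'v set set \<Rightarrow> 'v config \<Rightarrow> 'v \<times> real \<times> real \<Rightarrow> 'v \<times> real \<times> real \<Rightarrow> bool" where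
  "particle_step E \<omega> = (\<lambda>(x, s, \<sigma>) (y, s', \<sigma>'). \<exists>r>0.
     s' = frac (s + \<sigma> * r) \<and>
     (\<forall>q. 0 < q \<and> q < r \<longrightarrow> \<not> marked E \<omega> x (frac (s + \<sigma> * q))) \<and>
     (if marked E \<omega> x s'
      then {x, y} \<in> E \<and>
        ((s', Cross) \<in> \<omega> {x, y} \<and> \<sigma>' = \<sigma> \<or> (s', Bar) \<in> \<omega> {x, y} \<and> \<sigma>' = - \<sigma>)
      else y = x \<and> \<sigma>' = \<sigma>))"

text \<open>The set of points visited by a trajectory.  At a jump from \<open>x\<close> to \<open>y\<close> at time \<open>s\<close> both
  \<open>(x, s)\<close> and \<open>(y, s)\<close> are included, so that a trajectory and its reversal give the same set.
  Trajectories are closed, so the forward trajectory visits the whole loop.\<close>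

definition loop_from :: "'v set set \<Rightarrow> 'v config \<Rightarrow> 'v \<times> real \<times> real \<Rightarrow> ('v \<times> real) set" where
  "loop_from E \<omega> a = {(z, s'). \<exists>x s \<sigma> y \<sigma>'. (particle_step E \<omega>)\<^sup>*\<^sup>* a (x, s, \<sigma>) \<and>
     particle_step E \<omega> (x, s, \<sigma>) (y, s', \<sigma>') \<and> z \<in> {x, y}}"

definition loops :: "'v set \<Rightarrow> 'v set set \<Rightarrow> 'v config \<Rightarrow> ('v \<times> real) set set" where
  "loops V E \<omega> = loop_from E \<omega> ` (V \<times> {0..<1} \<times> {-1, 1})"

definition num_loops :: "'v set \<Rightarrow> 'v set set \<Rightarrow> 'v config \<Rightarrow> nat" where
  "num_loops V E \<omega> = card (loops V E \<omega>)"

definition supp_V :: "('v \<times> real) set \<Rightarrow> 'v set" where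
  "supp_V \<gamma> = {x. \<exists>s. (x, s) \<in> \<gamma>}"

definition partition_function :: "'v set \<Rightarrow> 'v set set \<Rightarrow> real \<Rightarrow> real \<Rightarrow> real \<Rightarrow> real" where
  "partition_function V E \<theta> t u = (\<integral>w. \<theta> ^ num_loops V E (config_of w) \<partial>rho E t u)"

definition loop_measure ::
    "'v set \<Rightarrow> 'v set set \<Rightarrow> real \<Rightarrow> real \<Rightarrow> real \<Rightarrow> 'v sample measure" where
  "loop_measure V E \<theta> t u = density (rho E t u)
     (\<lambda>w. ennreal (\<theta> ^ num_loops V E (config_of w) / partition_function V E \<theta> t u))"

definition large_loop_event ::
    "'v set \<Rightarrow> 'v set set \<Rightarrow> real \<Rightarrow> 'v config set" where
  "large_loop_event V E \<eta> =
     {\<omega>. \<exists>\<gamma>\<in>loops V E \<omega>. real (card (supp_V \<gamma>)) > \<eta> * real (card V)}"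

definition large_loop_prob ::
    "'v set \<Rightarrow> 'v set set \<Rightarrow> real \<Rightarrow> real \<Rightarrow> real \<Rightarrow> real \<Rightarrow> real" where
  "large_loop_prob V E \<theta> t u \<eta> = measure (loop_measure V E \<theta> t u)
     {w \<in> space (loop_measure V E \<theta> t u). config_of w \<in> large_loop_event V E \<eta>}"

section \<open>Random graphs on \<open>{1..n}\<close>, given by their edge sets\<close>

definition all_edges :: "nat \<Rightarrow> nat set set" where
  "all_edges n = {e. e \<subseteq> {1..n} \<and> card e = 2}"

definition regular_graphs :: "nat \<Rightarrow> nat \<Rightarrow> nat set set set" where
  "regular_graphs d n = {E. E \<subseteq> all_edges n \<and> (\<forall>i\<in>{1..n}. card {e\<in>E. i \<in> e} = d)}"

text \<open>Only meaningful if \<open>regular_graphs d n\<close> is nonempty, i.e. \<open>d < n\<close> and \<open>n d\<close> is even.\<close>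

definition random_regular :: "nat \<Rightarrow> nat \<Rightarrow> nat set set pmf" where
  "random_regular d n = pmf_of_set (regular_graphs d n)"

definition erdos_renyi :: "nat \<Rightarrow> real \<Rightarrow> nat set set pmf" where
  "erdos_renyi n p = map_pmf (\<lambda>f. {e \<in> all_edges n. f e})
     (Pi_pmf (all_edges n) False (\<lambda>_. bernoulli_pmf p))"

definition half_edges :: "nat \<Rightarrow> (nat \<Rightarrow> nat) \<Rightarrow> (nat \<times> nat) set" where
  "half_edges n d = (SIGMA i:{1..n}. {..<d i})"

definition pairings :: "'h set \<Rightarrow> 'h set set set" where
  "pairings H = {M. partition_on H M \<and> (\<forall>p\<in>M. card p = 2)}"

text \<open>A multigraph is a multiset of edges; a self-loop at \<open>i\<close> is the edge \<open>{i}\<close>.\<close>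

definition configuration_multigraph :: "nat \<Rightarrow> (nat \<Rightarrow> nat) \<Rightarrow> nat set multiset pmf" where
  "configuration_multigraph n d = map_pmf (\<lambda>M. image_mset (\<lambda>p. fst ` p) (mset_set M))
     (pmf_of_set (pairings (half_edges n d)))"

definition simple_multigraph :: "nat set multiset \<Rightarrow> bool" where
  "simple_multigraph G \<longleftrightarrow> (\<forall>e\<in>#G. card e = 2 \<and> count G e = 1)"

text \<open>Only meaningful if the multigraph is simple with positive probability; for degrees bounded
  between \<open>1\<close> and a constant and with even sum this holds for all large \<open>n\<close>.\<close>

definition simple_configuration_graph :: "nat \<Rightarrow> (nat \<Rightarrow> nat) \<Rightarrow> nat set set pmf" where
  "simple_configuration_graph n d =
     map_pmf set_mset (cond_pmf (configuration_multigraph n d) {G. simple_multigraph G})"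

definition c_const :: "real \<Rightarrow> real \<Rightarrow> real" where
  "c_const \<theta> u = 1 + \<theta> * max u (1 - u)"

definition T_bound :: "real \<Rightarrow> real \<Rightarrow> real \<Rightarrow> real" where
  "T_bound \<theta> u m = \<theta> * ln \<theta> / ((\<theta> - 1) * (m / 2 - c_const \<theta> u))"

end

theory Submission
  imports Defs
begin

text \<open>
  Write \<open>q\<close> for the integer weight \<open>\<theta>\<close>, \<open>n\<close> for the number of vertices and \<open>c = 1 + q max u (1 - u)\<close>.

  \<^emph>\<open>Colourings.\<close>  The marks of a configuration, read in the order of their times, form a word.  They
  cut the lines of \<open>V \<times> S\<^sup>1\<close> into arcs, and the loops are the classes of arcs generated by the
  links at the marks.  Hence \<open>q\<close> to the number of loops counts the \<open>q\<close>-colourings of the arcs that are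
  constant on loops.  Read level by level, such a colouring is a closed walk through the
  colourings of \<open>V\<close>, and the sum over all words yields \<open>Z = exp (- t |E|) Tr exp (t H)\<close> for a
  symmetric matrix \<open>H\<close> with nonnegative entries: the sum over the edges and both kinds of marks of the
  matrix of the mark times its probability (\<open>power_num_loops\<close>, \<open>sum_word_trace\<close>, \<open>nn_integral_word\<close>).

  \<^emph>\<open>Convexity.\<close>  Since \<open>H\<close> is symmetric, \<open>ln (Tr exp (t H))\<close> is convex in \<open>t\<close> by the
  Cauchy-Schwarz inequality, so its tangent at \<open>t\<close> lies below its value \<open>n ln q\<close> at \<open>0\<close>.  Together with
  \<open>Z \<ge> 1\<close> this gives \<open>t Tr (H exp (t H)) / Tr exp (t H) \<ge> t |E| - n ln q\<close> for every single \<open>t > 0\<close>, not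
  just on average over an interval of times.

  \<^emph>\<open>Adding a mark.\<close>  The quotient \<open>Tr (H exp (t H)) / Tr exp (t H)\<close> is the expectation, under the
  weighted measure, of the sum over the edges \<open>e\<close> of the mean factor by which an extra mark on \<open>e\<close> at
  time \<open>0\<close> changes the weight.  If the two ends of \<open>e\<close> at time \<open>0\<close> lie on different loops, the mark
  merges them and the factor is \<open>1 / q\<close>.  If they lie on the same loop, only one of the two kinds of
  marks can split it, and the mean factor is at most \<open>1 / q + (1 - 1 / q) c\<close> (\<open>add_mark\<close>,
  \<open>mark_sum_bound\<close>).  Therefore \<open>(1 - 1 / q) |E| - n ln q / t\<close> is at most \<open>(1 - 1 / q) c\<close> times the
  expected number of edges whose ends are on one loop.

  \<^emph>\<open>Sparsity.\<close>  Suppose that every set of at most \<open>\<eta> n\<close> vertices spans at most \<open>1 + \<epsilon>\<close> times as many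
  edges as it has vertices.  If no loop visits more than \<open>\<eta> n\<close> vertices, the loops partition
  \<open>V \<times> {0}\<close> into such sets, and at most \<open>(1 + \<epsilon>) n\<close> edges have both ends on one loop.  If the graph
  has about \<open>m n / 2\<close> edges and \<open>t\<close> exceeds the threshold, this contradicts the preceding bound
  unless large loops have a probability bounded away from \<open>0\<close> (\<open>large_loop_bound\<close>,
  \<open>large_loop_prob_lower_bound\<close>).

  \<^emph>\<open>Random graphs.\<close>  A first moment computation shows that a random graph is sparse in this sense with
  high probability as soon as a given set \<open>F\<close> of at most a small constant times \<open>n\<close> edges is contained
  in it with probability at most \<open>(C / n)\<close> to the power \<open>|F|\<close> (\<open>prob_dense_subset\<close>).  For \<open>G(n, \<lambda>/n)\<close>
  this is independence.  For regular graphs and the configuration model it follows from switchings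
  (\<open>switching_step\<close>), carried out once for graphs on a set of points projected to the vertices, which
  covers both ensembles.  The number of edges is deterministic in these two and concentrated
  in \<open>G(n, \<lambda>/n)\<close>.
\<close>

section \<open>Colourings of a finite graph\<close>

definition conn :: "'a set \<Rightarrow> ('a \<times> 'a) set \<Rightarrow> ('a \<times> 'a) set" where
  "conn A R = {(a, b). a \<in> A \<and> b \<in> A \<and> (a, b) \<in> (R \<union> R\<inverse>)\<^sup>*}"

definition colourings :: "nat \<Rightarrow> 'a set \<Rightarrow> ('a \<times> 'a) set \<Rightarrow> ('a \<Rightarrow> nat) set" where
  "colourings q A R = {f \<in> A \<rightarrow>\<^sub>E {..<q}. \<forall>(a, b)\<in>R. f a = f b}"

lemma finite_colourings: "finite A \<Longrightarrow> finite (colourings q A R)"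
  unfolding colourings_def by (rule finite_subset[of _ "A \<rightarrow>\<^sub>E {..<q}"]) (auto intro: finite_PiE)

lemma colourings_Un: "colourings q A (R \<union> S) = {f \<in> colourings q A R. \<forall>(a, b)\<in>S. f a = f b}"
  unfolding colourings_def by auto

lemma equiv_conn: "equiv A (conn A R)"
proof (rule equivI)
  have "sym ((R \<union> R\<inverse>)\<^sup>*)" by (intro sym_rtrancl sym_Un_converse)
  then show "sym (conn A R)" unfolding conn_def sym_def by blast
  show "trans (conn A R)" unfolding conn_def trans_def by (auto intro: rtrancl_trans)
  show "refl_on A (conn A R)" unfolding conn_def refl_on_def by auto
  show "conn A R \<subseteq> A \<times> A" unfolding conn_def by auto
qed

lemma conn_sym: "(a, b) \<in> conn A R \<Longrightarrow> (b, a) \<in> conn A R"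
  using equiv_conn[of A R] by (meson equiv_def symD)

lemma conn_trans: "(a, b) \<in> conn A R \<Longrightarrow> (b, c) \<in> conn A R \<Longrightarrow> (a, c) \<in> conn A R"
  using equiv_conn[of A R] by (meson equiv_def transD)

lemma conn_in: "(a, b) \<in> conn A R \<Longrightarrow> a \<in> A \<and> b \<in> A"
  by (auto simp: conn_def)

lemma conn_refl: "a \<in> A \<Longrightarrow> (a, a) \<in> conn A R"
  by (auto simp: conn_def)

lemma conn_step: "(a, b) \<in> R \<Longrightarrow> R \<subseteq> A \<times> A \<Longrightarrow> (a, b) \<in> conn A R"
  by (auto simp: conn_def)

lemma colouring_const:
  assumes "f \<in> colourings q A R" "(a, b) \<in> conn A R"
  shows "f a = f b"
proof -
  have "(a, b) \<in> (R \<union> R\<inverse>)\<^sup>*" using assms(2) by (simp add: conn_def)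
  then show ?thesis
    by (induction rule: rtrancl_induct) (use assms(1) in \<open>auto simp: colourings_def\<close>)
qed

text \<open>Indicators of classes are \<open>2\<close>-colourings; thus \<open>2\<close>-colourings detect the classes, and parity
  statements about all \<open>2\<close>-colourings turn into statements about the classes.\<close>

lemma class_indicator_colouring:
  assumes "R \<subseteq> A \<times> A"
  shows "(\<lambda>z\<in>A. if (a, z) \<in> conn A R then 1 else 0) \<in> colourings 2 A R"
proof -
  have "((a, x) \<in> conn A R) = ((a, y) \<in> conn A R)" if "(x, y) \<in> R" for x y
    using conn_step[OF that assms] conn_trans conn_sym by metis
  then show ?thesis using assms by (auto simp: colourings_def)
qed

lemma conn_iff_colourings:
  assumes "R \<subseteq> A \<times> A" "a \<in> A" "b \<in> A"
  shows "(a, b) \<in> conn A R \<longleftrightarrow> (\<forall>f\<in>colourings 2 A R. f a = f b)"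
proof
  assume *: "\<forall>f\<in>colourings 2 A R. f a = f b"
  have "(if (a, a) \<in> conn A R then 1 else 0::nat) = (if (a, b) \<in> conn A R then 1 else 0)"
    using bspec[OF * class_indicator_colouring[OF assms(1), of a]] assms by simp
  then show "(a, b) \<in> conn A R" using conn_refl[OF assms(2)] by (auto split: if_splits)
next
  assume "(a, b) \<in> conn A R"
  then show "\<forall>f\<in>colourings 2 A R. f a = f b" by (intro ballI colouring_const)
qed

lemma card_colourings:
  assumes A: "finite A" and R: "R \<subseteq> A \<times> A"
  shows "card (colourings q A R) = q ^ card (A // conn A R)"
proof -
  let ?Q = "A // conn A R"
  have finQ: "finite ?Q" using A equiv_conn[of A R] by (metis finite_quotient equiv_def)
  have cls: "conn A R `` {x} = conn A R `` {y}" if "(x, y) \<in> conn A R" for x y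
    using that equiv_class_eq[OF equiv_conn] by metis
  have "bij_betw (\<lambda>g. \<lambda>a\<in>A. g (conn A R `` {a})) (?Q \<rightarrow>\<^sub>E {..<q}) (colourings q A R)"
    unfolding bij_betw_def
  proof
    show "inj_on (\<lambda>g. \<lambda>a\<in>A. g (conn A R `` {a})) (?Q \<rightarrow>\<^sub>E {..<q})"
    proof (rule inj_onI)
      fix g h assume g: "g \<in> ?Q \<rightarrow>\<^sub>E {..<q}" and h: "h \<in> ?Q \<rightarrow>\<^sub>E {..<q}"
        and eq: "(\<lambda>a\<in>A. g (conn A R `` {a})) = (\<lambda>a\<in>A. h (conn A R `` {a}))"
      show "g = h"
      proof (rule PiE_ext[OF g h])
        fix C assume "C \<in> ?Q"
        then obtain a where "a \<in> A" "C = conn A R `` {a}" by (auto elim: quotientE)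
        then show "g C = h C" using fun_cong[OF eq, of a] by simp
      qed
    qed
    show "(\<lambda>g. \<lambda>a\<in>A. g (conn A R `` {a})) ` (?Q \<rightarrow>\<^sub>E {..<q}) = colourings q A R"
    proof
      show "(\<lambda>g. \<lambda>a\<in>A. g (conn A R `` {a})) ` (?Q \<rightarrow>\<^sub>E {..<q}) \<subseteq> colourings q A R"
      proof (rule image_subsetI)
        fix g assume g: "g \<in> ?Q \<rightarrow>\<^sub>E {..<q}"
        have "g (conn A R `` {x}) = g (conn A R `` {y})" if "(x, y) \<in> R" for x y
          using cls[OF conn_step[OF that R]] by simp
        moreover have "x \<in> A \<Longrightarrow> g (conn A R `` {x}) < q" for x
          using g quotientI[of x A] by (auto simp: PiE_iff)
        ultimately show "(\<lambda>a\<in>A. g (conn A R `` {a})) \<in> colourings q A R"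
          using R by (auto simp: colourings_def)
      qed
      show "colourings q A R \<subseteq> (\<lambda>g. \<lambda>a\<in>A. g (conn A R `` {a})) ` (?Q \<rightarrow>\<^sub>E {..<q})"
      proof
        fix f assume f: "f \<in> colourings q A R"
        define g where "g = (\<lambda>C\<in>?Q. f (SOME a. a \<in> C))"
        have val: "g (conn A R `` {a}) = f a" if "a \<in> A" for a
        proof -
          have "(SOME b. b \<in> conn A R `` {a}) \<in> conn A R `` {a}"
            using conn_refl[OF that] by (metis ImageI insertI1 someI_ex)
          then have "f (SOME b. b \<in> conn A R `` {a}) = f a"
            using colouring_const[OF f] by auto
          then show ?thesis using that by (simp add: g_def quotientI)
        qed
        have fA: "f \<in> A \<rightarrow>\<^sub>E {..<q}" using f by (simp add: colourings_def)
        have "g \<in> ?Q \<rightarrow>\<^sub>E {..<q}"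
        proof (rule PiE_I)
          fix C assume C: "C \<in> ?Q"
          then obtain a where "a \<in> A" "C = conn A R `` {a}" by (auto elim: quotientE)
          then show "g C \<in> {..<q}" using val fA by (auto simp: PiE_iff)
        qed (simp add: g_def)
        moreover have "f = (\<lambda>a\<in>A. g (conn A R `` {a}))"
          using fA val by (auto simp: fun_eq_iff PiE_iff extensional_def)
        ultimately show "f \<in> (\<lambda>g. \<lambda>a\<in>A. g (conn A R `` {a})) ` (?Q \<rightarrow>\<^sub>E {..<q})" by blast
      qed
    qed
  qed
  then have "card (colourings q A R) = card (?Q \<rightarrow>\<^sub>E {..<q})"
    by (simp add: bij_betw_same_card)
  then show ?thesis using finQ by (simp add: card_PiE)
qed

text \<open>Forcing two classes to have the same colour loses a factor \<open>q\<close>: the class of \<open>b\<close> can be recoloured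
  freely, so a colouring is the same as a colour for this class together with a colouring that gives
  \<open>a\<close> and \<open>b\<close> the same colour.\<close>

lemma card_colourings_join:
  assumes A: "finite A" and R: "R \<subseteq> A \<times> A" and ab: "a \<in> A" "b \<in> A" "(a, b) \<notin> conn A R"
  shows "q * card {f \<in> colourings q A R. f a = f b} = card (colourings q A R)"
proof -
  let ?J = "{f \<in> colourings q A R. f a = f b}"
  define re where "re f c = (\<lambda>z. if (b, z) \<in> conn A R then c else f z)" for f :: "'a \<Rightarrow> nat" and c
  have re_col: "re f c \<in> colourings q A R" if f: "f \<in> colourings q A R" and c: "c < q" for f c
  proof -
    have "(b, x) \<in> conn A R \<longleftrightarrow> (b, y) \<in> conn A R" if "(x, y) \<in> R" for x y
      using conn_step[OF that R] conn_trans conn_sym by metis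
    then show ?thesis using f c
      by (auto simp: colourings_def re_def PiE_iff extensional_def dest: conn_in)
  qed
  have bb: "(b, b) \<in> conn A R" and ba: "(b, a) \<notin> conn A R"
    using conn_refl[OF ab(2)] ab(3) conn_sym by metis+
  have "bij_betw (\<lambda>(c, f). re f c) ({..<q} \<times> ?J) (colourings q A R)"
  proof (rule bij_betw_byWitness[where f' = "\<lambda>f. (f b, re f (f a))"])
    have re_re: "re (re f c) (f a) = f" if "f \<in> ?J" for f c
    proof
      fix z show "re (re f c) (f a) z = f z"
        using that colouring_const[of f q A R b z] by (auto simp: re_def)
    qed
    show "\<forall>a'\<in>{..<q} \<times> ?J. (\<lambda>f. (f b, re f (f a))) (case a' of (c, f) \<Rightarrow> re f c) = a'"
    proof
      fix p assume p: "p \<in> {..<q} \<times> ?J"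
      obtain c f where cf: "p = (c, f)" by (cases p)
      have "re f c b = c" "re f c a = f a" using bb ba by (simp_all add: re_def)
      then show "(\<lambda>f. (f b, re f (f a))) (case p of (c, f) \<Rightarrow> re f c) = p"
        using re_re[of f c] p by (simp add: cf)
    qed
    show "\<forall>f\<in>colourings q A R. (case (f b, re f (f a)) of (c, f) \<Rightarrow> re f c) = f"
    proof
      fix f assume f: "f \<in> colourings q A R"
      show "(case (f b, re f (f a)) of (c, f) \<Rightarrow> re f c) = f"
        using colouring_const[OF f, of b] by (auto simp: re_def fun_eq_iff)
    qed
    show "(\<lambda>(c, f). re f c) ` ({..<q} \<times> ?J) \<subseteq> colourings q A R" using re_col by auto
    show "(\<lambda>f. (f b, re f (f a))) ` colourings q A R \<subseteq> {..<q} \<times> ?J"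
    proof (rule image_subsetI)
      fix f assume f: "f \<in> colourings q A R"
      then have "f a < q" "f b < q" using ab by (auto simp: colourings_def PiE_iff)
      then show "(f b, re f (f a)) \<in> {..<q} \<times> ?J"
        using re_col[OF f] bb ba by (auto simp: re_def)
    qed
  qed
  then have "card ({..<q} \<times> ?J) = card (colourings q A R)" by (rule bij_betw_same_card)
  then show ?thesis by (simp add: card_cartesian_product)
qed

lemma Collect_conj_eqI: "(\<And>f. f \<in> X \<Longrightarrow> P f = Q f) \<Longrightarrow> {f \<in> X. P f} = {f \<in> X. Q f}"
  by auto

lemma Collect_conj_all: "(\<And>f. f \<in> X \<Longrightarrow> P f) \<Longrightarrow> {f \<in> X. P f} = X"
  by auto

text \<open>Four cut ends \<open>a, b, c, d\<close> are connected in pairs, first as \<open>ab|cd\<close> and then, after a mark has been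
  added, as \<open>ad|cb\<close> or \<open>ac|bd\<close>.  Applied to the indicator of a class of \<open>R\<close>, the parity hypothesis
  says that every class contains an even number of the four points, so \<open>R\<close> itself connects them in
  one of the three ways.  If \<open>R\<close> connects them as \<open>ab|cd\<close> with \<open>ac\<close> separate, there are two loops, and
  both other ways of connecting merge them.  If \<open>R\<close> connects them as \<open>ac|bd\<close>, then only the new
  connection \<open>ac|bd\<close> splits the loop; the case \<open>ad|cb\<close> is symmetric.  If all four points are in one class of \<open>R\<close>, the three
  counts agree.\<close>

lemma reconnect_four_points:
  fixes q :: nat
  assumes A: "finite A" and R: "R \<subseteq> A \<times> A" and in_A: "a \<in> A" "b \<in> A" "c \<in> A" "d \<in> A"
    and parity: "\<And>f. f \<in> colourings 2 A R \<Longrightarrow> even (f a + f b + f c + f d)"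
    and q: "q \<ge> 1"
  defines "n \<equiv> \<lambda>S. card (colourings q A (R \<union> S))"
  defines "same \<equiv> (b, d) \<in> conn A (R \<union> {(a, b), (c, d)})"
  shows "\<not> same \<Longrightarrow> q * n {(a, d), (c, b)} = n {(a, b), (c, d)} \<and> q * n {(a, c), (b, d)} = n {(a, b), (c, d)}"
    and "same \<Longrightarrow> n {(a, d), (c, b)} \<le> q * n {(a, b), (c, d)} \<and> n {(a, c), (b, d)} \<le> n {(a, b), (c, d)}
      \<or> n {(a, c), (b, d)} \<le> q * n {(a, b), (c, d)} \<and> n {(a, d), (c, b)} \<le> n {(a, b), (c, d)}"
proof -
  let ?C = "conn A R"
  let ?X = "colourings q A R"
  have n: "n {(x, y), (z, w)} = card {f \<in> ?X. f x = f y \<and> f z = f w}" for x y z w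
    unfolding n_def colourings_Un by simp
  have same: "same \<longleftrightarrow> (\<forall>f\<in>colourings 2 A R. f a = f b \<and> f c = f d \<longrightarrow> f b = f d)"
  proof -
    have "R \<union> {(a, b), (c, d)} \<subseteq> A \<times> A" using in_A R by auto
    from conn_iff_colourings[OF this in_A(2,4)] show ?thesis
      unfolding same_def colourings_Un by auto
  qed
  have ind: "even ((if (x, a) \<in> ?C then 1 else 0) + (if (x, b) \<in> ?C then 1 else 0)
      + (if (x, c) \<in> ?C then 1 else 0) + (if (x, d) \<in> ?C then 1 else (0::nat)))" for x
    using parity[OF class_indicator_colouring[OF R, of x]] in_A by simp
  note r = conn_refl[OF in_A(1), of R] conn_refl[OF in_A(2), of R]
    conn_refl[OF in_A(3), of R] conn_refl[OF in_A(4), of R]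
  have ac: "(a, c) \<in> ?C \<longleftrightarrow> (b, d) \<in> ?C" if "(a, b) \<in> ?C" "(c, d) \<in> ?C"
    using that conn_trans conn_sym by metis
  have cases: "(a, b) \<in> ?C \<and> (c, d) \<in> ?C \<or> (a, c) \<in> ?C \<and> (b, d) \<in> ?C \<or> (a, d) \<in> ?C \<and> (c, b) \<in> ?C"
  proof (cases "(a, b) \<in> ?C")
    case True
    show ?thesis
    proof (cases "(c, a) \<in> ?C")
      case True': True
      then have "(c, b) \<in> ?C" using True conn_trans by metis
      then show ?thesis using ind[of c] r True True' by (auto split: if_splits)
    next
      case False
      then have "(c, b) \<notin> ?C" using True conn_trans conn_sym by metis
      then show ?thesis using ind[of c] r True False by (auto split: if_splits)
    qed
  next
    case False
    then have ba: "(b, a) \<notin> ?C" using conn_sym by metis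
    show ?thesis
    proof (cases "(a, c) \<in> ?C")
      case True
      then have "(b, c) \<notin> ?C" using ba conn_trans conn_sym by metis
      then show ?thesis using ind[of b] r ba True by (auto split: if_splits)
    next
      case nac: False
      then have ad: "(a, d) \<in> ?C" using ind[of a] r False by (auto split: if_splits)
      then have "(c, a) \<notin> ?C" "(c, d) \<notin> ?C" using nac conn_trans conn_sym by metis+
      then show ?thesis using ind[of c] r ad by (auto split: if_splits)
    qed
  qed
  have eqX: "f x = f y" if "(x, y) \<in> ?C" "f \<in> colourings p A R" for f x y p
    using colouring_const that by metis
  have eqX2: "f x = f y \<and> f z = f w" if "(x, y) \<in> ?C" "(z, w) \<in> ?C" "f \<in> ?X" for f x y z w
    using eqX that by blast
  have fX: "finite ?X" by (rule finite_colourings[OF A])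
  have mono: "card {f \<in> ?X. P f} \<le> card ?X" for P
    by (rule card_mono[OF fX]) auto
  show "q * n {(a, d), (c, b)} = n {(a, b), (c, d)} \<and> q * n {(a, c), (b, d)} = n {(a, b), (c, d)}"
    if ns: "\<not> same"
  proof -
    obtain f where f: "f \<in> colourings 2 A R" "f a = f b" "f c = f d" "f b \<noteq> f d"
      using ns unfolding same by blast
    have "\<not> ((a, c) \<in> ?C \<and> (b, d) \<in> ?C)" "\<not> ((a, d) \<in> ?C \<and> (c, b) \<in> ?C)"
      using eqX[of _ _ f 2] f by auto
    with cases have *: "(a, b) \<in> ?C" "(c, d) \<in> ?C" "(a, c) \<notin> ?C" using ac by blast+
    have "{f \<in> ?X. f a = f b \<and> f c = f d} = ?X"
      by (rule Collect_conj_all, rule eqX2[OF *(1,2)])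
    moreover have "{f \<in> ?X. f a = f d \<and> f c = f b} = {f \<in> ?X. f a = f c}"
      "{f \<in> ?X. f a = f c \<and> f b = f d} = {f \<in> ?X. f a = f c}"
      by (rule Collect_conj_eqI, drule eqX2[OF *(1,2)], elim conjE, fastforce)+
    ultimately show ?thesis
      unfolding n using card_colourings_join[OF A R in_A(1,3) *(3), of q] by simp
  qed
  show "n {(a, d), (c, b)} \<le> q * n {(a, b), (c, d)} \<and> n {(a, c), (b, d)} \<le> n {(a, b), (c, d)}
      \<or> n {(a, c), (b, d)} \<le> q * n {(a, b), (c, d)} \<and> n {(a, d), (c, b)} \<le> n {(a, b), (c, d)}"
    if s: "same"
  proof -
    have q1: "m \<le> q * m" for m using q by (cases q) auto
    consider (1) "(a, b) \<in> ?C" "(c, d) \<in> ?C" | (2) "(a, c) \<in> ?C" "(b, d) \<in> ?C" "(a, b) \<notin> ?C"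
      | (3) "(a, d) \<in> ?C" "(c, b) \<in> ?C" "(a, b) \<notin> ?C"
    proof (cases "(a, b) \<in> ?C")
      case True
      have "(c, d) \<in> ?C"
        using cases
      proof (elim disjE conjE)
        assume "(a, c) \<in> ?C" "(b, d) \<in> ?C"
        then show ?thesis using True conn_trans[of _ _ A R] conn_sym[of _ _ A R] by metis
      next
        assume "(a, d) \<in> ?C" "(c, b) \<in> ?C"
        then show ?thesis using True conn_trans[of _ _ A R] conn_sym[of _ _ A R] by metis
      qed
      with True that(1) show ?thesis by blast
    next
      case False
      with cases that show ?thesis by blast
    qed
    then show ?thesis
    proof cases
      case 1
      then have "{f \<in> ?X. f a = f b \<and> f c = f d} = ?X"
        by (intro Collect_conj_all eqX2)
      then have "n {(a, b), (c, d)} = card ?X" unfolding n by simp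
      then show ?thesis
        unfolding n by (simp only:) (intro disjI1 conjI order_trans[OF mono q1] mono)
    next
      case 2
      have "{f \<in> ?X. f a = f b \<and> f c = f d} = {f \<in> ?X. f a = f b}"
        "{f \<in> ?X. f a = f d \<and> f c = f b} = {f \<in> ?X. f a = f b}"
        by (rule Collect_conj_eqI, drule eqX2[OF 2(1,2)], elim conjE, fastforce)+
      then show ?thesis
        unfolding n using card_colourings_join[OF A R in_A(1,2) 2(3), of q] mono by simp
    next
      case 3
      have "{f \<in> ?X. f a = f b \<and> f c = f d} = {f \<in> ?X. f a = f b}"
        "{f \<in> ?X. f a = f c \<and> f b = f d} = {f \<in> ?X. f a = f b}"
        by (rule Collect_conj_eqI, drule eqX2[OF 3(1,2)], elim conjE, fastforce)+
      then show ?thesis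
        unfolding n using card_colourings_join[OF A R in_A(1,2) 3(3), of q] mono by simp
    qed
  qed
qed

section \<open>Words of marks\<close>

text \<open>A letter \<open>m\<close> of a word is an edge with a kind of mark.  The pair \<open>(z, i)\<close> is the arc of the line
  \<open>{z} \<times> S\<^sup>1\<close> between the \<open>i\<close>-th and the next mark time, over all edges; here \<open>i\<close> is the level below the mark
  and \<open>j\<close> the level above it.  A line away from the marked edge passes straight through, a cross
  exchanges the two lines of the edge, and a bar connects them below and above.\<close>

definition joins :: "'v set \<Rightarrow> 'v set \<times> mark \<Rightarrow> 'l \<Rightarrow> 'l \<Rightarrow> (('v \<times> 'l) \<times> ('v \<times> 'l)) set" where
  "joins V m i j = {((z, i), (z, j)) | z. z \<in> V \<and> z \<notin> fst m} \<union>
     (if snd m = Cross then {((x, i), (y, j)) | x y. x \<in> fst m \<and> y \<in> fst m \<and> x \<noteq> y}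
      else {((x, l), (y, l)) | x y l. x \<in> fst m \<and> y \<in> fst m \<and> l \<in> {i, j}})"

definition inner_links :: "'v set \<Rightarrow> ('v set \<times> mark) list \<Rightarrow> (('v \<times> nat) \<times> ('v \<times> nat)) set" where
  "inner_links V W = (\<Union>j<length W. joins V (W ! j) j (Suc j))"

definition arcs :: "'v set \<Rightarrow> ('v set \<times> mark) list \<Rightarrow> ('v \<times> nat) set" where
  "arcs V W = V \<times> {..length W}"

text \<open>The circle is cut open at time \<open>0\<close>, where no mark occurs: there the last arc of each line continues as the first one.\<close>

definition links :: "'v set \<Rightarrow> ('v set \<times> mark) list \<Rightarrow> (('v \<times> nat) \<times> ('v \<times> nat)) set" where
  "links V W = inner_links V W \<union> {((z, length W), (z, 0)) | z. z \<in> V}"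

definition word_trace :: "nat \<Rightarrow> 'v set \<Rightarrow> ('v set \<times> mark) list \<Rightarrow> nat" where
  "word_trace q V W = card (colourings q (arcs V W) (links V W))"

definition edges_in :: "'v set \<Rightarrow> 'v set set \<Rightarrow> bool" where
  "edges_in V E \<longleftrightarrow> (\<forall>e\<in>E. e \<subseteq> V \<and> card e = 2)"

lemma joins_subset: "fst m \<subseteq> V \<Longrightarrow> joins V m i j \<subseteq> (V \<times> {i, j}) \<times> (V \<times> {i, j})"
  by (auto simp: joins_def split: if_splits)

lemma inner_links_subset:
  assumes "edges_in V (fst ` set W)"
  shows "inner_links V W \<subseteq> arcs V W \<times> arcs V W"
proof -
  have "joins V (W ! j) j (Suc j) \<subseteq> (V \<times> {j, Suc j}) \<times> (V \<times> {j, Suc j})" if "j < length W" for j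
    using assms that by (intro joins_subset) (auto simp: edges_in_def)
  then show ?thesis unfolding inner_links_def arcs_def by fastforce
qed

lemma links_subset:
  "edges_in V (fst ` set W) \<Longrightarrow> links V W \<subseteq> arcs V W \<times> arcs V W"
  using inner_links_subset[of V W] by (auto simp: links_def arcs_def)

lemma inner_links_snoc:
  "inner_links V (W @ [m]) = inner_links V W \<union> joins V m (length W) (Suc (length W))"
proof -
  have "inner_links V (W @ [m]) = (\<Union>j\<in>insert (length W) {..<length W}. joins V ((W @ [m]) ! j) j (Suc j))"
    unfolding inner_links_def by (simp add: lessThan_Suc)
  also have "\<dots> = joins V m (length W) (Suc (length W)) \<union> (\<Union>j<length W. joins V ((W @ [m]) ! j) j (Suc j))"
    by simp
  also have "(\<Union>j<length W. joins V ((W @ [m]) ! j) j (Suc j)) = inner_links V W"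
    unfolding inner_links_def by (intro SUP_cong) (auto simp: nth_append)
  finally show ?thesis by blast
qed

text \<open>The sum of the colours of a level is conserved modulo \<open>2\<close>: a cross permutes the colours, and a bar
  replaces a pair of equal colours by another pair of equal colours.  This is the source of the parity
  hypothesis of \<open>reconnect_four_points\<close>.\<close>

lemma sum_colours_joins:
  fixes f :: "'v \<times> 'l \<Rightarrow> nat"
  assumes V: "finite V" and e: "fst m \<subseteq> V" "card (fst m) = 2"
    and f: "\<And>a b. (a, b) \<in> joins V m i j \<Longrightarrow> f a = f b"
  shows "even (\<Sum>z\<in>V. f (z, i)) \<longleftrightarrow> even (\<Sum>z\<in>V. f (z, j))"
proof -
  obtain x y where xy: "fst m = {x, y}" "x \<noteq> y" using e(2) by (auto simp: card_2_iff)
  have split: "(\<Sum>z\<in>V. f (z, l)) = (\<Sum>z\<in>V - {x, y}. f (z, l)) + (f (x, l) + f (y, l))" for l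
    using sum.subset_diff[of "{x, y}" V "\<lambda>z. f (z, l)"] e V xy by simp
  have rest: "(\<Sum>z\<in>V - {x, y}. f (z, i)) = (\<Sum>z\<in>V - {x, y}. f (z, j))"
    by (rule sum.cong) (auto intro!: f simp: joins_def xy)
  have "even (f (x, i) + f (y, i)) \<longleftrightarrow> even (f (x, j) + f (y, j))"
  proof (cases "snd m")
    case Cross
    then have "f (x, i) = f (y, j)" "f (y, i) = f (x, j)"
      using xy by (auto intro!: f simp: joins_def)
    then show ?thesis by auto
  next
    case Bar
    then have "f (x, i) = f (y, i)" "f (x, j) = f (y, j)"
      using xy by (auto intro!: f simp: joins_def)
    then show ?thesis by simp
  qed
  then show ?thesis unfolding split rest by auto
qed

lemma sum_colours_inner:
  fixes f :: "'v \<times> nat \<Rightarrow> nat"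
  assumes V: "finite V" and W: "edges_in V (fst ` set W)"
    and f: "\<And>a b. (a, b) \<in> inner_links V W \<Longrightarrow> f a = f b"
  shows "even (\<Sum>z\<in>V. f (z, 0)) \<longleftrightarrow> even (\<Sum>z\<in>V. f (z, length W))"
proof -
  have "j \<le> length W \<Longrightarrow> even (\<Sum>z\<in>V. f (z, 0)) \<longleftrightarrow> even (\<Sum>z\<in>V. f (z, j))" for j
  proof (induction j)
    case (Suc j)
    have "even (\<Sum>z\<in>V. f (z, j)) \<longleftrightarrow> even (\<Sum>z\<in>V. f (z, Suc j))"
      using W Suc.prems
      by (intro sum_colours_joins[OF V, of "W ! j"] f) (auto simp: edges_in_def inner_links_def)
    then show ?case using Suc by simp
  qed simp
  then show ?thesis by simp
qed

text \<open>A mark appended at the end, that is just before time \<open>0\<close>, creates a new level of arcs, which can be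
  identified with level \<open>0\<close> as no further mark lies between them.  The mark then acts
  between the last level of \<open>W\<close> and level \<open>0\<close>.\<close>

lemma word_trace_snoc:
  assumes m: "fst m \<subseteq> V" and W: "edges_in V (fst ` set W)"
  shows "word_trace q V (W @ [m]) =
    card (colourings q (arcs V W) (inner_links V W \<union> joins V m (length W) 0))"
proof -
  let ?k = "length W"
  let ?B = "colourings q (arcs V W) (inner_links V W \<union> joins V m ?k 0)"
  let ?A = "colourings q (arcs V (W @ [m])) (links V (W @ [m]))"
  let ?g = "\<lambda>f. \<lambda>(z, i)\<in>arcs V (W @ [m]). if i = Suc ?k then f (z, 0) else f (z, i)"
  have sub: "arcs V W \<subseteq> arcs V (W @ [m])" by (auto simp: arcs_def)
  have il: "inner_links V W \<subseteq> arcs V W \<times> arcs V W" by (rule inner_links_subset[OF W])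
  have "bij_betw (\<lambda>f. restrict f (arcs V W)) ?A ?B"
  proof (rule bij_betw_byWitness[where f' = ?g])
    show "\<forall>f\<in>?A. ?g (restrict f (arcs V W)) = f"
    proof
      fix f assume f: "f \<in> ?A"
      have "f (z, Suc ?k) = f (z, 0)" if "z \<in> V" for z
        using f that by (auto simp: colourings_def links_def)
      moreover have "f \<in> extensional (arcs V (W @ [m]))"
        using f by (auto simp: colourings_def PiE_iff)
      ultimately show "?g (restrict f (arcs V W)) = f"
        by (auto simp: fun_eq_iff arcs_def extensional_def le_Suc_eq)
    qed
    show "\<forall>f\<in>?B. restrict (?g f) (arcs V W) = f"
    proof
      fix f assume f: "f \<in> ?B"
      have "f \<in> extensional (arcs V W)"
        using f by (auto simp: colourings_def PiE_iff)
      then show "restrict (?g f) (arcs V W) = f"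
        by (auto simp: fun_eq_iff arcs_def extensional_def)
    qed
    show "(\<lambda>f. restrict f (arcs V W)) ` ?A \<subseteq> ?B"
    proof (rule image_subsetI)
      fix f assume f: "f \<in> ?A"
      have w: "f (z, Suc ?k) = f (z, 0)" if "z \<in> V" for z
        using f that by (auto simp: colourings_def links_def)
      have l: "f a = f b" if "(a, b) \<in> inner_links V W \<union> joins V m ?k (Suc ?k)" for a b
        using f that by (auto simp: colourings_def links_def inner_links_snoc)
      have j: "f a = f b" if ab: "(a, b) \<in> joins V m ?k 0" for a b
      proof -
        obtain x i y j where ab': "a = (x, i)" "b = (y, j)" by (cases a, cases b)
        let ?s = "\<lambda>i. if i = 0 then Suc ?k else i"
        have xy: "x \<in> V" "y \<in> V" using joins_subset[OF m, of ?k 0] ab ab' by auto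
        have "\<exists>i' j'. ((x, i'), (y, j')) \<in> joins V m ?k (Suc ?k) \<and>
            (i' = i \<or> i' = Suc ?k \<and> i = 0) \<and> (j' = j \<or> j' = Suc ?k \<and> j = 0)"
          using ab unfolding ab' joins_def by (auto split: if_splits)
        then show ?thesis using l w xy unfolding ab' by (metis UnI2)
      qed
      have "f \<in> arcs V (W @ [m]) \<rightarrow>\<^sub>E {..<q}" using f by (simp add: colourings_def)
      then have 1: "restrict f (arcs V W) \<in> arcs V W \<rightarrow>\<^sub>E {..<q}" using sub by (auto simp: PiE_iff)
      have "joins V m ?k 0 \<subseteq> arcs V W \<times> arcs V W"
        using joins_subset[OF m, of ?k 0] by (auto simp: arcs_def)
      with il have "a \<in> arcs V W \<and> b \<in> arcs V W"
        if "(a, b) \<in> inner_links V W \<union> joins V m ?k 0" for a b using that by blast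
      moreover have "f a = f b" if "(a, b) \<in> inner_links V W \<union> joins V m ?k 0" for a b
        using that j l by blast
      ultimately have "restrict f (arcs V W) a = restrict f (arcs V W) b"
        if "(a, b) \<in> inner_links V W \<union> joins V m ?k 0" for a b
        using that by simp
      then show "restrict f (arcs V W) \<in> ?B" using 1 by (simp add: colourings_def split_beta)
    qed
    show "?g ` ?B \<subseteq> ?A"
    proof (rule image_subsetI)
      fix f assume f: "f \<in> ?B"
      have l: "f a = f b" if "(a, b) \<in> inner_links V W \<union> joins V m ?k 0" for a b
        using f that by (auto simp: colourings_def)
      have 1: "?g f \<in> arcs V (W @ [m]) \<rightarrow>\<^sub>E {..<q}"
        using f by (auto simp: colourings_def PiE_iff arcs_def)
      have 2: "?g f a = ?g f b" if "(a, b) \<in> inner_links V W" for a b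
      proof -
        obtain x i y j where ab: "a = (x, i)" "b = (y, j)" by (cases a, cases b)
        have "(x, i) \<in> arcs V W" "(y, j) \<in> arcs V W" using that il unfolding ab by auto
        moreover have "f (x, i) = f (y, j)" using l[of a b] that unfolding ab by simp
        ultimately show ?thesis unfolding ab by (simp add: arcs_def)
      qed
      have 3: "?g f a = ?g f b" if ab: "(a, b) \<in> joins V m ?k (Suc ?k)" for a b
      proof -
        obtain x i y j where ab': "a = (x, i)" "b = (y, j)" by (cases a, cases b)
        have xy: "x \<in> V" "y \<in> V" "i \<in> {?k, Suc ?k}" "j \<in> {?k, Suc ?k}"
          using joins_subset[OF m, of ?k "Suc ?k"] ab ab' by auto
        let ?s = "\<lambda>i. if i = Suc ?k then 0 else i"
        have "((x, ?s i), (y, ?s j)) \<in> joins V m ?k 0"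
          using ab unfolding ab' joins_def by (auto split: if_splits)
        then have "f (x, ?s i) = f (y, ?s j)" using l by blast
        then show ?thesis using xy unfolding ab' by (auto simp: arcs_def)
      qed
      show "?g f \<in> ?A"
        unfolding colourings_def
      proof (intro CollectI conjI 1 ballI)
        fix p assume p: "p \<in> links V (W @ [m])"
        obtain a b where ab: "p = (a, b)" by (cases p)
        consider "(a, b) \<in> inner_links V W" | "(a, b) \<in> joins V m ?k (Suc ?k)"
          | z where "z \<in> V" "a = (z, Suc ?k)" "b = (z, 0)"
          using p unfolding ab by (auto simp: links_def inner_links_snoc)
        then have "?g f a = ?g f b"
        proof cases
          case 3 then show ?thesis by (simp add: arcs_def)
        qed (rule 2 3; assumption)+
        then show "case p of (a, b) \<Rightarrow> ?g f a = ?g f b" unfolding ab by (rule iffD2[OF split_conv])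
      qed
    qed
  qed
  then show ?thesis unfolding word_trace_def by (rule bij_betw_same_card)
qed

text \<open>Both ends of \<open>e\<close> lie on the same loop at time \<open>0\<close>.\<close>

definition same_at_0 :: "'v set \<Rightarrow> ('v set \<times> mark) list \<Rightarrow> 'v set \<Rightarrow> bool" where
  "same_at_0 V W e \<longleftrightarrow> (\<forall>x\<in>e. \<forall>y\<in>e. ((x, 0), (y, 0)) \<in> conn (arcs V W) (links V W))"

text \<open>Cut the two lines of \<open>e\<close> at time \<open>0\<close>.  The four ends are connected straight through without the
  mark, crosswise by a cross, and below and above by a bar, so the three connections of
  \<open>reconnect_four_points\<close> are the word \<open>W\<close> and its two extensions.\<close>

lemma add_mark:
  assumes V: "finite V" and W: "edges_in V (fst ` set W)" and e: "e \<subseteq> V" "card e = 2" and q: "q \<ge> 1"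
  defines "T \<equiv> word_trace q V"
  shows "\<not> same_at_0 V W e \<Longrightarrow> q * T (W @ [(e, a)]) = T W"
    and "same_at_0 V W e \<Longrightarrow>
      T (W @ [(e, Cross)]) \<le> q * T W \<and> T (W @ [(e, Bar)]) \<le> T W \<or>
      T (W @ [(e, Bar)]) \<le> q * T W \<and> T (W @ [(e, Cross)]) \<le> T W"
proof -
  let ?k = "length W" and ?A = "arcs V W"
  obtain x y where xy: "e = {x, y}" "x \<noteq> y" using e(2) by (auto simp: card_2_iff)
  have in_V: "x \<in> V" "y \<in> V" using e xy by auto
  let ?R = "inner_links V W \<union> {((z, ?k), (z, 0)) | z. z \<in> V \<and> z \<notin> e}"
  let ?n = "\<lambda>S. card (colourings q ?A (?R \<union> S))"
  let ?xm = "(x, ?k)" and ?xp = "(x, 0::nat)" and ?ym = "(y, ?k)" and ?yp = "(y, 0::nat)"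
  have finA: "finite ?A" using V by (simp add: arcs_def)
  have RA: "?R \<subseteq> ?A \<times> ?A" using inner_links_subset[OF W] by (auto simp: arcs_def)
  have links_eq: "links V W = ?R \<union> {(?xm, ?xp), (?ym, ?yp)}"
    using in_V by (auto simp: links_def xy)
  have T0: "T W = ?n {(?xm, ?xp), (?ym, ?yp)}"
    unfolding T_def word_trace_def links_eq ..
  have Tc: "T (W @ [(e, Cross)]) = ?n {(?xm, ?yp), (?ym, ?xp)}"
  proof -
    have "inner_links V W \<union> joins V (e, Cross) ?k 0 = ?R \<union> {(?xm, ?yp), (?ym, ?xp)}"
      using xy by (auto simp: joins_def)
    then show ?thesis unfolding T_def using word_trace_snoc[of "(e, Cross)" V W q] e W by simp
  qed
  have Tb: "T (W @ [(e, Bar)]) = ?n {(?xm, ?ym), (?xp, ?yp)}"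
  proof -
    let ?S = "{((x', l), (y', l)) | x' y' l. x' \<in> e \<and> y' \<in> e \<and> l \<in> {?k, 0}}"
    have "inner_links V W \<union> joins V (e, Bar) ?k 0 = ?R \<union> ?S"
      by (auto simp: joins_def)
    moreover have "(\<forall>(a, b)\<in>?S. f a = f b) \<longleftrightarrow> (\<forall>(a, b)\<in>{(?xm, ?ym), (?xp, ?yp)}. f a = f b)"
      for f :: "'a \<times> nat \<Rightarrow> nat"
      unfolding xy by fastforce
    ultimately have "colourings q ?A (inner_links V W \<union> joins V (e, Bar) ?k 0) =
        colourings q ?A (?R \<union> {(?xm, ?ym), (?xp, ?yp)})"
      by (simp only: colourings_Un)
    then show ?thesis unfolding T_def using word_trace_snoc[of "(e, Bar)" V W q] e W by simp
  qed
  \<comment> \<open>The sums over levels \<open>0\<close> and \<open>k\<close> have equal parity, and the uncut lines contribute equally to both.\<close>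
  have par: "even (f ?xm + f ?xp + f ?ym + f ?yp)" if f: "f \<in> colourings 2 ?A ?R" for f
  proof -
    have l: "f a = f b" if "(a, b) \<in> ?R" for a b using f that by (auto simp: colourings_def)
    have "even (\<Sum>z\<in>V. f (z, 0)) \<longleftrightarrow> even (\<Sum>z\<in>V. f (z, ?k))"
      by (rule sum_colours_inner[OF V W l]) simp
    moreover have "(\<Sum>z\<in>V. f (z, i)) = (\<Sum>z\<in>V - {x, y}. f (z, i)) + (f (x, i) + f (y, i))" for i
      using sum.subset_diff[of "{x, y}" V "\<lambda>z. f (z, i)"] e V xy by simp
    moreover have "(\<Sum>z\<in>V - {x, y}. f (z, ?k)) = (\<Sum>z\<in>V - {x, y}. f (z, 0))"
      by (intro sum.cong l) (auto simp: xy)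
    ultimately show ?thesis by simp presburger
  qed
  have same: "same_at_0 V W e \<longleftrightarrow> (?xp, ?yp) \<in> conn ?A (?R \<union> {(?xm, ?xp), (?ym, ?yp)})"
  proof -
    have "same_at_0 V W e \<longleftrightarrow> (?xp, ?yp) \<in> conn ?A (links V W)"
      unfolding same_at_0_def xy using in_V by (auto simp: arcs_def intro: conn_sym conn_refl)
    then show ?thesis by (simp only: links_eq)
  qed
  have inA: "?xm \<in> ?A" "?xp \<in> ?A" "?ym \<in> ?A" "?yp \<in> ?A" using in_V by (auto simp: arcs_def)
  note * = reconnect_four_points[OF finA RA inA par q]
  show "\<not> same_at_0 V W e \<Longrightarrow> q * T (W @ [(e, a)]) = T W"
    using *(1) unfolding same T0 by (cases a) (simp_all add: Tc Tb)
  show "same_at_0 V W e \<Longrightarrow>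
      T (W @ [(e, Cross)]) \<le> q * T W \<and> T (W @ [(e, Bar)]) \<le> T W \<or>
      T (W @ [(e, Bar)]) \<le> q * T W \<and> T (W @ [(e, Cross)]) \<le> T W"
    using *(2) unfolding same T0 Tc Tb by blast
qed

section \<open>Loops as classes of arcs\<close>

text \<open>The word \<open>W\<close> and the list \<open>ts\<close> of times describe the same marks as \<open>\<omega>\<close>.  Excluding the time
  \<open>0\<close> and coinciding times removes a null set of configurations and lets every mark separate two
  consecutive levels.\<close>

definition represents ::
    "'v set set \<Rightarrow> 'v config \<Rightarrow> real list \<Rightarrow> ('v set \<times> mark) list \<Rightarrow> bool" where
  "represents E \<omega> ts W \<longleftrightarrow> length ts = length W \<and> sorted_wrt (<) ts \<and> set ts \<subseteq> {0<..<1} \<and>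
     fst ` set W \<subseteq> E \<and> (\<forall>e\<in>E. \<omega> e = {(ts ! j, a) | j a. j < length W \<and> W ! j = (e, a)})"

text \<open>A configuration described by a word.  The goal of this locale is to replace the continuous motion of
  the particle by a permutation of the finitely many oriented arcs.\<close>

locale loop_word =
  fixes V :: "'v set" and E :: "'v set set" and \<omega> :: "'v config" and ts :: "real list"
    and W :: "('v set \<times> mark) list"
  assumes finite_V: "finite V" and edges: "edges_in V E" and rep: "represents E \<omega> ts W"
begin

abbreviation "k \<equiv> length W"

text \<open>Arc \<open>i\<close> of a line is the part between the times \<open>cut i\<close> and \<open>cut (Suc i)\<close>; the circle is cut open at
  time \<open>0\<close>, so the last arc ends at time \<open>1\<close>.\<close>

definition cut :: "nat \<Rightarrow> real" where
  "cut j = (if j = 0 then 0 else if j \<le> k then ts ! (j - 1) else 1)"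

definition len :: "nat \<Rightarrow> real" where
  "len i = cut (Suc i) - cut i"

lemma ts_props: "length ts = k" "j < k \<Longrightarrow> 0 < ts ! j" "j < k \<Longrightarrow> ts ! j < 1"
  "i < j \<Longrightarrow> j < k \<Longrightarrow> ts ! i < ts ! j"
proof -
  show l: "length ts = k" using rep by (simp add: represents_def)
  have *: "set ts \<subseteq> {0<..<1}" "sorted_wrt (<) ts" using rep by (auto simp: represents_def)
  show "j < k \<Longrightarrow> 0 < ts ! j" "j < k \<Longrightarrow> ts ! j < 1"
    using *(1) nth_mem[of j ts] l by (auto dest!: subsetD)
  show "i < j \<Longrightarrow> j < k \<Longrightarrow> ts ! i < ts ! j"
    using *(2) l by (simp add: sorted_wrt_iff_nth_less)
qed

lemma cut_less_Suc: "i \<le> k \<Longrightarrow> cut i < cut (Suc i)"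
  by (cases i) (auto simp: cut_def intro!: ts_props)

lemma cut_strict: "i < j \<Longrightarrow> j \<le> Suc k \<Longrightarrow> cut i < cut j"
proof (induction j)
  case (Suc j)
  then show ?case using cut_less_Suc[of j] by (cases "i = j") auto
qed simp

lemma cut_mono: "i \<le> j \<Longrightarrow> j \<le> Suc k \<Longrightarrow> cut i \<le> cut j"
  using cut_strict[of i j] by (cases "i = j") auto

lemma cut_bounds: "cut 0 = 0" "cut (Suc k) = 1" "j < k \<Longrightarrow> cut (Suc j) = ts ! j"
  "j \<le> Suc k \<Longrightarrow> 0 \<le> cut j" "j \<le> Suc k \<Longrightarrow> cut j \<le> 1"
  using cut_mono[of 0 j] cut_mono[of j "Suc k"] by (auto simp: cut_def)

lemma len_pos: "i \<le> k \<Longrightarrow> 0 < len i"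
  using cut_less_Suc by (simp add: len_def)

lemma cut_exists:
  assumes "0 \<le> s" "s < 1"
  shows "\<exists>i\<le>k. cut i \<le> s \<and> s < cut (Suc i)"
proof -
  define i where "i = Max {i. i \<le> k \<and> cut i \<le> s}"
  have fin: "finite {i. i \<le> k \<and> cut i \<le> s}" and ne: "{i. i \<le> k \<and> cut i \<le> s} \<noteq> {}"
    using assms by (auto intro: exI[of _ 0] simp: cut_bounds)
  have i: "i \<le> k" "cut i \<le> s" using Max_in[OF fin ne] unfolding i_def by auto
  have "s < cut (Suc i)"
  proof (cases "i = k")
    case False
    have "Suc i \<notin> {i. i \<le> k \<and> cut i \<le> s}"
    proof
      assume "Suc i \<in> {i. i \<le> k \<and> cut i \<le> s}"
      then have "Suc i \<le> Max {i. i \<le> k \<and> cut i \<le> s}" by (rule Max_ge[OF fin])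
      then show False by (simp add: i_def)
    qed
    then show ?thesis using False i by auto
  qed (use assms in \<open>simp add: cut_bounds\<close>)
  then show ?thesis using i by blast
qed

lemma cut_unique:
  assumes "i \<le> k" "j \<le> k" "cut i < s" "s < cut (Suc i)" "cut j \<le> s" "s \<le> cut (Suc j)"
  shows "i = j"
proof (rule ccontr)
  assume "i \<noteq> j"
  then consider "i < j" | "j < i" by linarith
  then show False
    using cut_mono[of "Suc i" j] cut_mono[of "Suc j" i] assms by cases auto
qed

lemma edge_letter: "j < k \<Longrightarrow> fst (W ! j) \<in> E" "j < k \<Longrightarrow> fst (W ! j) \<subseteq> V" "j < k \<Longrightarrow> card (fst (W ! j)) = 2"
proof -
  show *: "j < k \<Longrightarrow> fst (W ! j) \<in> E" using rep by (auto simp: represents_def)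
  show "j < k \<Longrightarrow> fst (W ! j) \<subseteq> V" "j < k \<Longrightarrow> card (fst (W ! j)) = 2"
    using * edges by (auto simp: edges_in_def)
qed

lemma mark_iff: "e \<in> E \<Longrightarrow> (s, a) \<in> \<omega> e \<longleftrightarrow> (\<exists>j<k. s = ts ! j \<and> W ! j = (e, a))"
  using rep by (auto simp: represents_def)

lemma marked_iff: "marked E \<omega> x s \<longleftrightarrow> (\<exists>j<k. s = ts ! j \<and> x \<in> fst (W ! j))"
proof
  assume "marked E \<omega> x s"
  then obtain e a where e: "e \<in> E" "x \<in> e" "(s, a) \<in> \<omega> e" by (auto simp: marked_def)
  then show "\<exists>j<k. s = ts ! j \<and> x \<in> fst (W ! j)" using mark_iff[OF e(1)] by fastforce
next
  assume "\<exists>j<k. s = ts ! j \<and> x \<in> fst (W ! j)"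
  then obtain j where j: "j < k" "s = ts ! j" "x \<in> fst (W ! j)" by blast
  have "(s, snd (W ! j)) \<in> \<omega> (fst (W ! j))"
    using mark_iff[OF edge_letter(1)[OF j(1)]] j by auto
  then show "marked E \<omega> x s" using j edge_letter(1)[OF j(1)] by (auto simp: marked_def)
qed

lemma ts_inj: "i < k \<Longrightarrow> j < k \<Longrightarrow> ts ! i = ts ! j \<Longrightarrow> i = j"
  using ts_props(4)[of i j] ts_props(4)[of j i] by (cases i j rule: linorder_cases) auto

subsection \<open>The induced dynamics on oriented arcs\<close>

definition other :: "'v set \<Rightarrow> 'v \<Rightarrow> 'v" where
  "other e x = (THE y. y \<in> e \<and> y \<noteq> x)"

lemma other_eq: "x \<noteq> y \<Longrightarrow> other {x, y} x = y" "x \<noteq> y \<Longrightarrow> other {y, x} x = y"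
  unfolding other_def by (rule the_equality; auto)+

lemma edge_cases:
  assumes "j < k" "x \<in> fst (W ! j)"
  obtains y where "fst (W ! j) = {x, y}" "x \<noteq> y" "y \<in> V" "other (fst (W ! j)) x = y" "other (fst (W ! j)) y = x"
proof -
  obtain a b where ab: "fst (W ! j) = {a, b}" "a \<noteq> b"
    using edge_letter(3)[OF assms(1)] by (auto simp: card_2_iff)
  have V: "fst (W ! j) \<subseteq> V" by (rule edge_letter(2)[OF assms(1)])
  show ?thesis
  proof (cases "x = a")
    case True
    show ?thesis by (rule that[of b]) (use ab V True in \<open>auto simp: other_eq\<close>)
  next
    case False
    then have "x = b" using assms ab by auto
    show ?thesis by (rule that[of a]) (use ab V \<open>x = b\<close> in \<open>auto simp: other_eq\<close>)
  qed
qed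

definition oriented_arcs :: "('v \<times> nat \<times> bool) set" where
  "oriented_arcs = V \<times> {..k} \<times> UNIV"

text \<open>\<open>jump j d i'\<close> is the arc on which a particle on \<open>d\<close> continues after meeting the \<open>j\<close>-th mark, where
  \<open>i'\<close> is the level on the other side of that mark.\<close>

definition jump :: "nat \<Rightarrow> 'v \<times> nat \<times> bool \<Rightarrow> nat \<Rightarrow> 'v \<times> nat \<times> bool" where
  "jump j = (\<lambda>(x, i, b) i'. if x \<notin> fst (W ! j) then (x, i', b)
     else if snd (W ! j) = Cross then (other (fst (W ! j)) x, i', b)
     else (other (fst (W ! j)) x, i, \<not> b))"

text \<open>The flag \<open>True\<close> means upward motion.  The mark above level \<open>i\<close> has index \<open>i\<close> and the mark below it
  has index \<open>i - 1\<close>.  Making the map the identity off the oriented arcs turns it into an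
  injection of the whole type, so that results on iterates of injective maps apply.\<close>

definition next_arc :: "'v \<times> nat \<times> bool \<Rightarrow> 'v \<times> nat \<times> bool" where
  "next_arc d = (if d \<notin> oriented_arcs then d else case d of (x, i, b) \<Rightarrow>
     if b then (if i = k then (x, 0, b) else jump i d (Suc i))
     else (if i = 0 then (x, k, b) else jump (i - 1) d (i - 1)))"

definition reverse_arc :: "'v \<times> nat \<times> bool \<Rightarrow> 'v \<times> nat \<times> bool" where
  "reverse_arc = (\<lambda>(x, i, b). (x, i, \<not> b))"

lemma reverse_arc_reverse_arc: "reverse_arc (reverse_arc d) = d" by (simp add: reverse_arc_def split_beta)

text \<open>Time reversal: turning around after a step leads back.  This yields injectivity, hence periodicity of
  the trajectories.\<close>

lemma next_arc_reverse_arc: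
  assumes "d \<in> oriented_arcs"
  shows "next_arc d \<in> oriented_arcs" "next_arc (reverse_arc (next_arc d)) = reverse_arc d"
proof -
  obtain x i b where d: "d = (x, i, b)" by (cases d)
  have xi: "x \<in> V" "i \<le> k" using assms by (auto simp: d oriented_arcs_def)
  have "next_arc d \<in> oriented_arcs \<and> next_arc (reverse_arc (next_arc d)) = reverse_arc d"
  proof (cases b)
    case True
    show ?thesis
    proof (cases "i = k")
      case ik: False
      then have i: "i < k" using xi by simp
      show ?thesis
      proof (cases "x \<in> fst (W ! i)")
        case x: True
        obtain y where y: "fst (W ! i) = {x, y}" "x \<noteq> y" "y \<in> V"
          "other (fst (W ! i)) x = y" "other (fst (W ! i)) y = x"
          using edge_cases[OF i x] .
        show ?thesis using True i x y xi
          by (cases "snd (W ! i)") (simp_all add: d next_arc_def reverse_arc_def oriented_arcs_def jump_def)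
      qed (use True i xi in \<open>simp add: d next_arc_def reverse_arc_def oriented_arcs_def jump_def\<close>)
    qed (use True xi in \<open>simp add: d next_arc_def reverse_arc_def oriented_arcs_def\<close>)
  next
    case False
    show ?thesis
    proof (cases "i = 0")
      case ik: False
      then obtain j where i: "i = Suc j" "j < k" using xi by (cases i) auto
      show ?thesis
      proof (cases "x \<in> fst (W ! j)")
        case x: True
        obtain y where y: "fst (W ! j) = {x, y}" "x \<noteq> y" "y \<in> V"
          "other (fst (W ! j)) x = y" "other (fst (W ! j)) y = x"
          using edge_cases[OF i(2) x] .
        show ?thesis using False i x y xi
          by (cases "snd (W ! j)") (simp_all add: d next_arc_def reverse_arc_def oriented_arcs_def jump_def)
      qed (use False i xi in \<open>simp add: d next_arc_def reverse_arc_def oriented_arcs_def jump_def\<close>)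
    qed (use False xi in \<open>simp add: d next_arc_def reverse_arc_def oriented_arcs_def\<close>)
  qed
  then show "next_arc d \<in> oriented_arcs" "next_arc (reverse_arc (next_arc d)) = reverse_arc d" by auto
qed

lemma inj_next_arc: "inj next_arc"
proof (rule injI)
  fix d d' assume eq: "next_arc d = next_arc d'"
  have "next_arc d \<in> oriented_arcs \<longleftrightarrow> d \<in> oriented_arcs" for d using next_arc_reverse_arc(1)[of d] by (auto simp: next_arc_def)
  then have "d \<in> oriented_arcs \<longleftrightarrow> d' \<in> oriented_arcs" using eq by metis
  then show "d = d'"
  proof (cases "d \<in> oriented_arcs")
    case True
    then have "reverse_arc d = reverse_arc d'" using next_arc_reverse_arc(2) eq \<open>d \<in> oriented_arcs \<longleftrightarrow> d' \<in> oriented_arcs\<close> by metis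
    then show ?thesis using reverse_arc_reverse_arc by metis
  qed (use eq in \<open>simp add: next_arc_def\<close>)
qed

definition trajectory :: "'v \<times> nat \<times> bool \<Rightarrow> ('v \<times> nat \<times> bool) set" where
  "trajectory d = range (\<lambda>n. (next_arc ^^ n) d)"

lemma trajectory_refl: "d \<in> trajectory d" unfolding trajectory_def by (rule range_eqI[of _ _ 0]) simp

lemma trajectory_trans: "d' \<in> trajectory d \<Longrightarrow> d'' \<in> trajectory d' \<Longrightarrow> d'' \<in> trajectory d"
  unfolding trajectory_def by (auto simp: funpow_add[THEN fun_cong, simplified, symmetric] simp del: funpow_add)

lemma trajectory_next_arc: "next_arc d \<in> trajectory d" unfolding trajectory_def by (rule range_eqI[of _ _ 1]) simp

lemma trajectory_oriented_arcs: "d \<in> oriented_arcs \<Longrightarrow> trajectory d \<subseteq> oriented_arcs"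
proof -
  assume "d \<in> oriented_arcs"
  then have "(next_arc ^^ n) d \<in> oriented_arcs" for n by (induction n) (auto intro: next_arc_reverse_arc)
  then show ?thesis by (auto simp: trajectory_def)
qed

lemma finite_oriented_arcs: "finite oriented_arcs" using finite_V by (simp add: oriented_arcs_def)

lemma recurrence:
  assumes "d \<in> oriented_arcs"
  obtains n where "n > 0" "(next_arc ^^ n) d = d"
proof -
  have "{y. \<exists>n. y = (next_arc ^^ n) d} \<subseteq> oriented_arcs" using trajectory_oriented_arcs[OF assms] by (auto simp: trajectory_def)
  then show ?thesis using funpow_inj_finite[OF inj_next_arc] finite_oriented_arcs that by (metis finite_subset)
qed

lemma funpow_period: "(next_arc ^^ n) d = d \<Longrightarrow> (next_arc ^^ (n * m)) d = d"
  by (induction m) (auto simp: funpow_add)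

text \<open>By periodicity every arc of the trajectory is reached again after arbitrarily many steps.  Two
  steps are what the proof of \<open>loop_from_state_at\<close> needs: the starting arc may be entered in the middle,
  and the visit to the start of an arc is the end of a step from the preceding one.\<close>

lemma trajectory_later:
  assumes "d \<in> oriented_arcs" "d' \<in> trajectory d"
  shows "\<exists>n. d' = (next_arc ^^ Suc (Suc n)) d"
proof -
  obtain m where m: "d' = (next_arc ^^ m) d" using assms(2) by (auto simp: trajectory_def)
  obtain p where p: "p > 0" "(next_arc ^^ p) d = d" using recurrence[OF assms(1)] .
  have "(next_arc ^^ (m + p * 2)) d = d'" using funpow_period[OF p(2), of 2] by (simp add: funpow_add m)
  moreover have "\<exists>n. m + p * 2 = Suc (Suc n)" using p(1) by (intro exI[of _ "m + p * 2 - 2"]) auto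
  ultimately show ?thesis by metis
qed

lemma trajectory_sym:
  assumes "d \<in> oriented_arcs" "d' \<in> trajectory d"
  shows "d \<in> trajectory d'"
proof -
  obtain m where m: "d' = (next_arc ^^ m) d" using assms(2) by (auto simp: trajectory_def)
  obtain p where p: "p > 0" "(next_arc ^^ p) d = d" using recurrence[OF assms(1)] .
  have "m \<le> p * m" using p(1) by (cases p) auto
  then have "(next_arc ^^ (p * m - m)) d' = (next_arc ^^ (p * m)) d"
    unfolding m by (simp flip: funpow_add[THEN fun_cong, simplified comp_def])
  then show ?thesis unfolding trajectory_def using funpow_period[OF p(2), of m] by (metis rangeI)
qed

subsection \<open>Orbits and connectedness\<close>

abbreviation joined where "joined \<equiv> conn (arcs V W) (links V W)"

lemma links_sub: "links V W \<subseteq> arcs V W \<times> arcs V W"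
proof -
  have "edges_in V (fst ` set W)" using edges rep by (auto simp: edges_in_def represents_def)
  then show ?thesis by (rule links_subset)
qed

lemma next_arc_linked:
  assumes "(x, i, b) \<in> oriented_arcs" "next_arc (x, i, b) = (y, j, b')"
  shows "((x, i), (y, j)) \<in> joined"
proof -
  have xi: "x \<in> V" "i \<le> k" using assms by (auto simp: oriented_arcs_def)
  have inner: "((z, l), (z', l')) \<in> joined" if "m < k" "((z, l), (z', l')) \<in> joins V (W ! m) m (Suc m)" for z l z' l' m
    using that by (intro conn_step links_sub) (auto simp: links_def inner_links_def)
  have wrap: "((z, k), (z, 0)) \<in> joined" if "z \<in> V" for z
    using that by (intro conn_step links_sub) (auto simp: links_def)
  show ?thesis
  proof (cases b)
    case True
    show ?thesis
    proof (cases "i = k")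
      case False
      then have i: "i < k" using xi by simp
      show ?thesis
      proof (cases "x \<in> fst (W ! i)")
        case x: True
        obtain z where z: "fst (W ! i) = {x, z}" "x \<noteq> z" "z \<in> V"
          "other (fst (W ! i)) x = z" "other (fst (W ! i)) z = x"
          using edge_cases[OF i x] .
        show ?thesis using assms True i x z xi
          by (intro inner[OF i]) (cases "snd (W ! i)"; auto simp: next_arc_def jump_def joins_def)
      qed (use assms True i xi in \<open>intro inner[OF i]; auto simp: next_arc_def jump_def joins_def\<close>)
    qed (use assms True xi wrap in \<open>auto simp: next_arc_def\<close>)
  next
    case False
    show ?thesis
    proof (cases "i = 0")
      case ik: False
      then obtain l where i: "i = Suc l" "l < k" using xi by (cases i) auto
      show ?thesis
      proof (cases "x \<in> fst (W ! l)")
        case x: True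
        obtain z where z: "fst (W ! l) = {x, z}" "x \<noteq> z" "z \<in> V"
          "other (fst (W ! l)) x = z" "other (fst (W ! l)) z = x"
          using edge_cases[OF i(2) x] .
        show ?thesis using assms False i x z xi
          by (intro conn_sym[OF inner[OF i(2)]]) (cases "snd (W ! l)"; auto simp: next_arc_def jump_def joins_def)
      qed (use assms False i xi in \<open>intro conn_sym[OF inner[OF i(2)]]; auto simp: next_arc_def jump_def joins_def\<close>)
    qed (use assms False xi wrap in \<open>auto simp: next_arc_def intro: conn_sym\<close>)
  qed
qed

text \<open>Every link is a step of the particle in a suitable direction.\<close>

lemma link_next_arc:
  assumes "((x, i), (y, j)) \<in> links V W" "(x, i) \<noteq> (y, j)"
  shows "\<exists>b b'. next_arc (x, i, b) = (y, j, b')"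
proof -
  have xy: "x \<in> V" "i \<le> k" "y \<in> V" "j \<le> k" using assms links_sub by (auto simp: arcs_def)
  consider (wrap) "i = k" "j = 0" "y = x" | (inner) m where "m < k" "((x, i), (y, j)) \<in> joins V (W ! m) m (Suc m)"
    using assms by (auto simp: links_def inner_links_def)
  then show ?thesis
  proof cases
    case wrap
    then have "next_arc (x, i, True) = (y, j, True)" using xy by (simp add: next_arc_def oriented_arcs_def)
    then show ?thesis by blast
  next
    case inner
    note m = inner(1)
    consider (1) "x \<notin> fst (W ! m)" "y = x" "i = m" "j = Suc m"
      | (2) "snd (W ! m) = Cross" "x \<in> fst (W ! m)" "y \<in> fst (W ! m)" "x \<noteq> y" "i = m" "j = Suc m"
      | (3) "snd (W ! m) = Bar" "x \<in> fst (W ! m)" "y \<in> fst (W ! m)" "x \<noteq> y" "i = m" "j = m"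
      | (4) "snd (W ! m) = Bar" "x \<in> fst (W ! m)" "y \<in> fst (W ! m)" "x \<noteq> y" "i = Suc m" "j = Suc m"
      using inner(2) assms(2) by (cases "snd (W ! m)") (auto simp: joins_def)
    then show ?thesis
    proof cases
      case 1
      then have "next_arc (x, i, True) = (y, j, True)" using xy m by (simp add: next_arc_def oriented_arcs_def jump_def)
      then show ?thesis by blast
    next
      case 2
      then obtain z where z: "fst (W ! m) = {x, z}" "other (fst (W ! m)) x = z" using edge_cases[OF m] by metis
      then have "next_arc (x, i, True) = (y, j, True)" using xy m 2 by (auto simp: next_arc_def oriented_arcs_def jump_def)
      then show ?thesis by blast
    next
      case 3
      then obtain z where z: "fst (W ! m) = {x, z}" "other (fst (W ! m)) x = z" using edge_cases[OF m] by metis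
      then have "next_arc (x, i, True) = (y, j, False)" using xy m 3 by (auto simp: next_arc_def oriented_arcs_def jump_def)
      then show ?thesis by blast
    next
      case 4
      then obtain z where z: "fst (W ! m) = {x, z}" "other (fst (W ! m)) x = z" using edge_cases[OF m] by metis
      then have "next_arc (x, i, False) = (y, j, True)" using xy m 4 by (auto simp: next_arc_def oriented_arcs_def jump_def)
      then show ?thesis by blast
    qed
  qed
qed

lemma trajectory_conn: "(x, i, b) \<in> oriented_arcs \<Longrightarrow> (y, j, b') \<in> trajectory (x, i, b) \<Longrightarrow> ((x, i), (y, j)) \<in> joined"
proof -
  assume d: "(x, i, b) \<in> oriented_arcs" and "(y, j, b') \<in> trajectory (x, i, b)"
  then obtain n where n: "(next_arc ^^ n) (x, i, b) = (y, j, b')" unfolding trajectory_def by auto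
  have "(next_arc ^^ n) (x, i, b) = (y, j, b') \<Longrightarrow> ((x, i), (y, j)) \<in> joined" for y j b'
  proof (induction n arbitrary: y j b')
    case 0
    then show ?case using d by (auto simp: oriented_arcs_def arcs_def intro: conn_refl)
  next
    case (Suc n)
    obtain z l c where z: "(next_arc ^^ n) (x, i, b) = (z, l, c)" by (metis prod_cases3)
    have "(z, l, c) \<in> oriented_arcs" using trajectory_oriented_arcs[OF d] z unfolding trajectory_def by (metis rangeI subsetD)
    then have "((z, l), (y, j)) \<in> joined" using Suc.prems z by (intro next_arc_linked) auto
    then show ?case using Suc.IH[OF z] conn_trans by metis
  qed
  then show ?thesis using n by blast
qed

text \<open>A link is followed either in the direction of the motion or against it.  In the latter case the
  reversed step starts at the far end, and the trajectory, being periodic, nevertheless reaches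
  that end.\<close>

lemma conn_trajectory:
  assumes "(u, v) \<in> joined"
  shows "\<exists>b'. (fst v, snd v, b') \<in> trajectory (fst u, snd u, b)"
proof -
  have one: "\<exists>b'. (fst v, snd v, b') \<in> trajectory (fst u, snd u, b)"
    if uv: "(u, v) \<in> links V W \<or> (v, u) \<in> links V W" for u v b
  proof (cases "u = v")
    case False
    have in_oriented_arcs: "(fst u, snd u, c) \<in> oriented_arcs" "(fst v, snd v, c) \<in> oriented_arcs" for c
      using uv links_sub by (auto simp: oriented_arcs_def arcs_def)
    have rev: "next_arc (fst v, snd v, \<not> c') = (fst u, snd u, \<not> c)"
      if "(fst u, snd u, c) \<in> oriented_arcs" "next_arc (fst u, snd u, c) = (fst v, snd v, c')" for u v c c'
      using next_arc_reverse_arc(2)[OF that(1)] that(2) by (simp add: reverse_arc_def)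
    obtain c c' where c: "next_arc (fst u, snd u, c) = (fst v, snd v, c')"
    proof (cases "(u, v) \<in> links V W")
      case True
      then show ?thesis using link_next_arc[of "fst u" "snd u" "fst v" "snd v"] False that by (auto simp: prod_eq_iff)
    next
      case nuv: False
      then obtain c c' where "next_arc (fst v, snd v, c) = (fst u, snd u, c')"
        using link_next_arc[of "fst v" "snd v" "fst u" "snd u"] False uv by (auto simp: prod_eq_iff)
      then show ?thesis using rev[OF in_oriented_arcs(2)] that by blast
    qed
    show ?thesis
    proof (cases "b = c")
      case True
      then show ?thesis using c trajectory_next_arc[of "(fst u, snd u, c)"] by auto
    next
      case False
      then have b: "b = (\<not> c)" by auto
      have "(fst u, snd u, \<not> c) \<in> trajectory (fst v, snd v, \<not> c')"
        using rev[OF in_oriented_arcs(1) c] trajectory_next_arc by metis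
      then have "(fst v, snd v, \<not> c') \<in> trajectory (fst u, snd u, \<not> c)" by (rule trajectory_sym[OF in_oriented_arcs(2)])
      then show ?thesis unfolding b by blast
    qed
  qed (use trajectory_refl in blast)
  have "(u, v) \<in> (links V W \<union> (links V W)\<inverse>)\<^sup>*" using assms by (simp add: conn_def)
  then show ?thesis
  proof (induction rule: rtrancl_induct)
    case base
    show ?case using trajectory_refl by blast
  next
    case (step v w)
    then obtain b' where "(fst v, snd v, b') \<in> trajectory (fst u, snd u, b)" by blast
    moreover obtain b'' where "(fst w, snd w, b'') \<in> trajectory (fst v, snd v, b')"
      using one[of v w b'] step(2) by auto
    ultimately show ?case using trajectory_trans by blast
  qed
qed

subsection \<open>Trajectories follow the orbits\<close>

definition direction :: "bool \<Rightarrow> real" where "direction b = (if b then 1 else -1)"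

definition entry :: "'v \<times> nat \<times> bool \<Rightarrow> real" where
  "entry = (\<lambda>(x, i, b). if b then cut i else cut (Suc i))"

definition exit_time :: "'v \<times> nat \<times> bool \<Rightarrow> real" where
  "exit_time = (\<lambda>(x, i, b). if b then cut (Suc i) else cut i)"

text \<open>The state of a particle that has travelled the distance \<open>p\<close> along an oriented arc.\<close>

definition state_at :: "'v \<times> nat \<times> bool \<Rightarrow> real \<Rightarrow> 'v \<times> real \<times> real" where
  "state_at = (\<lambda>(x, i, b) p. (x, frac (entry (x, i, b) + direction b * p), direction b))"

definition track :: "'v \<times> nat \<Rightarrow> ('v \<times> real) set" where
  "track = (\<lambda>(x, i). {x} \<times> frac ` {cut i..cut (Suc i)})"

lemma exit_entry: "exit_time (x, i, b) = entry (x, i, b) + direction b * len i"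
  by (auto simp: exit_time_def entry_def direction_def len_def)

lemma entry_next_arc:
  assumes "d \<in> oriented_arcs"
  shows "frac (entry (next_arc d)) = frac (exit_time d)"
proof -
  obtain x i b where d: "d = (x, i, b)" by (cases d)
  have i: "i \<le> k" using assms by (auto simp: d oriented_arcs_def)
  show ?thesis
  proof (cases b)
    case True
    then show ?thesis using assms i
      by (cases "i = k") (auto simp: d next_arc_def entry_def exit_time_def cut_bounds jump_def)
  next
    case False
    then show ?thesis using assms i
      by (cases i) (auto simp: d next_arc_def entry_def exit_time_def cut_bounds jump_def)
  qed
qed

lemma direction_simps: "direction b = direction b' \<longleftrightarrow> b = b'" "- direction b = direction (\<not> b)" "direction b * direction b = 1"
  by (auto simp: direction_def)

text \<open>The clause of \<open>particle_step\<close> that describes what happens at the end of a step.\<close>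

definition mark_jump :: "'v \<Rightarrow> real \<Rightarrow> real \<Rightarrow> 'v \<Rightarrow> real \<Rightarrow> bool" where
  "mark_jump x s \<sigma> y \<sigma>' \<longleftrightarrow> (if marked E \<omega> x s
      then {x, y} \<in> E \<and> ((s, Cross) \<in> \<omega> {x, y} \<and> \<sigma>' = \<sigma> \<or> (s, Bar) \<in> \<omega> {x, y} \<and> \<sigma>' = - \<sigma>)
      else y = x \<and> \<sigma>' = \<sigma>)"

lemma mark_jump_nth:
  assumes j: "j < k"
  shows "mark_jump x (ts ! j) (direction b) y \<sigma>' \<longleftrightarrow>
    (if x \<in> fst (W ! j) then y = other (fst (W ! j)) x \<and> \<sigma>' = (if snd (W ! j) = Cross then direction b else direction (\<not> b))
     else y = x \<and> \<sigma>' = direction b)"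
proof (cases "x \<in> fst (W ! j)")
  case True
  obtain z where z: "fst (W ! j) = {x, z}" "x \<noteq> z" "z \<in> V"
    "other (fst (W ! j)) x = z" "other (fst (W ! j)) z = x"
    using edge_cases[OF j True] .
  have E: "{x, z} \<in> E" using edge_letter(1)[OF j] z by simp
  have m: "marked E \<omega> x (ts ! j)" using j True by (auto simp: marked_iff)
  have *: "(ts ! j, a) \<in> \<omega> {x, y} \<longleftrightarrow> y = z \<and> a = snd (W ! j)" if "{x, y} \<in> E" for a y
  proof -
    have "(ts ! j, a) \<in> \<omega> {x, y} \<longleftrightarrow> W ! j = ({x, y}, a)"
      using mark_iff[OF that] j ts_inj by metis
    also have "\<dots> \<longleftrightarrow> y = z \<and> a = snd (W ! j)"
      using z by (auto simp: prod_eq_iff doubleton_eq_iff)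
    finally show ?thesis .
  qed
  show ?thesis
    using m True z E * by (cases "snd (W ! j)") (auto simp: mark_jump_def direction_simps)
next
  case False
  then have "\<not> marked E \<omega> x (ts ! j)" using ts_inj[OF j] by (auto simp: marked_iff)
  then show ?thesis using False by (simp add: mark_jump_def)
qed

lemma not_marked_0: "\<not> marked E \<omega> x 0"
  using ts_props by (force simp: marked_iff)

lemma frac_cut: "j < k \<Longrightarrow> frac (ts ! j) = ts ! j"
  using ts_props(2,3)[of j] by (simp add: frac_eq)

text \<open>At the end of an arc, the continuous dynamics does precisely what \<open>next_arc\<close> prescribes.  If the line
  is not affected by the mark, or the end is at time \<open>0\<close>, this means going straight on.\<close>

lemma exit_jump:
  assumes "(x, i, b) \<in> oriented_arcs"
  shows "mark_jump x (frac (exit_time (x, i, b))) (direction b) y \<sigma>' \<longleftrightarrow>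
    (\<exists>j b'. next_arc (x, i, b) = (y, j, b') \<and> \<sigma>' = direction b')"
proof (cases b)
  case True
  show ?thesis
  proof (cases "i = k")
    case True': True
    then show ?thesis using True assms not_marked_0
      by (auto simp: exit_time_def cut_bounds mark_jump_def next_arc_def)
  next
    case False
    then have "i < k" using assms by (auto simp: oriented_arcs_def)
    then show ?thesis using True assms
      by (auto simp: exit_time_def cut_bounds frac_cut mark_jump_nth next_arc_def jump_def)
  qed
next
  case False
  show ?thesis
  proof (cases i)
    case 0
    then show ?thesis using False assms not_marked_0
      by (auto simp: exit_time_def cut_bounds mark_jump_def next_arc_def)
  next
    case (Suc j)
    then have "j < k" using assms by (auto simp: oriented_arcs_def)
    then show ?thesis using False assms Suc
      by (auto simp: exit_time_def cut_bounds frac_cut mark_jump_nth next_arc_def jump_def)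
  qed
qed

lemma interior:
  assumes "i \<le> k" "0 < p" "p < len i"
  shows "cut i < entry (x, i, b) + direction b * p" "entry (x, i, b) + direction b * p < cut (Suc i)"
    "frac (entry (x, i, b) + direction b * p) = entry (x, i, b) + direction b * p"
    "\<not> marked E \<omega> y (frac (entry (x, i, b) + direction b * p))"
proof -
  let ?s = "entry (x, i, b) + direction b * p"
  show 1: "cut i < ?s" "?s < cut (Suc i)" using assms by (auto simp: entry_def direction_def len_def)
  have "0 \<le> ?s" "?s < 1" using 1 cut_bounds(4)[of i] cut_bounds(5)[of "Suc i"] assms by auto
  then show 2: "frac ?s = ?s" by (simp add: frac_eq)
  have "?s \<noteq> ts ! j" if "j < k" for j
  proof
    assume s: "?s = ts ! j"
    then have "i = Suc j"
      using cut_unique[of i "Suc j" ?s] cut_mono[of "Suc j" "Suc (Suc j)"] 1 that assms cut_bounds(3)[OF that] by auto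
    then show False using 1 s cut_bounds(3)[OF that] by simp
  qed
  then show "\<not> marked E \<omega> y (frac ?s)" unfolding 2 marked_iff by auto
qed

lemma state_at_track:
  assumes "(x, i, b) \<in> oriented_arcs" "0 \<le> p" "p \<le> len i"
  shows "(x, frac (entry (x, i, b) + direction b * p)) \<in> track (x, i)"
  using assms unfolding track_def by (auto simp: entry_def direction_def len_def intro!: imageI)

text \<open>One step of the particle may pass many mark times of other edges, hence many arcs.  The induction is on
  a bound for the length still to be travelled, measured in units of the shortest arc; each passage to a
  next arc uses up at least one unit.\<close>

lemma flow_sound:
  assumes d: "(x, i, b) \<in> oriented_arcs" and p: "0 \<le> p" "p < len i" and r: "0 < r"
    and free: "\<And>q. 0 < q \<Longrightarrow> q < r \<Longrightarrow> \<not> marked E \<omega> x (frac (entry (x, i, b) + direction b * (p + q)))"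
    and s': "s' = frac (entry (x, i, b) + direction b * (p + r))"
    and jmp: "mark_jump x s' (direction b) y \<sigma>'"
  shows "\<exists>j b' p'. (y, j, b') \<in> trajectory (x, i, b) \<and> 0 \<le> p' \<and> p' < len j \<and> (y, s', \<sigma>') = state_at (y, j, b') p' \<and>
    (\<exists>l. (x, l, b) \<in> trajectory (x, i, b) \<and> (x, s') \<in> track (x, l))"
proof -
  define g where "g = Min (len ` {..k})"
  have g: "0 < g" "\<And>i. i \<le> k \<Longrightarrow> g \<le> len i" unfolding g_def using len_pos by auto
  obtain n where "(p + r) / g \<le> real n" using real_arch_simple by blast
  then have "p + r \<le> real n * g" using g by (simp add: field_simps)
  then show ?thesis using assms
  proof (induction n arbitrary: i p r)
    case 0
    then show ?case by simp
  next
    case (Suc n)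
    note d = Suc.prems(2) and p = Suc.prems(3,4) and r = Suc.prems(5) and free = Suc.prems(6)
      and s' = Suc.prems(7) and jmp = Suc.prems(8)
    have ik: "i \<le> k" using d by (auto simp: oriented_arcs_def)
    consider "p + r < len i" | "p + r = len i" | "len i < p + r" by linarith
    then show ?case
    proof cases
      case 1
      have "\<not> marked E \<omega> x s'" unfolding s' using p r 1 ik by (intro interior(4)) auto
      then have "y = x" "\<sigma>' = direction b" using jmp by (auto simp: mark_jump_def)
      then show ?thesis
        using trajectory_refl[of "(x, i, b)"] state_at_track[OF d, of "p + r"] 1 p r s'
        by (intro exI[of _ i] exI[of _ b] exI[of _ "p + r"]) (auto simp: state_at_def)
    next
      case 2
      then have s: "s' = frac (exit_time (x, i, b))" unfolding s' exit_entry by simp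
      obtain j b' where j: "next_arc (x, i, b) = (y, j, b')" "\<sigma>' = direction b'"
        using jmp unfolding s exit_jump[OF d] by blast
      have "j \<le> k" using next_arc_reverse_arc(1)[OF d] j by (auto simp: oriented_arcs_def)
      moreover have "s' = frac (entry (y, j, b'))" using entry_next_arc[OF d] j s by simp
      ultimately show ?thesis
        using trajectory_next_arc[of "(x, i, b)"] trajectory_refl[of "(x, i, b)"] state_at_track[OF d, of "len i"] len_pos[of j] len_pos[OF ik] 2 s' j
        by (intro exI[of _ j] exI[of _ b'] exI[of _ 0]) (auto simp: state_at_def)
    next
      case 3
      have "\<not> marked E \<omega> x (frac (exit_time (x, i, b)))"
        using free[of "len i - p"] 3 p by (simp add: exit_entry)
      then have "mark_jump x (frac (exit_time (x, i, b))) (direction b) x (direction b)" by (simp add: mark_jump_def)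
      then obtain j where j: "next_arc (x, i, b) = (x, j, b)"
        unfolding exit_jump[OF d] by (auto simp: direction_simps)
      have dj: "(x, j, b) \<in> oriented_arcs" using next_arc_reverse_arc(1)[OF d] j by simp
      then have jk: "j \<le> k" by (auto simp: oriented_arcs_def)
      have shift: "frac (entry (x, j, b) + direction b * q) = frac (entry (x, i, b) + direction b * (len i + q))" for q
      proof -
        have "frac (entry (x, j, b) + direction b * q) = frac (frac (entry (x, j, b)) + direction b * q)" by simp
        also have "\<dots> = frac (frac (exit_time (x, i, b)) + direction b * q)"
          using entry_next_arc[OF d] j by simp
        also have "\<dots> = frac (exit_time (x, i, b) + direction b * q)" by simp
        finally show ?thesis by (simp add: exit_entry algebra_simps)
      qed
      have "\<exists>l b' p'. (y, l, b') \<in> trajectory (x, j, b) \<and> 0 \<le> p' \<and> p' < len l \<and> (y, s', \<sigma>') = state_at (y, l, b') p' \<and>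
          (\<exists>l. (x, l, b) \<in> trajectory (x, j, b) \<and> (x, s') \<in> track (x, l))"
      proof (rule Suc.IH[where p = 0 and r = "p + r - len i"])
        show "0 + (p + r - len i) \<le> real n * g" using Suc.prems(1) g(2)[OF ik] by (simp add: algebra_simps)
        show "0 < len j" by (rule len_pos[OF jk])
        show "\<not> marked E \<omega> x (frac (entry (x, j, b) + direction b * (0 + q)))" if "0 < q" "q < p + r - len i" for q
          using free[of "q + len i - p"] that p shift[of q] by (simp add: add.commute)
        show "s' = frac (entry (x, j, b) + direction b * (0 + (p + r - len i)))"
          unfolding s' using shift[of "p + r - len i"] by simp
      qed (use dj 3 jmp in auto)
      then show ?thesis using trajectory_trans[OF trajectory_next_arc[of "(x, i, b)", unfolded j]] by meson
    qed
  qed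
qed

lemma particle_step_iff: "particle_step E \<omega> (x, s, \<sigma>) (y, s', \<sigma>') \<longleftrightarrow> (\<exists>r>0. s' = frac (s + \<sigma> * r) \<and>
    (\<forall>q. 0 < q \<and> q < r \<longrightarrow> \<not> marked E \<omega> x (frac (s + \<sigma> * q))) \<and> mark_jump x s' \<sigma> y \<sigma>')"
  by (simp add: particle_step_def mark_jump_def)

lemma frac_shift: "frac (frac (a + c * p) + c * q) = frac (a + c * (p + q))" for a c p q :: real
  by (simp add: algebra_simps)

lemma step_sound:
  assumes d: "(x, i, b) \<in> oriented_arcs" and p: "0 \<le> p" "p < len i"
    and step: "particle_step E \<omega> (state_at (x, i, b) p) (y, s', \<sigma>')"
  obtains j b' p' l where "(y, j, b') \<in> trajectory (x, i, b)" "0 \<le> p'" "p' < len j" "(y, s', \<sigma>') = state_at (y, j, b') p'"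
    "(x, l, b) \<in> trajectory (x, i, b)" "(x, s') \<in> track (x, l)"
proof -
  obtain r where r: "r > 0" "s' = frac (entry (x, i, b) + direction b * (p + r))"
    "\<And>q. 0 < q \<Longrightarrow> q < r \<Longrightarrow> \<not> marked E \<omega> x (frac (entry (x, i, b) + direction b * (p + q)))"
    "mark_jump x s' (direction b) y \<sigma>'"
    using step unfolding state_at_def prod.case particle_step_iff frac_shift by blast
  show ?thesis
    using flow_sound[OF d p r(1) r(3) r(2,4)] that by blast
qed

lemma step_within:
  assumes d: "(x, i, b) \<in> oriented_arcs" and p: "0 \<le> p" "p < p'" "p' < len i"
  shows "particle_step E \<omega> (state_at (x, i, b) p) (state_at (x, i, b) p')"
proof -
  have ik: "i \<le> k" using d by (auto simp: oriented_arcs_def)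
  have free: "\<not> marked E \<omega> x (frac (entry (x, i, b) + direction b * (p + q)))" if "0 < q" "p + q \<le> p'" for q
    using that p by (intro interior(4)[OF ik]) auto
  have "mark_jump x (frac (entry (x, i, b) + direction b * p')) (direction b) x (direction b)"
    using free[of "p' - p"] p by (simp add: mark_jump_def)
  then show ?thesis
    unfolding state_at_def prod.case particle_step_iff frac_shift
    using free p by (intro exI[of _ "p' - p"]) auto
qed

lemma step_next:
  assumes d: "(x, i, b) \<in> oriented_arcs" and p: "0 \<le> p" "p < len i"
  shows "particle_step E \<omega> (state_at (x, i, b) p) (state_at (next_arc (x, i, b)) 0)"
proof -
  have ik: "i \<le> k" using d by (auto simp: oriented_arcs_def)
  have free: "\<not> marked E \<omega> x (frac (entry (x, i, b) + direction b * (p + q)))" if "0 < q" "p + q < len i" for q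
    using that p by (intro interior(4)[OF ik]) auto
  obtain y j b' where n: "next_arc (x, i, b) = (y, j, b')" by (metis prod_cases3)
  have "mark_jump x (frac (exit_time (x, i, b))) (direction b) y (direction b')"
    unfolding exit_jump[OF d] using n by blast
  moreover have "frac (entry (y, j, b')) = frac (exit_time (x, i, b))" using entry_next_arc[OF d] n by simp
  ultimately show ?thesis
    unfolding n unfolding state_at_def prod.case particle_step_iff frac_shift
    using free p by (intro exI[of _ "len i - p"]) (auto simp: exit_entry)
qed

lemma state_at_exists:
  assumes "x \<in> V" "0 \<le> s" "s < 1"
  shows "\<exists>i p. (x, i, b) \<in> oriented_arcs \<and> 0 \<le> p \<and> p < len i \<and> (x, s, direction b) = state_at (x, i, b) p"
proof -
  obtain i where i: "i \<le> k" "cut i \<le> s" "s < cut (Suc i)" using cut_exists assms by blast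
  have fs: "frac s = s" using assms by (simp add: frac_eq)
  show ?thesis
  proof (cases b)
    case True
    then show ?thesis using i assms fs
      by (intro exI[of _ i] exI[of _ "s - cut i"]) (auto simp: oriented_arcs_def state_at_def entry_def direction_def len_def)
  next
    case b: False
    show ?thesis
    proof (cases "cut i < s")
      case True
      then show ?thesis using i b assms fs
        by (intro exI[of _ i] exI[of _ "cut (Suc i) - s"]) (auto simp: oriented_arcs_def state_at_def entry_def direction_def len_def)
    next
      case False
      then have s: "s = cut i" using i by simp
      show ?thesis
      proof (cases i)
        case 0
        then show ?thesis using s b assms len_pos[of k]
          by (intro exI[of _ k] exI[of _ 0]) (auto simp: oriented_arcs_def state_at_def entry_def direction_def cut_bounds)
      next
        case (Suc j)
        then show ?thesis using s b i assms len_pos[of j] fs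
          by (intro exI[of _ j] exI[of _ 0]) (auto simp: oriented_arcs_def state_at_def entry_def direction_def)
      qed
    qed
  qed
qed

definition loop_of :: "('v \<times> nat) set \<Rightarrow> ('v \<times> real) set" where
  "loop_of K = \<Union> (track ` K)"

text \<open>The loop through a point consists of the arcs linked to the arc of that point.  A trajectory stays in
  the class because steps follow links.  Conversely it runs through every arc of the class in some
  direction, and a single direction suffices to visit all its points.\<close>

lemma loop_from_state_at:
  assumes d: "(x, i, b) \<in> oriented_arcs" and p: "0 \<le> p" "p < len i"
  shows "loop_from E \<omega> (state_at (x, i, b) p) = loop_of (joined `` {(x, i)})"
proof
  let ?O = "trajectory (x, i, b)"
  have in_joined: "track (y, j) \<subseteq> loop_of (joined `` {(x, i)})" if "(y, j, b') \<in> ?O" for y j b'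
    using trajectory_conn[OF d that] by (auto simp: loop_of_def)
  have reach: "\<exists>y j b' p'. a = state_at (y, j, b') p' \<and> (y, j, b') \<in> ?O \<and> 0 \<le> p' \<and> p' < len j"
    if "(particle_step E \<omega>)\<^sup>*\<^sup>* (state_at (x, i, b) p) a" for a
    using that
  proof (induction rule: rtranclp_induct)
    case base
    show ?case using p trajectory_refl by blast
  next
    case (step a a')
    then obtain y j b' p' where y: "a = state_at (y, j, b') p'" "(y, j, b') \<in> ?O" "0 \<le> p'" "p' < len j" by blast
    obtain z s \<sigma> where a': "a' = (z, s, \<sigma>)" by (cases a')
    have "(y, j, b') \<in> oriented_arcs" using y(2) trajectory_oriented_arcs[OF d] by blast
    from step_sound[OF this y(3,4)] obtain m c p'' where
      "(z, m, c) \<in> trajectory (y, j, b')" "0 \<le> p''" "p'' < len m" "(z, s, \<sigma>) = state_at (z, m, c) p''"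
      using step(2) unfolding y(1) a' by metis
    then show ?case using trajectory_trans[OF y(2)] unfolding a' by blast
  qed
  show "loop_from E \<omega> (state_at (x, i, b) p) \<subseteq> loop_of (joined `` {(x, i)})"
  proof
    fix w assume "w \<in> loop_from E \<omega> (state_at (x, i, b) p)"
    then obtain z s' y s \<sigma> y' \<sigma>' where w: "w = (z, s')" "(particle_step E \<omega>)\<^sup>*\<^sup>* (state_at (x, i, b) p) (y, s, \<sigma>)"
      "particle_step E \<omega> (y, s, \<sigma>) (y', s', \<sigma>')" "z \<in> {y, y'}"
      unfolding loop_from_def by blast
    obtain v j b' p' where v: "(y, s, \<sigma>) = state_at (v, j, b') p'" "(v, j, b') \<in> ?O" "0 \<le> p'" "p' < len j"
      using reach[OF w(2)] by blast
    have [simp]: "v = y" using v(1) by (simp add: state_at_def)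
    have oriented_arcs: "(y, j, b') \<in> oriented_arcs" using v(2) trajectory_oriented_arcs[OF d] by auto
    have "particle_step E \<omega> (state_at (y, j, b') p') (y', s', \<sigma>')" using w(3) v(1) by simp
    then obtain m c p'' l where m: "(y', m, c) \<in> trajectory (y, j, b')" "0 \<le> p''" "p'' < len m"
      "(y', s', \<sigma>') = state_at (y', m, c) p''" "(y, l, b') \<in> trajectory (y, j, b')" "(y, s') \<in> track (y, l)"
      by (rule step_sound[OF oriented_arcs v(3,4)])
    have "(y, j, b') \<in> ?O" using v(2) by simp
    then have "(y', m, c) \<in> ?O" "(y, l, b') \<in> ?O" using m(1,5) by (blast intro: trajectory_trans)+
    moreover have "(y', s') \<in> track (y', m)"
      using state_at_track[of y' m c p''] m trajectory_oriented_arcs[OF oriented_arcs] by (auto simp: state_at_def)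
    ultimately show "w \<in> loop_of (joined `` {(x, i)})" using in_joined m(6) w by blast
  qed
  have reach_fwd: "(particle_step E \<omega>)\<^sup>*\<^sup>* (state_at (x, i, b) p) (state_at ((next_arc ^^ Suc n) (x, i, b)) 0)" for n
  proof (induction n)
    case 0
    show ?case using step_next[OF d p] by auto
  next
    case (Suc n)
    obtain y j b' where y: "(next_arc ^^ Suc n) (x, i, b) = (y, j, b')" by (metis prod_cases3)
    have oriented_arcs: "(y, j, b') \<in> oriented_arcs" using trajectory_oriented_arcs[OF d] y unfolding trajectory_def by (metis rangeI subsetD)
    have "particle_step E \<omega> (state_at (y, j, b') 0) (state_at (next_arc (y, j, b')) 0)"
      using oriented_arcs by (intro step_next len_pos) (auto simp: oriented_arcs_def)
    then show ?case using Suc y by simp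
  qed
  show "loop_of (joined `` {(x, i)}) \<subseteq> loop_from E \<omega> (state_at (x, i, b) p)"
  proof
    fix w assume "w \<in> loop_of (joined `` {(x, i)})"
    then obtain y j where yj: "((x, i), (y, j)) \<in> joined" "w \<in> track (y, j)" by (auto simp: loop_of_def)
    obtain b' where b': "(y, j, b') \<in> ?O" using conn_trajectory[OF yj(1), of b] by auto
    have oriented_arcs: "(y, j, b') \<in> oriented_arcs" using b' trajectory_oriented_arcs[OF d] by auto
    then have jk: "j \<le> k" by (auto simp: oriented_arcs_def)
    obtain n where n: "(y, j, b') = (next_arc ^^ Suc (Suc n)) (x, i, b)" using trajectory_later[OF d b'] by blast
    obtain t where t: "w = (y, frac t)" "cut j \<le> t" "t \<le> cut (Suc j)" using yj(2) by (auto simp: track_def)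
    define p' where "p' = direction b' * (t - entry (y, j, b'))"
    have p': "0 \<le> p'" "p' \<le> len j" using t by (auto simp: p'_def direction_def entry_def len_def)
    have te: "t = entry (y, j, b') + direction b' * p'" by (simp add: p'_def direction_def)
    have r: "(particle_step E \<omega>)\<^sup>*\<^sup>* (state_at (x, i, b) p) (state_at (y, j, b') 0)" using reach_fwd[of "Suc n"] n by simp
    have add: "w \<in> loop_from E \<omega> (state_at (x, i, b) p)"
      if "(particle_step E \<omega>)\<^sup>*\<^sup>* (state_at (x, i, b) p) c" "particle_step E \<omega> c c'" "w = (fst c, fst (snd c')) \<or> w = (fst c', fst (snd c'))" for c c'
    proof -
      obtain x1 s1 \<sigma>1 where c1: "c = (x1, s1, \<sigma>1)" by (cases c)
      obtain x2 s2 \<sigma>2 where c2: "c' = (x2, s2, \<sigma>2)" by (cases c')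
      have "fst w \<in> {x1, x2}" "w = (fst w, s2)" using that(3) unfolding c1 c2 by auto
      then show ?thesis using that(1,2) unfolding c1 c2 loop_from_def by blast
    qed
    have lj: "0 < len j" by (rule len_pos[OF jk])
    consider "p' = 0" | "0 < p'" "p' < len j" | "p' = len j" using p' by linarith
    then show "w \<in> loop_from E \<omega> (state_at (x, i, b) p)"
    proof cases
      case 1
      obtain z m c where z: "(next_arc ^^ Suc n) (x, i, b) = (z, m, c)" by (metis prod_cases3)
      have zSt: "(z, m, c) \<in> oriented_arcs" using trajectory_oriented_arcs[OF d] z unfolding trajectory_def by (metis rangeI subsetD)
      have "particle_step E \<omega> (state_at (z, m, c) 0) (state_at (next_arc (z, m, c)) 0)"
        using zSt by (intro step_next len_pos) (auto simp: oriented_arcs_def)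
      moreover have "next_arc (z, m, c) = (y, j, b')" using n z by simp
      ultimately show ?thesis using reach_fwd[of n] z 1 t te
        by (intro add[of "state_at (z, m, c) 0" "state_at (y, j, b') 0"]) (auto simp: state_at_def)
    next
      case 2
      show ?thesis
        by (rule add[OF r step_within[OF oriented_arcs _ 2]]) (use t te in \<open>auto simp: state_at_def\<close>)
    next
      case 3
      have "frac (entry (next_arc (y, j, b'))) = frac t"
        using entry_next_arc[OF oriented_arcs] 3 te by (simp add: exit_entry)
      then show ?thesis
        by (intro add[OF r step_next[OF oriented_arcs order_refl lj]]) (auto simp: t state_at_def split_beta)
    qed
  qed
qed

lemma loops_eq: "loops V E \<omega> = loop_of ` (arcs V W // joined)"
proof
  show "loops V E \<omega> \<subseteq> loop_of ` (arcs V W // joined)"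
  proof
    fix L assume "L \<in> loops V E \<omega>"
    then obtain x s \<sigma> where x: "L = loop_from E \<omega> (x, s, \<sigma>)" "x \<in> V" "0 \<le> s" "s < 1" "\<sigma> \<in> {-1, 1}"
      by (auto simp: loops_def)
    obtain b where b: "\<sigma> = direction b" using x(5) by (metis insertE direction_def singletonD)
    obtain i p where i: "(x, i, b) \<in> oriented_arcs" "0 \<le> p" "p < len i" "(x, s, direction b) = state_at (x, i, b) p"
      using state_at_exists[OF x(2-4)] by blast
    have "L = loop_of (joined `` {(x, i)})" using loop_from_state_at[OF i(1-3)] i(4) x(1) b by simp
    moreover have "(x, i) \<in> arcs V W" using i(1) by (auto simp: oriented_arcs_def arcs_def)
    ultimately show "L \<in> loop_of ` (arcs V W // joined)" by (auto intro: quotientI)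
  qed
  show "loop_of ` (arcs V W // joined) \<subseteq> loops V E \<omega>"
  proof
    fix L assume "L \<in> loop_of ` (arcs V W // joined)"
    then obtain x i where x: "(x, i) \<in> arcs V W" "L = loop_of (joined `` {(x, i)})" by (auto elim!: quotientE)
    have oriented_arcs: "(x, i, True) \<in> oriented_arcs" and ik: "i \<le> k" using x by (auto simp: oriented_arcs_def arcs_def)
    have "L = loop_from E \<omega> (state_at (x, i, True) 0)"
      using loop_from_state_at[OF oriented_arcs order_refl len_pos[OF ik]] x by simp
    moreover have "state_at (x, i, True) 0 \<in> V \<times> {0..<1} \<times> {-1, 1}"
      using x by (auto simp: state_at_def direction_def arcs_def frac_lt_1)
    ultimately show "L \<in> loops V E \<omega>" by (auto simp: loops_def)
  qed
qed

text \<open>The endpoint of an arc can belong to several arcs, but its midpoint lies on no other.  Midpoints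
  therefore recover a class from its loop, and the support of the loop from the class.\<close>

lemma loop_of_mid:
  assumes K: "K \<subseteq> arcs V W" and "y \<in> V" "j \<le> k"
  shows "(y, (cut j + cut (Suc j)) / 2) \<in> loop_of K \<longleftrightarrow> (y, j) \<in> K"
proof -
  let ?m = "(cut j + cut (Suc j)) / 2"
  have m: "cut j < ?m" "?m < cut (Suc j)" using cut_less_Suc[OF assms(3)] by auto
  have m01: "0 < ?m" "?m < 1" using m cut_bounds(4)[of j] cut_bounds(5)[of "Suc j"] assms by auto
  have "i = j" if "i \<le> k" "cut i \<le> t" "t \<le> cut (Suc i)" "?m = frac t" for i t
  proof -
    have "t \<noteq> 1" using that(4) m01 by auto
    moreover have "0 \<le> t" "t \<le> 1" using that cut_bounds(4)[of i] cut_bounds(5)[of "Suc i"] by auto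
    ultimately have "t = ?m" using that(4) by (simp add: frac_eq)
    then show ?thesis using cut_unique[of j i ?m] m assms that by auto
  qed
  moreover have "?m \<in> frac ` {cut j..cut (Suc j)}"
    using m m01 by (intro image_eqI[of _ _ ?m]) (auto simp: frac_eq)
  ultimately show ?thesis
  proof -
    assume uniq: "\<And>i t. i \<le> k \<Longrightarrow> cut i \<le> t \<Longrightarrow> t \<le> cut (Suc i) \<Longrightarrow> ?m = frac t \<Longrightarrow> i = j"
      and im: "?m \<in> frac ` {cut j..cut (Suc j)}"
    show ?thesis
    proof
      assume "(y, ?m) \<in> loop_of K"
      then obtain i t where i: "(y, i) \<in> K" "cut i \<le> t" "t \<le> cut (Suc i)" "?m = frac t"
        unfolding loop_of_def track_def by auto
      then have "i \<le> k" using K by (auto simp: arcs_def)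
      then show "(y, j) \<in> K" using uniq[of i t] i by simp
    next
      assume "(y, j) \<in> K"
      then show "(y, ?m) \<in> loop_of K" using im unfolding loop_of_def track_def by blast
    qed
  qed
qed

lemma class_sub: "K \<in> arcs V W // joined \<Longrightarrow> K \<subseteq> arcs V W"
  by (auto elim!: quotientE simp: conn_def)

lemma inj_loop_of: "inj_on loop_of (arcs V W // joined)"
proof (rule inj_onI)
  fix K K' assume K: "K \<in> arcs V W // joined" "K' \<in> arcs V W // joined" and eq: "loop_of K = loop_of K'"
  have "p \<in> K \<longleftrightarrow> p \<in> K'" if "p \<in> arcs V W" for p
    using loop_of_mid[OF class_sub[OF K(1)], of "fst p" "snd p"]
      loop_of_mid[OF class_sub[OF K(2)], of "fst p" "snd p"] eq that by (auto simp: arcs_def)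
  then show "K = K'" using class_sub[OF K(1)] class_sub[OF K(2)] by blast
qed

text \<open>Loops are classes of arcs, so the number of colourings that are constant on loops is a power of \<open>q\<close>.\<close>

theorem power_num_loops: "q ^ num_loops V E \<omega> = word_trace q V W"
proof -
  have "num_loops V E \<omega> = card (arcs V W // joined)"
    unfolding num_loops_def loops_eq by (rule card_image[OF inj_loop_of])
  moreover have "finite (arcs V W)" using finite_V by (simp add: arcs_def)
  ultimately show ?thesis unfolding word_trace_def using card_colourings[OF _ links_sub] by simp
qed

lemma supp_loop_of: "K \<subseteq> arcs V W \<Longrightarrow> supp_V (loop_of K) = fst ` K"
proof
  assume K: "K \<subseteq> arcs V W"
  show "supp_V (loop_of K) \<subseteq> fst ` K" by (force simp: supp_V_def loop_of_def track_def)
  show "fst ` K \<subseteq> supp_V (loop_of K)"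
  proof
    fix y assume "y \<in> fst ` K"
    then obtain j where "(y, j) \<in> K" by auto
    moreover from this have "y \<in> V" "j \<le> k" using K by (auto simp: arcs_def)
    ultimately show "y \<in> supp_V (loop_of K)"
      using loop_of_mid[OF K] unfolding supp_V_def by blast
  qed
qed

end

definition big_class :: "'v set \<Rightarrow> ('v set \<times> mark) list \<Rightarrow> real \<Rightarrow> bool" where
  "big_class V W h \<longleftrightarrow> (\<exists>K\<in>arcs V W // conn (arcs V W) (links V W). h < real (card (fst ` K)))"

lemma (in loop_word) large_loop_iff:
  "\<omega> \<in> large_loop_event V E \<eta> \<longleftrightarrow> big_class V W (\<eta> * real (card V))"
  unfolding large_loop_event_def big_class_def mem_Collect_eq loops_eq
  using supp_loop_of[OF class_sub] by (auto simp: image_iff)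

section \<open>Random words\<close>

definition mark_prob :: "real \<Rightarrow> mark \<Rightarrow> real" where
  "mark_prob u a = (if a = Cross then u else 1 - u)"

definition word_prob :: "real \<Rightarrow> ('e \<times> mark) list \<Rightarrow> real" where
  "word_prob u W = (\<Prod>m\<leftarrow>W. mark_prob u (snd m))"

definition words :: "'e set \<Rightarrow> nat \<Rightarrow> ('e \<times> mark) list set" where
  "words E N = {W. set W \<subseteq> E \<times> UNIV \<and> length W = N}"

lemma finite_UNIV_mark: "finite (UNIV :: mark set)"
proof -
  have eq: "(UNIV :: mark set) = {Cross, Bar}" using mark.exhaust by auto
  show ?thesis by (subst eq) simp
qed

lemma finite_words: "finite E \<Longrightarrow> finite (words E N)"
  unfolding words_def by (rule finite_lists_length_eq) (simp add: finite_UNIV_mark)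

lemma word_prob_snoc: "word_prob u (W @ [m]) = word_prob u W * mark_prob u (snd m)"
  by (simp add: word_prob_def)

lemma mark_prob_nonneg: "u \<in> {0..1} \<Longrightarrow> 0 \<le> mark_prob u a"
  by (simp add: mark_prob_def)

lemma word_prob_nonneg: "u \<in> {0..1} \<Longrightarrow> 0 \<le> word_prob u W"
  unfolding word_prob_def by (induction W) (auto intro!: mult_nonneg_nonneg mark_prob_nonneg)

lemma sum_mark: "(\<Sum>a\<in>UNIV. f (a::mark)) = f Cross + f Bar"
proof -
  have eq: "(UNIV :: mark set) = {Cross, Bar}" using mark.exhaust by auto
  show ?thesis by (subst eq) (simp add: add.commute)
qed

lemma words_Suc: "words E (Suc N) = (\<lambda>(W, m). W @ [m]) ` (words E N \<times> (E \<times> UNIV))"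
proof
  show "words E (Suc N) \<subseteq> (\<lambda>(W, m). W @ [m]) ` (words E N \<times> (E \<times> UNIV))"
  proof
    fix W assume W: "W \<in> words E (Suc N)"
    then have "W \<noteq> []" by (auto simp: words_def)
    then have "W = butlast W @ [last W]" by simp
    moreover have "butlast W \<in> words E N" "last W \<in> E \<times> UNIV"
      using W \<open>W \<noteq> []\<close> by (auto simp: words_def dest: in_set_butlastD last_in_set)
    ultimately show "W \<in> (\<lambda>(W, m). W @ [m]) ` (words E N \<times> (E \<times> UNIV))" by force
  qed
qed (auto simp: words_def)

lemma sum_words_Suc:
  "(\<Sum>W\<in>words E (Suc N). f W) = (\<Sum>W\<in>words E N. \<Sum>e\<in>E. \<Sum>a\<in>UNIV. f (W @ [(e, a)]))"
proof -
  have "inj_on (\<lambda>(W, m). W @ [m]) (words E N \<times> (E \<times> UNIV))" by (auto simp: inj_on_def)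
  then have "(\<Sum>W\<in>words E (Suc N). f W) = (\<Sum>(W, m)\<in>words E N \<times> (E \<times> UNIV). f (W @ [m]))"
    unfolding words_Suc by (subst sum.reindex) (auto simp: split_beta)
  also have "\<dots> = (\<Sum>W\<in>words E N. \<Sum>m\<in>E \<times> UNIV. f (W @ [m]))"
    by (rule sum.cartesian_product[symmetric])
  also have "\<dots> = (\<Sum>W\<in>words E N. \<Sum>e\<in>E. \<Sum>a\<in>UNIV. f (W @ [(e, a)]))"
    by (intro sum.cong refl) (simp add: sum.cartesian_product split_beta)
  finally show ?thesis .
qed

lemma sum_word_prob: "(\<Sum>W\<in>words E N. word_prob u W) = real (card E) ^ N"
proof (induction N)
  case 0
  have "words E 0 = {[]}" by (auto simp: words_def)
  then show ?case by (simp add: word_prob_def)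
next
  case (Suc N)
  then show ?case
    unfolding sum_words_Suc word_prob_snoc
    by (simp add: sum_mark mark_prob_def sum_distrib_left[symmetric] sum_distrib_right[symmetric] algebra_simps)
qed

section \<open>The law of the time-ordered word\<close>

text \<open>Sequences of \<open>N\<close> marks with prescribed kinds and increasing times in the interval \<open>(0, s)\<close>.  The upper
  end \<open>s\<close> is a parameter for the sake of the induction over \<open>N\<close>.\<close>

definition timed :: "real \<Rightarrow> nat \<Rightarrow> (nat \<Rightarrow> mark) \<Rightarrow> real \<Rightarrow> (nat \<Rightarrow> real \<times> mark) set" where
  "timed u N a s = {y \<in> space (PiM {..<N} (\<lambda>_. mark_law u)).
     (\<forall>j\<in>{..<N}. 0 < fst (y j) \<and> fst (y j) < s \<and> snd (y j) = a j) \<and>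
     (\<forall>j\<in>{..<N}. \<forall>i\<in>{..<N}. i < j \<longrightarrow> fst (y i) < fst (y j))}"

lemma prob_space_mark_law: "prob_space (mark_law u)"
proof -
  interpret U: prob_space "uniform_measure lborel {0..<1::real}"
    by (rule prob_space_uniform_measure) auto
  interpret pair_prob_space "uniform_measure lborel {0..<1::real}"
    "measure_pmf (map_pmf (\<lambda>b. if b then Cross else Bar) (bernoulli_pmf u))" ..
  show ?thesis unfolding mark_law_def by unfold_locales
qed

lemma sets_mark_law: "sets (mark_law u) = sets (borel \<Otimes>\<^sub>M count_space UNIV)"
  unfolding mark_law_def by (intro sets_pair_measure_cong) auto

lemma space_mark_law: "space (mark_law u) = UNIV"
  by (simp add: mark_law_def space_pair_measure)

lemma measurable_fst_mark_law[measurable]: "fst \<in> mark_law u \<rightarrow>\<^sub>M borel"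
  by (subst measurable_cong_sets[OF sets_mark_law refl]) simp

lemma measurable_snd_mark_law[measurable]: "snd \<in> mark_law u \<rightarrow>\<^sub>M count_space UNIV"
  by (subst measurable_cong_sets[OF sets_mark_law refl]) simp

lemma sets_timed: "timed u N a s \<in> sets (PiM {..<N} (\<lambda>_. mark_law u))"
proof -
  let ?P = "PiM {..<N} (\<lambda>_. mark_law u)"
  have [measurable]: "(\<lambda>y. fst (y j)) \<in> borel_measurable ?P" "(\<lambda>y. snd (y j)) \<in> ?P \<rightarrow>\<^sub>M count_space UNIV"
    if "j \<in> {..<N}" for j
    using measurable_component_singleton[OF that, of "\<lambda>_. mark_law u"] by measurable
  show ?thesis unfolding timed_def
    by (intro sets.sets_Collect_conj sets.sets_Collect_finite_All sets.sets_Collect_imp; simp?; measurable)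
qed

lemma pmf_mark: "u \<in> {0..1} \<Longrightarrow> pmf (map_pmf (\<lambda>b. if b then Cross else Bar) (bernoulli_pmf u)) a = mark_prob u a"
proof -
  assume u: "u \<in> {0..1}"
  have inj: "inj (\<lambda>b. if b then Cross else Bar)" by (auto simp: inj_def)
  show ?thesis
  proof (cases a)
    case Cross
    then show ?thesis using u pmf_map_inj'[OF inj, of "bernoulli_pmf u" True] by (simp add: mark_prob_def)
  next
    case Bar
    then show ?thesis using u pmf_map_inj'[OF inj, of "bernoulli_pmf u" False] by (simp add: mark_prob_def)
  qed
qed

lemma nn_integral_mark_law:
  assumes u: "u \<in> {0..1}" and [measurable]: "g \<in> borel_measurable borel"
  shows "(\<integral>\<^sup>+ z. g (fst z) * indicator {a} (snd z) \<partial>mark_law u) =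
    ennreal (mark_prob u a) * (\<integral>\<^sup>+ s. g s * indicator {0..<1} s \<partial>lborel)"
proof -
  let ?U = "uniform_measure lborel {0..<1::real}"
  let ?B = "measure_pmf (map_pmf (\<lambda>b. if b then Cross else Bar) (bernoulli_pmf u))"
  have "(\<integral>\<^sup>+ z. g (fst z) * indicator {a} (snd z) \<partial>mark_law u) =
      (\<integral>\<^sup>+ s. \<integral>\<^sup>+ b. g s * indicator {a} b \<partial>?B \<partial>?U)"
  proof -
    have "(\<lambda>z. g (fst z) * indicator {a} (snd z)) \<in> borel_measurable (?U \<Otimes>\<^sub>M ?B)"
    proof (subst measurable_cong_sets[OF sets_mark_law[unfolded mark_law_def] refl])
      have "indicator {a} \<in> borel_measurable (count_space UNIV)" by simp
      then show "(\<lambda>z. g (fst z) * indicator {a} (snd z)) \<in> borel_measurable (borel \<Otimes>\<^sub>M count_space UNIV)"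
        by (intro borel_measurable_times_ennreal measurable_compose[OF measurable_fst]
            measurable_compose[OF measurable_snd] assms(2))
    qed
    then show ?thesis
      unfolding mark_law_def
      by (subst sigma_finite_measure.nn_integral_fst[symmetric])
        (auto intro: prob_space_imp_sigma_finite measure_pmf.prob_space_axioms)
  qed
  also have "\<dots> = (\<integral>\<^sup>+ s. ennreal (mark_prob u a) * g s \<partial>?U)"
  proof (intro nn_integral_cong)
    fix s
    have "(\<integral>\<^sup>+ b. indicator {a} b \<partial>?B) = ennreal (mark_prob u a)"
      by (subst nn_integral_indicator) (simp_all add: emeasure_pmf_single pmf_mark[OF u] del: map_pmf_rep_eq measure_map_pmf)
    then show "(\<integral>\<^sup>+ b. g s * indicator {a} b \<partial>?B) = ennreal (mark_prob u a) * g s"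
      by (subst nn_integral_cmult) (simp_all only: mult.commute, simp)
  qed
  also have "\<dots> = ennreal (mark_prob u a) * (\<integral>\<^sup>+ s. g s * indicator {0..<1} s \<partial>lborel)"
    by (simp add: nn_integral_cmult nn_integral_uniform_measure divide_ennreal_def)
  finally show ?thesis .
qed

lemma nn_integral_power_Ioo:
  assumes "0 \<le> s" "s \<le> 1" "0 \<le> c"
  shows "(\<integral>\<^sup>+ \<tau>. indicator {0<..<s} \<tau> * ennreal (\<tau> ^ N / fact N * c) * indicator {0..<1} \<tau> \<partial>lborel) =
    ennreal (s ^ Suc N / fact (Suc N) * c)"
proof -
  have "(\<integral>\<^sup>+ \<tau>. indicator {0<..<s} \<tau> * ennreal (\<tau> ^ N / fact N * c) * indicator {0..<1} \<tau> \<partial>lborel) =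
      (\<integral>\<^sup>+ \<tau>. ennreal (\<tau> ^ N / fact N * c) * indicator {0..s} \<tau> \<partial>lborel)"
  proof (rule nn_integral_cong_AE)
    show "AE \<tau> in lborel. indicator {0<..<s} \<tau> * ennreal (\<tau> ^ N / fact N * c) * indicator {0..<1} \<tau> =
        ennreal (\<tau> ^ N / fact N * c) * indicator {0..s} \<tau>"
      using AE_lborel_singleton[of 0] AE_lborel_singleton[of s]
    proof eventually_elim
      case (elim \<tau>)
      then show ?case using assms by (auto simp: indicator_def)
    qed
  qed
  also have "\<dots> = ennreal (s ^ Suc N / fact (Suc N) * c) - ennreal (0 ^ Suc N / fact (Suc N) * c)"
  proof (subst nn_integral_FTC_Icc[where F = "\<lambda>\<tau>. \<tau> ^ Suc N / fact (Suc N) * c"])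
    fix \<tau> :: real assume \<tau>: "\<tau> \<in> {0..s}"
    have "((\<lambda>\<tau>. \<tau> ^ Suc N / fact (Suc N) * c) has_real_derivative (real (Suc N) * \<tau> ^ N / fact (Suc N) * c)) (at \<tau>)"
      by (auto intro!: derivative_eq_intros simp del: power_Suc)
    also have "real (Suc N) * \<tau> ^ N / fact (Suc N) * c = \<tau> ^ N / fact N * c"
      by (simp add: field_simps del: of_nat_Suc)
    finally show "((\<lambda>\<tau>. \<tau> ^ Suc N / fact (Suc N) * c) has_real_derivative (\<tau> ^ N / fact N * c)) (at \<tau>)" .
    show "0 \<le> \<tau> ^ N / fact N * c" using \<tau> assms by simp
  qed (use assms in auto)
  finally show ?thesis by simp
qed

text \<open>The volume of the simplex of ordered times.  The induction splits off the last mark: given its time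
  \<open>\<tau>\<close>, the others are ordered in \<open>(0, \<tau>)\<close>, and \<open>\<tau>\<^sup>N / N!\<close> integrates to \<open>s\<^bsup>N+1\<^esup> / (N+1)!\<close>.\<close>

lemma emeasure_timed:
  assumes u: "u \<in> {0..1}" and s: "0 \<le> s" "s \<le> 1"
  shows "emeasure (PiM {..<N} (\<lambda>_. mark_law u)) (timed u N a s) =
    ennreal (s ^ N / fact N * (\<Prod>j<N. mark_prob u (a j)))"
  using s
proof (induction N arbitrary: s)
  case 0
  interpret product_prob_space "\<lambda>_. mark_law u" "{..<0::nat}"
    by (intro product_prob_spaceI prob_space_mark_law)
  have "timed u 0 a s = space (PiM {..<0} (\<lambda>_. mark_law u))" by (simp add: timed_def)
  then show ?case using P.emeasure_space_1 by simp
next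
  case (Suc N)
  let ?M = "mark_law u"
  let ?P = "\<lambda>N. PiM {..<N::nat} (\<lambda>_. ?M)"
  let ?c = "\<Prod>j<N. mark_prob u (a j)"
  interpret product_sigma_finite "\<lambda>_::nat. ?M"
    by (intro product_sigma_finite.intro prob_space_imp_sigma_finite prob_space_mark_law)
  have c: "0 \<le> ?c" by (intro prod_nonneg ballI mark_prob_nonneg[OF u])
  have ind: "indicator (timed u (Suc N) a s) (x(N := z)) =
      (indicator {0<..<s} (fst z) * indicator {a N} (snd z) * indicator (timed u N a (fst z)) x :: ennreal)"
    if x: "x \<in> space (?P N)" for x z
  proof -
    have sp: "x(N := z) \<in> space (?P (Suc N))"
      using x by (auto simp: space_PiM space_mark_law PiE_iff extensional_def)
    have "x(N := z) \<in> timed u (Suc N) a s \<longleftrightarrow> 0 < fst z \<and> fst z < s \<and> snd z = a N \<and> x \<in> timed u N a (fst z)"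
      using x sp unfolding timed_def lessThan_Suc by (auto; force)
    then show ?thesis by (auto simp: indicator_def)
  qed
  have "emeasure (?P (Suc N)) (timed u (Suc N) a s) = (\<integral>\<^sup>+ y. indicator (timed u (Suc N) a s) y \<partial>?P (Suc N))"
    using sets_timed by (simp add: nn_integral_indicator)
  also have "\<dots> = (\<integral>\<^sup>+ z. \<integral>\<^sup>+ x. indicator (timed u (Suc N) a s) (x(N := z)) \<partial>?P N \<partial>?M)"
    using sets_timed[of u "Suc N" a s] unfolding lessThan_Suc
    by (intro product_nn_integral_insert_rev) auto
  also have "\<dots> = (\<integral>\<^sup>+ z. (\<lambda>\<tau>. indicator {0<..<s} \<tau> * ennreal (\<tau> ^ N / fact N * ?c)) (fst z) * indicator {a N} (snd z) \<partial>?M)"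
  proof (rule nn_integral_cong)
    fix z
    have "(\<integral>\<^sup>+ x. indicator (timed u (Suc N) a s) (x(N := z)) \<partial>?P N) =
        (\<integral>\<^sup>+ x. indicator {0<..<s} (fst z) * indicator {a N} (snd z) * indicator (timed u N a (fst z)) x \<partial>?P N)"
      by (intro nn_integral_cong ind)
    also have "\<dots> = indicator {0<..<s} (fst z) * indicator {a N} (snd z) * emeasure (?P N) (timed u N a (fst z))"
      using sets_timed[of u N a "fst z"] by (simp add: nn_integral_cmult)
    also have "\<dots> = indicator {0<..<s} (fst z) * indicator {a N} (snd z) * ennreal (fst z ^ N / fact N * ?c)"
      using Suc.IH[of "fst z"] Suc.prems by (auto simp: indicator_def)
    finally show "(\<integral>\<^sup>+ x. indicator (timed u (Suc N) a s) (x(N := z)) \<partial>?P N) =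
        (\<lambda>\<tau>. indicator {0<..<s} \<tau> * ennreal (\<tau> ^ N / fact N * ?c)) (fst z) * indicator {a N} (snd z)"
      by (simp add: mult_ac)
  qed
  also have "\<dots> = ennreal (mark_prob u (a N)) *
      (\<integral>\<^sup>+ \<tau>. (indicator {0<..<s} \<tau> * ennreal (\<tau> ^ N / fact N * ?c)) * indicator {0..<1} \<tau> \<partial>lborel)"
    by (rule nn_integral_mark_law[OF u]) measurable
  also have "\<dots> = ennreal (mark_prob u (a N)) * ennreal (s ^ Suc N / fact (Suc N) * ?c)"
    using nn_integral_power_Ioo[OF Suc.prems c] by simp
  also have "\<dots> = ennreal (s ^ Suc N / fact (Suc N) * (\<Prod>j<Suc N. mark_prob u (a j)))"
    using mark_prob_nonneg[OF u, of "a N"] by (subst ennreal_mult'[symmetric]) (simp_all add: mult_ac)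
  finally show ?case .
qed

lemma prob_space_poisson_space: "0 \<le> t \<Longrightarrow> prob_space M \<Longrightarrow> prob_space (poisson_space t M)"
proof -
  assume t: "0 \<le> t" and "prob_space M"
  then interpret M: prob_space M by simp
  interpret A: prob_space "poisson_law t" by (rule prob_space_poisson_law[OF t])
  interpret S: prob_space "PiM UNIV (\<lambda>_::nat. M)" by (rule prob_space_PiM) unfold_locales
  interpret Q: pair_prob_space "poisson_law t" "PiM UNIV (\<lambda>_::nat. M)" ..
  show ?thesis unfolding poisson_space_def by unfold_locales
qed

lemma emeasure_poisson_law: "emeasure (poisson_law t) {k} = ennreal (t ^ k / fact k * exp (- t))"
  by (simp add: poisson_law_def emeasure_density nn_integral_indicator_singleton)

abbreviation sample_space :: "'v set set \<Rightarrow> real \<Rightarrow> real \<Rightarrow> 'v sample measure" where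
  "sample_space E t u \<equiv> PiM E (\<lambda>_. poisson_space t (mark_law u))"

text \<open>The label \<open>(e, i)\<close> denotes the \<open>i\<close>-th point in the sample of edge \<open>e\<close>; a list of labels turns a sample
  into a sequence of marks.\<close>

definition labelled_points :: "('v set \<times> nat) list \<Rightarrow> 'v sample \<Rightarrow> nat \<Rightarrow> real \<times> mark" where
  "labelled_points xs w = (\<lambda>j\<in>{..<length xs}. snd (w (fst (xs ! j))) (snd (xs ! j)))"

lemma measurable_labelled_points:
  assumes "fst ` set xs \<subseteq> E"
  shows "labelled_points xs \<in> sample_space E t u \<rightarrow>\<^sub>M PiM {..<length xs} (\<lambda>_. mark_law u)"
  unfolding labelled_points_def
proof (rule measurable_restrict)
  fix j assume "j \<in> {..<length xs}"
  then have e: "fst (xs ! j) \<in> E" using assms by (metis image_subset_iff lessThan_iff nth_mem)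
  have 1: "(\<lambda>w. w (fst (xs ! j))) \<in> sample_space E t u \<rightarrow>\<^sub>M poisson_space t (mark_law u)"
    by (rule measurable_component_singleton[OF e])
  have 2: "(\<lambda>p. snd p (snd (xs ! j))) \<in> poisson_space t (mark_law u) \<rightarrow>\<^sub>M mark_law u"
    unfolding poisson_space_def
    by (rule measurable_compose[OF measurable_snd measurable_component_singleton]) simp
  show "(\<lambda>w. snd (w (fst (xs ! j))) (snd (xs ! j))) \<in> sample_space E t u \<rightarrow>\<^sub>M mark_law u"
    by (rule measurable_compose[OF 1 2])
qed

definition counts_event :: "'v set set \<Rightarrow> real \<Rightarrow> real \<Rightarrow> ('v set \<Rightarrow> nat) \<Rightarrow> 'v sample set" where
  "counts_event E t u \<kappa> = {w \<in> space (sample_space E t u). \<forall>e\<in>E. fst (w e) = \<kappa> e}"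

lemma sets_counts_event: "finite E \<Longrightarrow> counts_event E t u \<kappa> \<in> sets (sample_space E t u)"
proof -
  assume E: "finite E"
  have sp: "space (poisson_law t) = UNIV" by (simp add: poisson_law_def)
  have "counts_event E t u \<kappa> = PiE E (\<lambda>e. {\<kappa> e} \<times> space (PiM UNIV (\<lambda>_::nat. mark_law u)))"
    unfolding counts_event_def
    by (auto simp: space_PiM poisson_space_def space_pair_measure sp PiE_iff mem_Times_iff extensional_def)
  also have "\<dots> \<in> sets (sample_space E t u)"
    unfolding poisson_space_def
    by (intro sets_PiM_I_finite E pair_measureI) (auto simp: poisson_law_def)
  finally show ?thesis .
qed

text \<open>On boxes the statement reduces to the product structure over the edges and, for each edge, to the
  product of the Poisson law with the i.i.d. points.\<close>

lemma labelled_points_box: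
  assumes E: "finite E" and t: "0 \<le> t"
    and xs: "distinct xs" "set xs = Sigma E (\<lambda>e. {..<\<kappa> e})"
    and A: "\<And>j. j \<in> {..<length xs} \<Longrightarrow> A j \<in> sets (mark_law u)"
  shows "emeasure (sample_space E t u)
      (counts_event E t u \<kappa> \<inter> labelled_points xs -` (PiE {..<length xs} A)) =
    (\<Prod>e\<in>E. ennreal (t ^ \<kappa> e / fact (\<kappa> e) * exp (- t))) * (\<Prod>j<length xs. emeasure (mark_law u) (A j))"
proof -
  let ?M = "mark_law u"
  let ?S = "PiM UNIV (\<lambda>_::nat. ?M)"
  let ?L = "Sigma E (\<lambda>e. {..<\<kappa> e})"
  have bij: "bij_betw ((!) xs) {..<length xs} ?L" using bij_betw_nth[OF xs(1) refl xs(2)[symmetric]] .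
  define pos where "pos = inv_into {..<length xs} ((!) xs)"
  have bij': "bij_betw pos ?L {..<length xs}" unfolding pos_def by (rule bij_betw_inv_into[OF bij])
  have pos_nth: "pos (xs ! j) = j" if "j < length xs" for j
    unfolding pos_def using bij that by (simp add: bij_betw_inv_into_left)
  have nth_pos: "xs ! pos l = l" if "l \<in> ?L" for l
    unfolding pos_def using bij_betw_inv_into_right[OF bij that] .
  have pos_lt: "pos l < length xs" if "l \<in> ?L" for l using bij' that by (auto simp: bij_betw_def)
  define F where "F e = {\<kappa> e} \<times> prod_emb UNIV (\<lambda>_::nat. ?M) {..<\<kappa> e} (PiE {..<\<kappa> e} (\<lambda>i. A (pos (e, i))))" for e
  have spL: "space (poisson_law t) = UNIV" by (simp add: poisson_law_def)
  have As: "A (pos (e, i)) \<in> sets ?M" if "e \<in> E" "i < \<kappa> e" for e i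
    using A pos_lt[of "(e, i)"] that by auto
  have sets_emb: "prod_emb UNIV (\<lambda>_::nat. ?M) {..<\<kappa> e} (PiE {..<\<kappa> e} (\<lambda>i. A (pos (e, i)))) \<in> sets ?S" if "e \<in> E" for e
    using As[OF that] by (intro measurable_prod_emb sets_PiM_I_finite) auto
  have emb: "x \<in> prod_emb UNIV (\<lambda>_::nat. ?M) {..<\<kappa> e} (PiE {..<\<kappa> e} (\<lambda>i. A (pos (e, i)))) \<longleftrightarrow>
      (\<forall>i<\<kappa> e. x i \<in> A (pos (e, i)))" for x e
    by (auto simp: prod_emb_def PiE_iff space_mark_law extensional_def)
  have eq: "counts_event E t u \<kappa> \<inter> labelled_points xs -` (PiE {..<length xs} A) = PiE E F"
  proof (rule set_eqI)
    fix w
    have sp: "w \<in> space (sample_space E t u) \<longleftrightarrow> w \<in> extensional E"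
      by (auto simp: space_PiM PiE_iff poisson_space_def space_pair_measure spL space_mark_law)
    have "w \<in> PiE E F \<longleftrightarrow> w \<in> extensional E \<and> (\<forall>e\<in>E. fst (w e) = \<kappa> e \<and> (\<forall>i<\<kappa> e. snd (w e) i \<in> A (pos (e, i))))"
      by (auto simp: PiE_iff F_def mem_Times_iff emb)
    also have "\<dots> \<longleftrightarrow> w \<in> extensional E \<and> (\<forall>e\<in>E. fst (w e) = \<kappa> e) \<and>
        (\<forall>l\<in>?L. snd (w (fst l)) (snd l) \<in> A (pos l))" by auto
    also have "(\<forall>l\<in>?L. snd (w (fst l)) (snd l) \<in> A (pos l)) \<longleftrightarrow>
        (\<forall>j<length xs. snd (w (fst (xs ! j))) (snd (xs ! j)) \<in> A j)" (is "?l \<longleftrightarrow> ?r")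
    proof
      assume ?l
      then show ?r using xs(2) pos_nth by (metis nth_mem)
    next
      assume ?r
      then show ?l using nth_pos pos_lt by metis
    qed
    also have "\<dots> \<longleftrightarrow> labelled_points xs w \<in> PiE {..<length xs} A"
      by (auto simp: labelled_points_def PiE_iff)
    finally show "w \<in> counts_event E t u \<kappa> \<inter> labelled_points xs -` (PiE {..<length xs} A) \<longleftrightarrow> w \<in> PiE E F"
      by (auto simp: counts_event_def sp)
  qed
  interpret PM: product_sigma_finite "\<lambda>_::'a set. poisson_space t ?M"
    by (intro product_sigma_finite.intro prob_space_imp_sigma_finite prob_space_poisson_space t prob_space_mark_law)
  interpret product_prob_space "\<lambda>_::nat. ?M" UNIV by (intro product_prob_spaceI prob_space_mark_law)
  have SF: "sigma_finite_measure ?S" by (rule prob_space_imp_sigma_finite) unfold_locales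
  have "emeasure (sample_space E t u) (PiE E F) = (\<Prod>e\<in>E. emeasure (poisson_space t ?M) (F e))"
    using sets_emb unfolding F_def poisson_space_def
    by (intro PM.emeasure_PiM[unfolded poisson_space_def] E pair_measureI) (auto simp: poisson_law_def)
  also have "\<dots> = (\<Prod>e\<in>E. ennreal (t ^ \<kappa> e / fact (\<kappa> e) * exp (- t)) * (\<Prod>i<\<kappa> e. emeasure ?M (A (pos (e, i)))))"
  proof (rule prod.cong[OF refl])
    fix e assume e: "e \<in> E"
    have "emeasure (poisson_space t ?M) (F e) = emeasure (poisson_law t) {\<kappa> e} *
        emeasure ?S (prod_emb UNIV (\<lambda>_::nat. ?M) {..<\<kappa> e} (PiE {..<\<kappa> e} (\<lambda>i. A (pos (e, i)))))"
      unfolding F_def poisson_space_def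
      by (rule sigma_finite_measure.emeasure_pair_measure_Times[OF SF]) (auto simp: poisson_law_def sets_emb[OF e])
    also have "emeasure ?S (prod_emb UNIV (\<lambda>_::nat. ?M) {..<\<kappa> e} (PiE {..<\<kappa> e} (\<lambda>i. A (pos (e, i))))) =
        (\<Prod>i<\<kappa> e. emeasure ?M (A (pos (e, i))))"
      using As[OF e] by (intro emeasure_PiM_emb) auto
    finally show "emeasure (poisson_space t ?M) (F e) =
        ennreal (t ^ \<kappa> e / fact (\<kappa> e) * exp (- t)) * (\<Prod>i<\<kappa> e. emeasure ?M (A (pos (e, i))))"
      by (simp add: emeasure_poisson_law)
  qed
  also have "\<dots> = (\<Prod>e\<in>E. ennreal (t ^ \<kappa> e / fact (\<kappa> e) * exp (- t))) *
      (\<Prod>e\<in>E. \<Prod>i<\<kappa> e. emeasure ?M (A (pos (e, i))))"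
    by (rule prod.distrib)
  also have "(\<Prod>e\<in>E. \<Prod>i<\<kappa> e. emeasure ?M (A (pos (e, i)))) = (\<Prod>l\<in>?L. emeasure ?M (A (pos l)))"
    using E by (subst prod.Sigma) (auto simp: split_beta)
  also have "\<dots> = (\<Prod>j<length xs. emeasure ?M (A j))"
    by (rule prod.reindex_bij_betw[OF bij'])
  finally show ?thesis unfolding eq .
qed

lemma fst_Sigma_subset: "fst ` Sigma A B \<subseteq> A"
  by auto

text \<open>Given the numbers of points on all edges, the points, in any fixed order of their labels, are
  i.i.d. with law \<open>mark_law u\<close>.  The conditional law agrees with this product measure on boxes, which
  determines it.\<close>

lemma labelled_points_law:
  assumes E: "finite E" and t: "0 < t"
    and xs: "distinct xs" "set xs = Sigma E (\<lambda>e. {..<\<kappa> e})"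
    and A: "A \<in> sets (PiM {..<length xs} (\<lambda>_. mark_law u))"
  shows "emeasure (sample_space E t u) (counts_event E t u \<kappa> \<inter> labelled_points xs -` A) =
    ennreal (\<Prod>e\<in>E. t ^ \<kappa> e / fact (\<kappa> e) * exp (- t)) * emeasure (PiM {..<length xs} (\<lambda>_. mark_law u)) A"
proof -
  let ?R = "sample_space E t u" and ?P = "PiM {..<length xs} (\<lambda>_. mark_law u)"
  define c where "c = (\<Prod>e\<in>E. t ^ \<kappa> e / fact (\<kappa> e) * exp (- t))"
  let ?c = c
  let ?D = "distr (density ?R (indicator (counts_event E t u \<kappa>))) ?P (labelled_points xs)"
  have c: "0 < ?c" unfolding c_def by (rule prod_pos) (use t in simp)
  have ec: "(\<Prod>e\<in>E. ennreal (t ^ \<kappa> e / fact (\<kappa> e) * exp (- t))) = ennreal ?c"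
    unfolding c_def by (rule prod_ennreal) (use t in simp)
  have [measurable]: "counts_event E t u \<kappa> \<in> sets ?R" by (rule sets_counts_event[OF E])
  have "fst ` set xs \<subseteq> E" unfolding xs(2) by (rule fst_Sigma_subset)
  then have meas: "labelled_points xs \<in> ?R \<rightarrow>\<^sub>M ?P" by (rule measurable_labelled_points)
  have D: "emeasure ?D B = emeasure ?R (counts_event E t u \<kappa> \<inter> labelled_points xs -` B)" if "B \<in> sets ?P" for B
  proof -
    have "emeasure ?D B = emeasure (density ?R (indicator (counts_event E t u \<kappa>))) (labelled_points xs -` B \<inter> space ?R)"
    proof -
      have "labelled_points xs \<in> density ?R (indicator (counts_event E t u \<kappa>)) \<rightarrow>\<^sub>M ?P" using meas by simp
      from emeasure_distr[OF this that] show ?thesis by simp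
    qed
    also have "\<dots> = (\<integral>\<^sup>+ w. indicator (counts_event E t u \<kappa>) w * indicator (labelled_points xs -` B \<inter> space ?R) w \<partial>?R)"
      using measurable_sets[OF meas that] by (subst emeasure_density) auto
    also have "\<dots> = (\<integral>\<^sup>+ w. indicator (counts_event E t u \<kappa> \<inter> labelled_points xs -` B) w \<partial>?R)"
      by (intro nn_integral_cong) (auto simp: indicator_def)
    also have "counts_event E t u \<kappa> \<inter> labelled_points xs -` B =
        counts_event E t u \<kappa> \<inter> (labelled_points xs -` B \<inter> space ?R)"
      by (auto simp: counts_event_def)
    finally show ?thesis using measurable_sets[OF meas that]
      by (simp add: nn_integral_indicator) (simp add: counts_event_def Int_def conj_commute conj_left_commute)
  qed
  interpret product_sigma_finite "\<lambda>_::nat. mark_law u"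
    by (intro product_sigma_finite.intro prob_space_imp_sigma_finite prob_space_mark_law)
  have inv: "ennreal (1 / ?c) * ennreal ?c = 1"
    using c by (subst ennreal_mult'[symmetric]) auto
  have "scale_measure (ennreal (1 / ?c)) ?D = ?P"
  proof (rule PiM_eqI)
    fix B assume B: "\<And>i. i \<in> {..<length xs} \<Longrightarrow> B i \<in> sets (mark_law u)"
    then have "PiE {..<length xs} B \<in> sets ?P" by (intro sets_PiM_I_finite) auto
    then have "emeasure (scale_measure (ennreal (1 / ?c)) ?D) (PiE {..<length xs} B) =
        ennreal (1 / ?c) * (ennreal ?c * (\<Prod>j<length xs. emeasure (mark_law u) (B j)))"
      using labelled_points_box[OF E less_imp_le[OF t] xs B] D ec by simp
    then show "emeasure (scale_measure (ennreal (1 / ?c)) ?D) (PiE {..<length xs} B) =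
        (\<Prod>j<length xs. emeasure (mark_law u) (B j))"
      using inv by (simp add: mult.assoc[symmetric])
  qed auto
  then have "emeasure ?P A = ennreal (1 / ?c) * emeasure ?D A" by (metis emeasure_scale_measure)
  then have "ennreal ?c * emeasure ?P A = (ennreal (1 / ?c) * ennreal ?c) * emeasure ?D A" by (simp add: mult_ac)
  then show ?thesis using D[OF A] inv by (simp add: c_def)
qed

text \<open>The labels with a given first component can be distributed over its occurrences in \<open>w\<close> in any order.\<close>

lemma card_labelled_arrangements:
  fixes L :: "('e \<times> nat) set"
  assumes "finite L" "finite E" "set w \<subseteq> E" "\<And>e. count_list w e = card {l \<in> L. fst l = e}"
  shows "card {xs. distinct xs \<and> set xs = L \<and> map fst xs = w} = (\<Prod>e\<in>E. fact (count_list w e))"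
    and "finite {xs. distinct xs \<and> set xs = L \<and> map fst xs = w}"
proof -
  have "card {xs. distinct xs \<and> set xs = L \<and> map fst xs = w} = (\<Prod>e\<in>E. fact (count_list w e)) \<and>
    finite {xs. distinct xs \<and> set xs = L \<and> map fst xs = w}"
    using assms
  proof (induction w arbitrary: L)
    case Nil
    have "L = {}"
    proof (rule ccontr)
      assume "L \<noteq> {}"
      then obtain l where "l \<in> L" by blast
      then have "{l' \<in> L. fst l' = fst l} \<noteq> {}" by blast
      then have "card {l' \<in> L. fst l' = fst l} \<noteq> 0" using Nil(1) by (subst card_0_eq) auto
      then show False using Nil(4)[of "fst l"] by simp
    qed
    then have "{xs. distinct xs \<and> set xs = L \<and> map fst xs = []} = {[]}" by auto
    then show ?case by simp
  next
    case (Cons e w)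
    let ?X = "\<lambda>L w. {xs. distinct xs \<and> set xs = L \<and> map fst xs = w}"
    let ?H = "{l \<in> L. fst l = e}"
    have finH: "finite ?H" using Cons.prems(1) by simp
    have eq: "?X L (e # w) = (\<Union>l\<in>?H. (#) l ` ?X (L - {l}) w)"
    proof (intro set_eqI iffI)
      fix xs assume xs: "xs \<in> ?X L (e # w)"
      then obtain l ys where l: "xs = l # ys" "fst l = e" by (cases xs) auto
      then have "l \<in> ?H" "ys \<in> ?X (L - {l}) w" using xs by auto
      then show "xs \<in> (\<Union>l\<in>?H. (#) l ` ?X (L - {l}) w)" using l by blast
    next
      fix xs assume "xs \<in> (\<Union>l\<in>?H. (#) l ` ?X (L - {l}) w)"
      then obtain l ys where l: "l \<in> L" "fst l = e" "xs = l # ys" and ys: "ys \<in> ?X (L - {l}) w" by blast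
      from ys have "distinct ys" "set ys = L - {l}" "map fst ys = w" by simp_all
      then show "xs \<in> ?X L (e # w)" using l by (simp add: insert_absorb)
    qed
    have cnt: "count_list w e' = card {l' \<in> L - {l}. fst l' = e'}" if "l \<in> ?H" for l e'
    proof (cases "e' = e")
      case True
      have "{l' \<in> L - {l}. fst l' = e'} = {l' \<in> L. fst l' = e'} - {l}" by auto
      then show ?thesis using Cons.prems(4)[of e'] that True by simp
    next
      case False
      then have "{l' \<in> L - {l}. fst l' = e'} = {l' \<in> L. fst l' = e'}" using that by auto
      then show ?thesis using Cons.prems(4)[of e'] False by simp
    qed
    have IH: "card (?X (L - {l}) w) = (\<Prod>e\<in>E. fact (count_list w e))" "finite (?X (L - {l}) w)" if "l \<in> ?H" for l
      using Cons.IH[of "L - {l}"] Cons.prems(1-3) cnt[OF that] by auto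
    have "card (?X L (e # w)) = (\<Sum>l\<in>?H. card ((#) l ` ?X (L - {l}) w))"
      unfolding eq using IH(2) by (intro card_UN_disjoint finH) auto
    also have "\<dots> = (\<Sum>l\<in>?H. \<Prod>e\<in>E. fact (count_list w e))"
      using IH(1) by (intro sum.cong refl) (simp add: card_image)
    also have "\<dots> = Suc (count_list w e) * (\<Prod>e\<in>E. fact (count_list w e))"
      using Cons.prems(4)[of e] by simp
    also have "\<dots> = (\<Prod>e'\<in>E. fact (count_list (e # w) e'))"
    proof -
      have eE: "e \<in> E" using Cons.prems(3) by simp
      have rest: "(\<Prod>e'\<in>E - {e}. fact (count_list (e # w) e') :: nat) = (\<Prod>e'\<in>E - {e}. fact (count_list w e'))"
        by (rule prod.cong) auto
      then have "(\<Prod>e'\<in>E. fact (count_list (e # w) e') :: nat) =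
          fact (Suc (count_list w e)) * (\<Prod>e'\<in>E - {e}. fact (count_list w e'))"
        unfolding prod.remove[OF Cons.prems(2) eE] by (subst rest) simp
      then show ?thesis
        unfolding prod.remove[OF Cons.prems(2) eE] by (simp only: fact_Suc mult.assoc of_nat_id)
    qed
    finally show ?case unfolding eq using finH IH(2) by auto
  qed
  then show "card {xs. distinct xs \<and> set xs = L \<and> map fst xs = w} = (\<Prod>e\<in>E. fact (count_list w e))"
    "finite {xs. distinct xs \<and> set xs = L \<and> map fst xs = w}" by auto
qed

text \<open>All ways to attach labels to the letters of \<open>W\<close>: the arrangement says which sample point of its edge
  each letter is.\<close>

definition arrangements :: "'v set set \<Rightarrow> ('v set \<times> mark) list \<Rightarrow> ('v set \<times> nat) list set" where
  "arrangements E W = {xs. distinct xs \<and> set xs = Sigma E (\<lambda>e. {..<count_list (map fst W) e}) \<and>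
     map fst xs = map fst W}"

definition ordered_event ::
    "'v set set \<Rightarrow> real \<Rightarrow> real \<Rightarrow> ('v set \<times> mark) list \<Rightarrow> ('v set \<times> nat) list \<Rightarrow> 'v sample set" where
  "ordered_event E t u W xs = counts_event E t u (count_list (map fst W)) \<inter>
     labelled_points xs -` timed u (length xs) (\<lambda>j. snd (W ! j)) 1"

text \<open>The event that the marks, ordered by time, spell the word \<open>W\<close>.\<close>

definition word_event :: "'v set set \<Rightarrow> real \<Rightarrow> real \<Rightarrow> ('v set \<times> mark) list \<Rightarrow> 'v sample set" where
  "word_event E t u W = (\<Union>xs\<in>arrangements E W. ordered_event E t u W xs)"

lemma sum_count_list: "finite E \<Longrightarrow> set w \<subseteq> E \<Longrightarrow> (\<Sum>e\<in>E. count_list w e) = length w"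
  by (rule sum_count_set)

lemma card_arrangements:
  assumes E: "finite E" and W: "W \<in> words E N"
  shows "card (arrangements E W) = (\<Prod>e\<in>E. fact (count_list (map fst W) e))" "finite (arrangements E W)"
proof -
  let ?L = "Sigma E (\<lambda>e. {..<count_list (map fst W) e})"
  have sub: "set (map fst W) \<subseteq> E" using W by (auto simp: words_def)
  have c: "count_list (map fst W) e = card {l \<in> ?L. fst l = e}" for e
  proof (cases "e \<in> E")
    case True
    then have "{l \<in> ?L. fst l = e} = Pair e ` {..<count_list (map fst W) e}" by auto
    then show ?thesis by (simp add: card_image inj_on_def)
  next
    case False
    then have "{l \<in> ?L. fst l = e} = {}" and *: "e \<notin> set (map fst W)" using sub by auto
    then have "card {l \<in> ?L. fst l = e} = 0" by (simp only: card.empty)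
    moreover have "count_list (map fst W) e = 0" using * by (simp only: count_list_0_iff not_False_eq_True)
    ultimately show ?thesis by (simp only:)
  qed
  have "finite ?L" using E by auto
  from card_labelled_arrangements[OF this E sub c]
  show "card (arrangements E W) = (\<Prod>e\<in>E. fact (count_list (map fst W) e))" "finite (arrangements E W)"
    unfolding arrangements_def by auto
qed

lemma length_arrangement: "xs \<in> arrangements E W \<Longrightarrow> length xs = length W"
  unfolding arrangements_def using map_eq_imp_length_eq by fastforce

lemma ordered_event_represents:
  assumes W: "W \<in> words E N" and xs: "xs \<in> arrangements E W" and w: "w \<in> ordered_event E t u W xs"
  shows "represents E (config_of w) (map (\<lambda>l. fst (snd (w (fst l)) (snd l))) xs) W"
proof -
  let ?x = "\<lambda>l. snd (w (fst l)) (snd l)"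
  let ?L = "Sigma E (\<lambda>e. {..<count_list (map fst W) e})"
  have len: "length xs = length W" by (rule length_arrangement[OF xs])
  have L: "set xs = ?L" and fst_xs: "map fst xs = map fst W" using xs by (auto simp: arrangements_def)
  have cnt: "fst (w e) = count_list (map fst W) e" if "e \<in> E" for e
    using w that by (auto simp: ordered_event_def counts_event_def)
  have T: "0 < fst (?x (xs ! j))" "fst (?x (xs ! j)) < 1" "snd (?x (xs ! j)) = snd (W ! j)" if "j < length xs" for j
    using w that by (auto simp: ordered_event_def timed_def labelled_points_def)
  have S: "fst (?x (xs ! i)) < fst (?x (xs ! j))" if "i < j" "j < length xs" for i j
    using w that by (auto simp: ordered_event_def timed_def labelled_points_def)
  have fj: "fst (xs ! j) = fst (W ! j)" if "j < length xs" for j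
    using fst_xs len that by (metis nth_map)
  have cfg: "config_of w e = {(fst (?x (xs ! j)), a) | j a. j < length W \<and> W ! j = (e, a)}" if e: "e \<in> E" for e
  proof (intro set_eqI iffI)
    fix z assume "z \<in> config_of w e"
    then obtain i where i: "i < count_list (map fst W) e" "z = ?x (e, i)"
      using cnt[OF e] by (auto simp: config_of_def points_def split_beta)
    then have "(e, i) \<in> set xs" using e L by auto
    then obtain j where j: "j < length xs" "xs ! j = (e, i)" by (auto simp: in_set_conv_nth)
    then have "W ! j = (e, snd z)" using T(3)[OF j(1)] fj[OF j(1)] i by (auto simp: prod_eq_iff)
    then show "z \<in> {(fst (?x (xs ! j)), a) | j a. j < length W \<and> W ! j = (e, a)}"
      using j i len by (intro CollectI exI[of _ j] exI[of _ "snd z"]) auto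
  next
    fix z assume "z \<in> {(fst (?x (xs ! j)), a) | j a. j < length W \<and> W ! j = (e, a)}"
    then obtain j a where j: "j < length W" "W ! j = (e, a)" "z = (fst (?x (xs ! j)), a)" by blast
    have "xs ! j \<in> ?L" using j len L nth_mem by metis
    moreover have "fst (xs ! j) = e" using fj j len by simp
    ultimately have "snd (xs ! j) < count_list (map fst W) e" by auto
    moreover have "z = ?x (e, snd (xs ! j))" using T(3)[of j] j len \<open>fst (xs ! j) = e\<close> by (auto simp: prod_eq_iff)
    ultimately show "z \<in> config_of w e" using cnt[OF e] by (auto simp: config_of_def points_def split_beta)
  qed
  moreover have "sorted_wrt (<) (map (\<lambda>l. fst (?x l)) xs)"
    using S by (auto simp: sorted_wrt_iff_nth_less)
  moreover have "set (map (\<lambda>l. fst (?x l)) xs) \<subseteq> {0<..<1}"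
  proof
    fix s assume "s \<in> set (map (\<lambda>l. fst (?x l)) xs)"
    then obtain l where l: "l \<in> set xs" "s = fst (?x l)" unfolding set_map by (rule imageE)
    from l(1) obtain j where "j < length xs" "xs ! j = l" unfolding in_set_conv_nth by blast
    then have "j < length xs" "s = fst (?x (xs ! j))" using l(2) by simp_all
    then show "s \<in> {0<..<1}" using T(1,2) by simp
  qed
  moreover have "fst ` set W \<subseteq> E" using W by (auto simp: words_def)
  moreover have "{(map (\<lambda>l. fst (?x l)) xs ! j, a) | j a. j < length W \<and> W ! j = (e, a)} =
      {(fst (?x (xs ! j)), a) | j a. j < length W \<and> W ! j = (e, a)}" for e
    using len by (metis (no_types, lifting) nth_map)
  ultimately show ?thesis unfolding represents_def
  proof (intro conjI ballI)
    show "length (map (\<lambda>l. fst (?x l)) xs) = length W" using len by simp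
    fix e assume "e \<in> E"
    from cfg[OF this] show "config_of w e = {(map (\<lambda>l. fst (?x l)) xs ! j, a) | j a. j < length W \<and> W ! j = (e, a)}"
      using \<open>\<And>e. {(map (\<lambda>l. fst (?x l)) xs ! j, a) | j a. j < length W \<and> W ! j = (e, a)} =
        {(fst (?x (xs ! j)), a) | j a. j < length W \<and> W ! j = (e, a)}\<close>[of e] by (simp only:)
  qed
qed

text \<open>The times are recovered as the set of all mark times, in increasing order, and distinct times
  determine the letters.\<close>

lemma represents_unique:
  assumes 1: "represents E \<omega> ts W" and 2: "represents E \<omega> ts' W'"
  shows "ts = ts'" "W = W'"
proof -
  have set_ts: "set ts = {s. \<exists>e\<in>E. \<exists>a. (s, a) \<in> \<omega> e}" if "represents E \<omega> ts W" for ts and W :: "('a set \<times> mark) list"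
  proof (intro set_eqI iffI)
    fix s assume "s \<in> set ts"
    moreover have "length ts = length W" using that by (simp add: represents_def)
    ultimately obtain j where j: "j < length W" "s = ts ! j" by (metis in_set_conv_nth)
    obtain e a where "W ! j = (e, a)" by (cases "W ! j")
    moreover have "fst (W ! j) \<in> E" using that j by (auto simp: represents_def)
    ultimately show "s \<in> {s. \<exists>e\<in>E. \<exists>a. (s, a) \<in> \<omega> e}" using that j by (auto simp: represents_def)
  next
    fix s assume "s \<in> {s. \<exists>e\<in>E. \<exists>a. (s, a) \<in> \<omega> e}"
    then show "s \<in> set ts" using that by (auto simp: represents_def)
  qed
  have sorted: "sorted_wrt (<) ts" "sorted_wrt (<) ts'" using 1 2 by (auto simp: represents_def)
  show ts: "ts = ts'"
    using strict_sorted_equal[OF sorted] set_ts[OF 1] set_ts[OF 2] by simp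
  have len: "length ts = length W" "length ts' = length W'" using 1 2 by (auto simp: represents_def)
  show "W = W'"
  proof (rule nth_equalityI)
    show "length W = length W'" using len ts by simp
    fix j assume j: "j < length W"
    obtain e a where ea: "W ! j = (e, a)" by (cases "W ! j")
    have "fst ` set W \<subseteq> E" using 1 unfolding represents_def by (elim conjE)
    moreover have "W ! j \<in> set W" using j by simp
    ultimately have "fst (W ! j) \<in> E" by blast
    then have e: "e \<in> E" using ea by simp
    have "(ts ! j, a) \<in> \<omega> e" using 1 j ea e by (auto simp: represents_def)
    then obtain i where i: "i < length W'" "ts ! j = ts' ! i" "W' ! i = (e, a)"
      using 2 e by (auto simp: represents_def)
    have "distinct ts" using sorted(1) by (simp add: strict_sorted_iff)
    then have "i = j" using i j len ts by (simp add: nth_eq_iff_index_eq)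
    then show "W ! j = W' ! j" using ea i by simp
  qed
qed

lemma word_event_represents:
  assumes "W \<in> words E N" "w \<in> word_event E t u W"
  shows "\<exists>ts. represents E (config_of w) ts W"
  using assms ordered_event_represents unfolding word_event_def by blast

lemma word_events_disjoint:
  assumes "W \<in> words E N" "w \<in> word_event E t u W" "W' \<in> words E N'" "w \<in> word_event E t u W'"
  shows "W = W'"
  using word_event_represents[OF assms(1,2)] word_event_represents[OF assms(3,4)] represents_unique(2) by blast

text \<open>The times are distinct, so only one labelling sorts them.\<close>

lemma ordered_events_disjoint:
  assumes W: "W \<in> words E N" and xs: "xs \<in> arrangements E W" "xs' \<in> arrangements E W"
    and w: "w \<in> ordered_event E t u W xs" "w \<in> ordered_event E t u W xs'"
  shows "xs = xs'"
proof (rule nth_equalityI)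
  let ?f = "\<lambda>l. fst (snd (w (fst l)) (snd l))"
  note r = ordered_event_represents[OF W xs(1) w(1)] ordered_event_represents[OF W xs(2) w(2)]
  show len: "length xs = length xs'" using xs length_arrangement by metis
  fix j assume j: "j < length xs"
  have eq: "map ?f xs = map ?f xs'" by (rule represents_unique(1)[OF r])
  have d: "distinct (map ?f xs)" using r(1) by (auto simp: represents_def strict_sorted_iff)
  have "set xs = set xs'" using xs by (auto simp: arrangements_def)
  then have "xs' ! j \<in> set xs" using j len by simp
  then have "xs ! j \<in> set xs" "xs' ! j \<in> set xs" using j by auto
  moreover have "?f (xs ! j) = ?f (xs' ! j)" using arg_cong[OF eq, of "\<lambda>ys. ys ! j"] j len by simp
  ultimately show "xs ! j = xs' ! j" using d by (auto simp: distinct_map inj_on_def)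
qed

lemma sets_ordered_event:
  assumes E: "finite E" and xs: "xs \<in> arrangements E W"
  shows "ordered_event E t u W xs \<in> sets (sample_space E t u)"
proof -
  have "set xs = Sigma E (\<lambda>e. {..<count_list (map fst W) e})" using xs by (simp add: arrangements_def)
  then have "fst ` set xs \<subseteq> E" by (simp only: fst_Sigma_subset)
  from measurable_sets[OF measurable_labelled_points[OF this] sets_timed]
  have "labelled_points xs -` timed u (length xs) (\<lambda>j. snd (W ! j)) 1 \<inter> space (sample_space E t u) \<in> sets (sample_space E t u)" .
  moreover have "ordered_event E t u W xs = counts_event E t u (count_list (map fst W)) \<inter>
      (labelled_points xs -` timed u (length xs) (\<lambda>j. snd (W ! j)) 1 \<inter> space (sample_space E t u))"
    by (auto simp: ordered_event_def counts_event_def)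
  ultimately show ?thesis using sets.Int[OF sets_counts_event[OF E]] by metis
qed

lemma sets_word_event:
  "finite E \<Longrightarrow> W \<in> words E N \<Longrightarrow> word_event E t u W \<in> sets (sample_space E t u)"
  unfolding word_event_def by (intro sets.finite_UN card_arrangements(2) sets_ordered_event)

text \<open>The probability of a word: the numbers of marks are Poisson, the \<open>\<kappa>\<^sub>e!\<close> arrangements on each edge
  cancel the factorials of the Poisson laws, and ordering the times contributes one factorial of the
  length.\<close>

definition word_weight :: "'e set \<Rightarrow> real \<Rightarrow> real \<Rightarrow> ('e \<times> mark) list \<Rightarrow> real" where
  "word_weight E t u W = exp (- (t * real (card E))) * t ^ length W / fact (length W) * word_prob u W"

lemma emeasure_word_event:
  assumes E: "finite E" and t: "0 < t" and u: "u \<in> {0..1}" and W: "W \<in> words E N"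
  shows "emeasure (sample_space E t u) (word_event E t u W) = ennreal (word_weight E t u W)"
proof -
  let ?c = "count_list (map fst W)"
  let ?R = "sample_space E t u"
  let ?q = "(\<Prod>e\<in>E. t ^ ?c e / fact (?c e) * exp (- t)) * (1 / fact (length W) * word_prob u W)"
  have wp: "(\<Prod>j<length W. mark_prob u (snd (W ! j))) = word_prob u W"
    unfolding word_prob_def by (simp add: prod.list_conv_set_nth atLeast0LessThan)
  have sub: "set (map fst W) \<subseteq> E" using W by (auto simp: words_def)
  have one: "emeasure ?R (ordered_event E t u W xs) = ennreal ?q" if xs: "xs \<in> arrangements E W" for xs
  proof -
    have "emeasure ?R (ordered_event E t u W xs) = ennreal (\<Prod>e\<in>E. t ^ ?c e / fact (?c e) * exp (- t)) *
        emeasure (PiM {..<length xs} (\<lambda>_. mark_law u)) (timed u (length xs) (\<lambda>j. snd (W ! j)) 1)"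
      unfolding ordered_event_def using xs
      by (intro labelled_points_law E t sets_timed) (auto simp: arrangements_def)
    also have "\<dots> = ennreal (\<Prod>e\<in>E. t ^ ?c e / fact (?c e) * exp (- t)) * ennreal (1 / fact (length W) * word_prob u W)"
      using emeasure_timed[OF u, of 1 "length xs"] length_arrangement[OF xs] wp by simp
    also have "\<dots> = ennreal ?q"
      using t by (subst ennreal_mult') (auto intro!: prod_nonneg)
    finally show ?thesis .
  qed
  have "emeasure ?R (word_event E t u W) = (\<Sum>xs\<in>arrangements E W. emeasure ?R (ordered_event E t u W xs))"
    unfolding word_event_def using ordered_events_disjoint[OF W]
    by (intro sum_emeasure[symmetric] card_arrangements(2)[OF E W])
      (auto simp: disjoint_family_on_def intro!: sets_ordered_event[OF E])
  also have "\<dots> = (\<Sum>xs\<in>arrangements E W. ennreal ?q)"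
    by (intro sum.cong refl one)
  also have "\<dots> = ennreal (real (card (arrangements E W)) * ?q)"
    by (simp only: sum_constant ennreal_of_nat_eq_real_of_nat ennreal_mult'[OF of_nat_0_le_iff])
  also have "real (card (arrangements E W)) * ?q = word_weight E t u W"
  proof -
    have "(\<Prod>e\<in>E. real (fact (?c e))) * (\<Prod>e\<in>E. t ^ ?c e / fact (?c e) * exp (- t)) =
        (\<Prod>e\<in>E. t ^ ?c e * exp (- t))"
      by (simp add: prod.distrib[symmetric])
    also have "\<dots> = t ^ (\<Sum>e\<in>E. ?c e) * exp (- (t * real (card E)))"
      by (simp add: prod.distrib power_sum exp_of_nat_mult[symmetric] mult.commute)
    also have "(\<Sum>e\<in>E. ?c e) = length W" using sum_count_list[OF E sub] by simp
    finally show ?thesis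
      using card_arrangements(1)[OF E W] by (simp add: word_weight_def mult_ac)
  qed
  finally show ?thesis .
qed

text \<open>The word events exhaust the probability space up to a null set.  Computing their total mass in this way
  avoids a separate proof that the mark times are almost surely distinct and positive.\<close>

lemma sums_word_weight:
  "(\<lambda>N. \<Sum>W\<in>words E N. word_weight E t u W) sums 1"
proof -
  have "(\<Sum>W\<in>words E N. word_weight E t u W) =
      exp (- (t * real (card E))) * ((t * real (card E)) ^ N /\<^sub>R fact N)" for N
  proof -
    have "(\<Sum>W\<in>words E N. word_weight E t u W) =
        (\<Sum>W\<in>words E N. exp (- (t * real (card E))) * t ^ N / fact N * word_prob u W)"
      by (rule sum.cong) (auto simp: word_weight_def words_def)
    also have "\<dots> = exp (- (t * real (card E))) * t ^ N / fact N * real (card E) ^ N"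
      by (simp only: sum_distrib_left[symmetric] sum_word_prob)
    finally show ?thesis by (simp add: power_mult_distrib field_simps)
  qed
  then show ?thesis
    using sums_mult[OF exp_converges[of "t * real (card E)"], of "exp (- (t * real (card E)))"]
    by (simp add: exp_minus)
qed

text \<open>Any quantity that depends only on the word is integrated by summing over words.  Outside the word
  events \<open>F\<close> is arbitrary; measurability follows since their complement is a null set and \<open>rho\<close> is
  complete.\<close>

lemma nn_integral_word:
  fixes F :: "'v sample \<Rightarrow> ennreal" and \<phi> :: "('v set \<times> mark) list \<Rightarrow> real"
  assumes E: "finite E" and t: "0 < t" and u: "u \<in> {0..1}"
    and F: "\<And>w ts W. represents E (config_of w) ts W \<Longrightarrow> F w = ennreal (\<phi> W)"
    and \<phi>: "\<And>W. 0 \<le> \<phi> W"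
  shows "(\<integral>\<^sup>+ w. F w \<partial>rho E t u) = (\<Sum>N. ennreal (\<Sum>W\<in>words E N. word_weight E t u W * \<phi> W))"
    and "F \<in> borel_measurable (rho E t u)"
proof -
  let ?R = "sample_space E t u"
  let ?ind = "\<lambda>W. indicator (word_event E t u W) :: 'v sample \<Rightarrow> ennreal"
  define G where "G \<psi> w = (\<Sum>N. \<Sum>W\<in>words E N. ennreal (\<psi> W) * ?ind W w)" for \<psi> :: "('v set \<times> mark) list \<Rightarrow> real" and w
  have ww: "0 \<le> word_weight E t u W" for W
    unfolding word_weight_def using t word_prob_nonneg[OF u, of W]
    by (intro mult_nonneg_nonneg divide_nonneg_nonneg) auto
  have [measurable]: "?ind W \<in> borel_measurable ?R" if "W \<in> words E N" for W N
    using sets_word_event[OF E that] by (rule borel_measurable_indicator)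
  have term_meas: "(\<lambda>w. ennreal (\<psi> W) * ?ind W w) \<in> borel_measurable ?R" if "W \<in> words E N" for W N \<psi>
    using that by measurable
  have G_meas: "G \<psi> \<in> borel_measurable ?R" for \<psi>
    unfolding G_def by (intro borel_measurable_suminf_order borel_measurable_sum term_meas)
  have G_int: "(\<integral>\<^sup>+ w. G \<psi> w \<partial>?R) = (\<Sum>N. ennreal (\<Sum>W\<in>words E N. word_weight E t u W * \<psi> W))" if "\<And>W. 0 \<le> \<psi> W" for \<psi>
  proof -
    have "(\<integral>\<^sup>+ w. G \<psi> w \<partial>?R) = (\<Sum>N. \<integral>\<^sup>+ w. (\<Sum>W\<in>words E N. ennreal (\<psi> W) * ?ind W w) \<partial>?R)"
      unfolding G_def by (intro nn_integral_suminf borel_measurable_sum term_meas)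
    also have "\<dots> = (\<Sum>N. \<Sum>W\<in>words E N. ennreal (\<psi> W) * ennreal (word_weight E t u W))"
    proof (rule suminf_cong)
      fix N
      have "(\<integral>\<^sup>+ w. (\<Sum>W\<in>words E N. ennreal (\<psi> W) * ?ind W w) \<partial>?R) =
          (\<Sum>W\<in>words E N. \<integral>\<^sup>+ w. ennreal (\<psi> W) * ?ind W w \<partial>?R)"
        by (intro nn_integral_sum term_meas)
      also have "\<dots> = (\<Sum>W\<in>words E N. ennreal (\<psi> W) * ennreal (word_weight E t u W))"
        using sets_word_event[OF E] emeasure_word_event[OF E t u]
        by (intro sum.cong refl) (simp add: nn_integral_cmult_indicator)
      finally show "(\<integral>\<^sup>+ w. (\<Sum>W\<in>words E N. ennreal (\<psi> W) * ?ind W w) \<partial>?R) =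
          (\<Sum>W\<in>words E N. ennreal (\<psi> W) * ennreal (word_weight E t u W))" .
    qed
    also have "\<dots> = (\<Sum>N. ennreal (\<Sum>W\<in>words E N. word_weight E t u W * \<psi> W))"
      using that ww by (intro suminf_cong) (simp add: ennreal_mult[symmetric] sum_ennreal mult.commute)
    finally show ?thesis .
  qed
  have G_val: "G \<psi> w = ennreal (\<psi> W)" if W: "W \<in> words E N" "w \<in> word_event E t u W" for \<psi> w W N
  proof -
    have "(\<Sum>W'\<in>words E N'. ennreal (\<psi> W') * ?ind W' w) = (if N' = N then ennreal (\<psi> W) else 0)" for N'
    proof (cases "N' = N")
      case True
      have "(\<Sum>W'\<in>words E N. ennreal (\<psi> W') * ?ind W' w) = (\<Sum>W'\<in>words E N. if W' = W then ennreal (\<psi> W) else 0)"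
      proof (rule sum.cong[OF refl])
        fix W' assume W': "W' \<in> words E N"
        show "ennreal (\<psi> W') * ?ind W' w = (if W' = W then ennreal (\<psi> W) else 0)"
        proof (cases "W' = W")
          case False
          then have "w \<notin> word_event E t u W'" using word_events_disjoint[OF W W'] by blast
          then show ?thesis using False by simp
        qed (use W(2) in simp)
      qed
      then show ?thesis using True W(1) by (simp add: finite_words[OF E])
    next
      case False
      have "W \<notin> words E N'" using False W(1) by (auto simp: words_def)
      then have "w \<notin> word_event E t u W'" if "W' \<in> words E N'" for W'
        using word_events_disjoint[OF W that] that by blast
      then have "(\<Sum>W'\<in>words E N'. ennreal (\<psi> W') * ?ind W' w) = (\<Sum>W'\<in>words E N'. 0)"
        by (intro sum.cong refl) simp
      then show ?thesis using False by simp
    qed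
    then have "G \<psi> w = (\<Sum>N'. if N' = N then ennreal (\<psi> W) else 0)" unfolding G_def by simp
    also have "\<dots> = (\<Sum>N'\<in>{N}. if N' = N then ennreal (\<psi> W) else 0)"
      by (rule suminf_finite) auto
    finally show ?thesis by simp
  qed
  interpret R: prob_space ?R
    by (intro prob_space_PiM prob_space_poisson_space prob_space_mark_law less_imp_le t)
  let ?U = "\<Union>N. \<Union>W\<in>words E N. word_event E t u W"
  have U_sets: "?U \<in> sets ?R"
    by (rule sets.countable_UN, rule image_subsetI, rule sets.finite_UN[OF finite_words[OF E]],
        rule sets_word_event[OF E])
  have "emeasure ?R ?U = (\<integral>\<^sup>+ w. indicator ?U w \<partial>?R)" using U_sets by simp
  also have "\<dots> = (\<integral>\<^sup>+ w. G (\<lambda>_. 1) w \<partial>?R)"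
  proof (rule nn_integral_cong)
    fix w
    show "indicator ?U w = G (\<lambda>_. 1) w"
    proof (cases "w \<in> ?U")
      case True
      then obtain N W where "W \<in> words E N" "w \<in> word_event E t u W" by auto
      from G_val[OF this, of "\<lambda>_. 1"] True show ?thesis by simp
    next
      case False
      then have "?ind W w = 0" if "W \<in> words E N" for W N using that by (auto simp: indicator_def)
      then show ?thesis using False unfolding G_def by simp
    qed
  qed
  also have "\<dots> = (\<Sum>N. ennreal (\<Sum>W\<in>words E N. word_weight E t u W))" using G_int[of "\<lambda>_. 1"] by simp
  also have "\<dots> = ennreal 1"
    by (rule suminf_ennreal_eq[OF _ sums_word_weight]) (intro sum_nonneg ww)
  also have "\<dots> = 1" by (rule ennreal_1)
  finally have "emeasure ?R ?U = 1" .
  then have "measure ?R ?U = 1" by (simp only: measure_def enn2real_1)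
  then have AE: "AE w in ?R. w \<in> ?U" by (simp only: R.AE_in_set_eq_1[OF U_sets])
  have eq: "AE w in ?R. F w = G \<phi> w"
    using AE
  proof eventually_elim
    case (elim w)
    then obtain N W where W: "W \<in> words E N" "w \<in> word_event E t u W" by auto
    then show ?case using word_event_represents[OF W] F G_val[OF W] by auto
  qed
  have eqc: "AE w in completion ?R. F w = G \<phi> w" by (rule AE_completion[OF eq])
  have "(\<integral>\<^sup>+ w. F w \<partial>rho E t u) = (\<integral>\<^sup>+ w. G \<phi> w \<partial>completion ?R)"
    unfolding rho_def by (rule nn_integral_cong_AE[OF eqc])
  also have "\<dots> = (\<integral>\<^sup>+ w. G \<phi> w \<partial>?R)" by (rule nn_integral_completion)
  also note G_int[OF \<phi>]
  finally show "(\<integral>\<^sup>+ w. F w \<partial>rho E t u) = (\<Sum>N. ennreal (\<Sum>W\<in>words E N. word_weight E t u W * \<phi> W))" .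
  show "F \<in> borel_measurable (rho E t u)"
  proof (rule measurableI)
    fix B :: "ennreal set" assume B: "B \<in> sets borel"
    show "F -` B \<inter> space (rho E t u) \<in> sets (rho E t u)"
      unfolding rho_def
    proof (rule completion.in_sets_AE)
      show "G \<phi> -` B \<inter> space ?R \<in> sets (completion ?R)" using measurable_sets[OF G_meas B] by auto
      show "AE x in completion ?R. (x \<in> G \<phi> -` B \<inter> space ?R) = (x \<in> F -` B \<inter> space (completion ?R))"
        using eqc by eventually_elim auto
    qed auto
  qed simp
qed

section \<open>Symmetric matrices with nonnegative entries\<close>

fun mpow :: "'a set \<Rightarrow> ('a \<Rightarrow> 'a \<Rightarrow> real) \<Rightarrow> nat \<Rightarrow> 'a \<Rightarrow> 'a \<Rightarrow> real" where
  "mpow X H 0 \<sigma> \<tau> = (if \<sigma> = \<tau> then 1 else 0)"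
| "mpow X H (Suc n) \<sigma> \<tau> = (\<Sum>\<rho>\<in>X. mpow X H n \<sigma> \<rho> * H \<rho> \<tau>)"

definition trace_pow :: "'a set \<Rightarrow> ('a \<Rightarrow> 'a \<Rightarrow> real) \<Rightarrow> nat \<Rightarrow> real" where
  "trace_pow X H n = (\<Sum>\<sigma>\<in>X. mpow X H n \<sigma> \<sigma>)"

text \<open>The trace of \<open>H\<^sup>j exp (t H)\<close>, which is also the \<open>j\<close>-th derivative of the trace of \<open>exp (t H)\<close>.\<close>

definition trace_exp :: "'a set \<Rightarrow> ('a \<Rightarrow> 'a \<Rightarrow> real) \<Rightarrow> nat \<Rightarrow> real \<Rightarrow> real" where
  "trace_exp X H j t = (\<Sum>n. trace_pow X H (n + j) / fact n * t ^ n)"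

locale sym_matrix =
  fixes X :: "'a set" and H :: "'a \<Rightarrow> 'a \<Rightarrow> real"
  assumes finite_X: "finite X" and ne: "X \<noteq> {}"
    and sym: "\<And>\<sigma> \<tau>. \<sigma> \<in> X \<Longrightarrow> \<tau> \<in> X \<Longrightarrow> H \<sigma> \<tau> = H \<tau> \<sigma>"
    and nonneg: "\<And>\<sigma> \<tau>. \<sigma> \<in> X \<Longrightarrow> \<tau> \<in> X \<Longrightarrow> 0 \<le> H \<sigma> \<tau>"
begin

abbreviation "P \<equiv> mpow X H"
abbreviation "m \<equiv> trace_pow X H"
abbreviation "g \<equiv> trace_exp X H"

lemma mpow_nonneg: "\<sigma> \<in> X \<Longrightarrow> \<tau> \<in> X \<Longrightarrow> 0 \<le> P n \<sigma> \<tau>"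
  by (induction n arbitrary: \<tau>) (auto intro!: sum_nonneg mult_nonneg_nonneg nonneg)

lemma mpow_add: "\<sigma> \<in> X \<Longrightarrow> \<tau> \<in> X \<Longrightarrow> P (a + b) \<sigma> \<tau> = (\<Sum>\<rho>\<in>X. P a \<sigma> \<rho> * P b \<rho> \<tau>)"
proof (induction b arbitrary: \<tau>)
  case 0
  have "(\<Sum>\<rho>\<in>X. P a \<sigma> \<rho> * P 0 \<rho> \<tau>) = (\<Sum>\<rho>\<in>X. if \<rho> = \<tau> then P a \<sigma> \<tau> else 0)"
    by (intro sum.cong refl) simp
  then show ?case using 0 finite_X by simp
next
  case (Suc b)
  have "P (a + Suc b) \<sigma> \<tau> = (\<Sum>\<rho>\<in>X. (\<Sum>\<rho>'\<in>X. P a \<sigma> \<rho>' * P b \<rho>' \<rho>) * H \<rho> \<tau>)"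
    using Suc.IH[OF Suc.prems(1)] by simp
  also have "\<dots> = (\<Sum>\<rho>\<in>X. \<Sum>\<rho>'\<in>X. P a \<sigma> \<rho>' * (P b \<rho>' \<rho> * H \<rho> \<tau>))"
    by (simp add: sum_distrib_right mult.assoc)
  also have "\<dots> = (\<Sum>\<rho>'\<in>X. \<Sum>\<rho>\<in>X. P a \<sigma> \<rho>' * (P b \<rho>' \<rho> * H \<rho> \<tau>))"
    by (rule sum.swap)
  finally show ?case by (simp add: sum_distrib_left)
qed

lemma mpow_sym: "\<sigma> \<in> X \<Longrightarrow> \<tau> \<in> X \<Longrightarrow> P n \<sigma> \<tau> = P n \<tau> \<sigma>"
proof (induction n arbitrary: \<sigma> \<tau>)
  case (Suc n)
  have one: "P 1 \<rho> \<rho>' = H \<rho> \<rho>'" if "\<rho> \<in> X" for \<rho> \<rho>'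
  proof -
    have "P 1 \<rho> \<rho>' = (\<Sum>\<rho>''\<in>X. if \<rho>'' = \<rho> then H \<rho> \<rho>' else 0)"
      by (simp) (intro sum.cong refl, simp)
    then show ?thesis using that finite_X by simp
  qed
  have "P (Suc n) \<tau> \<sigma> = (\<Sum>\<rho>\<in>X. P 1 \<tau> \<rho> * P n \<rho> \<sigma>)"
    using mpow_add[of \<tau> \<sigma> 1 n] Suc.prems by simp
  also have "\<dots> = (\<Sum>\<rho>\<in>X. P n \<sigma> \<rho> * H \<rho> \<tau>)"
  proof (rule sum.cong[OF refl])
    fix \<rho> assume \<rho>: "\<rho> \<in> X"
    have "P 1 \<tau> \<rho> = H \<rho> \<tau>" using one[OF Suc.prems(2), of \<rho>] sym[OF Suc.prems(2) \<rho>] by metis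
    moreover have "P n \<rho> \<sigma> = P n \<sigma> \<rho>" by (rule Suc.IH[OF \<rho> Suc.prems(1)])
    ultimately show "P 1 \<tau> \<rho> * P n \<rho> \<sigma> = P n \<sigma> \<rho> * H \<rho> \<tau>" by (simp only: mult.commute)
  qed
  finally show ?case by simp
qed simp

definition entry_sum :: real where "entry_sum = (\<Sum>\<sigma>\<in>X. \<Sum>\<tau>\<in>X. H \<sigma> \<tau>)"

lemma mpow_le: "\<sigma> \<in> X \<Longrightarrow> \<tau> \<in> X \<Longrightarrow> P n \<sigma> \<tau> \<le> entry_sum ^ n"
proof (induction n arbitrary: \<tau>)
  case (Suc n)
  have B0: "0 \<le> entry_sum" unfolding entry_sum_def by (intro sum_nonneg nonneg)
  have "P (Suc n) \<sigma> \<tau> \<le> (\<Sum>\<rho>\<in>X. entry_sum ^ n * H \<rho> \<tau>)"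
    using Suc by (auto intro!: sum_mono mult_right_mono nonneg)
  also have "\<dots> \<le> entry_sum ^ n * (\<Sum>\<rho>\<in>X. \<Sum>\<tau>\<in>X. H \<rho> \<tau>)"
    unfolding sum_distrib_left[symmetric]
    using B0 finite_X Suc.prems
    by (intro mult_left_mono sum_mono) (auto intro!: member_le_sum nonneg)
  finally show ?case by (simp add: entry_sum_def mult.commute)
qed simp

lemma summable_mpow:
  assumes "\<sigma> \<in> X" "\<tau> \<in> X"
  shows "summable (\<lambda>n. \<bar>s ^ n / fact n * P (n + j) \<sigma> \<tau>\<bar>)"
proof (rule summable_comparison_test)
  have "summable (\<lambda>n. entry_sum ^ j * (inverse (fact n) * (\<bar>s\<bar> * entry_sum) ^ n))"
    by (intro summable_mult summable_exp)
  then show "summable (\<lambda>n. entry_sum ^ j * (inverse (fact n) * (\<bar>s\<bar> * entry_sum) ^ n))" .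
  have "norm \<bar>s ^ n / fact n * P (n + j) \<sigma> \<tau>\<bar> \<le> entry_sum ^ j * (inverse (fact n) * (\<bar>s\<bar> * entry_sum) ^ n)" for n
  proof -
    have "norm \<bar>s ^ n / fact n * P (n + j) \<sigma> \<tau>\<bar> = \<bar>s\<bar> ^ n / fact n * P (n + j) \<sigma> \<tau>"
      using mpow_nonneg[OF assms, of "n + j"] by (simp add: abs_mult power_abs)
    also have "\<dots> \<le> \<bar>s\<bar> ^ n / fact n * entry_sum ^ (n + j)"
      by (intro mult_left_mono mpow_le assms) simp
    finally show ?thesis by (simp add: power_add power_mult_distrib field_simps)
  qed
  then show "\<exists>N. \<forall>n\<ge>N. norm \<bar>s ^ n / fact n * P (n + j) \<sigma> \<tau>\<bar> \<le> entry_sum ^ j * (inverse (fact n) * (\<bar>s\<bar> * entry_sum) ^ n)" by blast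
qed

lemma summable_trace: "summable (\<lambda>n. m (n + j) / fact n * t ^ n)"
proof -
  have "summable (\<lambda>n. \<Sum>\<sigma>\<in>X. t ^ n / fact n * P (n + j) \<sigma> \<sigma>)"
    by (rule summable_sum, rule summable_rabs_cancel, rule summable_mpow)
  moreover have "m (n + j) / fact n * t ^ n = (\<Sum>\<sigma>\<in>X. t ^ n / fact n * P (n + j) \<sigma> \<sigma>)" for n
    by (simp only: trace_pow_def sum_distrib_left[symmetric]) simp
  ultimately show ?thesis by (simp only:)
qed

lemma trace_exp_deriv: "(g j has_real_derivative g (Suc j) t) (at t)"
proof -
  have "((\<lambda>t. \<Sum>n. (m (n + j) / fact n) * t ^ n) has_real_derivative
      (\<Sum>n. diffs (\<lambda>n. m (n + j) / fact n) n * t ^ n)) (at t)"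
    by (rule termdiffs_strong_converges_everywhere) (use summable_trace in simp)
  moreover have "diffs (\<lambda>n. m (n + j) / fact n) = (\<lambda>n. m (n + Suc j) / fact n)"
    by (auto simp: diffs_def fun_eq_iff simp del: of_nat_Suc)
  ultimately show ?thesis unfolding trace_exp_def by simp
qed

lemma exp_conv: "(\<Sum>i\<le>n. ((t/2) ^ i / fact i) * ((t/2) ^ (n - i) / fact (n - i))) = (t::real) ^ n / fact n"
proof -
  have "(\<Sum>i\<le>n. ((t/2) ^ i / fact i) * ((t/2) ^ (n - i) / fact (n - i))) =
      (\<Sum>i\<le>n. (real (n choose i)) * ((t/2) ^ i * (t/2) ^ (n - i))) / fact n"
    unfolding sum_divide_distrib
    by (intro sum.cong refl) (simp add: binomial_fact field_simps)
  also have "\<dots> = (t/2 + t/2) ^ n / fact n" unfolding binomial_ring by (simp add: mult.assoc)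
  finally show ?thesis by simp
qed

text \<open>By symmetry, the trace of \<open>H\<^bsup>p+r\<^esup> exp (t H)\<close> is the inner product, entry by entry, of the matrices
  \<open>H\<^sup>p exp (t H / 2)\<close> and \<open>H\<^sup>r exp (t H / 2)\<close>.  Expanding the product of the two exponential series leads to
  the binomial convolution \<open>exp_conv\<close>.\<close>

lemma trace_exp_eq_inner:
  "(\<Sum>\<sigma>\<in>X. \<Sum>\<tau>\<in>X. (\<Sum>i. (t/2) ^ i / fact i * P (i + p) \<sigma> \<tau>) * (\<Sum>i. (t/2) ^ i / fact i * P (i + r) \<sigma> \<tau>)) = g (p + r) t"
proof -
  let ?a = "\<lambda>i. (t/2) ^ i / fact i"
  have "(\<lambda>n. \<Sum>\<sigma>\<in>X. \<Sum>\<tau>\<in>X. \<Sum>i\<le>n. (?a i * P (i + p) \<sigma> \<tau>) * (?a (n - i) * P (n - i + r) \<sigma> \<tau>)) sums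
      (\<Sum>\<sigma>\<in>X. \<Sum>\<tau>\<in>X. (\<Sum>i. ?a i * P (i + p) \<sigma> \<tau>) * (\<Sum>i. ?a i * P (i + r) \<sigma> \<tau>))"
  proof (rule sums_sum, rule sums_sum)
    fix \<sigma> \<tau> assume "\<sigma> \<in> X" "\<tau> \<in> X"
    from summable_mpow[OF this, of "t/2" p] summable_mpow[OF this, of "t/2" r]
    show "(\<lambda>n. \<Sum>i\<le>n. (?a i * P (i + p) \<sigma> \<tau>) * (?a (n - i) * P (n - i + r) \<sigma> \<tau>)) sums
        ((\<Sum>i. ?a i * P (i + p) \<sigma> \<tau>) * (\<Sum>i. ?a i * P (i + r) \<sigma> \<tau>))"
      by (intro Cauchy_product_sums[of "\<lambda>i. ?a i * P (i + p) \<sigma> \<tau>" "\<lambda>i. ?a i * P (i + r) \<sigma> \<tau>"])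
        (simp_all only: real_norm_def)
  qed
  moreover have "(\<Sum>\<sigma>\<in>X. \<Sum>\<tau>\<in>X. \<Sum>i\<le>n. (?a i * P (i + p) \<sigma> \<tau>) * (?a (n - i) * P (n - i + r) \<sigma> \<tau>)) =
      m (n + (p + r)) / fact n * t ^ n" for n
  proof -
    have "(\<Sum>\<sigma>\<in>X. \<Sum>\<tau>\<in>X. \<Sum>i\<le>n. (?a i * P (i + p) \<sigma> \<tau>) * (?a (n - i) * P (n - i + r) \<sigma> \<tau>)) =
        (\<Sum>\<sigma>\<in>X. \<Sum>i\<le>n. ?a i * ?a (n - i) * (\<Sum>\<tau>\<in>X. P (i + p) \<sigma> \<tau> * P (n - i + r) \<tau> \<sigma>))"
    proof (rule sum.cong[OF refl])
      fix \<sigma> assume \<sigma>: "\<sigma> \<in> X"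
      have "(\<Sum>\<tau>\<in>X. \<Sum>i\<le>n. (?a i * P (i + p) \<sigma> \<tau>) * (?a (n - i) * P (n - i + r) \<sigma> \<tau>)) =
          (\<Sum>i\<le>n. \<Sum>\<tau>\<in>X. (?a i * P (i + p) \<sigma> \<tau>) * (?a (n - i) * P (n - i + r) \<sigma> \<tau>))"
        by (rule sum.swap)
      also have "\<dots> = (\<Sum>i\<le>n. ?a i * ?a (n - i) * (\<Sum>\<tau>\<in>X. P (i + p) \<sigma> \<tau> * P (n - i + r) \<tau> \<sigma>))"
        unfolding sum_distrib_left using mpow_sym[OF \<sigma>]
        by (intro sum.cong refl) (simp add: mult_ac)
      finally show "(\<Sum>\<tau>\<in>X. \<Sum>i\<le>n. (?a i * P (i + p) \<sigma> \<tau>) * (?a (n - i) * P (n - i + r) \<sigma> \<tau>)) =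
          (\<Sum>i\<le>n. ?a i * ?a (n - i) * (\<Sum>\<tau>\<in>X. P (i + p) \<sigma> \<tau> * P (n - i + r) \<tau> \<sigma>))" .
    qed
    also have "\<dots> = (\<Sum>\<sigma>\<in>X. \<Sum>i\<le>n. ?a i * ?a (n - i) * P (n + (p + r)) \<sigma> \<sigma>)"
    proof (intro sum.cong refl)
      fix \<sigma> i assume \<sigma>: "\<sigma> \<in> X" and i: "i \<in> {..n}"
      then have "(i + p) + (n - i + r) = n + (p + r)" by simp
      then have "(\<Sum>\<tau>\<in>X. P (i + p) \<sigma> \<tau> * P (n - i + r) \<tau> \<sigma>) = P (n + (p + r)) \<sigma> \<sigma>"
        using mpow_add[OF \<sigma> \<sigma>, of "i + p" "n - i + r"] by (simp only:)
      then show "?a i * ?a (n - i) * (\<Sum>\<tau>\<in>X. P (i + p) \<sigma> \<tau> * P (n - i + r) \<tau> \<sigma>) =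
          ?a i * ?a (n - i) * P (n + (p + r)) \<sigma> \<sigma>"
        by (simp only:)
    qed
    also have "\<dots> = (\<Sum>\<sigma>\<in>X. t ^ n / fact n * P (n + (p + r)) \<sigma> \<sigma>)"
      unfolding sum_distrib_right[symmetric] exp_conv ..
    also have "\<dots> = m (n + (p + r)) / fact n * t ^ n"
      by (simp only: trace_pow_def sum_distrib_left[symmetric]) simp
    finally show ?thesis .
  qed
  ultimately have "(\<lambda>n. m (n + (p + r)) / fact n * t ^ n) sums
      (\<Sum>\<sigma>\<in>X. \<Sum>\<tau>\<in>X. (\<Sum>i. ?a i * P (i + p) \<sigma> \<tau>) * (\<Sum>i. ?a i * P (i + r) \<sigma> \<tau>))"
    by simp
  then show ?thesis unfolding trace_exp_def by (simp add: sums_iff)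
qed

text \<open>The Cauchy-Schwarz inequality for the inner product of \<open>trace_exp_eq_inner\<close>.  Divided by \<open>(g 0 t)\<^sup>2\<close>, it
  states that the second derivative of \<open>ln (g 0 t)\<close> is nonnegative.\<close>

lemma trace_exp_log_convex: "(g 1 t)\<^sup>2 \<le> g 0 t * g 2 t"
proof -
  define K where "K p \<sigma> \<tau> = (\<Sum>i. (t/2) ^ i / fact i * P (i + p) \<sigma> \<tau>)" for p \<sigma> \<tau>
  have inner: "(\<Sum>(\<sigma>, \<tau>)\<in>X \<times> X. K p \<sigma> \<tau> * K r \<sigma> \<tau>) = g (p + r) t" for p r
    unfolding K_def trace_exp_eq_inner[symmetric] by (simp add: sum.cartesian_product split_beta)
  have "(\<Sum>(\<sigma>, \<tau>)\<in>X \<times> X. K 0 \<sigma> \<tau> * K 1 \<sigma> \<tau>)\<^sup>2 \<le>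
      (\<Sum>(\<sigma>, \<tau>)\<in>X \<times> X. (K 0 \<sigma> \<tau>)\<^sup>2) * (\<Sum>(\<sigma>, \<tau>)\<in>X \<times> X. (K 1 \<sigma> \<tau>)\<^sup>2)"
    using Cauchy_Schwarz_ineq_sum[of "\<lambda>(\<sigma>, \<tau>). K 0 \<sigma> \<tau>" "\<lambda>(\<sigma>, \<tau>). K 1 \<sigma> \<tau>" "X \<times> X"]
    by (simp add: split_beta)
  then show ?thesis using inner[of 0 1] inner[of 0 0] inner[of 1 1] by (simp add: power2_eq_square numeral_2_eq_2)
qed

lemma m_0: "m 0 = real (card X)" by (simp add: trace_pow_def)

lemma trace_exp_0: "g 0 0 = real (card X)"
proof -
  have "g 0 0 = (\<Sum>n. if n = 0 then m 0 else 0)"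
    unfolding trace_exp_def by (intro suminf_cong) auto
  also have "\<dots> = (\<Sum>n\<in>{0::nat}. if n = 0 then m 0 else 0)" by (rule suminf_finite) auto
  finally show ?thesis by (simp add: m_0)
qed

lemma trace_exp_pos:
  assumes "0 \<le> t"
  shows "0 < g 0 t"
proof -
  have nn: "0 \<le> m n" for n unfolding trace_pow_def by (intro sum_nonneg mpow_nonneg)
  have "0 < real (card X)" using finite_X ne by (simp add: card_gt_0_iff)
  then have "0 < (\<Sum>n\<in>{0}. m (n + 0) / fact n * t ^ n)" by (simp add: m_0)
  also have "\<dots> \<le> g 0 t" unfolding trace_exp_def
    using nn assms by (intro sum_le_suminf summable_trace) auto
  finally show ?thesis .
qed

text \<open>The tangent at \<open>t\<close> of the convex function \<open>ln (g 0 t)\<close> lies below its value at \<open>0\<close>.\<close>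

lemma trace_exp_tangent:
  assumes t: "0 < t"
  shows "ln (g 0 t) - ln (real (card X)) \<le> t * (g 1 t / g 0 t)"
proof -
  let ?F = "\<lambda>s. ln (g 0 s)" and ?D = "\<lambda>s. g 1 s / g 0 s"
  have d0: "(g 0 has_real_derivative g 1 s) (at s)" for s using trace_exp_deriv[of 0 s] by simp
  have d1: "(g 1 has_real_derivative g 2 s) (at s)" for s using trace_exp_deriv[of 1 s] by (simp add: numeral_2_eq_2)
  have F: "(?F has_real_derivative ?D s) (at s)" if "0 \<le> s" for s
    using trace_exp_pos[OF that] by (auto intro!: derivative_eq_intros d0)
  have D: "(?D has_real_derivative (g 2 s * g 0 s - g 1 s * g 1 s) / (g 0 s * g 0 s)) (at s)" if "0 \<le> s" for s
    by (rule DERIV_divide[OF d1 d0]) (use trace_exp_pos[OF that] in simp)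
  have mono: "?D s \<le> ?D t" if "0 \<le> s" "s \<le> t" for s
  proof (rule DERIV_nonneg_imp_nondecreasing[OF that(2)])
    fix x assume "s \<le> x" "x \<le> t"
    then have x: "0 \<le> x" using that by simp
    have "0 \<le> (g 2 x * g 0 x - g 1 x * g 1 x) / (g 0 x * g 0 x)"
      using trace_exp_log_convex[of x] by (intro divide_nonneg_nonneg) (auto simp: power2_eq_square mult.commute)
    then show "\<exists>y. (?D has_real_derivative y) (at x) \<and> 0 \<le> y" using D[OF x] by blast
  qed
  obtain \<xi> where \<xi>: "0 < \<xi>" "\<xi> < t" "?F t - ?F 0 = (t - 0) * ?D \<xi>"
    using MVT2[OF t, of ?F ?D] F by auto
  moreover have "t * ?D \<xi> \<le> t * ?D t" using mono[of \<xi>] \<xi> t by (intro mult_left_mono) auto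
  moreover have "?F t - ?F 0 = t * ?D \<xi>" using \<xi>(3) by (simp only: diff_zero)
  ultimately have "?F t - ?F 0 \<le> t * ?D t" by (simp only:)
  then show ?thesis by (simp only: trace_exp_0)
qed

end

section \<open>Transfer matrices\<close>

text \<open>The matrix entry of a mark: whether the colourings \<open>\<sigma>\<close> of the level below and \<open>\<tau>\<close> of the level
  above are compatible with it.\<close>

definition passes :: "'v set \<Rightarrow> 'v set \<times> mark \<Rightarrow> ('v \<Rightarrow> 'c) \<Rightarrow> ('v \<Rightarrow> 'c) \<Rightarrow> bool" where
  "passes V m \<sigma> \<tau> \<longleftrightarrow> (\<forall>z\<in>V - fst m. \<sigma> z = \<tau> z) \<and>
     (if snd m = Cross then \<forall>x\<in>fst m. \<forall>y\<in>fst m. x \<noteq> y \<longrightarrow> \<sigma> x = \<tau> y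
      else \<forall>x\<in>fst m. \<forall>y\<in>fst m. \<sigma> x = \<sigma> y \<and> \<tau> x = \<tau> y)"

lemma passes_sym: "passes V m \<sigma> \<tau> = passes V m \<tau> \<sigma>"
  unfolding passes_def by (auto; metis)

lemma joins_passes:
  "(\<forall>(a, b)\<in>joins V m i j. f a = f b) \<longleftrightarrow> passes V m (\<lambda>z. f (z, i)) (\<lambda>z. f (z, j))"
  unfolding joins_def passes_def by (cases "snd m = Cross") (simp_all, blast+)

abbreviation cols :: "nat \<Rightarrow> 'v set \<Rightarrow> ('v \<Rightarrow> nat) set" where
  "cols q V \<equiv> V \<rightarrow>\<^sub>E {..<q}"

text \<open>Colourings of the arcs with prescribed first and last level, without the link at time \<open>0\<close>.\<close>

definition walks :: "nat \<Rightarrow> 'v set \<Rightarrow> ('v set \<times> mark) list \<Rightarrow> ('v \<Rightarrow> nat) \<Rightarrow> ('v \<Rightarrow> nat) \<Rightarrow> ('v \<times> nat \<Rightarrow> nat) set" where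
  "walks q V W \<sigma> \<tau> = {f \<in> colourings q (arcs V W) (inner_links V W).
     \<forall>z\<in>V. f (z, 0) = \<sigma> z \<and> f (z, length W) = \<tau> z}"

lemma finite_walks: "finite V \<Longrightarrow> finite (walks q V W \<sigma> \<tau>)"
  unfolding walks_def by (rule finite_subset[OF _ finite_colourings[of "arcs V W"]]) (auto simp: arcs_def)

lemma cols_eqI: "\<sigma> \<in> cols q V \<Longrightarrow> \<tau> \<in> cols q V \<Longrightarrow> (\<And>z. z \<in> V \<Longrightarrow> \<sigma> z = \<tau> z) \<Longrightarrow> \<sigma> = \<tau>"
  by (rule PiE_ext)

lemma walks_disjoint: "\<rho> \<in> cols q V \<Longrightarrow> \<rho>' \<in> cols q V \<Longrightarrow> \<rho> \<noteq> \<rho>' \<Longrightarrow> walks q V W \<sigma> \<rho> \<inter> walks q V W \<sigma>' \<rho>' = {}"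
  using cols_eqI[where \<sigma> = \<rho> and \<tau> = \<rho>' and q = q and V = V] unfolding walks_def by force

lemma level_col: "f \<in> colourings q (arcs V W) R \<Longrightarrow> i \<le> length W \<Longrightarrow> (\<lambda>z\<in>V. f (z, i)) \<in> cols q V"
  by (auto simp: colourings_def arcs_def PiE_iff)

lemma card_walks_Nil:
  assumes "\<sigma> \<in> cols q V" "\<tau> \<in> cols q V"
  shows "card (walks q V [] \<sigma> \<tau>) = (if \<sigma> = \<tau> then 1 else 0)"
proof (cases "\<sigma> = \<tau>")
  case True
  have "walks q V [] \<sigma> \<tau> = {\<lambda>a\<in>V \<times> {0::nat}. \<sigma> (fst a)}"
  proof (intro set_eqI iffI)
    fix f assume f: "f \<in> walks q V [] \<sigma> \<tau>"
    then have "f \<in> extensional (V \<times> {0})" "\<forall>z\<in>V. f (z, 0) = \<sigma> z"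
      by (auto simp: walks_def colourings_def arcs_def PiE_iff)
    then show "f \<in> {\<lambda>a\<in>V \<times> {0::nat}. \<sigma> (fst a)}" by (force simp: fun_eq_iff extensional_def)
  next
    fix f assume "f \<in> {\<lambda>a\<in>V \<times> {0::nat}. \<sigma> (fst a)}"
    then show "f \<in> walks q V [] \<sigma> \<tau>"
      using assms True by (auto simp: walks_def colourings_def arcs_def PiE_iff inner_links_def)
  qed
  then show ?thesis using True by simp
next
  case False
  then have "walks q V [] \<sigma> \<tau> = {}"
    using cols_eqI[OF assms] unfolding walks_def by force
  then show ?thesis using False by simp
qed

text \<open>Condition on the colouring \<open>\<rho>\<close> of the last level of \<open>W\<close>.  The new mark then only constrains the
  pair \<open>(\<rho>, \<tau>)\<close>, so the count is a matrix product.\<close>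

lemma card_walks_snoc:
  assumes V: "finite V" and W: "edges_in V (fst ` set W)" and m: "fst m \<subseteq> V"
    and \<sigma>: "\<sigma> \<in> cols q V" and \<tau>: "\<tau> \<in> cols q V"
  shows "card (walks q V (W @ [m]) \<sigma> \<tau>) =
    (\<Sum>\<rho>\<in>cols q V. card (walks q V W \<sigma> \<rho>) * (if passes V m \<rho> \<tau> then 1 else 0))"
proof -
  let ?k = "length W"
  let ?r = "\<lambda>f. restrict f (arcs V W)"
  let ?ext = "\<lambda>f. \<lambda>(z, i)\<in>arcs V (W @ [m]). if i = Suc ?k then \<tau> z else f (z, i)"
  let ?U = "\<Union>\<rho>\<in>{\<rho>\<in>cols q V. passes V m \<rho> \<tau>}. walks q V W \<sigma> \<rho>"
  have il: "inner_links V W \<subseteq> arcs V W \<times> arcs V W" by (rule inner_links_subset[OF W])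
  have fc: "finite (cols q V)" using V by (simp add: finite_PiE)
  have passes_cong: "passes V m s s' \<longleftrightarrow> passes V m r r'" if "\<And>z. z \<in> V \<Longrightarrow> s z = r z" "\<And>z. z \<in> V \<Longrightarrow> s' z = r' z" for s s' r r' :: "'a \<Rightarrow> nat"
  proof -
    have "\<And>z. z \<in> fst m \<Longrightarrow> s z = r z" "\<And>z. z \<in> fst m \<Longrightarrow> s' z = r' z"
      "\<And>z. z \<in> V - fst m \<Longrightarrow> s z = r z" "\<And>z. z \<in> V - fst m \<Longrightarrow> s' z = r' z" using that m by auto
    note eqs = this
    have "(\<forall>z\<in>V - fst m. s z = s' z) \<longleftrightarrow> (\<forall>z\<in>V - fst m. r z = r' z)"
      by (rule ball_cong) (simp_all only: eqs)
    then show ?thesis unfolding passes_def using eqs(1,2) by (simp cong: ball_cong)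
  qed
  have "bij_betw ?r (walks q V (W @ [m]) \<sigma> \<tau>) ?U"
  proof (rule bij_betw_byWitness[where f' = ?ext])
    show "\<forall>f\<in>walks q V (W @ [m]) \<sigma> \<tau>. ?ext (?r f) = f"
    proof
      fix f assume f: "f \<in> walks q V (W @ [m]) \<sigma> \<tau>"
      then have "f \<in> extensional (arcs V (W @ [m]))" "\<forall>z\<in>V. f (z, Suc ?k) = \<tau> z"
        by (auto simp: walks_def colourings_def PiE_iff)
      then show "?ext (?r f) = f" by (auto simp: fun_eq_iff extensional_def arcs_def le_Suc_eq)
    qed
    show "\<forall>f\<in>?U. ?r (?ext f) = f"
    proof
      fix f assume "f \<in> ?U"
      then have "f \<in> extensional (arcs V W)" by (auto simp: walks_def colourings_def PiE_iff)
      then show "?r (?ext f) = f" by (auto simp: fun_eq_iff extensional_def arcs_def)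
    qed
    show "?r ` walks q V (W @ [m]) \<sigma> \<tau> \<subseteq> ?U"
    proof (rule image_subsetI)
      fix f assume f: "f \<in> walks q V (W @ [m]) \<sigma> \<tau>"
      then have fE: "f \<in> arcs V (W @ [m]) \<rightarrow>\<^sub>E {..<q}"
        and l: "\<forall>(a, b)\<in>inner_links V (W @ [m]). f a = f b"
        and ends: "\<forall>z\<in>V. f (z, 0) = \<sigma> z \<and> f (z, Suc ?k) = \<tau> z"
        by (auto simp: walks_def colourings_def)
      define \<rho> where "\<rho> = (\<lambda>z\<in>V. f (z, ?k))"
      have \<rho>: "\<rho> \<in> cols q V" using fE by (auto simp: \<rho>_def arcs_def PiE_iff)
      have "passes V m (\<lambda>z. f (z, ?k)) (\<lambda>z. f (z, Suc ?k))"
        using l unfolding joins_passes[symmetric] inner_links_snoc by blast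
      then have p: "passes V m \<rho> \<tau>"
        using passes_cong[of "\<lambda>z. f (z, ?k)" \<rho> "\<lambda>z. f (z, Suc ?k)" \<tau>] ends by (simp add: \<rho>_def)
      have "?r f \<in> arcs V W \<rightarrow>\<^sub>E {..<q}" using fE by (auto simp: arcs_def PiE_iff)
      moreover have "?r f a = ?r f b" if "(a, b) \<in> inner_links V W" for a b
      proof -
        have "a \<in> arcs V W" "b \<in> arcs V W" using that il by auto
        moreover have "f a = f b" using that l unfolding inner_links_snoc by blast
        ultimately show ?thesis by simp
      qed
      ultimately have "?r f \<in> walks q V W \<sigma> \<rho>"
        using ends unfolding walks_def colourings_def mem_Collect_eq by (simp add: split_beta arcs_def \<rho>_def)
      then show "?r f \<in> ?U" using \<rho> p by blast
    qed
    show "?ext ` ?U \<subseteq> walks q V (W @ [m]) \<sigma> \<tau>"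
    proof (rule image_subsetI)
      fix f assume "f \<in> ?U"
      then obtain \<rho> where p: "passes V m \<rho> \<tau>" and f: "f \<in> walks q V W \<sigma> \<rho>" by blast
      have fE: "f \<in> arcs V W \<rightarrow>\<^sub>E {..<q}" and l: "\<forall>(a, b)\<in>inner_links V W. f a = f b"
        and ends: "\<forall>z\<in>V. f (z, 0) = \<sigma> z \<and> f (z, ?k) = \<rho> z"
        using f by (auto simp: walks_def colourings_def)
      have 1: "?ext f \<in> arcs V (W @ [m]) \<rightarrow>\<^sub>E {..<q}"
        using fE \<tau> by (auto simp: arcs_def PiE_iff)
      have 2: "?ext f a = ?ext f b" if ab: "(a, b) \<in> inner_links V W" for a b
      proof -
        obtain x i y j where c: "a = (x, i)" "b = (y, j)" by (cases a, cases b)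
        have "(x, i) \<in> arcs V W" "(y, j) \<in> arcs V W" using ab il unfolding c by auto
        moreover have "f (x, i) = f (y, j)" using l ab unfolding c by blast
        ultimately show ?thesis unfolding c by (simp add: arcs_def)
      qed
      have "passes V m (\<lambda>z. ?ext f (z, ?k)) (\<lambda>z. ?ext f (z, Suc ?k))"
        using passes_cong[of "\<lambda>z. ?ext f (z, ?k)" \<rho> "\<lambda>z. ?ext f (z, Suc ?k)" \<tau>] ends p by (simp add: arcs_def)
      then have "\<forall>(a, b)\<in>joins V m ?k (Suc ?k). ?ext f a = ?ext f b" by (simp only: joins_passes)
      then have "\<forall>(a, b)\<in>inner_links V (W @ [m]). ?ext f a = ?ext f b"
        unfolding inner_links_snoc using 2 by blast
      then show "?ext f \<in> walks q V (W @ [m]) \<sigma> \<tau>"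
        using 1 ends unfolding walks_def colourings_def by (simp add: arcs_def)
    qed
  qed
  then have "card (walks q V (W @ [m]) \<sigma> \<tau>) = card ?U" by (rule bij_betw_same_card)
  also have "\<dots> = (\<Sum>\<rho>\<in>{\<rho>\<in>cols q V. passes V m \<rho> \<tau>}. card (walks q V W \<sigma> \<rho>))"
    by (intro card_UN_disjoint ballI impI walks_disjoint finite_walks V) (use fc in auto)
  also have "\<dots> = (\<Sum>\<rho>\<in>cols q V. if passes V m \<rho> \<tau> then card (walks q V W \<sigma> \<rho>) else 0)"
    using fc by (simp add: sum.inter_filter)
  finally show ?thesis by (simp add: if_distrib cong: if_cong)
qed

text \<open>The links at time \<open>0\<close> identify the last level with the first one: closing the walk is taking the trace.\<close>

lemma word_trace_walks:
  assumes V: "finite V"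
  shows "word_trace q V W = (\<Sum>\<sigma>\<in>cols q V. card (walks q V W \<sigma> \<sigma>))"
proof -
  have "colourings q (arcs V W) (links V W) = (\<Union>\<sigma>\<in>cols q V. walks q V W \<sigma> \<sigma>)"
  proof (intro set_eqI iffI)
    fix f assume f: "f \<in> colourings q (arcs V W) (links V W)"
    then have "(\<lambda>z\<in>V. f (z, 0)) \<in> cols q V" by (rule level_col) simp
    moreover have "f \<in> walks q V W (\<lambda>z\<in>V. f (z, 0)) (\<lambda>z\<in>V. f (z, 0))"
      using f by (auto simp: walks_def colourings_def links_def)
    ultimately show "f \<in> (\<Union>\<sigma>\<in>cols q V. walks q V W \<sigma> \<sigma>)" by blast
  qed (auto simp: walks_def colourings_def links_def)
  moreover have "card (\<Union>\<sigma>\<in>cols q V. walks q V W \<sigma> \<sigma>) = (\<Sum>\<sigma>\<in>cols q V. card (walks q V W \<sigma> \<sigma>))"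
    by (intro card_UN_disjoint finite_PiE V ballI impI walks_disjoint finite_walks) auto
  ultimately show ?thesis unfolding word_trace_def by (simp only:)
qed

definition transfer :: "'v set \<Rightarrow> 'v set set \<Rightarrow> real \<Rightarrow> ('v \<Rightarrow> nat) \<Rightarrow> ('v \<Rightarrow> nat) \<Rightarrow> real" where
  "transfer V E u \<sigma> \<tau> = (\<Sum>e\<in>E. \<Sum>a\<in>UNIV. mark_prob u a * (if passes V (e, a) \<sigma> \<tau> then 1 else 0))"

lemma sum_walks_mpow:
  assumes V: "finite V" and E: "edges_in V E" and \<sigma>: "\<sigma> \<in> cols q V" and \<tau>: "\<tau> \<in> cols q V"
  shows "(\<Sum>W\<in>words E N. word_prob u W * real (card (walks q V W \<sigma> \<tau>))) = mpow (cols q V) (transfer V E u) N \<sigma> \<tau>"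
  using \<tau>
proof (induction N arbitrary: \<tau>)
  case 0
  have "words E 0 = {[]}" by (auto simp: words_def)
  then show ?case using card_walks_Nil[OF \<sigma> 0] by (simp add: word_prob_def)
next
  case (Suc N)
  let ?X = "cols q V"
  have "(\<Sum>W\<in>words E (Suc N). word_prob u W * real (card (walks q V W \<sigma> \<tau>))) =
      (\<Sum>W\<in>words E N. \<Sum>e\<in>E. \<Sum>a\<in>UNIV. \<Sum>\<rho>\<in>?X. (word_prob u W * real (card (walks q V W \<sigma> \<rho>))) *
         (mark_prob u a * (if passes V (e, a) \<rho> \<tau> then 1 else 0)))"
    unfolding sum_words_Suc
  proof (intro sum.cong refl)
    fix W e and a :: mark assume W: "W \<in> words E N" and e: "e \<in> E"
    have "fst ` set W \<subseteq> E" using W by (auto simp: words_def)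
    then have "edges_in V (fst ` set W)" "e \<subseteq> V" using E e unfolding edges_in_def by blast+
    then have "real (card (walks q V (W @ [(e, a)]) \<sigma> \<tau>)) =
        (\<Sum>\<rho>\<in>?X. real (card (walks q V W \<sigma> \<rho>)) * (if passes V (e, a) \<rho> \<tau> then 1 else 0))"
      using card_walks_snoc[OF V _ _ \<sigma> Suc.prems, of W "(e, a)"]
      by (simp add: if_distrib[of real] cong: if_cong)
    then show "word_prob u (W @ [(e, a)]) * real (card (walks q V (W @ [(e, a)]) \<sigma> \<tau>)) =
        (\<Sum>\<rho>\<in>?X. (word_prob u W * real (card (walks q V W \<sigma> \<rho>))) * (mark_prob u a * (if passes V (e, a) \<rho> \<tau> then 1 else 0)))"
      by (simp add: word_prob_snoc sum_distrib_left mult_ac)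
  qed
  also have "\<dots> = (\<Sum>\<rho>\<in>?X. (\<Sum>W\<in>words E N. word_prob u W * real (card (walks q V W \<sigma> \<rho>))) * transfer V E u \<rho> \<tau>)"
  proof -
    have "(\<Sum>W\<in>words E N. \<Sum>e\<in>E. \<Sum>a\<in>UNIV. \<Sum>\<rho>\<in>?X. f W \<rho> * h e a \<rho>) =
        (\<Sum>\<rho>\<in>?X. (\<Sum>W\<in>words E N. f W \<rho>) * (\<Sum>e\<in>E. \<Sum>a\<in>(UNIV::mark set). h e a \<rho>))" for f and h :: "_ \<Rightarrow> _ \<Rightarrow> _ \<Rightarrow> real"
    proof -
      have "(\<Sum>W\<in>words E N. \<Sum>e\<in>E. \<Sum>a\<in>UNIV. \<Sum>\<rho>\<in>?X. f W \<rho> * h e a \<rho>) =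
          (\<Sum>W\<in>words E N. \<Sum>\<rho>\<in>?X. \<Sum>e\<in>E. \<Sum>a\<in>UNIV. f W \<rho> * h e a \<rho>)"
      proof (rule sum.cong[OF refl])
        fix W
        have "(\<Sum>e\<in>E. \<Sum>a\<in>UNIV. \<Sum>\<rho>\<in>?X. f W \<rho> * h e a \<rho>) = (\<Sum>e\<in>E. \<Sum>\<rho>\<in>?X. \<Sum>a\<in>UNIV. f W \<rho> * h e a \<rho>)"
          by (rule sum.cong[OF refl], rule sum.swap)
        also have "\<dots> = (\<Sum>\<rho>\<in>?X. \<Sum>e\<in>E. \<Sum>a\<in>UNIV. f W \<rho> * h e a \<rho>)"
          by (rule sum.swap)
        finally show "(\<Sum>e\<in>E. \<Sum>a\<in>UNIV. \<Sum>\<rho>\<in>?X. f W \<rho> * h e a \<rho>) = (\<Sum>\<rho>\<in>?X. \<Sum>e\<in>E. \<Sum>a\<in>UNIV. f W \<rho> * h e a \<rho>)" .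
      qed
      also have "\<dots> = (\<Sum>\<rho>\<in>?X. \<Sum>W\<in>words E N. \<Sum>e\<in>E. \<Sum>a\<in>UNIV. f W \<rho> * h e a \<rho>)" by (rule sum.swap)
      also have "\<dots> = (\<Sum>\<rho>\<in>?X. (\<Sum>W\<in>words E N. f W \<rho>) * (\<Sum>e\<in>E. \<Sum>a\<in>(UNIV::mark set). h e a \<rho>))"
        by (rule sum.cong[OF refl], simp only: sum_distrib_right, simp only: sum_distrib_left)
      finally show ?thesis .
    qed
    then show ?thesis unfolding transfer_def .
  qed
  also have "\<dots> = (\<Sum>\<rho>\<in>?X. mpow ?X (transfer V E u) N \<sigma> \<rho> * transfer V E u \<rho> \<tau>)"
    using Suc.IH by (intro sum.cong refl) simp
  finally show ?case by simp
qed

text \<open>The sum over all words of length \<open>N\<close> factorises letter by letter into the \<open>N\<close>-th power of the transfer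
  matrix.\<close>

lemma sum_word_trace:
  assumes V: "finite V" and E: "edges_in V E"
  shows "(\<Sum>W\<in>words E N. word_prob u W * real (word_trace q V W)) = trace_pow (cols q V) (transfer V E u) N"
proof -
  have "(\<Sum>W\<in>words E N. word_prob u W * real (word_trace q V W)) =
      (\<Sum>W\<in>words E N. \<Sum>\<sigma>\<in>cols q V. word_prob u W * real (card (walks q V W \<sigma> \<sigma>)))"
    by (simp add: word_trace_walks[OF V] sum_distrib_left)
  also have "\<dots> = (\<Sum>\<sigma>\<in>cols q V. \<Sum>W\<in>words E N. word_prob u W * real (card (walks q V W \<sigma> \<sigma>)))"
    by (rule sum.swap)
  finally show ?thesis unfolding trace_pow_def using sum_walks_mpow[OF V E] by simp
qed

section \<open>Large loops on sparse graphs\<close>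

text \<open>The mean factor of an extra mark.  For an edge inside a loop, one kind of mark multiplies the number of
  colourings by at most \<open>q\<close> and the other by at most \<open>1\<close>; giving the larger probability
  \<open>M = max u (1 - u)\<close> to the former yields \<open>1 + M (q - 1)\<close>, and this equals
  \<open>1 / q + (1 - 1 / q) (1 + q M)\<close>.  The constant \<open>c_const\<close> has its origin in this identity.\<close>

lemma mark_sum_bound:
  fixes q :: nat and u :: real
  assumes V: "finite V" and W: "edges_in V (fst ` set W)" and e: "e \<subseteq> V" "card e = 2"
    and q: "q \<ge> 2" and u: "u \<in> {0..1}"
  shows "(\<Sum>a\<in>UNIV. mark_prob u a * real (word_trace q V (W @ [(e, a)]))) \<le>
    real (word_trace q V W) * (1 / q + (if same_at_0 V W e then (1 - 1 / q) * c_const q u else 0))"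
proof -
  let ?T = "word_trace q V"
  have q0: "real q > 0" "q \<ge> 1" using q by auto
  note am = add_mark[OF V W e q0(2)]
  show ?thesis
  proof (cases "same_at_0 V W e")
    case False
    have "real (?T (W @ [(e, a)])) = real (?T W) / q" for a
    proof -
      have "real (q * ?T (W @ [(e, a)])) = real (?T W)" using am(1)[OF False, of a] by (simp only:)
      then show ?thesis using q0 by (simp add: field_simps)
    qed
    then have "(\<Sum>a\<in>UNIV. mark_prob u a * real (?T (W @ [(e, a)]))) = (u + (1 - u)) * (real (?T W) / q)"
      unfolding distrib_right by (simp add: sum_mark mark_prob_def)
    then show ?thesis using False by simp
  next
    case True
    define M where "M = max u (1 - u)"
    define T where "T = real (?T W)"
    have M: "u \<le> M" "1 - u \<le> M" by (auto simp: M_def)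
    have T0: "0 \<le> T * (real q - 1)" using q by (simp add: T_def)
    have eq: "1 / q + (1 - 1 / q) * c_const q u = 1 + M * (real q - 1)"
      using q0 by (simp add: c_const_def M_def field_simps)
    have bnd: "u * x + (1 - u) * y \<le> T * (1 + M * (real q - 1))"
      if "x \<le> q * T \<and> y \<le> T \<or> y \<le> q * T \<and> x \<le> T" for x y
    proof -
      have "u * x + (1 - u) * y \<le> T + max u (1 - u) * (T * (real q - 1))"
        using that
      proof (elim disjE conjE)
        assume "x \<le> q * T" "y \<le> T"
        then have "u * x + (1 - u) * y \<le> u * (q * T) + (1 - u) * T"
          using u by (intro add_mono mult_left_mono) auto
        also have "\<dots> = T + u * (T * (real q - 1))" by (simp add: algebra_simps)
        also have "\<dots> \<le> T + max u (1 - u) * (T * (real q - 1))"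
          using T0 by (intro add_left_mono mult_right_mono) auto
        finally show ?thesis .
      next
        assume "y \<le> q * T" "x \<le> T"
        then have "u * x + (1 - u) * y \<le> u * T + (1 - u) * (q * T)"
          using u by (intro add_mono mult_left_mono) auto
        also have "\<dots> = T + (1 - u) * (T * (real q - 1))" by (simp add: algebra_simps)
        also have "\<dots> \<le> T + max u (1 - u) * (T * (real q - 1))"
          using T0 by (intro add_left_mono mult_right_mono) auto
        finally show ?thesis .
      qed
      then show ?thesis by (simp add: M_def algebra_simps)
    qed
    let ?x = "real (?T (W @ [(e, Cross)]))" and ?y = "real (?T (W @ [(e, Bar)]))"
    have "?x \<le> q * T \<and> ?y \<le> T \<or> ?y \<le> q * T \<and> ?x \<le> T"
      using am(2)[OF True] unfolding T_def by (simp only: of_nat_mult[symmetric] of_nat_le_iff)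
    from bnd[OF this] show ?thesis
      using True eq by (simp add: sum_mark mark_prob_def T_def)
  qed
qed

text \<open>An edge with both ends on one loop at time \<open>0\<close> is spanned by the points of that loop at time \<open>0\<close>.  If no
  loop is large, these sets are small, hence sparse, and they are disjoint.\<close>

lemma card_same_at_0_le:
  fixes \<epsilon> :: real
  assumes V: "finite V" and E: "edges_in V E" "finite E" and W: "edges_in V (fst ` set W)" and eps: "0 \<le> \<epsilon>"
    and sparse: "\<And>S. S \<subseteq> V \<Longrightarrow> real (card S) \<le> h \<Longrightarrow> real (card {e\<in>E. e \<subseteq> S}) \<le> (1 + \<epsilon>) * card S"
    and small: "\<not> big_class V W h"
  shows "real (card {e\<in>E. same_at_0 V W e}) \<le> (1 + \<epsilon>) * card V"
proof -
  let ?A = "arcs V W" and ?C = "conn (arcs V W) (links V W)"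
  let ?Q = "?A // ?C"
  define level where "level K = {x\<in>V. (x, 0::nat) \<in> K}" for K
  have finA: "finite ?A" using V by (simp add: arcs_def)
  have finQ: "finite ?Q" using finA equiv_conn[of ?A "links V W"] by (metis finite_quotient equiv_def)
  have lev: "card (level K) \<le> card (fst ` K)" if "K \<in> ?Q" for K
  proof (rule card_mono)
    have "K \<subseteq> ?A" using that by (auto elim!: quotientE simp: conn_def)
    then show "finite (fst ` K)" using finA by (meson finite_imageI finite_subset)
    show "level K \<subseteq> fst ` K" by (force simp: level_def)
  qed
  have "real (card {e\<in>E. e \<subseteq> level K}) \<le> (1 + \<epsilon>) * card (level K)" if K: "K \<in> ?Q" for K
  proof (rule sparse)
    show "level K \<subseteq> V" by (auto simp: level_def)
    have "real (card (fst ` K)) \<le> h" using small K unfolding big_class_def by force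
    then show "real (card (level K)) \<le> h" using lev[OF K] by linarith
  qed
  then have "(\<Sum>K\<in>?Q. real (card {e\<in>E. e \<subseteq> level K})) \<le> (\<Sum>K\<in>?Q. (1 + \<epsilon>) * real (card (level K)))"
    by (rule sum_mono)
  also have "\<dots> = (1 + \<epsilon>) * real (\<Sum>K\<in>?Q. card (level K))" by (simp add: sum_distrib_left)
  also have "(\<Sum>K\<in>?Q. card (level K)) = card (\<Union>K\<in>?Q. level K)"
  proof (rule card_UN_disjoint[symmetric])
    show "\<forall>K\<in>?Q. finite (level K)" using V by (simp add: level_def)
    show "\<forall>K\<in>?Q. \<forall>K'\<in>?Q. K \<noteq> K' \<longrightarrow> level K \<inter> level K' = {}"
      using quotient_disj[OF equiv_conn[of ?A "links V W"]] unfolding level_def by blast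
  qed (rule finQ)
  also have "(1 + \<epsilon>) * real (card (\<Union>K\<in>?Q. level K)) \<le> (1 + \<epsilon>) * card V"
    using eps V by (intro mult_left_mono) (auto intro!: card_mono simp: level_def)
  finally have bound: "(\<Sum>K\<in>?Q. real (card {e\<in>E. e \<subseteq> level K})) \<le> (1 + \<epsilon>) * card V" .
  have "{e\<in>E. same_at_0 V W e} \<subseteq> (\<Union>K\<in>?Q. {e\<in>E. e \<subseteq> level K})"
  proof
    fix e assume "e \<in> {e\<in>E. same_at_0 V W e}"
    then have e: "e \<in> E" "same_at_0 V W e" by auto
    then obtain x where x: "x \<in> e" "e \<subseteq> V" using E(1) by (force simp: edges_in_def)
    let ?K = "?C `` {(x, 0)}"
    have "?K \<in> ?Q" using x by (intro quotientI) (auto simp: arcs_def)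
    moreover have "e \<subseteq> level ?K" using e(2) x by (auto simp: same_at_0_def level_def)
    ultimately show "e \<in> (\<Union>K\<in>?Q. {e\<in>E. e \<subseteq> level K})" using e(1) by blast
  qed
  then have "card {e\<in>E. same_at_0 V W e} \<le> card (\<Union>K\<in>?Q. {e\<in>E. e \<subseteq> level K})"
    using finQ E(2) by (intro card_mono) auto
  also have "\<dots> \<le> (\<Sum>K\<in>?Q. card {e\<in>E. e \<subseteq> level K})" by (rule card_UN_le[OF finQ])
  finally have "real (card {e\<in>E. same_at_0 V W e}) \<le> (\<Sum>K\<in>?Q. real (card {e\<in>E. e \<subseteq> level K}))"
    by (simp only: of_nat_sum[symmetric] of_nat_le_iff)
  then show ?thesis using bound by linarith
qed

lemma words_edges_in: "edges_in V E \<Longrightarrow> W \<in> words E N \<Longrightarrow> edges_in V (fst ` set W)"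
  unfolding edges_in_def words_def by fastforce

text \<open>Comparison of two estimates for \<open>g 1 t / g 0 t\<close>, the mean factor of an extra mark at time \<open>0\<close>,
  summed over the edges.  The tangent inequality bounds it from below, since \<open>g 0 t \<ge> exp (t |E|)\<close>.  Summing
  \<open>mark_sum_bound\<close> bounds it from above by \<open>|E| / q\<close> plus \<open>(1 - 1 / q) c\<close> times the expected
  number of edges inside loops, which is at most \<open>(1 + \<epsilon>) |V|\<close> without a large loop and at most
  \<open>|E|\<close> in any case.\<close>

theorem large_loop_bound:
  fixes q :: nat and t u \<eta> \<epsilon> :: real
  assumes V: "finite V" and E: "edges_in V E" and q: "q \<ge> 2" and t: "0 < t" and u: "u \<in> {0..1}"
    and eps: "0 \<le> \<epsilon>"
    and sparse: "\<And>S. S \<subseteq> V \<Longrightarrow> real (card S) \<le> \<eta> * real (card V) \<Longrightarrow> real (card {e\<in>E. e \<subseteq> S}) \<le> (1 + \<epsilon>) * card S"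
  shows "(1 - 1 / q) * card E - card V * ln q / t \<le>
    (1 - 1 / q) * c_const q u * ((1 + \<epsilon>) * card V + card E * large_loop_prob V E q t u \<eta>)"
proof -
  have finE: "finite E" using E V by (auto simp: edges_in_def intro: finite_subset[of E "Pow V"])
  let ?X = "cols q V" and ?H = "transfer V E u"
  let ?k = "real (card E)" and ?n = "real (card V)"
  interpret M: sym_matrix ?X ?H
  proof
    show "finite ?X" using V by (simp add: finite_PiE)
    have "(\<lambda>x\<in>V. 0) \<in> ?X" using q by auto
    then show "?X \<noteq> {}" by blast
    show "?H \<sigma> \<tau> = ?H \<tau> \<sigma>" for \<sigma> \<tau> unfolding transfer_def using passes_sym[of V _ \<sigma> \<tau>] by simp
    show "0 \<le> ?H \<sigma> \<tau>" for \<sigma> \<tau> unfolding transfer_def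
      by (intro sum_nonneg mult_nonneg_nonneg mark_prob_nonneg[OF u]) auto
  qed
  define c where "c = c_const q u"
  have q1: "0 \<le> 1 - 1 / real q" using q by simp
  have c0: "0 \<le> c" using u by (simp add: c_const_def c_def add_nonneg_nonneg)
  define wt where "wt = word_weight E t u"
  define T where "T W = real (word_trace q V W)" for W
  define ext where "ext W = (\<Sum>e\<in>E. \<Sum>a\<in>UNIV. mark_prob u a * T (W @ [(e, a)]))" for W
  define big where "big W = (if big_class V W (\<eta> * ?n) then 1 else (0::real))" for W
  have wt0: "0 \<le> wt W" for W
    unfolding wt_def word_weight_def using t word_prob_nonneg[OF u, of W]
    by (intro mult_nonneg_nonneg divide_nonneg_nonneg) auto
  have wt_sum: "(\<Sum>W\<in>words E N. wt W * \<phi> W) = exp (- (t * ?k)) * ((\<Sum>W\<in>words E N. word_prob u W * \<phi> W) / fact N * t ^ N)" for N and \<phi> :: "('a set \<times> mark) list \<Rightarrow> real"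
  proof -
    have "(\<Sum>W\<in>words E N. wt W * \<phi> W) = (\<Sum>W\<in>words E N. (exp (- (t * ?k)) * t ^ N / fact N) * (word_prob u W * \<phi> W))"
      by (rule sum.cong) (auto simp: wt_def word_weight_def words_def)
    also have "\<dots> = (exp (- (t * ?k)) * t ^ N / fact N) * (\<Sum>W\<in>words E N. word_prob u W * \<phi> W)"
      by (rule sum_distrib_left[symmetric])
    finally show ?thesis by simp
  qed
  define Z where "Z = exp (- (t * ?k)) * M.g 0 t"
  have Zpos: "0 < Z" unfolding Z_def using M.trace_exp_pos[of t] t by simp
  have Zsums: "(\<lambda>N. \<Sum>W\<in>words E N. wt W * T W) sums Z"
    unfolding wt_sum Z_def T_def sum_word_trace[OF V E]
    using sums_mult[OF summable_sums[OF M.summable_trace[of 0 t]]] by (simp add: trace_exp_def)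
  have Gsums: "(\<lambda>N. \<Sum>W\<in>words E N. wt W * ext W) sums (exp (- (t * ?k)) * M.g 1 t)"
  proof -
    have "(\<Sum>W\<in>words E N. word_prob u W * ext W) = trace_pow ?X ?H (N + 1)" for N
      using sum_word_trace[OF V E, where N = "Suc N" and u = u and q = q]
      by (simp add: sum_words_Suc word_prob_snoc ext_def T_def sum_distrib_left mult_ac)
    then show ?thesis
      unfolding wt_sum using sums_mult[OF summable_sums[OF M.summable_trace[of 1 t]]]
      by (simp add: trace_exp_def)
  qed
  have T1: "1 \<le> T W" if "W \<in> words E N" for W N
  proof -
    have "finite (arcs V W)" using V by (simp add: arcs_def)
    from card_colourings[OF this links_subset[OF words_edges_in[OF E that]]]
    have "T W = real (q ^ card (arcs V W // conn (arcs V W) (links V W)))" unfolding T_def word_trace_def by simp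
    then show ?thesis using q by simp
  qed
  have bigsum: "summable (\<lambda>N. \<Sum>W\<in>words E N. wt W * (T W * big W))"
  proof (rule summable_comparison_test'[OF sums_summable[OF Zsums]])
    fix N :: nat assume "N \<ge> 0"
    have "(\<Sum>W\<in>words E N. wt W * (T W * big W)) \<le> (\<Sum>W\<in>words E N. wt W * T W)"
      using wt0 by (intro sum_mono mult_left_mono) (auto simp: big_def T_def)
    moreover have "0 \<le> (\<Sum>W\<in>words E N. wt W * (T W * big W))"
      using wt0 by (intro sum_nonneg mult_nonneg_nonneg) (auto simp: big_def T_def)
    ultimately show "norm (\<Sum>W\<in>words E N. wt W * (T W * big W)) \<le> (\<Sum>W\<in>words E N. wt W * T W)" by simp
  qed
  define b where "b = (\<Sum>N. \<Sum>W\<in>words E N. wt W * (T W * big W))"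
  have bsums: "(\<lambda>N. \<Sum>W\<in>words E N. wt W * (T W * big W)) sums b"
    unfolding b_def by (rule summable_sums[OF bigsum])
  have b0: "0 \<le> b" unfolding b_def
    using wt0 by (intro suminf_nonneg bigsum sum_nonneg mult_nonneg_nonneg) (auto simp: big_def T_def)
  \<comment> \<open>\<open>\<alpha>\<close> bounds the factor without a large loop, and \<open>\<beta>\<close> the additional contribution of a large loop.\<close>
  define \<alpha> where "\<alpha> = ?k / q + (1 - 1 / q) * c * ((1 + \<epsilon>) * ?n)"
  define \<beta> where "\<beta> = (1 - 1 / q) * c * ?k"
  have ext_le: "ext W \<le> T W * (\<alpha> + \<beta> * big W)" if W: "W \<in> words E N" for W N
  proof -
    let ?S = "{e\<in>E. same_at_0 V W e}"
    have "ext W \<le> (\<Sum>e\<in>E. T W * (1 / q + (if same_at_0 V W e then (1 - 1 / q) * c else 0)))"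
      unfolding ext_def T_def c_def using E
      by (intro sum_mono mark_sum_bound V words_edges_in[OF E W] q u) (auto simp: edges_in_def)
    also have "\<dots> = T W * (?k / q + (1 - 1 / q) * c * real (card ?S))"
      unfolding sum_distrib_left[symmetric] using finE
      by (simp add: sum.distrib sum.inter_filter[symmetric])
    also have "\<dots> \<le> T W * (\<alpha> + \<beta> * big W)"
    proof (rule mult_left_mono)
      have "real (card ?S) \<le> (1 + \<epsilon>) * ?n + ?k * big W"
      proof (cases "big_class V W (\<eta> * ?n)")
        case True
        have "card ?S \<le> card E" using finE by (intro card_mono) auto
        then show ?thesis using True eps by (simp add: big_def add_increasing)
      next
        case False
        then show ?thesis
          using card_same_at_0_le[OF V E finE words_edges_in[OF E W] eps sparse False] by (simp add: big_def)
      qed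
      then have "(1 - 1 / q) * c * real (card ?S) \<le> (1 - 1 / q) * c * ((1 + \<epsilon>) * ?n + ?k * big W)"
        using q1 c0 by (intro mult_left_mono) auto
      then show "?k / q + (1 - 1 / q) * c * real (card ?S) \<le> \<alpha> + \<beta> * big W"
        unfolding \<alpha>_def \<beta>_def by (simp add: algebra_simps)
    qed (simp add: T_def)
    finally show ?thesis .
  qed
  have "exp (- (t * ?k)) * M.g 1 t \<le> \<alpha> * Z + \<beta> * b"
  proof (rule sums_le[OF _ Gsums sums_add[OF sums_mult[OF Zsums] sums_mult[OF bsums]]])
    fix N
    have "(\<Sum>W\<in>words E N. wt W * ext W) \<le> (\<Sum>W\<in>words E N. wt W * (T W * (\<alpha> + \<beta> * big W)))"
      using ext_le wt0 by (intro sum_mono mult_left_mono) auto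
    also have "\<dots> = \<alpha> * (\<Sum>W\<in>words E N. wt W * T W) + \<beta> * (\<Sum>W\<in>words E N. wt W * (T W * big W))"
      by (simp add: sum_distrib_left sum.distrib[symmetric] algebra_simps)
    finally show "(\<Sum>W\<in>words E N. wt W * ext W) \<le>
        \<alpha> * (\<Sum>W\<in>words E N. wt W * T W) + \<beta> * (\<Sum>W\<in>words E N. wt W * (T W * big W))" .
  qed
  then have "exp (- (t * ?k)) * M.g 1 t / Z \<le> (\<alpha> * Z + \<beta> * b) / Z"
    using Zpos by (intro divide_right_mono) auto
  moreover have "exp (- (t * ?k)) * M.g 1 t / Z = M.g 1 t / M.g 0 t" unfolding Z_def by simp
  moreover have "(\<alpha> * Z + \<beta> * b) / Z = \<alpha> + \<beta> * (b / Z)" using Zpos by (simp add: field_simps)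
  ultimately have upper: "M.g 1 t / M.g 0 t \<le> \<alpha> + \<beta> * (b / Z)" by simp
  \<comment> \<open>Every word has at least one colouring, and the words have total weight \<open>1\<close>.\<close>
  have "1 \<le> Z"
  proof (rule sums_le[OF _ sums_word_weight[of E t u] Zsums])
    fix N
    show "(\<Sum>W\<in>words E N. word_weight E t u W) \<le> (\<Sum>W\<in>words E N. wt W * T W)"
    proof (rule sum_mono)
      fix W assume "W \<in> words E N"
      then show "word_weight E t u W \<le> wt W * T W"
        using mult_left_mono[OF T1 wt0] by (simp add: wt_def)
    qed
  qed
  then have "exp (t * ?k) \<le> M.g 0 t" by (simp add: Z_def exp_minus field_simps)
  then have "t * ?k \<le> ln (M.g 0 t)" using M.trace_exp_pos[of t] t by (simp add: ln_ge_iff)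
  moreover have "ln (real (card ?X)) = ?n * ln q" using V q by (simp add: card_PiE ln_realpow)
  ultimately have "t * ?k - ?n * ln q \<le> t * (M.g 1 t / M.g 0 t)"
    using M.trace_exp_tangent[OF t] by simp
  also have "\<dots> \<le> t * (\<alpha> + \<beta> * (b / Z))" using upper t by (intro mult_left_mono) auto
  finally have main: "?k - ?n * ln q / t \<le> \<alpha> + \<beta> * (b / Z)" using t by (simp add: field_simps)
  \<comment> \<open>The sums over words are integrals: \<open>Z\<close> is the partition function, and \<open>b / Z\<close> the probability of a large loop.\<close>
  have loc: "loop_word V E (config_of w) ts W" if "represents E (config_of w) ts W" for w :: "'a sample" and ts W
    by unfold_locales (use V E that in auto)
  have num: "real q ^ num_loops V E (config_of w) = T W" if "represents E (config_of w) ts W" for w :: "'a sample" and ts W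
    using loop_word.power_num_loops[OF loc[OF that], of q] unfolding T_def by (metis of_nat_power)
  have ev: "(if config_of w \<in> large_loop_event V E \<eta> then 1 else 0) = big W" if "represents E (config_of w) ts W" for w :: "'a sample" and ts W
    using loop_word.large_loop_iff[OF loc[OF that], of \<eta>] unfolding big_def by simp
  let ?R = "rho E t u" and ?f = "\<lambda>w. real q ^ num_loops V E (config_of w)"
  have T0: "0 \<le> T W" for W by (simp add: T_def)
  have big0: "0 \<le> big W" for W by (simp add: big_def)
  have ennsum: "(\<Sum>N. ennreal (\<Sum>W\<in>words E N. word_weight E t u W * \<phi> W)) = ennreal s"
    if "(\<lambda>N. \<Sum>W\<in>words E N. wt W * \<phi> W) sums s" "\<And>W. 0 \<le> \<phi> W" for \<phi> s
    using that wt0 unfolding wt_def by (intro suminf_ennreal_eq sum_nonneg mult_nonneg_nonneg)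
  have fm: "(\<lambda>w. ennreal (?f w)) \<in> borel_measurable ?R"
    by (rule nn_integral_word(2)[OF finE t u, of _ T]) (use num T0 in auto)
  have fm': "?f \<in> borel_measurable ?R"
  proof -
    have "(\<lambda>w. enn2real (ennreal (?f w))) \<in> borel_measurable ?R" using fm by (rule borel_measurable_enn2real)
    then show ?thesis by simp
  qed
  have "(\<integral>\<^sup>+ w. ennreal (?f w) \<partial>?R) = (\<Sum>N. ennreal (\<Sum>W\<in>words E N. word_weight E t u W * T W))"
    by (rule nn_integral_word(1)[OF finE t u]) (use num T0 in auto)
  also have "\<dots> = ennreal Z" by (rule ennsum[OF Zsums T0])
  finally have nnZ: "(\<integral>\<^sup>+ w. ennreal (?f w) \<partial>?R) = ennreal Z" .
  have part: "partition_function V E q t u = Z"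
    unfolding partition_function_def using integral_eq_nn_integral[OF fm'] nnZ Zpos by simp
  let ?A = "{w \<in> space ?R. config_of w \<in> large_loop_event V E \<eta>}"
  have "(\<lambda>w. ennreal (if config_of w \<in> large_loop_event V E \<eta> then 1 else 0)) \<in> borel_measurable ?R"
    by (rule nn_integral_word(2)[OF finE t u, of _ big]) (use ev big0 in \<open>auto simp only:\<close>)
  from measurable_sets[OF this borel_closed[OF closed_singleton, of 1]]
  have "(\<lambda>w. ennreal (if config_of w \<in> large_loop_event V E \<eta> then 1 else 0)) -` {1} \<inter> space ?R \<in> sets ?R" .
  moreover have "(\<lambda>w. ennreal (if config_of w \<in> large_loop_event V E \<eta> then 1 else 0)) -` {1} \<inter> space ?R = ?A"
    by (auto split: if_splits)
  ultimately have A: "?A \<in> sets ?R" by (simp only:)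
  have dm: "(\<lambda>w. ennreal (?f w / Z)) \<in> borel_measurable ?R" using fm' by measurable
  have "emeasure (loop_measure V E q t u) ?A = (\<integral>\<^sup>+ w. ennreal (?f w / Z) * indicator ?A w \<partial>?R)"
    unfolding loop_measure_def part using dm A by (simp add: emeasure_density)
  also have "\<dots> = (\<integral>\<^sup>+ w. ennreal (?f w / Z * (if config_of w \<in> large_loop_event V E \<eta> then 1 else 0)) \<partial>?R)"
    by (intro nn_integral_cong) (auto simp: indicator_def)
  also have "\<dots> = (\<Sum>N. ennreal (\<Sum>W\<in>words E N. word_weight E t u W * (T W / Z * big W)))"
  proof (rule nn_integral_word(1)[OF finE t u])
    fix w ts W assume r: "represents E (config_of w) ts W"
    show "ennreal (?f w / Z * (if config_of w \<in> large_loop_event V E \<eta> then 1 else 0)) = ennreal (T W / Z * big W)"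
      unfolding num[OF r] ev[OF r] ..
  qed (use T0 big0 Zpos in \<open>simp add: zero_le_divide_iff\<close>)
  also have "\<dots> = ennreal (b / Z)"
  proof (rule ennsum)
    show "(\<lambda>N. \<Sum>W\<in>words E N. wt W * (T W / Z * big W)) sums (b / Z)"
      using sums_divide[OF bsums, of Z] by (simp add: sum_divide_distrib)
  qed (use T0 big0 Zpos in \<open>simp add: zero_le_divide_iff\<close>)
  finally have "large_loop_prob V E q t u \<eta> = b / Z"
    unfolding large_loop_prob_def measure_def using b0 Zpos by (simp add: loop_measure_def)
  then have "?k - ?n * ln q / t \<le> \<alpha> + \<beta> * large_loop_prob V E q t u \<eta>" using main by simp
  then show ?thesis unfolding \<alpha>_def \<beta>_def c_def by (simp add: algebra_simps)
qed

section \<open>Sparse random graphs\<close>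

lemma power_le_exp_fact: "real s ^ s \<le> exp (real s) * fact s"
proof -
  have "(\<Sum>n\<in>{s}. real s ^ n /\<^sub>R fact n) \<le> (\<Sum>n. real s ^ n /\<^sub>R fact n)"
    by (intro sum_le_suminf summable_exp_generic) auto
  then have "real s ^ s / fact s \<le> exp (real s)" by (simp add: exp_def field_simps)
  then show ?thesis by (simp add: field_simps)
qed

lemma binomial_le_power_fact: "real (n choose s) * fact s \<le> real n ^ s"
proof -
  have "real ((n choose s) * fact s) \<le> real (n ^ s)"
    using binomial_fact_pow[of n s] by (simp only: of_nat_le_iff)
  then show ?thesis by simp
qed

text \<open>The estimate \<open>n choose s \<le> (e n / s)\<^sup>s\<close> in a form that makes sense for \<open>s = 0\<close>.\<close>

lemma binomial_exp_bound: "real (n choose s) * real s ^ s \<le> (exp 1 * real n) ^ s"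
proof -
  have "real (n choose s) * real s ^ s \<le> real (n choose s) * (exp (real s) * fact s)"
    by (intro mult_left_mono power_le_exp_fact) simp
  also have "\<dots> \<le> exp (real s) * real n ^ s"
    using binomial_le_power_fact[of n s] by (simp add: mult_ac)
  finally show ?thesis by (simp add: power_mult_distrib exp_of_nat_mult[symmetric])
qed

text \<open>The least number of edges that exceeds \<open>(1 + \<epsilon>) s\<close>.\<close>

definition excess :: "real \<Rightarrow> nat \<Rightarrow> nat" where
  "excess \<epsilon> s = Suc (nat \<lfloor>(1 + \<epsilon>) * real s\<rfloor>)"

lemma excess_bounds:
  fixes \<epsilon> :: real and s :: nat
  assumes "0 < \<epsilon>" "\<epsilon> \<le> 1" "1 \<le> s"
  shows "(1 + \<epsilon>) * s < excess \<epsilon> s" "s < excess \<epsilon> s" "excess \<epsilon> s \<le> 3 * s"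
proof -
  have nn: "0 \<le> (1 + \<epsilon>) * real s" using assms by simp
  show 1: "(1 + \<epsilon>) * s < excess \<epsilon> s"
    using nn real_of_int_floor_add_one_gt[of "(1 + \<epsilon>) * real s"] by (simp add: excess_def add.commute)
  have "real s \<le> (1 + \<epsilon>) * real s" using assms by (simp add: algebra_simps)
  then show "s < excess \<epsilon> s" using 1 by linarith
  have "(1 + \<epsilon>) * real s \<le> 2 * real s" using assms by (intro mult_right_mono) auto
  then have "\<lfloor>(1 + \<epsilon>) * real s\<rfloor> \<le> 2 * int s" by (simp add: floor_le_iff)
  then show "excess \<epsilon> s \<le> 3 * s" using assms(3) by (simp add: excess_def)
qed

lemma excess_le: "(1 + \<epsilon>) * real s < real m \<Longrightarrow> 0 \<le> \<epsilon> \<Longrightarrow> excess \<epsilon> s \<le> m"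
  by (simp add: excess_def Suc_le_eq floor_less_iff nat_less_iff)

text \<open>The expected number of sets of \<open>s\<close> vertices with \<open>m\<close> inner edges.  With \<open>x = s / n\<close> the left-hand side is at
  most \<open>e\<^bsup>s+m\<^esup> C\<^sup>m x\<^bsup>m-s\<^esup>\<close>.  Because \<open>m \<le> 3 s\<close>, the first two factors are at most
  \<open>(e\<^sup>4 C\<^sup>3)\<^sup>s\<close>.  Because \<open>m - s\<close> exceeds both \<open>1\<close> and \<open>\<epsilon> s\<close>, hence also their mean, the last factor
  is at most \<open>\<surd>x \<eta>\<^bsup>\<epsilon>s/2\<^esup>\<close>: for small \<open>\<eta>\<close> its second part beats the exponential growth, while
  \<open>\<surd>x\<close> makes the sum over \<open>s\<close> tend to \<open>0\<close> as \<open>n\<close> grows.\<close>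

lemma first_moment_term:
  fixes C \<epsilon> \<eta> :: real and n s m :: nat
  assumes C: "1 \<le> C" and eps: "0 < \<epsilon>" "\<epsilon> \<le> 1" and \<eta>: "0 < \<eta>" "\<eta> \<le> 1" and s: "1 \<le> s" "s \<le> \<eta> * n"
    and K: "exp 4 * C ^ 3 * \<eta> powr (\<epsilon> / 2) \<le> 1 / 2"
  defines "m \<equiv> excess \<epsilon> s"
  shows "real (n choose s) * (real ((s choose 2) choose m) * (C / n) ^ m) \<le> 1 / sqrt n * (s * (1 / 2) ^ s)"
proof -
  have n: "0 < real n" using s \<eta> by (cases n) auto
  define x where "x = real s / n"
  have x: "0 < x" "x \<le> \<eta>" using s n by (auto simp: x_def field_simps)
  have x1: "x \<le> 1" using x \<eta> by linarith
  note x = x x1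
  have sR: "0 < real s" using s by simp
  note m = excess_bounds[OF eps s(1), folded m_def]
  have b1: "real (n choose s) \<le> (exp 1 / x) ^ s"
  proof -
    have "real (n choose s) \<le> (exp 1 * real n) ^ s / real s ^ s"
      using binomial_exp_bound[of n s] sR by (simp add: field_simps)
    also have "\<dots> = (exp 1 / x) ^ s" using n sR by (simp add: x_def power_divide field_simps power_mult_distrib)
    finally show ?thesis .
  qed
  have "s choose 2 \<le> s ^ 2" by (cases "2 \<le> s") (auto intro: binomial_le_pow simp: binomial_eq_0)
  then have p2: "real (s choose 2) \<le> real s ^ 2" by (metis of_nat_le_iff of_nat_power)
  have b2: "real ((s choose 2) choose m) \<le> (exp 1 * real s) ^ m"
  proof -
    have mR: "0 < real m" using m s by simp
    have "real ((s choose 2) choose m) * real m ^ m \<le> (exp 1 * real (s choose 2)) ^ m"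
      by (rule binomial_exp_bound)
    also have "\<dots> \<le> (exp 1 * (real s * real m)) ^ m"
    proof (intro power_mono mult_left_mono)
      show "real (s choose 2) \<le> real s * real m"
        using p2 m(2) mult_left_mono[of "real s" "real m" "real s"] by (simp add: power2_eq_square)
    qed auto
    also have "\<dots> = (exp 1 * real s) ^ m * real m ^ m" by (simp add: power_mult_distrib)
    finally show ?thesis using mR by simp
  qed
  have "real (n choose s) * (real ((s choose 2) choose m) * (C / n) ^ m) \<le>
      (exp 1 / x) ^ s * ((exp 1 * real s) ^ m * (C / n) ^ m)"
    using b1 b2 C n x by (intro mult_mono mult_right_mono mult_nonneg_nonneg) auto
  also have "\<dots> = exp 1 ^ (s + m) * C ^ m * (x ^ m / x ^ s)"
    by (simp add: x_def power_mult_distrib power_divide power_add field_simps)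
  also have "x ^ m / x ^ s = x ^ (m - s)" using x m by (simp add: power_diff)
  also have "exp 1 ^ (s + m) * C ^ m * x ^ (m - s) \<le> (exp 4 * C ^ 3) ^ s * x ^ (m - s)"
  proof (rule mult_right_mono)
    have "exp 1 ^ (s + m) \<le> (exp (1::real)) ^ (4 * s)" using m by (intro power_increasing) auto
    also have "\<dots> = exp 4 ^ s" by (simp add: power_mult flip: exp_of_nat_mult)
    finally have 1: "exp (1::real) ^ (s + m) \<le> exp 4 ^ s" .
    have "C ^ m \<le> C ^ (3 * s)" using C m by (intro power_increasing) auto
    then have 2: "C ^ m \<le> (C ^ 3) ^ s" by (simp add: power_mult)
    have "exp 1 ^ (s + m) * C ^ m \<le> exp 4 ^ s * (C ^ 3) ^ s"
      using 1 2 C by (intro mult_mono) auto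
    then show "exp 1 ^ (s + m) * C ^ m \<le> (exp 4 * C ^ 3) ^ s" by (simp add: power_mult_distrib)
  qed (use x in simp)
  also have "x ^ (m - s) \<le> sqrt x * (\<eta> powr (\<epsilon> / 2)) ^ s"
  proof -
    have ms: "(1 + \<epsilon> * s) / 2 \<le> real (m - s)"
    proof -
      have "1 \<le> real (m - s)" "\<epsilon> * s \<le> real (m - s)"
        using m by (auto simp: of_nat_diff algebra_simps)
      then show ?thesis by simp
    qed
    have "x ^ (m - s) = x powr real (m - s)" using x by (simp add: powr_realpow)
    also have "\<dots> \<le> x powr ((1 + \<epsilon> * s) / 2)" using ms x by (intro powr_mono') auto
    also have "\<dots> = x powr (1 / 2) * (x powr (\<epsilon> / 2)) ^ s"
      using x by (simp add: add_divide_distrib powr_add powr_powr flip: powr_realpow)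
    also have "\<dots> \<le> sqrt x * (\<eta> powr (\<epsilon> / 2)) ^ s"
      using x eps by (intro mult_mono power_mono powr_mono2) (auto simp: powr_half_sqrt)
    finally show ?thesis .
  qed
  then have "(exp 4 * C ^ 3) ^ s * x ^ (m - s) \<le> (exp 4 * C ^ 3) ^ s * (sqrt x * (\<eta> powr (\<epsilon> / 2)) ^ s)"
    using C by (intro mult_left_mono) auto
  also have "\<dots> = sqrt x * (exp 4 * C ^ 3 * \<eta> powr (\<epsilon> / 2)) ^ s" by (simp add: power_mult_distrib mult_ac)
  also have "\<dots> \<le> sqrt x * (1 / 2) ^ s"
    using K C x by (intro mult_left_mono power_mono) auto
  also have "\<dots> \<le> 1 / sqrt n * (s * (1 / 2) ^ s)"
  proof -
    have "sqrt s \<le> s" using s by (simp add: real_le_lsqrt power2_eq_square)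
    then have "sqrt x \<le> s / sqrt n" unfolding x_def using n by (simp add: real_sqrt_divide divide_right_mono)
    then have "sqrt x * (1 / 2) ^ s \<le> s / sqrt n * (1 / 2) ^ s" by (rule mult_right_mono) simp
    then show ?thesis by simp
  qed
  finally show ?thesis .
qed

lemma sum_half_powers: "(\<Sum>s\<in>{1..N}. real s * (1 / 2) ^ s) \<le> 2"
proof -
  have "(\<Sum>s\<in>{1..N}. real s * (1 / 2) ^ s) = 2 - (real N + 2) * (1 / 2) ^ N"
    by (induction N) (auto simp: field_simps)
  then show ?thesis by simp
qed

definition inner_edges :: "nat set \<Rightarrow> nat set set" where
  "inner_edges S = {e. e \<subseteq> S \<and> card e = 2}"

lemma card_inner_edges: "finite S \<Longrightarrow> card (inner_edges S) = (card S choose 2)" "finite S \<Longrightarrow> finite (inner_edges S)"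
  unfolding inner_edges_def by (auto simp: n_subsets intro: finite_subset[of _ "Pow S"])

text \<open>The union bound over the sets \<open>S\<close> and over the sets \<open>F\<close> of \<open>excess \<epsilon> (card S)\<close> edges inside \<open>S\<close>.  As
  \<open>card F \<le> 3 card S\<close>, the condition \<open>3 \<eta> \<le> \<kappa>\<close> ensures that only sets \<open>F\<close> of at most \<open>\<kappa> n\<close> edges
  occur.\<close>

lemma prob_dense_subset:
  fixes p :: "nat set set pmf" and C \<epsilon> \<eta> \<kappa> :: real
  assumes supp: "set_pmf p \<subseteq> Pow (all_edges n)" and n: "1 \<le> n"
    and F: "\<And>F. F \<subseteq> all_edges n \<Longrightarrow> real (card F) \<le> \<kappa> * n \<Longrightarrow> measure_pmf.prob p {E. F \<subseteq> E} \<le> (C / n) ^ card F"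
    and C: "1 \<le> C" and eps: "0 < \<epsilon>" "\<epsilon> \<le> 1" and \<eta>: "0 < \<eta>" "\<eta> \<le> 1" "3 * \<eta> \<le> \<kappa>"
    and K: "exp 4 * C ^ 3 * \<eta> powr (\<epsilon> / 2) \<le> 1 / 2"
  shows "measure_pmf.prob p {E. \<exists>S\<subseteq>{1..n}. real (card S) \<le> \<eta> * n \<and> (1 + \<epsilon>) * card S < card {e\<in>E. e \<subseteq> S}} \<le> 2 / sqrt n"
proof -
  let ?P = "measure_pmf.prob p"
  let ?D = "{E. \<exists>S\<subseteq>{1..n}. real (card S) \<le> \<eta> * n \<and> (1 + \<epsilon>) * card S < card {e\<in>E. e \<subseteq> S}}"
  define Ss where "Ss = {S. S \<subseteq> {1..n} \<and> 1 \<le> card S \<and> real (card S) \<le> \<eta> * n}"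
  define Fs where "Fs S = {F. F \<subseteq> inner_edges S \<and> card F = excess \<epsilon> (card S)}" for S
  have finS: "finite S" if "S \<in> Ss" for S
    by (rule finite_subset[of _ "{1..n}"]) (use that in \<open>auto simp: Ss_def\<close>)
  have finSs: "finite Ss" unfolding Ss_def by (rule finite_subset[of _ "Pow {1..n}"]) auto
  have finFs: "finite (Fs S)" if "S \<in> Ss" for S
    unfolding Fs_def using card_inner_edges(2)[OF finS[OF that]] by (auto intro: finite_subset[of _ "Pow (inner_edges S)"])
  have cardFs: "card (Fs S) = ((card S choose 2) choose excess \<epsilon> (card S))" if "S \<in> Ss" for S
    unfolding Fs_def using card_inner_edges[OF finS[OF that]] by (simp add: n_subsets)
  have "?P ?D = ?P (?D \<inter> Pow (all_edges n))"
    by (rule measure_prob_cong_0) (use supp in \<open>auto simp: set_pmf_iff\<close>)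
  also have "\<dots> \<le> ?P (\<Union>S\<in>Ss. \<Union>F\<in>Fs S. {E. F \<subseteq> E})"
  proof (rule measure_pmf.finite_measure_mono)
    show "?D \<inter> Pow (all_edges n) \<subseteq> (\<Union>S\<in>Ss. \<Union>F\<in>Fs S. {E. F \<subseteq> E})"
    proof
      fix E assume "E \<in> ?D \<inter> Pow (all_edges n)"
      then obtain S where S: "S \<subseteq> {1..n}" "real (card S) \<le> \<eta> * n" "(1 + \<epsilon>) * card S < card {e\<in>E. e \<subseteq> S}"
        and E: "E \<subseteq> all_edges n" by blast
      have fS: "finite S" using S(1) by (rule finite_subset) simp
      have sub: "{e\<in>E. e \<subseteq> S} \<subseteq> inner_edges S" using E by (auto simp: inner_edges_def all_edges_def)
      have "S \<noteq> {}"
      proof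
        assume "S = {}"
        then have "inner_edges S = {}" by (auto simp: inner_edges_def)
        then have "{e\<in>E. e \<subseteq> S} = {}" using sub by blast
        then have "card {e\<in>E. e \<subseteq> S} = 0" by (simp only: card.empty)
        then have "(1 + \<epsilon>) * real (card S) < 0" using S(3) by (simp only: of_nat_0)
        moreover have "0 \<le> (1 + \<epsilon>) * real (card S)" using eps by simp
        ultimately show False by linarith
      qed
      then have SS: "S \<in> Ss" using S fS by (simp add: Ss_def Suc_le_eq card_gt_0_iff)
      have "excess \<epsilon> (card S) \<le> card {e\<in>E. e \<subseteq> S}" using S(3) eps by (intro excess_le) auto
      then obtain F where F: "F \<subseteq> {e\<in>E. e \<subseteq> S}" "card F = excess \<epsilon> (card S)"
        by (meson obtain_subset_with_card_n)
      then have "F \<in> Fs S" "F \<subseteq> E" using sub by (auto simp: Fs_def)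
      then show "E \<in> (\<Union>S\<in>Ss. \<Union>F\<in>Fs S. {E. F \<subseteq> E})" using SS by blast
    qed
  qed simp
  also have "\<dots> \<le> (\<Sum>S\<in>Ss. ?P (\<Union>F\<in>Fs S. {E. F \<subseteq> E}))"
    using finSs by (intro measure_pmf.finite_measure_subadditive_finite) auto
  also have "\<dots> \<le> (\<Sum>S\<in>Ss. real ((card S choose 2) choose excess \<epsilon> (card S)) * (C / n) ^ excess \<epsilon> (card S))"
  proof (rule sum_mono)
    fix S assume S: "S \<in> Ss"
    have "?P (\<Union>F\<in>Fs S. {E. F \<subseteq> E}) \<le> (\<Sum>F\<in>Fs S. ?P {E. F \<subseteq> E})"
      using finFs[OF S] by (intro measure_pmf.finite_measure_subadditive_finite) auto
    also have "\<dots> \<le> (\<Sum>F\<in>Fs S. (C / n) ^ excess \<epsilon> (card S))"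
    proof (rule sum_mono)
      fix G assume G: "G \<in> Fs S"
      have "G \<subseteq> all_edges n" using G S by (auto simp: Fs_def Ss_def inner_edges_def all_edges_def)
      moreover have "real (card G) \<le> \<kappa> * n"
      proof -
        have "real (card G) \<le> 3 * card S"
          using G excess_bounds(3)[OF eps, of "card S"] S by (simp add: Fs_def Ss_def)
        also have "\<dots> \<le> 3 * \<eta> * n" using S by (simp add: Ss_def)
        also have "\<dots> \<le> \<kappa> * n" using \<eta> by (intro mult_right_mono) auto
        finally show ?thesis .
      qed
      ultimately show "?P {E. G \<subseteq> E} \<le> (C / n) ^ excess \<epsilon> (card S)" using F[of G] G by (simp add: Fs_def)
    qed
    also have "\<dots> = real ((card S choose 2) choose excess \<epsilon> (card S)) * (C / n) ^ excess \<epsilon> (card S)"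
      by (simp add: cardFs[OF S])
    finally show "?P (\<Union>F\<in>Fs S. {E. F \<subseteq> E}) \<le> real ((card S choose 2) choose excess \<epsilon> (card S)) * (C / n) ^ excess \<epsilon> (card S)" .
  qed
  also have "\<dots> = (\<Sum>s\<in>{1..nat \<lfloor>\<eta> * n\<rfloor>}. \<Sum>S\<in>{S\<in>Ss. card S = s}. real ((card S choose 2) choose excess \<epsilon> (card S)) * (C / n) ^ excess \<epsilon> (card S))"
    by (rule sum.group[symmetric]) (use finSs in \<open>auto simp: Ss_def le_nat_floor\<close>)
  also have "\<dots> \<le> (\<Sum>s\<in>{1..nat \<lfloor>\<eta> * n\<rfloor>}. 1 / sqrt n * (s * (1 / 2) ^ s))"
  proof (rule sum_mono)
    fix s assume s: "s \<in> {1..nat \<lfloor>\<eta> * n\<rfloor>}"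
    then have s': "1 \<le> s" "real s \<le> \<eta> * n" using \<eta> n by (auto simp: le_nat_floor le_nat_iff le_floor_iff)
    let ?h = "real ((s choose 2) choose excess \<epsilon> s) * (C / n) ^ excess \<epsilon> s"
    have h0: "0 \<le> ?h" using C by simp
    have "(\<Sum>S\<in>{S\<in>Ss. card S = s}. real ((card S choose 2) choose excess \<epsilon> (card S)) * (C / n) ^ excess \<epsilon> (card S)) =
        real (card {S\<in>Ss. card S = s}) * ?h" by simp
    also have "\<dots> \<le> real (n choose s) * ?h"
    proof (rule mult_right_mono[OF _ h0])
      have "card {S\<in>Ss. card S = s} \<le> card {S. S \<subseteq> {1..n} \<and> card S = s}"
        by (intro card_mono) (auto simp: Ss_def)
      then show "real (card {S\<in>Ss. card S = s}) \<le> real (n choose s)" by (simp add: n_subsets)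
    qed
    also have "\<dots> \<le> 1 / sqrt n * (s * (1 / 2) ^ s)"
      by (rule first_moment_term[OF C eps \<eta>(1,2) s' K])
    finally show "(\<Sum>S\<in>{S\<in>Ss. card S = s}. real ((card S choose 2) choose excess \<epsilon> (card S)) * (C / n) ^ excess \<epsilon> (card S)) \<le> 1 / sqrt n * (s * (1 / 2) ^ s)" .
  qed
  also have "\<dots> = 1 / sqrt n * (\<Sum>s\<in>{1..nat \<lfloor>\<eta> * n\<rfloor>}. s * (1 / 2) ^ s)" by (rule sum_distrib_left[symmetric])
  also have "\<dots> \<le> 1 / sqrt n * 2" by (intro mult_left_mono sum_half_powers) simp
  finally show ?thesis by simp
qed

text \<open>Let \<open>c = c_const \<theta> u\<close> and \<open>L = \<theta> ln \<theta> / (\<theta> - 1)\<close>.  Divided by \<open>1 - 1 / \<theta>\<close>, the inequality \<open>large_loop_bound\<close>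
  reads \<open>|E| - n L / t \<le> c ((1 + \<epsilon>) n + |E| P)\<close>, where \<open>P\<close> is the probability of a large loop.  The threshold
  satisfies \<open>L / T_bound \<theta> u m = m / 2 - c\<close>, so for \<open>t \<ge> T_bound \<theta> u m + \<delta>\<close> the term \<open>L / t\<close> is at most
  \<open>a < m / 2 - c\<close>.  Of the gap \<open>\<kappa> = m / 2 - c - a\<close> one quarter is spent on missing edges and one on \<open>\<epsilon>\<close>;
  the remaining half forces \<open>P\<close> to be positive.  None of the constants depends on \<open>t\<close>.\<close>

lemma large_loop_prob_lower_bound:
  fixes \<theta> :: nat and u t m \<delta> \<eta> a \<kappa> \<epsilon> :: real
  assumes u: "u \<in> {0..1}" and \<theta>: "\<theta> > 1" and m: "m > 2 * c_const \<theta> u" and \<delta>: "0 < \<delta>"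
    and t: "t \<ge> T_bound \<theta> u m + \<delta>"
  defines "a \<equiv> real \<theta> * ln \<theta> / ((real \<theta> - 1) * (T_bound \<theta> u m + \<delta>))"
  defines "\<kappa> \<equiv> m / 2 - c_const \<theta> u - a"
  defines "\<epsilon> \<equiv> min 1 (\<kappa> / (4 * c_const \<theta> u))"
  shows "0 < \<kappa>" and "0 < \<kappa> / (2 * c_const \<theta> u * (m / 2 - \<kappa> / 4))" and "0 < \<epsilon>"
    and "\<And>n E. 1 \<le> n \<Longrightarrow> E \<subseteq> all_edges n \<Longrightarrow> (m / 2 - \<kappa> / 4) * n \<le> real (card E) \<Longrightarrow>
      (\<And>S. S \<subseteq> {1..n} \<Longrightarrow> real (card S) \<le> \<eta> * n \<Longrightarrow> real (card {e\<in>E. e \<subseteq> S}) \<le> (1 + \<epsilon>) * card S) \<Longrightarrow>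
      \<kappa> / (2 * c_const \<theta> u * (m / 2 - \<kappa> / 4)) \<le> large_loop_prob {1..n} E \<theta> t u \<eta>"
proof -
  define c where "c = c_const \<theta> u"
  define T where "T = T_bound \<theta> u m"
  define L where "L = real \<theta> * ln \<theta> / (real \<theta> - 1)"
  have \<theta>R: "real \<theta> > 1" using \<theta> by simp
  have c1: "1 \<le> c" using u by (simp add: c_def c_const_def)
  have mc: "0 < m / 2 - c" using m by (simp add: c_def)
  have L: "0 < L" using \<theta>R by (simp add: L_def)
  have T: "T = L / (m / 2 - c)" by (simp add: T_def T_bound_def L_def c_def)
  have T0: "0 < T" using L mc by (simp add: T)
  have a: "a = L / (T + \<delta>)" unfolding a_def L_def T_def by simp
  have a0: "0 < a" using L T0 \<delta> by (simp add: a)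
  have "L / (T + \<delta>) < L / T" using L T0 \<delta> by (intro divide_strict_left_mono) auto
  also have "L / T = m / 2 - c" using L mc by (simp add: T)
  finally have "a < m / 2 - c" by (simp add: a)
  then have \<kappa>0: "0 < \<kappa>" by (simp add: \<kappa>_def c_def)
  have \<kappa>c: "\<kappa> = m / 2 - c - a" by (simp add: \<kappa>_def c_def)
  define B where "B = m / 2 - \<kappa> / 4"
  have B: "0 < B" "0 \<le> B - \<kappa> / 2" using a0 c1 \<kappa>0 by (auto simp: B_def \<kappa>c)
  show "0 < \<kappa>" by (rule \<kappa>0)
  show pos: "0 < \<kappa> / (2 * c_const \<theta> u * (m / 2 - \<kappa> / 4))"
    using \<kappa>0 B c1 unfolding c_def[symmetric] B_def[symmetric] by simp
  show \<epsilon>0: "0 < \<epsilon>" using \<kappa>0 c1 by (simp add: \<epsilon>_def c_def)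
  fix n :: nat and E assume n: "1 \<le> n" and E: "E \<subseteq> all_edges n"
    and edges: "(m / 2 - \<kappa> / 4) * n \<le> real (card E)"
    and sparse: "\<And>S. S \<subseteq> {1..n} \<Longrightarrow> real (card S) \<le> \<eta> * n \<Longrightarrow> real (card {e\<in>E. e \<subseteq> S}) \<le> (1 + \<epsilon>) * card S"
  let ?P = "large_loop_prob {1..n} E \<theta> t u \<eta>"
  let ?E = "real (card E)" and ?n = "real n" and ?r = "1 - 1 / real \<theta>"
  have t0: "0 < t" using t T0 \<delta> by (simp add: T_def)
  have "?r * ?E - real (card {1..n}) * ln \<theta> / t \<le> ?r * c_const \<theta> u * ((1 + \<epsilon>) * card {1..n} + ?E * ?P)"
  proof (rule large_loop_bound)
    show "edges_in {1..n} E" using E by (auto simp: edges_in_def all_edges_def)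
    show "2 \<le> \<theta>" using \<theta> by simp
  qed (use u t0 \<epsilon>0 sparse in auto)
  then have *: "?r * ?E - ?n * ln \<theta> / t \<le> ?r * (c * ((1 + \<epsilon>) * ?n + ?E * ?P))" by (simp add: c_def mult.assoc)
  have r0: "0 < ?r" using \<theta>R by simp
  have lr: "L = ln \<theta> / ?r" using \<theta>R by (simp add: L_def field_simps)
  have lnL: "ln \<theta> = L * ?r" unfolding lr using r0 by simp
  have "?r * (?E - ?n * (L / t)) \<le> ?r * (c * ((1 + \<epsilon>) * ?n + ?E * ?P))"
    using * unfolding lnL by (simp add: algebra_simps)
  then have 1: "?E - ?n * (L / t) \<le> c * ((1 + \<epsilon>) * ?n + ?E * ?P)" using r0 by simp
  have "L / t \<le> a" unfolding a using t T0 \<delta> L by (intro divide_left_mono) (auto simp: T_def)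
  then have 2: "?n * (L / t) \<le> ?n * a" by (intro mult_left_mono) auto
  have "c * \<epsilon> \<le> c * (\<kappa> / (4 * c))" using c1 by (intro mult_left_mono) (auto simp: \<epsilon>_def c_def)
  then have "c * \<epsilon> \<le> \<kappa> / 4" using c1 by simp
  then have 3: "c * \<epsilon> * ?n \<le> \<kappa> / 4 * ?n" by (intro mult_right_mono) auto
  have 4: "?E - ?n * (B - \<kappa> / 2) \<le> c * (?E * ?P)"
  proof -
    have "B - \<kappa> / 2 = c + a + \<kappa> / 4" unfolding B_def \<kappa>c by (simp add: field_simps)
    then have "?n * (B - \<kappa> / 2) = c * ?n + ?n * a + \<kappa> / 4 * ?n" by (simp add: algebra_simps)
    moreover have "c * ((1 + \<epsilon>) * ?n + ?E * ?P) = c * ?n + c * \<epsilon> * ?n + c * (?E * ?P)" by (simp add: algebra_simps)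
    ultimately show ?thesis using 1 2 3 by linarith
  qed
  have "?n \<le> ?E / B" using edges B by (simp add: B_def field_simps)
  then have "?n * (B - \<kappa> / 2) \<le> ?E / B * (B - \<kappa> / 2)" using B by (intro mult_right_mono) auto
  also have "\<dots> = ?E - ?E * (\<kappa> / (2 * B))" using B by (simp add: field_simps)
  finally have "?E * (\<kappa> / (2 * B)) \<le> ?E * (c * ?P)" using 4 by (simp add: mult_ac)
  moreover have "0 < ?E"
  proof -
    have "0 < B * ?n" using B n by simp
    then show ?thesis using edges unfolding B_def by linarith
  qed
  ultimately have "\<kappa> / (2 * B) \<le> c * ?P" by (rule mult_left_le_imp_le)
  then show "\<kappa> / (2 * c_const \<theta> u * (m / 2 - \<kappa> / 4)) \<le> ?P"
    unfolding c_def[symmetric] B_def[symmetric] using c1 B by (simp add: field_simps)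
qed

text \<open>What remains to be checked for an ensemble: containment probabilities and the number of edges.
  The filter is a parameter because the regular graphs only exist along a subsequence.  The choice of
  \<open>\<eta>\<close> makes the constant in \<open>first_moment_term\<close> at most one half, and is made before \<open>t\<close> is given.\<close>

lemma random_graph_large_loops:
  fixes p :: "nat \<Rightarrow> nat set set pmf" and \<theta> :: nat and u m C \<kappa> :: real and Fl :: "nat filter"
  assumes u: "u \<in> {0..1}" and \<theta>: "\<theta> > 1" and m: "m > 2 * c_const \<theta> u"
    and Fl: "Fl \<le> sequentially" and C: "1 \<le> C" and \<kappa>: "0 < \<kappa>"
    and supp: "eventually (\<lambda>n. set_pmf (p n) \<subseteq> Pow (all_edges n)) Fl"
    and F: "eventually (\<lambda>n. \<forall>F\<subseteq>all_edges n. real (card F) \<le> \<kappa> * n \<longrightarrow>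
      measure_pmf.prob (p n) {E. F \<subseteq> E} \<le> (C / n) ^ card F) Fl"
    and edges: "\<And>\<epsilon>. 0 < \<epsilon> \<Longrightarrow> ((\<lambda>n. measure_pmf.prob (p n) {E. (m / 2 - \<epsilon>) * n \<le> real (card E)}) \<longlongrightarrow> 1) Fl"
  shows "\<forall>\<delta>>0. \<exists>\<eta>>0. \<exists>c>0. \<forall>t \<ge> T_bound \<theta> u m + \<delta>.
    ((\<lambda>n. measure_pmf.prob (p n) {E. large_loop_prob {1..n} E \<theta> t u \<eta> \<ge> c}) \<longlongrightarrow> 1) Fl"
proof (intro allI impI)
  fix \<delta> :: real assume \<delta>: "0 < \<delta>"
  define a where "a = real \<theta> * ln \<theta> / ((real \<theta> - 1) * (T_bound \<theta> u m + \<delta>))"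
  define \<kappa>' where "\<kappa>' = m / 2 - c_const \<theta> u - a"
  define \<epsilon> :: real where "\<epsilon> = min 1 (\<kappa>' / (4 * c_const \<theta> u))"
  define c' where "c' = \<kappa>' / (2 * c_const \<theta> u * (m / 2 - \<kappa>' / 4))"
  note lower = large_loop_prob_lower_bound[OF u \<theta> m \<delta>, folded a_def, folded \<kappa>'_def, folded \<epsilon>_def c'_def]
  have \<kappa>'0: "0 < \<kappa>'" and c'0: "0 < c'" and \<epsilon>0: "0 < \<epsilon>" using lower(1-3)[OF order_refl] by auto
  have \<epsilon>1: "\<epsilon> \<le> 1" by (simp add: \<epsilon>_def)
  define K where "K = exp 4 * C ^ 3"
  have K: "0 < K" using C by (simp add: K_def)
  define \<eta> where "\<eta> = min 1 (min (\<kappa> / 3) ((1 / (2 * K)) powr (2 / \<epsilon>)))"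
  have \<eta>: "0 < \<eta>" "\<eta> \<le> 1" "3 * \<eta> \<le> \<kappa>" using \<kappa> K by (auto simp: \<eta>_def)
  have "\<eta> powr (\<epsilon> / 2) \<le> ((1 / (2 * K)) powr (2 / \<epsilon>)) powr (\<epsilon> / 2)"
    using \<eta>(1) \<epsilon>0 by (intro powr_mono2) (auto simp: \<eta>_def)
  also have "\<dots> = 1 / (2 * K)" using \<epsilon>0 K by (simp add: powr_powr)
  finally have K\<eta>: "exp 4 * C ^ 3 * \<eta> powr (\<epsilon> / 2) \<le> 1 / 2"
    using K unfolding K_def[symmetric] by (simp add: field_simps)
  show "\<exists>\<eta>>0. \<exists>c>0. \<forall>t \<ge> T_bound \<theta> u m + \<delta>.
    ((\<lambda>n. measure_pmf.prob (p n) {E. large_loop_prob {1..n} E \<theta> t u \<eta> \<ge> c}) \<longlongrightarrow> 1) Fl"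
  proof (rule exI[of _ \<eta>], rule conjI[OF \<eta>(1)], rule exI[of _ c'], rule conjI[OF c'0], intro allI impI)
    fix t assume t: "T_bound \<theta> u m + \<delta> \<le> t"
    let ?X = "\<lambda>n::nat. {E::nat set set. (m / 2 - \<kappa>' / 4) * n \<le> real (card E)}"
    let ?D = "\<lambda>n::nat. {E::nat set set. \<exists>S\<subseteq>{1..n}. real (card S) \<le> \<eta> * n \<and> (1 + \<epsilon>) * card S < card {e\<in>E. e \<subseteq> S}}"
    let ?Y = "\<lambda>n. {E. large_loop_prob {1..n} E \<theta> t u \<eta> \<ge> c'}"
    have lo: "eventually (\<lambda>n. measure_pmf.prob (p n) (?X n) - 2 / sqrt n \<le> measure_pmf.prob (p n) (?Y n)) Fl"
      using supp F filter_leD[OF Fl eventually_ge_at_top[of 1]]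
    proof eventually_elim
      case (elim n)
      let ?P = "measure_pmf.prob (p n)"
      have D: "?P (?D n) \<le> 2 / sqrt n"
        using elim by (intro prob_dense_subset[OF _ _ _ C \<epsilon>0 \<epsilon>1 \<eta> K\<eta>]) auto
      have "?P (?X n) = ?P (?X n \<inter> Pow (all_edges n))"
        by (rule measure_prob_cong_0) (use elim(1) in \<open>auto simp: set_pmf_iff\<close>)
      also have "\<dots> \<le> ?P (?Y n \<union> ?D n)"
      proof (rule measure_pmf.finite_measure_mono)
        show "?X n \<inter> Pow (all_edges n) \<subseteq> ?Y n \<union> ?D n"
        proof
          fix E assume E: "E \<in> ?X n \<inter> Pow (all_edges n)"
          show "E \<in> ?Y n \<union> ?D n"
          proof (cases "E \<in> ?D n")
            case False
            have "real (card {e\<in>E. e \<subseteq> S}) \<le> (1 + \<epsilon>) * card S" if "S \<subseteq> {1..n}" "real (card S) \<le> \<eta> * n" for S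
            proof (rule ccontr)
              assume "\<not> real (card {e\<in>E. e \<subseteq> S}) \<le> (1 + \<epsilon>) * card S"
              then have "(1 + \<epsilon>) * card S < card {e\<in>E. e \<subseteq> S}" by simp
              then show False using False that by blast
            qed
            then have "c' \<le> large_loop_prob {1..n} E \<theta> t u \<eta>"
              using E elim by (intro lower(4)[OF t]) auto
            then show ?thesis by simp
          qed simp
        qed
      qed simp
      also have "\<dots> \<le> ?P (?Y n) + ?P (?D n)" by (rule measure_Un_le) auto
      finally show ?case using D by simp
    qed
    have lim: "((\<lambda>n. measure_pmf.prob (p n) (?X n) - 2 / sqrt n) \<longlongrightarrow> 1) Fl"
    proof -
      have "(\<lambda>n. 2 / sqrt (real n)) \<longlonglongrightarrow> 0"
        by (intro tendsto_divide_0[OF tendsto_const] filterlim_at_top_imp_at_infinity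
            filterlim_compose[OF sqrt_at_top filterlim_real_sequentially])
      then have "((\<lambda>n. 2 / sqrt (real n)) \<longlongrightarrow> 0) Fl" by (rule tendsto_mono[OF Fl])
      from tendsto_diff[OF edges[of "\<kappa>' / 4"] this] show ?thesis using \<kappa>'0 by simp
    qed
    show "((\<lambda>n. measure_pmf.prob (p n) (?Y n)) \<longlongrightarrow> 1) Fl"
      by (rule tendsto_sandwich[OF lo _ lim tendsto_const])
        (intro always_eventually allI measure_pmf.prob_le_1)
  qed
qed

section \<open>Switchings\<close>

text \<open>Graphs on a set \<open>X\<close> of points with prescribed degrees whose projection along \<open>v\<close> to the vertices is
  simple: no edge becomes a loop and no two edges become parallel.  With \<open>v = id\<close> these are the graphs with a given
  degree sequence, and with half-edges as points and degrees \<open>1\<close> they are the pairings whose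
  multigraph is simple.\<close>

definition realisations :: "'h set \<Rightarrow> ('h \<Rightarrow> 'v) \<Rightarrow> ('h \<Rightarrow> nat) \<Rightarrow> 'h set set set" where
  "realisations X v dg = {G. G \<subseteq> {e. e \<subseteq> X \<and> card e = 2} \<and> (\<forall>h\<in>X. card {e\<in>G. h \<in> e} = dg h) \<and>
     (\<forall>e\<in>G. card (v ` e) = 2) \<and> inj_on ((`) v) G}"

definition darts :: "'h set set \<Rightarrow> ('h \<times> 'h) set" where
  "darts G = {(a, b). {a, b} \<in> G \<and> a \<noteq> b}"

definition switch :: "'h set set \<Rightarrow> 'h \<Rightarrow> 'h \<Rightarrow> 'h \<Rightarrow> 'h \<Rightarrow> 'h set set" where
  "switch G a b c d = (G - {{a, b}, {c, d}}) \<union> {{a, c}, {b, d}}"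

lemma card_darts:
  assumes X: "finite X" and G: "G \<subseteq> {e. e \<subseteq> X \<and> card e = 2}"
  shows "card (darts G) = (\<Sum>a\<in>X. card {e\<in>G. a \<in> e})" "finite (darts G)"
    "\<And>a. card {b. (a, b) \<in> darts G} = card {e\<in>G. a \<in> e}"
proof -
  have sub: "darts G \<subseteq> X \<times> X" using G by (auto simp: darts_def)
  then show fin: "finite (darts G)" using X by (meson finite_SigmaI finite_subset)
  show 1: "card {b. (a, b) \<in> darts G} = card {e\<in>G. a \<in> e}" for a
  proof -
    have "bij_betw (\<lambda>b. {a, b}) {b. (a, b) \<in> darts G} {e\<in>G. a \<in> e}"
    proof (rule bij_betwI')
      show "({a, x} = {a, y}) = (x = y)" for x y by (auto simp: doubleton_eq_iff)
      show "b \<in> {b. (a, b) \<in> darts G} \<Longrightarrow> {a, b} \<in> {e\<in>G. a \<in> e}" for b by (auto simp: darts_def)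
      fix e assume e: "e \<in> {e\<in>G. a \<in> e}"
      then have "card e = 2" "a \<in> e" using G by auto
      then obtain b where "e = {a, b}" "a \<noteq> b" by (auto simp: card_2_iff)
      then show "\<exists>b\<in>{b. (a, b) \<in> darts G}. e = {a, b}" using e by (auto simp: darts_def)
    qed
    then show ?thesis by (rule bij_betw_same_card)
  qed
  have "darts G = Sigma X (\<lambda>a. {b. (a, b) \<in> darts G})" using sub by auto
  then have "card (darts G) = card (Sigma X (\<lambda>a. {b. (a, b) \<in> darts G}))" by simp
  also have "\<dots> = (\<Sum>a\<in>X. card {b. (a, b) \<in> darts G})"
  proof (rule card_SigmaI[OF X])
    show "\<forall>a\<in>X. finite {b. (a, b) \<in> darts G}"
      using sub X by (auto intro: finite_subset[of _ X])
  qed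
  finally show "card (darts G) = (\<Sum>a\<in>X. card {e\<in>G. a \<in> e})" using 1 by simp
qed

lemma darts_swap: "(a, b) \<in> darts G \<longleftrightarrow> (b, a) \<in> darts G"
  by (auto simp: darts_def insert_commute)

lemma switch_degree:
  assumes fin: "finite G" and G: "{a, b} \<in> G" "{c, d} \<in> G" "{a, c} \<notin> G" "{b, d} \<notin> G"
    and dist: "distinct [a, b, c, d]"
  shows "card {e\<in>switch G a b c d. h \<in> e} = card {e\<in>G. h \<in> e}"
proof -
  have cnt: "card {e\<in>A. h \<in> e} = (\<Sum>e\<in>A. if h \<in> e then 1 else 0)" if "finite A" for A :: "'a set set"
    using that by (simp add: sum.inter_filter[symmetric])
  let ?G0 = "G - {{a, b}, {c, d}}" and ?f = "\<lambda>e::'a set. if h \<in> e then 1 else (0::nat)"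
  have ne: "{a, b} \<noteq> {c, d}" "{a, c} \<noteq> {b, d}" using dist by (auto simp: doubleton_eq_iff)
  have "(\<Sum>e\<in>G. ?f e) = (\<Sum>e\<in>?G0. ?f e) + (\<Sum>e\<in>{{a, b}, {c, d}}. ?f e)"
    using fin G by (intro sum.subset_diff) auto
  moreover have "(\<Sum>e\<in>switch G a b c d. ?f e) = (\<Sum>e\<in>?G0. ?f e) + (\<Sum>e\<in>{{a, c}, {b, d}}. ?f e)"
    unfolding switch_def using fin G by (intro sum.union_disjoint) auto
  moreover have "(\<Sum>e\<in>{{a, b}, {c, d}}. ?f e) = (\<Sum>e\<in>{{a, c}, {b, d}}. ?f e)"
    using ne dist by auto
  ultimately show ?thesis using cnt[of G] cnt[of "switch G a b c d"] fin by (simp add: switch_def)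
qed

lemma switch_back:
  assumes "{a, b} \<in> G" "{c, d} \<in> G" "{a, c} \<notin> G" "{b, d} \<notin> G"
  shows "(switch G a b c d - {{a, c}, {b, d}}) \<union> {{a, b}, {c, d}} = G"
  using assms by (auto simp: switch_def)

text \<open>The vertices at distance at most \<open>1\<close> from \<open>x\<close> in the projected graph.\<close>

definition nbh :: "('h \<Rightarrow> 'v) \<Rightarrow> 'h set set \<Rightarrow> 'v \<Rightarrow> 'v set" where
  "nbh v G x = insert x (v ` {b. \<exists>a. (a, b) \<in> darts G \<and> v a = x})"

locale degree_bound =
  fixes X :: "'h set" and v :: "'h \<Rightarrow> 'v" and dg :: "'h \<Rightarrow> nat" and D :: nat
  assumes finite_X: "finite X" and D: "\<And>x. (\<Sum>h\<in>{h\<in>X. v h = x}. dg h) \<le> D"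
begin

abbreviation "two_sets \<equiv> {e. e \<subseteq> X \<and> card e = 2}"

lemma card_darts_at:
  assumes "G \<subseteq> two_sets" "\<And>h. h \<in> X \<Longrightarrow> card {e\<in>G. h \<in> e} \<le> dg h"
  shows "card {(a, b) \<in> darts G. v a = x} \<le> D"
proof -
  have fin: "finite {h\<in>X. v h = x}" using finite_X by simp
  have sub: "darts G \<subseteq> X \<times> X" using assms(1) by (auto simp: darts_def)
  have "{(a, b) \<in> darts G. v a = x} = Sigma {h\<in>X. v h = x} (\<lambda>a. {b. (a, b) \<in> darts G})"
    using sub by auto
  then have "card {(a, b) \<in> darts G. v a = x} = card (Sigma {h\<in>X. v h = x} (\<lambda>a. {b. (a, b) \<in> darts G}))"
    by (simp only:)
  also have "\<dots> = (\<Sum>a\<in>{h\<in>X. v h = x}. card {b. (a, b) \<in> darts G})"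
  proof (rule card_SigmaI[OF fin], rule ballI)
    fix a
    have "{b. (a, b) \<in> darts G} \<subseteq> X" using sub by auto
    then show "finite {b. (a, b) \<in> darts G}" using finite_X by (rule finite_subset)
  qed
  also have "\<dots> \<le> (\<Sum>a\<in>{h\<in>X. v h = x}. dg a)"
    using card_darts(3)[OF finite_X assms(1)] assms(2) by (intro sum_mono) auto
  also have "\<dots> \<le> D" by (rule D)
  finally show ?thesis .
qed

lemma card_nbh:
  assumes "G \<subseteq> two_sets" "\<And>h. h \<in> X \<Longrightarrow> card {e\<in>G. h \<in> e} \<le> dg h"
  shows "card (nbh v G x) \<le> Suc D" "finite (nbh v G x)"
proof -
  have fin: "finite {(a, b) \<in> darts G. v a = x}"
    using card_darts(2)[OF finite_X assms(1)] by (rule rev_finite_subset) auto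
  have eq: "v ` {b. \<exists>a. (a, b) \<in> darts G \<and> v a = x} = (\<lambda>(a, b). v b) ` {(a, b) \<in> darts G. v a = x}" by force
  have "card (v ` {b. \<exists>a. (a, b) \<in> darts G \<and> v a = x}) \<le> card {(a, b) \<in> darts G. v a = x}"
    unfolding eq by (rule card_image_le[OF fin])
  then have "card (v ` {b. \<exists>a. (a, b) \<in> darts G \<and> v a = x}) \<le> D"
    using card_darts_at[OF assms] le_trans by blast
  moreover have "finite (v ` {b. \<exists>a. (a, b) \<in> darts G \<and> v a = x})"
    unfolding eq by (rule finite_imageI[OF fin])
  ultimately show "card (nbh v G x) \<le> Suc D"
    unfolding nbh_def by (simp add: card_insert_if)
  show "finite (nbh v G x)" unfolding nbh_def eq using fin by simp
qed

lemma card_near_darts: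
  assumes "G \<subseteq> two_sets" "\<And>h. h \<in> X \<Longrightarrow> card {e\<in>G. h \<in> e} \<le> dg h"
    and S: "finite S"
  shows "card {(a, b) \<in> darts G. v a \<in> S} \<le> card S * D"
proof -
  have "{(a, b) \<in> darts G. v a \<in> S} = (\<Union>x\<in>S. {(a, b) \<in> darts G. v a = x})" by auto
  then have "card {(a, b) \<in> darts G. v a \<in> S} \<le> (\<Sum>x\<in>S. card {(a, b) \<in> darts G. v a = x})"
    using card_UN_le[OF S] by simp
  also have "\<dots> \<le> (\<Sum>x\<in>S. D)" by (intro sum_mono card_darts_at assms)
  finally show ?thesis by simp
qed

text \<open>Bounded degrees make most darts start and end away from two given small sets.\<close>

lemma card_far_darts:
  assumes G: "G \<subseteq> two_sets" "\<And>h. h \<in> X \<Longrightarrow> card {e\<in>G. h \<in> e} \<le> dg h"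
    and S: "finite S" "card S \<le> s" and S': "finite S'" "card S' \<le> s'"
  shows "card (darts G) \<le> card {(a, b) \<in> darts G. v a \<notin> S \<and> v b \<notin> S'} + (s + s') * D"
proof -
  let ?N = "{(a, b) \<in> darts G. v a \<in> S}" and ?N' = "{(a, b) \<in> darts G. v b \<in> S'}"
    and ?F = "{(a, b) \<in> darts G. v a \<notin> S \<and> v b \<notin> S'}"
  have fin: "finite (darts G)" by (rule card_darts(2)[OF finite_X G(1)])
  have bij: "bij_betw (\<lambda>(a, b). (b, a)) {(a, b) \<in> darts G. v a \<in> S'} ?N'"
    by (rule bij_betw_byWitness[where f' = "\<lambda>(a, b). (b, a)"]) (use darts_swap[of _ _ G] in auto)
  have "card ?N' = card {(a, b) \<in> darts G. v a \<in> S'}"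
    by (rule bij_betw_same_card[OF bij, symmetric])
  also have "\<dots> \<le> s' * D" using card_near_darts[OF G S'(1)] S'(2) by (meson le_trans mult_le_mono1)
  finally have N': "card ?N' \<le> s' * D" .
  have N: "card ?N \<le> s * D" using card_near_darts[OF G S(1)] S(2) by (meson le_trans mult_le_mono1)
  have "card (darts G) \<le> card (?F \<union> (?N \<union> ?N'))"
  proof (rule card_mono)
    show "finite (?F \<union> (?N \<union> ?N'))" by (rule finite_subset[OF _ fin]) auto
  qed auto
  also have "\<dots> \<le> card ?F + card (?N \<union> ?N')" by (rule card_Un_le)
  also have "\<dots> \<le> card ?F + (card ?N + card ?N')" by (intro add_left_mono card_Un_le)
  finally show ?thesis using N N' by (simp add: algebra_simps)
qed

text \<open>The new edges project to \<open>{v a, v c}\<close> and \<open>{v b, v d}\<close>.  The hypothesis \<open>far\<close> states that neither pair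
  coincides or is adjacent already, so simplicity is preserved.\<close>

lemma switch_realisation:
  assumes G: "G \<in> realisations X v dg" and e: "(a, b) \<in> darts G" and f: "(c, d) \<in> darts G"
    and far: "v c \<notin> nbh v G (v a)" "v d \<notin> nbh v G (v b)"
  shows "switch G a b c d \<in> realisations X v dg" "{a, c} \<notin> G" "{b, d} \<notin> G" "distinct [a, b, c, d]"
    and "(a, c) \<in> darts (switch G a b c d)" "(b, d) \<in> darts (switch G a b c d)"
    and "\<And>g. g \<in> G \<Longrightarrow> g \<noteq> {a, b} \<Longrightarrow> g \<noteq> {c, d} \<Longrightarrow> g \<in> switch G a b c d"
proof -
  have G': "G \<subseteq> two_sets" "\<And>h. h \<in> X \<Longrightarrow> card {e\<in>G. h \<in> e} = dg h"
    "\<And>e. e \<in> G \<Longrightarrow> card (v ` e) = 2" "inj_on ((`) v) G" using G by (auto simp: realisations_def)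
  have finG: "finite G" using G'(1) finite_X by (auto intro: finite_subset[of G "Pow X"])
  have ab: "{a, b} \<in> G" "a \<noteq> b" and cd: "{c, d} \<in> G" "c \<noteq> d" using e f by (auto simp: darts_def)
  have inX: "a \<in> X" "b \<in> X" "c \<in> X" "d \<in> X" using G'(1) ab cd by auto
  have nba: "v y \<in> nbh v G (v x)" if "{x, y} \<in> G" for x y
  proof (cases "x = y")
    case False
    then have "(x, y) \<in> darts G" using that by (simp add: darts_def)
    then show ?thesis unfolding nbh_def by blast
  qed (simp add: nbh_def)
  have nbx: "v z \<in> nbh v G (v x)" if "{y, z} \<in> G" "v y = v x" for x y z
    using nba[OF that(1)] that(2) by simp
  have self: "x \<in> nbh v G x" for x by (simp add: nbh_def)
  have vab: "v b \<in> nbh v G (v a)" "v a \<in> nbh v G (v b)" using nba[OF ab(1)] nba[of b a] ab(1) by (auto simp: insert_commute)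
  have vne: "v c \<noteq> v a" "v c \<noteq> v b" "v d \<noteq> v b" "v d \<noteq> v a" using far vab self by metis+
  have hne: "c \<noteq> a" "c \<noteq> b" "d \<noteq> a" "d \<noteq> b" using vne by auto
  show dist: "distinct [a, b, c, d]" using ab cd hne by auto
  have noac: "v ` e \<noteq> {v a, v c}" if "e \<in> G" for e
  proof
    assume eq: "v ` e = {v a, v c}"
    have "card e = 2" using that G'(1) by auto
    then obtain y z where yz: "e = {y, z}" by (auto simp: card_2_iff)
    then have "v y = v a \<and> v z = v c \<or> v z = v a \<and> v y = v c" using eq by (auto simp: doubleton_eq_iff)
    then show False
    proof
      assume "v y = v a \<and> v z = v c"
      then show False using nbx[of y z a] that yz far(1) by metis
    next
      assume "v z = v a \<and> v y = v c"
      then show False using nbx[of z y a] that yz far(1) by (metis insert_commute)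
    qed
  qed
  have nobd: "v ` e \<noteq> {v b, v d}" if "e \<in> G" for e
  proof
    assume eq: "v ` e = {v b, v d}"
    have "card e = 2" using that G'(1) by auto
    then obtain y z where yz: "e = {y, z}" by (auto simp: card_2_iff)
    then have "v y = v b \<and> v z = v d \<or> v z = v b \<and> v y = v d" using eq by (auto simp: doubleton_eq_iff)
    then show False
    proof
      assume "v y = v b \<and> v z = v d"
      then show False using nbx[of y z b] that yz far(2) by metis
    next
      assume "v z = v b \<and> v y = v d"
      then show False using nbx[of z y b] that yz far(2) by (metis insert_commute)
    qed
  qed
  show ac: "{a, c} \<notin> G" using noac[of "{a, c}"] by auto
  show bd: "{b, d} \<notin> G" using nobd[of "{b, d}"] by auto
  show "(a, c) \<in> darts (switch G a b c d)" "(b, d) \<in> darts (switch G a b c d)"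
    using hne by (auto simp: darts_def switch_def)
  show "\<And>g. g \<in> G \<Longrightarrow> g \<noteq> {a, b} \<Longrightarrow> g \<noteq> {c, d} \<Longrightarrow> g \<in> switch G a b c d" by (simp add: switch_def)
  have vab_ne: "v a \<noteq> v b" using G'(3)[OF ab(1)] by (auto simp: card_insert_if split: if_splits)
  show "switch G a b c d \<in> realisations X v dg"
    unfolding realisations_def
  proof (intro CollectI conjI ballI)
    show "switch G a b c d \<subseteq> two_sets" using G'(1) inX hne by (auto simp: switch_def)
    show "card {e\<in>switch G a b c d. h \<in> e} = dg h" if "h \<in> X" for h
      using switch_degree[OF finG ab(1) cd(1) ac bd dist, of h] G'(2)[OF that] by simp
    show "card (v ` e) = 2" if "e \<in> switch G a b c d" for e
      using that G'(3) vne by (auto simp: switch_def)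
    show "inj_on ((`) v) (switch G a b c d)"
    proof -
      have "inj_on ((`) v) (G - {{a, b}, {c, d}})" using G'(4) by (rule inj_on_subset) auto
      moreover have "v ` {a, c} \<noteq> v ` {b, d}" using vab_ne vne by (auto simp: doubleton_eq_iff)
      then have "inj_on ((`) v) {{a, c}, {b, d}}" by (auto simp: inj_on_def)
      moreover have "(`) v ` (G - {{a, b}, {c, d}} - {{a, c}, {b, d}}) \<inter> (`) v ` ({{a, c}, {b, d}} - (G - {{a, b}, {c, d}})) = {}"
      proof -
        have "v ` e \<noteq> v ` e'" if "e \<in> G" "e' \<in> {{a, c}, {b, d}}" for e e'
          using that(2) noac[OF that(1)] nobd[OF that(1)] by (elim insertE) simp_all
        then show ?thesis by blast
      qed
      ultimately show ?thesis unfolding switch_def by (simp only: inj_on_Un simp_thms)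
    qed
  qed
qed

definition containing :: "'v set set \<Rightarrow> 'h set set set" where
  "containing F = {G \<in> realisations X v dg. F \<subseteq> (`) v ` G}"

lemma finite_realisations: "finite (realisations X v dg)"
  unfolding realisations_def by (rule finite_subset[of _ "Pow (Pow X)"]) (use finite_X in auto)

lemma finite_containing: "finite (containing F)"
  unfolding containing_def using finite_realisations by simp

abbreviation "deg_sum \<equiv> \<Sum>h\<in>X. dg h"

text \<open>Double counting of switchings that destroy the edge \<open>{x, y}\<close>.  A graph containing \<open>{x, y}\<close> and \<open>F\<close>
  has at least \<open>deg_sum - 2 |F| - 2 (D + 1) D\<close> darts that are far from \<open>x\<close> and \<open>y\<close> and not part of
  \<open>F\<close>; switching \<open>{x, y}\<close> with such a dart gives a graph that still contains \<open>F\<close>.  The switching can be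
  undone once a dart at \<open>x\<close> and a dart at \<open>y\<close> of the new graph are specified, which leaves at most
  \<open>D\<^sup>2\<close> possibilities.\<close>

lemma switching_step:
  assumes F: "finite F" and xy: "x \<noteq> y" "{x, y} \<notin> F"
  shows "card (containing (insert {x, y} F)) * (deg_sum - 2 * card F - 2 * (Suc D * D)) \<le> card (containing F) * (D * D)"
proof -
  let ?N1 = "containing (insert {x, y} F)" and ?N0 = "containing F"
  \<comment> \<open>The dart of \<open>G\<close> that projects to \<open>(x, y)\<close>.\<close>
  define lift where "lift G = (SOME p. p \<in> darts G \<and> v (fst p) = x \<and> v (snd p) = y)" for G
  define far where "far G = {(c, d) \<in> darts G. v c \<notin> nbh v G x \<and> v d \<notin> nbh v G y} - {(c, d) \<in> darts G. {v c, v d} \<in> F}" for G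
  have R: "G \<in> realisations X v dg" "insert {x, y} F \<subseteq> (`) v ` G" if "G \<in> ?N1" for G
    using that by (auto simp: containing_def)
  have R': "G \<subseteq> two_sets" "\<And>h. h \<in> X \<Longrightarrow> card {e\<in>G. h \<in> e} = dg h" "inj_on ((`) v) G" if "G \<in> realisations X v dg" for G
    using that by (auto simp: realisations_def)
  have lift: "lift G \<in> darts G \<and> v (fst (lift G)) = x \<and> v (snd (lift G)) = y" if G: "G \<in> ?N1" for G
  proof -
    obtain e where e: "e \<in> G" "v ` e = {x, y}" using R(2)[OF G] by auto
    have "card e = 2" using e(1) R'(1)[OF R(1)[OF G]] by auto
    then obtain a b where ab: "e = {a, b}" "a \<noteq> b" by (auto simp: card_2_iff)
    then have "v a = x \<and> v b = y \<or> v b = x \<and> v a = y" using e(2) by (auto simp: doubleton_eq_iff)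
    moreover have "(a, b) \<in> darts G" "(b, a) \<in> darts G" using e ab by (auto simp: darts_def insert_commute)
    ultimately have "\<exists>p. p \<in> darts G \<and> v (fst p) = x \<and> v (snd p) = y" by (metis fst_conv snd_conv)
    then show ?thesis unfolding lift_def by (rule someI_ex)
  qed
  have far_card: "deg_sum - 2 * card F - 2 * (Suc D * D) \<le> card (far G)" if G: "G \<in> ?N1" for G
  proof -
    note r = R'[OF R(1)[OF G]]
    have deg: "card {e\<in>G. h \<in> e} \<le> dg h" if "h \<in> X" for h using r(2)[OF that] by simp
    have fin: "finite (darts G)" by (rule card_darts(2)[OF finite_X r(1)])
    have tot: "card (darts G) = deg_sum"
      unfolding card_darts(1)[OF finite_X r(1)] by (rule sum.cong[OF refl r(2)])
    have 1: "card (darts G) \<le> card {(c, d) \<in> darts G. v c \<notin> nbh v G x \<and> v d \<notin> nbh v G y} + (Suc D + Suc D) * D"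
      by (rule card_far_darts[OF r(1) deg]) (auto intro: card_nbh[OF r(1) deg])
    have 2: "card {(c, d) \<in> darts G. {v c, v d} \<in> F} \<le> 2 * card F"
    proof -
      let ?B = "{e\<in>G. v ` e \<in> F}"
      have finB: "finite ?B" using r(1) finite_X by (auto intro: finite_subset[of _ "Pow X"])
      have "card ?B = card ((`) v ` ?B)" by (rule card_image[symmetric], rule inj_on_subset[OF r(3)]) auto
      also have "\<dots> \<le> card F" using F by (intro card_mono) auto
      finally have B: "card ?B \<le> card F" .
      have "{(c, d) \<in> darts G. {v c, v d} \<in> F} \<subseteq> (\<Union>e\<in>?B. {(c, d). e = {c, d}})" by (auto simp: darts_def)
      moreover have fe: "finite {(c, d). e = {c, d}} \<and> card {(c, d). e = {c, d}} \<le> 2" if "e \<in> ?B" for e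
      proof -
        have "card e = 2" using that r(1) by auto
        then obtain a b where ab: "e = {a, b}" "a \<noteq> b" by (auto simp: card_2_iff)
        have eq: "{(c, d). e = {c, d}} = {(a, b), (b, a)}" unfolding ab using ab(2) by (auto simp: doubleton_eq_iff)
        have "card {(a, b), (b, a)} = 2" using ab(2) by simp
        then show ?thesis unfolding eq by simp
      qed
      ultimately have "card {(c, d) \<in> darts G. {v c, v d} \<in> F} \<le> card (\<Union>e\<in>?B. {(c, d). e = {c, d}})"
        using finB by (intro card_mono) auto
      also have "\<dots> \<le> (\<Sum>e\<in>?B. card {(c, d). e = {c, d}})" by (rule card_UN_le[OF finB])
      also have "\<dots> \<le> (\<Sum>e\<in>?B. 2)" using fe by (intro sum_mono) auto
      finally show ?thesis using B by simp
    qed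
    have "card {(c, d) \<in> darts G. v c \<notin> nbh v G x \<and> v d \<notin> nbh v G y} - card {(c, d) \<in> darts G. {v c, v d} \<in> F} \<le> card (far G)"
      unfolding far_def by (rule diff_card_le_card_Diff) (rule finite_subset[OF _ fin], auto)
    moreover have "(Suc D + Suc D) * D = 2 * (Suc D * D)" by (simp only: mult_2 add_mult_distrib)
    ultimately show ?thesis using 1 2 tot by linarith
  qed
  \<comment> \<open>A switching is encoded by its result together with the two new darts, at \<open>x\<close> and at \<open>y\<close>.\<close>
  define \<Phi> where "\<Phi> = (\<lambda>(G, (c, d)). (switch G (fst (lift G)) (snd (lift G)) c d, ((fst (lift G), c), (snd (lift G), d))))"
  define target where "target = Sigma ?N0 (\<lambda>G. {(a, b) \<in> darts G. v a = x} \<times> {(a, b) \<in> darts G. v a = y})"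
  have dart_fin: "finite {(a, b) \<in> darts G. v a = z}" if "G \<in> ?N0" for G z
  proof (rule finite_subset)
    show "finite (darts G)" using that R'(1) card_darts(2)[OF finite_X] by (auto simp: containing_def)
  qed auto
  have finN0: "finite ?N0" and finN1: "finite ?N1" by (rule finite_containing)+
  have fin_far: "finite (far G)" if "G \<in> ?N1" for G
    unfolding far_def using card_darts(2)[OF finite_X R'(1)[OF R(1)[OF that]]] by (auto intro: finite_subset)
  have fin_target: "finite target" unfolding target_def using finN0 dart_fin by (intro finite_SigmaI finite_cartesian_product) auto
  have step: "lift G = (a, b) \<Longrightarrow> (c, d) \<in> far G \<Longrightarrow>
      switch G a b c d \<in> ?N0 \<and> (a, c) \<in> darts (switch G a b c d) \<and> (b, d) \<in> darts (switch G a b c d) \<and>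
      {a, b} \<in> G \<and> {c, d} \<in> G \<and> {a, c} \<notin> G \<and> {b, d} \<notin> G \<and> v a = x \<and> v b = y"
    if G: "G \<in> ?N1" for G a b c d
  proof -
    assume ab: "lift G = (a, b)" and cd: "(c, d) \<in> far G"
    have vab: "(a, b) \<in> darts G" "v a = x" "v b = y" using lift[OF G] ab by auto
    have vcd: "(c, d) \<in> darts G" "v c \<notin> nbh v G (v a)" "v d \<notin> nbh v G (v b)" "{v c, v d} \<notin> F"
      using cd vab by (auto simp: far_def)
    note s = switch_realisation[OF R(1)[OF G] vab(1) vcd(1-3)]
    have "F \<subseteq> (`) v ` switch G a b c d"
    proof
      fix f assume f: "f \<in> F"
      then obtain g where g: "g \<in> G" "f = v ` g" using R(2)[OF G] by auto
      have "g \<noteq> {a, b}" using f g vab xy by auto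
      moreover have "g \<noteq> {c, d}" using f g vcd by auto
      ultimately show "f \<in> (`) v ` switch G a b c d" using s(7)[OF g(1)] g(2) by blast
    qed
    then show ?thesis using s vab vcd by (auto simp: containing_def darts_def)
  qed
  have "inj_on \<Phi> (Sigma ?N1 far)"
  proof (rule inj_onI)
    fix p p' assume p: "p \<in> Sigma ?N1 far" "p' \<in> Sigma ?N1 far" and eq: "\<Phi> p = \<Phi> p'"
    obtain G c d where p1: "p = (G, (c, d))" by (metis prod_cases3)
    obtain G' c' d' where p2: "p' = (G', (c', d'))" by (metis prod_cases3)
    obtain a b where ab: "lift G = (a, b)" by (cases "lift G")
    obtain a' b' where ab': "lift G' = (a', b')" by (cases "lift G'")
    have G: "G \<in> ?N1" "(c, d) \<in> far G" "G' \<in> ?N1" "(c', d') \<in> far G'" using p p1 p2 by auto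
    note s = step[OF G(1) ab G(2)] and s' = step[OF G(3) ab' G(4)]
    have e: "switch G a b c d = switch G' a' b' c' d'" "a = a'" "b = b'" "c = c'" "d = d'"
      using eq by (auto simp: \<Phi>_def p1 p2 ab ab')
    have "G = G'" using switch_back[of a b G c d] switch_back[of a' b' G' c' d'] s s' e by metis
    then show "p = p'" using e p1 p2 by simp
  qed
  moreover have "\<Phi> ` Sigma ?N1 far \<subseteq> target"
  proof
    fix z assume "z \<in> \<Phi> ` Sigma ?N1 far"
    then obtain G c d where G: "G \<in> ?N1" "(c, d) \<in> far G" "z = \<Phi> (G, (c, d))" by auto
    obtain a b where ab: "lift G = (a, b)" by (cases "lift G")
    show "z \<in> target" using step[OF G(1) ab G(2)] unfolding G(3) target_def \<Phi>_def by (auto simp: ab)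
  qed
  ultimately have "card (Sigma ?N1 far) \<le> card target" using fin_target by (intro card_inj_on_le)
  also have "\<dots> \<le> card ?N0 * (D * D)"
  proof -
    have "card target = (\<Sum>G\<in>?N0. card ({(a, b) \<in> darts G. v a = x} \<times> {(a, b) \<in> darts G. v a = y}))"
      unfolding target_def using finN0 dart_fin by (intro card_SigmaI) auto
    also have "\<dots> \<le> (\<Sum>G\<in>?N0. D * D)"
    proof (rule sum_mono)
      fix G assume "G \<in> ?N0"
      then have r: "G \<subseteq> two_sets" "\<And>h. h \<in> X \<Longrightarrow> card {e\<in>G. h \<in> e} \<le> dg h"
        by (auto simp: containing_def realisations_def)
      show "card ({(a, b) \<in> darts G. v a = x} \<times> {(a, b) \<in> darts G. v a = y}) \<le> D * D"
        unfolding card_cartesian_product by (intro mult_le_mono card_darts_at r)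
    qed
    finally show ?thesis by simp
  qed
  finally have le: "card (Sigma ?N1 far) \<le> card ?N0 * (D * D)" .
  have "card ?N1 * (deg_sum - 2 * card F - 2 * (Suc D * D)) = (\<Sum>G\<in>?N1. deg_sum - 2 * card F - 2 * (Suc D * D))" by simp
  also have "\<dots> \<le> (\<Sum>G\<in>?N1. card (far G))" using far_card by (intro sum_mono) auto
  also have "\<dots> = card (Sigma ?N1 far)" using finN1 fin_far by (intro card_SigmaI[symmetric]) auto
  finally show ?thesis using le by simp
qed

text \<open>Adding the edges of \<open>F\<close> one at a time, each costs a factor \<open>r\<close> of order \<open>D\<^sup>2 / deg_sum\<close>.\<close>

lemma card_containing_le:
  fixes r :: real
  assumes F: "finite F" "\<And>f. f \<in> F \<Longrightarrow> card f = 2"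
    and r: "real (D * D) \<le> r * (real deg_sum - 2 * real (card F) - 2 * real (Suc D * D))"
    and pos: "0 < real deg_sum - 2 * real (card F) - 2 * real (Suc D * D)" and r0: "0 \<le> r"
  shows "real (card (containing F)) \<le> r ^ card F * card (realisations X v dg)"
  using assms
proof (induction F rule: finite_induct)
  case empty
  show ?case by (simp add: containing_def)
next
  case (insert f F)
  obtain x y where xy: "f = {x, y}" "x \<noteq> y" using insert.prems(1)[of f] by (auto simp: card_2_iff)
  have cF: "card (insert f F) = Suc (card F)" using insert.hyps by simp
  let ?w = "real deg_sum - 2 * real (card F) - 2 * real (Suc D * D)"
  have w: "0 < ?w" "real deg_sum - 2 * real (card (insert f F)) - 2 * real (Suc D * D) \<le> ?w" using insert.prems(3) cF by auto
  have rw: "real (D * D) \<le> r * ?w"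
    using insert.prems(2) mult_left_mono[OF w(2) r0] by linarith
  have IH: "real (card (containing F)) \<le> r ^ card F * card (realisations X v dg)"
    using insert.IH insert.prems(1) rw w(1) r0 by simp
  have "card (containing (insert f F)) * (deg_sum - 2 * card F - 2 * (Suc D * D)) \<le> card (containing F) * (D * D)"
    using switching_step[OF insert.hyps(1) xy(2)] insert.hyps(2) unfolding xy by simp
  then have "real (card (containing (insert f F)) * (deg_sum - 2 * card F - 2 * (Suc D * D))) \<le> real (card (containing F) * (D * D))"
    by (simp only: of_nat_le_iff)
  moreover have "real (deg_sum - 2 * card F - 2 * (Suc D * D)) = ?w"
  proof -
    have eq: "real (2 * card F + 2 * (Suc D * D)) = 2 * real (card F) + 2 * real (Suc D * D)"
      by (simp only: of_nat_add of_nat_mult of_nat_numeral)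
    have "real (2 * card F + 2 * (Suc D * D)) \<le> real deg_sum" using w(1) unfolding eq by simp
    then have "2 * card F + 2 * (Suc D * D) \<le> deg_sum" by (simp only: of_nat_le_iff)
    then have "real (deg_sum - (2 * card F + 2 * (Suc D * D))) = real deg_sum - real (2 * card F + 2 * (Suc D * D))"
      by (rule of_nat_diff)
    then show ?thesis unfolding eq diff_diff_left by simp
  qed
  ultimately have "card (containing (insert f F)) * ?w \<le> real (card (containing F)) * real (D * D)" by (simp only: of_nat_mult)
  also have "\<dots> \<le> real (card (containing F)) * (r * ?w)" using rw by (intro mult_left_mono) auto
  finally have "card (containing (insert f F)) * ?w \<le> (real (card (containing F)) * r) * ?w" by (simp add: mult.assoc)
  then have "card (containing (insert f F)) \<le> real (card (containing F)) * r" using w(1) by simp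
  also have "\<dots> \<le> r ^ card F * card (realisations X v dg) * r" using IH r0 by (intro mult_right_mono) auto
  finally show ?case by (simp add: cF mult_ac)
qed

end

section \<open>Existence of simple pairings\<close>

definition partial_pairings :: "'h set \<Rightarrow> ('h \<Rightarrow> 'v) \<Rightarrow> 'h set set set" where
  "partial_pairings X v = {M. M \<subseteq> {e. e \<subseteq> X \<and> card e = 2} \<and> disjoint M \<and>
     (\<forall>e\<in>M. card (v ` e) = 2) \<and> inj_on ((`) v) M}"

lemma nbh_mono: "G \<subseteq> G' \<Longrightarrow> nbh v G x \<subseteq> nbh v G' x"
  unfolding nbh_def darts_def by blast

lemma nbh_insert:
  assumes "y \<in> nbh v (insert {a, b} G) x"
  shows "y \<in> nbh v G x \<or> v a = x \<and> y = v b \<or> v b = x \<and> y = v a"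
  using assms unfolding nbh_def darts_def by (auto simp: doubleton_eq_iff)

lemma nbhI: "(y, z) \<in> darts G \<Longrightarrow> v y = x \<Longrightarrow> v z \<in> nbh v G x"
  unfolding nbh_def by blast

lemma add_pair:
  assumes M: "M \<in> partial_pairings X v" and h: "a \<in> X" "b \<in> X" "a \<notin> \<Union>M" "b \<notin> \<Union>M"
    and far: "v b \<notin> nbh v M (v a)"
  shows "insert {a, b} M \<in> partial_pairings X v" "{a, b} \<notin> M"
proof -
  have M': "M \<subseteq> {e. e \<subseteq> X \<and> card e = 2}" "disjoint M" "\<And>e. e \<in> M \<Longrightarrow> card (v ` e) = 2" "inj_on ((`) v) M"
    using M by (auto simp: partial_pairings_def)
  have vne: "v a \<noteq> v b" using far by (auto simp: nbh_def)
  have new: "v ` e \<noteq> {v a, v b}" if "e \<in> M" for e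
  proof
    assume eq: "v ` e = {v a, v b}"
    have "card e = 2" using that M'(1) by auto
    then obtain y z where yz: "e = {y, z}" "y \<noteq> z" by (auto simp: card_2_iff)
    then have d: "(y, z) \<in> darts M" "(z, y) \<in> darts M" using that by (auto simp: darts_def insert_commute)
    have "v y = v a \<and> v z = v b \<or> v z = v a \<and> v y = v b" using eq yz by (auto simp: doubleton_eq_iff)
    then show False using nbhI[OF d(1), of v "v a"] nbhI[OF d(2), of v "v a"] far by auto
  qed
  show nin: "{a, b} \<notin> M" using h(3) by auto
  have "disjoint (insert {a, b} M)"
    using M'(2) h(3,4) by (auto simp: pairwise_insert disjnt_def)
  moreover have "inj_on ((`) v) (insert {a, b} M)"
    using M'(4) new by (auto simp: inj_on_insert)
  moreover have "a \<noteq> b" using vne by auto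
  then have "card (v ` {a, b}) = 2" "card {a, b} = 2" using vne by simp_all
  ultimately show "insert {a, b} M \<in> partial_pairings X v"
    using M' h(1,2) by (auto simp: partial_pairings_def)
qed

lemma remove_pair: "M \<in> partial_pairings X v \<Longrightarrow> M - N \<in> partial_pairings X v"
  by (auto simp: partial_pairings_def inj_on_diff intro: pairwise_subset)

text \<open>Take a partial pairing of maximal size and suppose that a point \<open>a\<close> is unpaired.  By maximality every other
  unpaired point lies over a neighbour of \<open>v a\<close>, so at most \<open>(D + 1) D\<close> points are unpaired.  By parity
  there is a second unpaired point \<open>b\<close>.  As almost all points are paired, there is a pair \<open>{c, d}\<close> far from
  both, and replacing it by \<open>{a, c}\<close> and \<open>{b, d}\<close> gives a larger partial pairing.\<close>

lemma simple_pairing_exists: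
  fixes v :: "'h \<Rightarrow> 'v"
  assumes X: "finite X" "even (card X)" and D: "\<And>x. card {h\<in>X. v h = x} \<le> D"
    and large: "Suc (Suc D * D) + (Suc (Suc D) + Suc D) * D < card X"
  shows "realisations X v (\<lambda>_. 1) \<noteq> {}"
proof -
  interpret degree_bound X v "\<lambda>_. 1" D
    by unfold_locales (use X D in auto)
  let ?P = "partial_pairings X v"
  have finP: "finite ?P" unfolding partial_pairings_def
    by (rule finite_subset[of _ "Pow (Pow X)"]) (use X in auto)
  have "{} \<in> ?P" by (simp add: partial_pairings_def)
  then have "?P \<noteq> {}" by blast
  obtain M where M: "M \<in> ?P" "card M = Max (card ` ?P)"
    using obtains_MAX[OF finP \<open>?P \<noteq> {}\<close>, of card] by metis
  have max: "card N \<le> card M" if "N \<in> ?P" for N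
    unfolding M(2) using finP that by (intro Max_ge) auto
  note M = M(1)
  have M': "M \<subseteq> two_sets" "disjoint M" "\<And>e. e \<in> M \<Longrightarrow> card (v ` e) = 2" "inj_on ((`) v) M"
    using M by (auto simp: partial_pairings_def)
  have finM: "finite M" using M'(1) X(1) by (auto intro: finite_subset[of M "Pow X"])
  have fin_e: "finite e" if "e \<in> M" for e using that M'(1) X(1) by (auto intro: finite_subset)
  have cU: "card (\<Union>M) = 2 * card M"
  proof -
    have "card (\<Union>M) = sum card M" using M'(2) fin_e by (rule card_Union_disjoint)
    also have "\<dots> = (\<Sum>e\<in>M. 2)" using M'(1) by (intro sum.cong) auto
    finally show ?thesis by simp
  qed
  have UX: "\<Union>M \<subseteq> X" using M'(1) by auto
  have deg: "card {e\<in>M. h \<in> e} \<le> 1" for h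
  proof -
    have "e = e'" if "e \<in> {e\<in>M. h \<in> e}" "e' \<in> {e\<in>M. h \<in> e}" for e e'
      using that M'(2) by (auto simp: pairwise_def disjnt_def)
    then show ?thesis using finM by (simp add: card_le_Suc0_iff_eq)
  qed
  have "\<Union>M = X"
  proof (rule ccontr)
    assume "\<Union>M \<noteq> X"
    define U where "U = X - \<Union>M"
    have finU: "finite U" using X by (simp add: U_def)
    have U: "U \<noteq> {}" using UX \<open>\<Union>M \<noteq> X\<close> by (auto simp: U_def)
    have cardU: "card X = card U + 2 * card M"
      using UX X(1) cU card_Diff_subset[of "\<Union>M" X] card_mono[OF X(1) UX] finite_subset[OF UX X(1)] by (simp add: U_def)
    then have evU: "even (card U)" using X(2) by simp
    obtain a where a: "a \<in> U" using U by blast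
    show False
    proof (cases "\<exists>b\<in>U. v b \<notin> nbh v M (v a)")
      case True
      then obtain b where b: "b \<in> U" "v b \<notin> nbh v M (v a)" by blast
      have "insert {a, b} M \<in> ?P" "{a, b} \<notin> M"
        using add_pair[OF M, of a b] a b by (auto simp: U_def)
      then show False using max[of "insert {a, b} M"] finM by simp
    next
      case False
      note deg' = card_nbh[OF M'(1) deg]
      have "U \<subseteq> (\<Union>x\<in>nbh v M (v a). {h\<in>X. v h = x})" using False by (auto simp: U_def)
      then have "card U \<le> card (\<Union>x\<in>nbh v M (v a). {h\<in>X. v h = x})"
        using deg'(2) X(1) by (intro card_mono) auto
      also have "\<dots> \<le> (\<Sum>x\<in>nbh v M (v a). card {h\<in>X. v h = x})" by (rule card_UN_le[OF deg'(2)])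
      also have "\<dots> \<le> card (nbh v M (v a)) * D" using sum_bounded_above[of "nbh v M (v a)" "\<lambda>x. card {h\<in>X. v h = x}" D] D by simp
      also have "\<dots> \<le> Suc D * D" using deg'(1) by (rule mult_le_mono1)
      finally have cU2: "card U \<le> Suc D * D" .
      have "card U \<noteq> 1" using evU by auto
      then have "U \<noteq> {a}" by auto
      then obtain b where b: "b \<in> U" "b \<noteq> a" using a by blast
      \<comment> \<open>Excluding \<open>v c = v b\<close> as well guarantees that \<open>{b, d}\<close> does not become parallel to the new pair \<open>{a, c}\<close>.\<close>
      let ?S = "insert (v b) (nbh v M (v a))"
      have S: "finite ?S" "card ?S \<le> Suc (Suc D)" using deg'(1,2)[of "v a"] by (auto simp: card_insert_if)
      have "card (darts M) \<le> card {(c, d) \<in> darts M. v c \<notin> ?S \<and> v d \<notin> nbh v M (v b)} + (Suc (Suc D) + Suc D) * D"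
        by (rule card_far_darts[OF M'(1) deg S deg'(2,1)])
      moreover have "2 * card M \<le> card (darts M)"
      proof -
        have "card (\<Union>M) = (\<Sum>h\<in>\<Union>M. 1)" by simp
        also have "\<dots> \<le> (\<Sum>h\<in>\<Union>M. card {e\<in>M. h \<in> e})"
          using finM by (intro sum_mono) (auto simp: Suc_le_eq card_gt_0_iff)
        also have "\<dots> \<le> (\<Sum>h\<in>X. card {e\<in>M. h \<in> e})" using UX X(1) by (intro sum_mono2) auto
        finally show ?thesis using card_darts(1)[OF X(1) M'(1)] cU by simp
      qed
      ultimately have "0 < card {(c, d) \<in> darts M. v c \<notin> ?S \<and> v d \<notin> nbh v M (v b)}"
        using cU2 cardU large by linarith
      then have "{(c, d) \<in> darts M. v c \<notin> ?S \<and> v d \<notin> nbh v M (v b)} \<noteq> {}"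
        by (rule contrapos_pn) (simp only: card.empty less_irrefl not_False_eq_True)
      then obtain c d where cd: "(c, d) \<in> darts M" "v c \<notin> ?S" "v d \<notin> nbh v M (v b)" by blast
      have cdM: "{c, d} \<in> M" "c \<noteq> d" using cd(1) by (auto simp: darts_def)
      have vcd: "v c \<noteq> v d" using M'(3)[OF cdM(1)] by auto
      let ?M1 = "M - {{c, d}}"
      have M1: "?M1 \<in> ?P" by (rule remove_pair[OF M])
      have cd_free: "c \<notin> \<Union>?M1" "d \<notin> \<Union>?M1"
      proof -
        have "e \<inter> {c, d} = {}" if "e \<in> ?M1" for e
          using pairwiseD[OF M'(2) _ cdM(1), of e] that by (auto simp: disjnt_def)
        then show "c \<notin> \<Union>?M1" "d \<notin> \<Union>?M1" by blast+
      qed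
      have inX: "c \<in> X" "d \<in> X" "a \<in> X" "b \<in> X" using cdM M'(1) a b by (auto simp: U_def)
      have ab_free: "a \<notin> \<Union>M" "b \<notin> \<Union>M" using a b by (auto simp: U_def)
      have n1: "v c \<notin> nbh v ?M1 (v a)" using cd(2) nbh_mono[of ?M1 M v "v a"] by blast
      let ?M2 = "insert {a, c} ?M1"
      have M2: "?M2 \<in> ?P" "{a, c} \<notin> ?M1"
        using add_pair[OF M1 inX(3,1) _ cd_free(1) n1] ab_free by auto
      have n2: "v d \<notin> nbh v ?M2 (v b)"
      proof
        assume "v d \<in> nbh v ?M2 (v b)"
        then have "v d \<in> nbh v ?M1 (v b) \<or> v a = v b \<and> v d = v c \<or> v c = v b \<and> v d = v a" by (rule nbh_insert)
        then show False using cd vcd nbh_mono[of ?M1 M v "v b"] by auto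
      qed
      have b2: "b \<notin> \<Union>?M2" using ab_free b(2) cdM by auto
      have d2: "d \<notin> \<Union>?M2" using cd_free(2) cdM ab_free by auto
      have M3: "insert {b, d} ?M2 \<in> ?P" "{b, d} \<notin> ?M2"
        using add_pair[OF M2(1) inX(4,2) b2 d2 n2] by auto
      have "card (insert {b, d} ?M2) = Suc (card M)"
      proof -
        have "card (insert {b, d} ?M2) = Suc (card ?M2)" using M3(2) finM by (intro card_insert_disjoint) auto
        also have "card ?M2 = Suc (card ?M1)" using M2(2) finM by (intro card_insert_disjoint) auto
        also have "Suc (card ?M1) = card M" by (rule card_Suc_Diff1[OF finM cdM(1)])
        finally show ?thesis .
      qed
      then show False using max[OF M3(1)] by simp
    qed
  qed
  have "card {e\<in>M. h \<in> e} = 1" if "h \<in> X" for h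
  proof -
    have "{e\<in>M. h \<in> e} \<noteq> {}" using that \<open>\<Union>M = X\<close> by auto
    then have "0 < card {e\<in>M. h \<in> e}" using finM by (simp add: card_gt_0_iff)
    then show ?thesis using deg[of h] by simp
  qed
  then have "M \<in> realisations X v (\<lambda>_. 1)" using M' by (auto simp: realisations_def)
  then show ?thesis by blast
qed

section \<open>Regular graphs and the configuration model\<close>

lemma card_realisation:
  assumes X: "finite X" and G: "G \<in> realisations X v dg"
  shows "2 * card ((`) v ` G) = (\<Sum>h\<in>X. dg h)"
proof -
  have G': "G \<subseteq> {e. e \<subseteq> X \<and> card e = 2}" "\<And>h. h \<in> X \<Longrightarrow> card {e\<in>G. h \<in> e} = dg h" "inj_on ((`) v) G"
    using G by (auto simp: realisations_def)
  have finG: "finite G" using G'(1) X by (auto intro: finite_subset[of G "Pow X"])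
  have "(\<Sum>h\<in>X. dg h) = (\<Sum>h\<in>X. card {e\<in>G. h \<in> e})" using G'(2) by simp
  also have "\<dots> = (\<Sum>h\<in>X. \<Sum>e\<in>G. if h \<in> e then 1 else 0)"
    using finG by (simp add: sum.inter_filter[symmetric])
  also have "\<dots> = (\<Sum>e\<in>G. \<Sum>h\<in>X. if h \<in> e then 1 else 0)" by (rule sum.swap)
  also have "\<dots> = (\<Sum>e\<in>G. 2)"
  proof (rule sum.cong[OF refl])
    fix e assume "e \<in> G"
    then have e: "e \<subseteq> X" "card e = 2" using G'(1) by auto
    have "(\<Sum>h\<in>X. if h \<in> e then 1 else 0) = card {h\<in>X. h \<in> e}" using X by (simp add: sum.inter_filter[symmetric])
    also have "{h\<in>X. h \<in> e} = e" using e by auto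
    finally show "(\<Sum>h\<in>X. if h \<in> e then 1 else 0) = (2::nat)" using e by simp
  qed
  also have "\<dots> = 2 * card G" by simp
  finally show ?thesis using card_image[OF G'(3)] by simp
qed

definition realisation_pmf :: "'h set \<Rightarrow> ('h \<Rightarrow> 'v) \<Rightarrow> ('h \<Rightarrow> nat) \<Rightarrow> 'v set set pmf" where
  "realisation_pmf X v dg = map_pmf (\<lambda>G. (`) v ` G) (pmf_of_set (realisations X v dg))"

text \<open>As soon as \<open>n\<close> is large compared with \<open>D\<close> and \<open>F\<close> has at most \<open>n / 8\<close> edges, the number of available
  darts in \<open>switching_step\<close> is at least \<open>n / 2\<close>, whence the factor \<open>2 D\<^sup>2 / n\<close> for each edge.\<close>

lemma realisation_pmf_props:
  fixes X :: "'h set" and v :: "'h \<Rightarrow> nat" and n D :: nat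
  assumes X: "finite X" "v ` X \<subseteq> {1..n}" and D: "\<And>x. (\<Sum>h\<in>{h\<in>X. v h = x}. dg h) \<le> D"
    and S: "n \<le> (\<Sum>h\<in>X. dg h)" and n: "8 * (Suc D * D) \<le> n" "1 \<le> n" and ne: "realisations X v dg \<noteq> {}"
  shows "set_pmf (realisation_pmf X v dg) \<subseteq> Pow (all_edges n)"
    and "\<And>E. E \<in> set_pmf (realisation_pmf X v dg) \<Longrightarrow> 2 * card E = (\<Sum>h\<in>X. dg h)"
    and "\<And>F. F \<subseteq> all_edges n \<Longrightarrow> real (card F) \<le> 1 / 8 * real n \<Longrightarrow>
      measure_pmf.prob (realisation_pmf X v dg) {E. F \<subseteq> E} \<le> (max 1 (2 * real D ^ 2) / real n) ^ card F"
proof -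
  interpret degree_bound X v dg D by unfold_locales (use X D in auto)
  let ?R = "realisations X v dg"
  note fin = finite_realisations
  have supp: "set_pmf (realisation_pmf X v dg) = (\<lambda>G. (`) v ` G) ` ?R"
    unfolding realisation_pmf_def using fin ne by simp
  show "set_pmf (realisation_pmf X v dg) \<subseteq> Pow (all_edges n)"
  proof -
    have "v ` e \<in> all_edges n" if "G \<in> ?R" "e \<in> G" for G e
    proof -
      have "e \<subseteq> X" "card (v ` e) = 2" using that by (auto simp: realisations_def)
      then show ?thesis using X(2) by (auto simp: all_edges_def)
    qed
    then show ?thesis unfolding supp by auto
  qed
  show "2 * card E = (\<Sum>h\<in>X. dg h)" if "E \<in> set_pmf (realisation_pmf X v dg)" for E
    using that card_realisation[OF X(1)] unfolding supp by auto
  show "measure_pmf.prob (realisation_pmf X v dg) {E. F \<subseteq> E} \<le> (max 1 (2 * real D ^ 2) / real n) ^ card F"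
    if F: "F \<subseteq> all_edges n" "real (card F) \<le> 1 / 8 * real n" for F
  proof -
  have finF: "finite F" using F(1) by (rule finite_subset) (auto simp: all_edges_def intro: finite_subset[of _ "Pow {1..n}"])
  have c2: "card f = 2" if "f \<in> F" for f using that F(1) by (auto simp: all_edges_def)
  let ?r = "2 * real D ^ 2 / n"
  have nR: "0 < real n" using n by simp
  have S': "real n \<le> real deg_sum" using S by (simp only: of_nat_le_iff)
  have "real (8 * (Suc D * D)) \<le> real n" using n(1) by (simp only: of_nat_le_iff)
  then have n8: "8 * real (Suc D * D) \<le> real n" by (simp only: of_nat_mult of_nat_numeral)
  have w: "real n / 2 \<le> real deg_sum - 2 * real (card F) - 2 * real (Suc D * D)"
    using F(2) S' n8 by linarith
  have "measure_pmf.prob (realisation_pmf X v dg) {E. F \<subseteq> E} = measure_pmf.prob (pmf_of_set ?R) {G. F \<subseteq> (`) v ` G}"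
    unfolding realisation_pmf_def by (simp add: vimage_def)
  also have "\<dots> = real (card (containing F)) / real (card ?R)"
    unfolding measure_pmf_of_set[OF ne fin] containing_def by (simp add: Int_def)
  also have "\<dots> \<le> ?r ^ card F"
  proof -
    have cR: "0 < real (card ?R)" using ne fin by (simp add: card_gt_0_iff)
    have "real (card (containing F)) \<le> ?r ^ card F * card ?R"
    proof (rule card_containing_le[OF finF c2])
      have "real (D * D) = ?r * (real n / 2)" using nR by (simp add: power2_eq_square)
      also have "\<dots> \<le> ?r * (real deg_sum - 2 * real (card F) - 2 * real (Suc D * D))" using w by (intro mult_left_mono) auto
      finally show "real (D * D) \<le> ?r * (real deg_sum - 2 * real (card F) - 2 * real (Suc D * D))" .
      show "0 < real deg_sum - 2 * real (card F) - 2 * real (Suc D * D)" using w nR by linarith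
    qed auto
    then show ?thesis using cR by (simp add: pos_divide_le_eq)
  qed
  also have "\<dots> \<le> (max 1 (2 * real D ^ 2) / real n) ^ card F" by (intro power_mono divide_right_mono) auto
  finally show ?thesis .
  qed
qed

lemma finite_half_edges: "finite (half_edges n d)"
  by (auto simp: half_edges_def)

lemma card_half_edges: "card (half_edges n d) = (\<Sum>i=1..n. d i)"
  by (simp add: half_edges_def)

lemma half_edges_at: "{h\<in>half_edges n d. fst h = x} = (if x \<in> {1..n} then Pair x ` {..<d x} else {})"
  by (auto simp: half_edges_def)

lemma card_half_edges_at: "card {h\<in>half_edges n d. fst h = x} = (if x \<in> {1..n} then d x else 0)"
  unfolding half_edges_at by (simp add: card_image inj_on_def)

lemma half_edge_pairing_exists:
  assumes "\<And>i. i \<in> {1..n} \<Longrightarrow> d i \<le> D" "even (\<Sum>i=1..n. d i)" "n \<le> (\<Sum>i=1..n. d i)"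
    "Suc (Suc D * D) + (Suc (Suc D) + Suc D) * D < n"
  shows "realisations (half_edges n d) fst (\<lambda>_. 1) \<noteq> {}"
proof (rule simple_pairing_exists[OF finite_half_edges])
  show "even (card (half_edges n d))" using assms(2) by (simp add: card_half_edges)
  show "card {h\<in>half_edges n d. fst h = x} \<le> D" for x using assms(1)[of x] by (simp add: card_half_edges_at)
  show "Suc (Suc D * D) + (Suc (Suc D) + Suc D) * D < card (half_edges n d)"
    unfolding card_half_edges using assms(3,4) by (rule less_le_trans[rotated])
qed

text \<open>A simple pairing of half-edges projects to a simple graph with the right degrees.  This provides the
  existence of regular graphs.\<close>

lemma project_realisation:
  assumes M: "M \<in> realisations (half_edges n d) fst (\<lambda>_. 1)"
  shows "(`) fst ` M \<in> realisations {1..n} id d"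
proof -
  let ?H = "half_edges n d"
  have M': "M \<subseteq> {e. e \<subseteq> ?H \<and> card e = 2}" "\<And>h. h \<in> ?H \<Longrightarrow> card {e\<in>M. h \<in> e} = 1"
    "\<And>e. e \<in> M \<Longrightarrow> card (fst ` e) = 2" "inj_on ((`) fst) M" using M by (auto simp: realisations_def)
  have deg: "card {e \<in> (`) fst ` M. i \<in> e} = d i" if i: "i \<in> {1..n}" for i
  proof -
    have "{e \<in> (`) fst ` M. i \<in> e} = (`) fst ` {m\<in>M. i \<in> fst ` m}" by auto
    then have "card {e \<in> (`) fst ` M. i \<in> e} = card {m\<in>M. i \<in> fst ` m}"
      using card_image[OF inj_on_subset[OF M'(4)], of "{m\<in>M. i \<in> fst ` m}"] by auto
    also have "{m\<in>M. i \<in> fst ` m} = (\<Union>h\<in>{h\<in>?H. fst h = i}. {m\<in>M. h \<in> m})" using M'(1) by auto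
    also have "card \<dots> = (\<Sum>h\<in>{h\<in>?H. fst h = i}. card {m\<in>M. h \<in> m})"
    proof (rule card_UN_disjoint)
      show "finite {h\<in>?H. fst h = i}" using finite_half_edges by simp
      show "\<forall>h\<in>{h\<in>?H. fst h = i}. finite {m\<in>M. h \<in> m}"
        using M'(2) by (auto intro: card_ge_0_finite)
      show "\<forall>h\<in>{h\<in>?H. fst h = i}. \<forall>h'\<in>{h\<in>?H. fst h = i}. h \<noteq> h' \<longrightarrow> {m\<in>M. h \<in> m} \<inter> {m\<in>M. h' \<in> m} = {}"
      proof (intro ballI impI)
        fix h h' assume h: "h \<in> {h\<in>?H. fst h = i}" "h' \<in> {h\<in>?H. fst h = i}" "h \<noteq> h'"
        have False if "m \<in> M" "h \<in> m" "h' \<in> m" for m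
        proof -
          have "card m = 2" using that M'(1) by auto
          then have "m = {h, h'}" using that h(3) by (auto simp: card_2_iff)
          then have "fst ` m = {i}" using h by auto
          then show False using M'(3)[OF that(1)] by simp
        qed
        then show "{m\<in>M. h \<in> m} \<inter> {m\<in>M. h' \<in> m} = {}" by blast
      qed
    qed
    also have "\<dots> = card {h\<in>?H. fst h = i}" using M'(2) by simp
    also have "\<dots> = d i" using i by (simp add: card_half_edges_at)
    finally show ?thesis .
  qed
  have sub: "fst ` m \<subseteq> {1..n}" if "m \<in> M" for m
  proof -
    have "m \<subseteq> ?H" using that M'(1) by auto
    then show ?thesis by (auto simp: half_edges_def)
  qed
  show ?thesis unfolding realisations_def using deg sub M'(3) by (auto simp: image_id)
qed

lemma regular_realisation: "random_regular d n = realisation_pmf {1..n} id (\<lambda>_. d)"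
proof -
  have "regular_graphs d n = realisations {1..n} id (\<lambda>_. d)"
    unfolding regular_graphs_def realisations_def all_edges_def by (auto simp: inj_on_def)
  then show ?thesis by (simp add: random_regular_def realisation_pmf_def image_id id_def[symmetric] map_pmf_id[unfolded id_def])
qed

lemma cond_pmf_of_set:
  assumes "finite A" "A \<inter> B \<noteq> {}"
  shows "cond_pmf (pmf_of_set A) B = pmf_of_set (A \<inter> B)"
proof (rule pmf_eqI)
  fix x
  have ne: "A \<noteq> {}" using assms by auto
  have "set_pmf (pmf_of_set A) \<inter> B \<noteq> {}" using assms ne by simp
  moreover have "0 < card (A \<inter> B)" "0 < card A" using assms ne by (auto simp: card_gt_0_iff)
  ultimately show "pmf (cond_pmf (pmf_of_set A) B) x = pmf (pmf_of_set (A \<inter> B)) x"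
    using assms ne by (simp add: pmf_cond measure_pmf_of_set indicator_def field_simps)
qed

text \<open>A pairing gives a simple multigraph iff its projection has neither loops nor parallel edges, and a
  uniform pairing conditioned on this event is uniform on the simple pairings.\<close>

lemma configuration_realisation:
  assumes "realisations (half_edges n d) fst (\<lambda>_. 1) \<noteq> {}"
  shows "simple_configuration_graph n d = realisation_pmf (half_edges n d) fst (\<lambda>_. 1)"
proof -
  let ?H = "half_edges n d"
  let ?f = "\<lambda>M. image_mset (\<lambda>p. fst ` p) (mset_set M) :: nat set multiset"
  let ?R = "realisations ?H fst (\<lambda>_. 1)"
  have finM: "finite M" if "M \<in> pairings ?H" for M
    using that finite_half_edges[of n d] finite_elements by (auto simp: pairings_def)
  have fin: "finite (pairings ?H)"
    by (rule finite_subset[of _ "Pow (Pow ?H)"]) (auto simp: pairings_def partition_on_def finite_half_edges)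
  have simple: "simple_multigraph (?f M) \<longleftrightarrow> (\<forall>e\<in>M. card (fst ` e) = 2) \<and> inj_on ((`) fst) M" if "finite M" for M
  proof -
    have cnt: "count (?f M) x = card {e\<in>M. fst ` e = x}" for x
      using that by (simp add: count_image_mset' sum.If_cases Int_def conj_commute eq_commute) 
    have "(\<forall>e\<in>M. card {e'\<in>M. fst ` e' = fst ` e} = 1) \<longleftrightarrow> inj_on ((`) fst) M"
    proof
      assume *: "\<forall>e\<in>M. card {e'\<in>M. fst ` e' = fst ` e} = 1"
      show "inj_on ((`) fst) M"
      proof (rule inj_onI)
        fix e e' assume e: "e \<in> M" "e' \<in> M" "fst ` e = fst ` e'"
        have "card {e'\<in>M. fst ` e' = fst ` e} = 1" using * e(1) by blast
        then obtain z where "{e'\<in>M. fst ` e' = fst ` e} = {z}" by (rule card_1_singletonE)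
        then have "e = z" "e' = z" using e by auto
        then show "e = e'" by simp
      qed
    next
      assume inj: "inj_on ((`) fst) M"
      have "{e'\<in>M. fst ` e' = fst ` e} = {e}" if "e \<in> M" for e using inj that by (auto simp: inj_on_def)
      then show "\<forall>e\<in>M. card {e'\<in>M. fst ` e' = fst ` e} = 1" by simp
    qed
    then show ?thesis using that by (simp add: simple_multigraph_def cnt ball_conj_distrib)
  qed
  have pair_iff: "M \<in> pairings ?H \<longleftrightarrow> M \<subseteq> {e. e \<subseteq> ?H \<and> card e = 2} \<and> (\<forall>h\<in>?H. card {e\<in>M. h \<in> e} = 1)" for M
  proof
    assume M: "M \<in> pairings ?H"
    then have p: "\<Union>M = ?H" "disjoint M" "\<And>e. e \<in> M \<Longrightarrow> card e = 2" by (auto simp: pairings_def partition_on_def)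
    have "card {e\<in>M. h \<in> e} = 1" if h: "h \<in> ?H" for h
    proof -
      obtain e where e: "e \<in> M" "h \<in> e" using p(1) h by blast
      have "{e\<in>M. h \<in> e} = {e}" using e p(2) by (auto simp: pairwise_def disjnt_def)
      then show ?thesis by simp
    qed
    then show "M \<subseteq> {e. e \<subseteq> ?H \<and> card e = 2} \<and> (\<forall>h\<in>?H. card {e\<in>M. h \<in> e} = 1)" using p by auto
  next
    assume M: "M \<subseteq> {e. e \<subseteq> ?H \<and> card e = 2} \<and> (\<forall>h\<in>?H. card {e\<in>M. h \<in> e} = 1)"
    have "\<Union>M = ?H"
    proof
      show "?H \<subseteq> \<Union>M"
      proof
        fix h assume "h \<in> ?H"
        then have "card {e\<in>M. h \<in> e} = 1" using M by blast
        then obtain e where "{e\<in>M. h \<in> e} = {e}" by (rule card_1_singletonE)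
        then show "h \<in> \<Union>M" by blast
      qed
    qed (use M in auto)
    moreover have "disjoint M"
    proof (rule pairwiseI)
      fix e e' assume e: "e \<in> M" "e' \<in> M" "e \<noteq> e'"
      have False if "h \<in> e" "h \<in> e'" for h
      proof -
        have "h \<in> ?H" using that e M by auto
        then have "card {e\<in>M. h \<in> e} = 1" using M by blast
        then obtain z where "{e\<in>M. h \<in> e} = {z}" by (rule card_1_singletonE)
        then have "e = z" "e' = z" using e that by auto
        then show False using e by simp
      qed
      then show "disjnt e e'" by (auto simp: disjnt_def)
    qed
    moreover have "{} \<notin> M" using M by auto
    ultimately show "M \<in> pairings ?H" using M by (auto simp: pairings_def partition_on_def)
  qed
  have R: "pairings ?H \<inter> ?f -` {G. simple_multigraph G} = ?R"
  proof (rule set_eqI)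
    fix M
    show "M \<in> pairings ?H \<inter> ?f -` {G. simple_multigraph G} \<longleftrightarrow> M \<in> ?R"
    proof (cases "M \<in> pairings ?H")
      case True
      have "simple_multigraph (?f M) \<longleftrightarrow> (\<forall>e\<in>M. card (fst ` e) = 2) \<and> inj_on ((`) fst) M"
        by (rule simple[OF finM[OF True]])
      then show ?thesis using True pair_iff[of M] unfolding realisations_def by simp
    next
      case False
      then have "M \<notin> ?R" unfolding pair_iff realisations_def by blast
      then show ?thesis using False by simp
    qed
  qed
  have ne: "pairings ?H \<noteq> {}" using assms R by auto
  have "cond_pmf (configuration_multigraph n d) {G. simple_multigraph G} =
      map_pmf ?f (cond_pmf (pmf_of_set (pairings ?H)) (?f -` {G. simple_multigraph G}))"
    unfolding configuration_multigraph_def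
    by (rule cond_map_pmf) (use assms R ne fin in auto)
  also have "cond_pmf (pmf_of_set (pairings ?H)) (?f -` {G. simple_multigraph G}) = pmf_of_set ?R"
    unfolding R[symmetric] by (rule cond_pmf_of_set[OF fin]) (use assms R in auto)
  finally have "simple_configuration_graph n d = map_pmf (set_mset \<circ> ?f) (pmf_of_set ?R)"
    unfolding simple_configuration_graph_def by (simp add: map_pmf_comp comp_def)
  also have "\<dots> = map_pmf (\<lambda>G. (`) fst ` G) (pmf_of_set ?R)"
  proof (rule map_pmf_cong[OF refl])
    fix M assume "M \<in> set_pmf (pmf_of_set ?R)"
    moreover have "finite ?R" using fin R by (metis finite_Int)
    ultimately have "M \<in> pairings ?H" using assms R by auto
    then show "(set_mset \<circ> ?f) M = (`) fst ` M" using finM by simp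
  qed
  finally show ?thesis by (simp add: realisation_pmf_def)
qed

section \<open>Erdos-Renyi graphs\<close>

lemma finite_all_edges: "finite (all_edges n)"
  unfolding all_edges_def by (rule finite_subset[of _ "Pow {1..n}"]) auto

lemma card_all_edges: "card (all_edges n) = n choose 2"
  unfolding all_edges_def using n_subsets[of "{1..n}" 2] by simp

lemma erdos_renyi_contains:
  assumes p: "0 \<le> p" "p \<le> 1" and F: "F \<subseteq> all_edges n"
  shows "measure_pmf.prob (erdos_renyi n p) {E. F \<subseteq> E} = p ^ card F"
proof -
  let ?A = "all_edges n"
  let ?B = "\<lambda>e. if e \<in> F then {True} else UNIV"
  have "measure_pmf.prob (erdos_renyi n p) {E. F \<subseteq> E} =
      measure_pmf.prob (Pi_pmf ?A False (\<lambda>_. bernoulli_pmf p)) (Pi ?A ?B)"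
  proof -
    have "(\<lambda>f. {e \<in> ?A. f e}) -` {E. F \<subseteq> E} = Pi ?A ?B"
      using F by (auto simp: Pi_def split: if_splits)
    then show ?thesis unfolding erdos_renyi_def by simp
  qed
  also have "\<dots> = (\<Prod>e\<in>?A. measure_pmf.prob (bernoulli_pmf p) (?B e))"
    by (rule measure_Pi_pmf_Pi[OF finite_all_edges])
  also have "\<dots> = (\<Prod>e\<in>?A. if e \<in> F then p else 1)"
    using p by (intro prod.cong refl) (auto simp: measure_pmf_single)
  also have "\<dots> = p ^ card F"
    using F finite_all_edges[of n] by (simp add: prod.If_cases Int_absorb1)
  finally show ?thesis .
qed

lemma set_pmf_erdos_renyi: "set_pmf (erdos_renyi n p) \<subseteq> Pow (all_edges n)"
  by (auto simp: erdos_renyi_def)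

text \<open>Chebyshev's inequality.  The second moment is a sum of the containment probabilities of pairs of
  edges, \<open>p\<close> on the diagonal and \<open>p\<^sup>2\<close> off it.\<close>

lemma erdos_renyi_edges_concentrate:
  fixes n :: nat and p a :: real
  assumes p: "0 \<le> p" "p \<le> 1" and a: "0 < a"
  defines "\<mu> \<equiv> real (n choose 2) * p"
  shows "measure_pmf.prob (erdos_renyi n p) {E. \<mu> - a < real (card E)} \<ge> 1 - \<mu> / a\<^sup>2"
proof -
  let ?A = "all_edges n" and ?M = "measure_pmf (erdos_renyi n p)"
  let ?I = "\<lambda>F. indicat_real {E. F \<subseteq> E}"
  have finS: "finite (set_pmf (erdos_renyi n p))"
    by (rule finite_subset[OF set_pmf_erdos_renyi]) (simp add: finite_all_edges)
  have int[simp]: "integrable ?M f" for f :: "nat set set \<Rightarrow> real"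
    by (rule integrable_measure_pmf_finite[OF finS])
  define X where "X E = (\<Sum>e\<in>?A. ?I {e} E)" for E
  have X: "X E = real (card E)" if "E \<in> set_pmf (erdos_renyi n p)" for E
  proof -
    have "E \<subseteq> ?A" using that set_pmf_erdos_renyi by blast
    then have "?A \<inter> {e. e \<in> E} = E" by auto
    then show ?thesis unfolding X_def using finite_all_edges[of n] by (simp add: indicator_def sum.If_cases)
  qed
  have I: "measure_pmf.expectation (erdos_renyi n p) (?I F) = p ^ card F" if "F \<subseteq> ?A" for F
    using erdos_renyi_contains[OF p that] by simp
  have EX: "measure_pmf.expectation (erdos_renyi n p) X = \<mu>"
  proof -
    have "measure_pmf.expectation (erdos_renyi n p) X = (\<Sum>e\<in>?A. measure_pmf.expectation (erdos_renyi n p) (?I {e}))"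
      unfolding X_def by (rule Bochner_Integration.integral_sum) simp
    also have "\<dots> = (\<Sum>e\<in>?A. p)" by (intro sum.cong refl) (subst I; simp)
    finally show ?thesis by (simp add: card_all_edges \<mu>_def)
  qed
  have EX2: "measure_pmf.expectation (erdos_renyi n p) (\<lambda>E. (X E)\<^sup>2) \<le> \<mu> + \<mu>\<^sup>2"
  proof -
    have "(X E)\<^sup>2 = (\<Sum>e\<in>?A. \<Sum>f\<in>?A. ?I {e, f} E)" for E
      unfolding X_def power2_eq_square sum_product
      by (intro sum.cong refl) (auto simp: indicator_def)
    then have "measure_pmf.expectation (erdos_renyi n p) (\<lambda>E. (X E)\<^sup>2) =
        (\<Sum>e\<in>?A. \<Sum>f\<in>?A. measure_pmf.expectation (erdos_renyi n p) (?I {e, f}))"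
      by (simp add: Bochner_Integration.integral_sum)
    also have "\<dots> = (\<Sum>e\<in>?A. \<Sum>f\<in>?A. p ^ card {e, f})" by (intro sum.cong refl I) auto
    also have "\<dots> \<le> (\<Sum>e\<in>?A. \<Sum>f\<in>?A. (if f = e then p else 0) + p\<^sup>2)"
      using p by (intro sum_mono) (auto simp: card_insert_if power2_eq_square)
    also have "\<dots> = \<mu> + \<mu>\<^sup>2"
      using finite_all_edges[of n]
      by (simp add: sum.distrib card_all_edges \<mu>_def power2_eq_square algebra_simps)
    finally show ?thesis .
  qed
  have "measure_pmf.variance (erdos_renyi n p) X =
      measure_pmf.expectation (erdos_renyi n p) (\<lambda>E. (X E)\<^sup>2) - \<mu>\<^sup>2"
    using measure_pmf.variance_eq[of "erdos_renyi n p" X] EX by simp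
  then have var: "measure_pmf.variance (erdos_renyi n p) X \<le> \<mu>" using EX2 by simp
  have "measure_pmf.prob (erdos_renyi n p) {E. a \<le> \<bar>X E - \<mu>\<bar>} \<le> measure_pmf.variance (erdos_renyi n p) X / a\<^sup>2"
    using measure_pmf.Chebyshev_inequality[of X "erdos_renyi n p" a] a EX by simp
  also have "\<dots> \<le> \<mu> / a\<^sup>2" using var by (rule divide_right_mono) simp
  finally have 1: "measure_pmf.prob (erdos_renyi n p) {E. a \<le> \<bar>X E - \<mu>\<bar>} \<le> \<mu> / a\<^sup>2" .
  have "1 - measure_pmf.prob (erdos_renyi n p) {E. a \<le> \<bar>X E - \<mu>\<bar>} = measure_pmf.prob (erdos_renyi n p) (- {E. a \<le> \<bar>X E - \<mu>\<bar>})"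
    using measure_pmf.prob_compl[of "{E. a \<le> \<bar>X E - \<mu>\<bar>}" "erdos_renyi n p"] by (simp add: Compl_eq_Diff_UNIV)
  also have "\<dots> = measure_pmf.prob (erdos_renyi n p) (- {E. a \<le> \<bar>real (card E) - \<mu>\<bar>})"
    by (rule measure_prob_cong_0; rule ccontr) (use X in \<open>auto simp: set_pmf_iff\<close>)
  also have "\<dots> \<le> measure_pmf.prob (erdos_renyi n p) {E. \<mu> - a < real (card E)}"
    by (rule measure_pmf.finite_measure_mono) auto
  finally show ?thesis using 1 by linarith
qed

lemma tendsto_prob_1:
  fixes Fl :: "nat filter"
  assumes "eventually (\<lambda>n. 1 - f n \<le> measure_pmf.prob (p n) (A n)) Fl" "(f \<longlongrightarrow> 0) Fl"
  shows "((\<lambda>n. measure_pmf.prob (p n) (A n)) \<longlongrightarrow> 1) Fl"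
proof (rule tendsto_sandwich[OF assms(1) _ _ tendsto_const])
  show "((\<lambda>n. 1 - f n) \<longlongrightarrow> 1) Fl" using tendsto_diff[OF tendsto_const assms(2), of 1] by simp
qed (intro always_eventually allI measure_pmf.prob_le_1)

text \<open>The mean is \<open>l (n - 1) / 2\<close>; half of \<open>\<epsilon> n\<close> absorbs the difference to \<open>l n / 2\<close>, and the other half
  is the deviation in Chebyshev's inequality.\<close>

lemma erdos_renyi_many_edges:
  assumes l: "0 < l" and \<epsilon>: "0 < \<epsilon>"
  shows "(\<lambda>n. measure_pmf.prob (erdos_renyi n (l / n)) {E. (l / 2 - \<epsilon>) * n \<le> real (card E)}) \<longlonglongrightarrow> 1"
proof (rule tendsto_prob_1)
  show "(\<lambda>n. (2 * l / \<epsilon>\<^sup>2) * inverse (real n)) \<longlonglongrightarrow> 0"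
    using tendsto_mult[OF tendsto_const[of "2 * l / \<epsilon>\<^sup>2"] lim_inverse_n] by simp
  show "\<forall>\<^sub>F n in sequentially. 1 - (2 * l / \<epsilon>\<^sup>2) * inverse (real n) \<le>
      measure_pmf.prob (erdos_renyi n (l / n)) {E. (l / 2 - \<epsilon>) * n \<le> real (card E)}"
    using eventually_ge_at_top[of "nat \<lceil>l\<rceil> + nat \<lceil>l / \<epsilon>\<rceil> + 1"]
  proof eventually_elim
    case (elim n)
    have n: "1 \<le> n" "l \<le> n" "l / \<epsilon> \<le> n" using elim by linarith+
    let ?\<mu> = "real (n choose 2) * (l / n)" and ?a = "\<epsilon> * n / 2"
    have ch: "real (n choose 2) = real n * (real n - 1) / 2"
    proof -
      have "even (n * (n - 1))" by (cases n) auto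
      then have "2 * (n choose 2) = n * (n - 1)" unfolding choose_two by (rule even_two_times_div_two)
      then have "2 * real (n choose 2) = real n * real (n - 1)" by (metis of_nat_mult of_nat_numeral)
      then show ?thesis using n(1) by (simp add: of_nat_diff)
    qed
    have \<mu>: "?\<mu> = l * (real n - 1) / 2" unfolding ch using n(1) by (simp add: field_simps)
    have a: "0 < ?a" using n \<epsilon> by simp
    have "1 - ?\<mu> / ?a\<^sup>2 \<le> measure_pmf.prob (erdos_renyi n (l / n)) {E. ?\<mu> - ?a < real (card E)}"
      using n l by (intro erdos_renyi_edges_concentrate a) (auto simp: field_simps)
    also have "\<dots> \<le> measure_pmf.prob (erdos_renyi n (l / n)) {E. (l / 2 - \<epsilon>) * n \<le> real (card E)}"
    proof (rule measure_pmf.finite_measure_mono)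
      have "l \<le> \<epsilon> * n" using n(3) \<epsilon> by (simp add: field_simps)
      then have "(l / 2 - \<epsilon>) * n \<le> ?\<mu> - ?a" unfolding \<mu> by (simp add: field_simps)
      then show "{E. ?\<mu> - ?a < real (card E)} \<subseteq> {E. (l / 2 - \<epsilon>) * n \<le> real (card E)}" by auto
    qed simp
    finally have "1 - ?\<mu> / ?a\<^sup>2 \<le> measure_pmf.prob (erdos_renyi n (l / n)) {E. (l / 2 - \<epsilon>) * n \<le> real (card E)}" .
    moreover have "?\<mu> / ?a\<^sup>2 \<le> (2 * l / \<epsilon>\<^sup>2) * inverse (real n)"
    proof -
      have "?\<mu> \<le> l * real n / 2" unfolding \<mu> using l by (simp add: field_simps)
      then have "?\<mu> / ?a\<^sup>2 \<le> (l * real n / 2) / ?a\<^sup>2" by (rule divide_right_mono) simp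
      also have "\<dots> = (2 * l / \<epsilon>\<^sup>2) * inverse (real n)" using n(1) \<epsilon> by (simp add: field_simps power2_eq_square)
      finally show ?thesis .
    qed
    ultimately show ?case by linarith
  qed
qed

section \<open>Large loops in the three ensembles\<close>

text \<open>The common case of regular graphs and the configuration model.  The number of edges is half the sum of
  the degrees.\<close>

lemma realisation_large_loops:
  fixes X :: "nat \<Rightarrow> 'h set" and v :: "'h \<Rightarrow> nat" and dg :: "nat \<Rightarrow> 'h \<Rightarrow> nat" and p :: "nat \<Rightarrow> nat set set pmf"
    and \<theta> :: nat and u \<rho> :: real and Fl :: "nat filter"
  assumes u: "u \<in> {0..1}" and \<theta>: "\<theta> > 1" and \<rho>: "\<rho> > 2 * c_const \<theta> u" and Fl: "Fl \<le> sequentially"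
    and p: "eventually (\<lambda>n. p n = realisation_pmf (X n) v (dg n) \<and> realisations (X n) v (dg n) \<noteq> {}) Fl"
    and X: "\<And>n. finite (X n)" "\<And>n. v ` X n \<subseteq> {1..n}" and D: "\<And>n x. (\<Sum>h\<in>{h\<in>X n. v h = x}. dg n h) \<le> D"
    and S: "\<And>n. n \<le> (\<Sum>h\<in>X n. dg n h)"
    and dens: "((\<lambda>n. real (\<Sum>h\<in>X n. dg n h) / real n) \<longlongrightarrow> \<rho>) Fl"
  shows "\<forall>\<delta>>0. \<exists>\<eta>>0. \<exists>c>0. \<forall>t \<ge> T_bound \<theta> u \<rho> + \<delta>.
    ((\<lambda>n. measure_pmf.prob (p n) {E. large_loop_prob {1..n} E \<theta> t u \<eta> \<ge> c}) \<longlongrightarrow> 1) Fl"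
proof (rule random_graph_large_loops[OF u \<theta> \<rho> Fl])
  let ?C = "max 1 (2 * real D ^ 2)"
  show "1 \<le> ?C" "0 < (1 / 8 :: real)" by auto
  have props: "eventually (\<lambda>n. set_pmf (p n) \<subseteq> Pow (all_edges n) \<and>
      (\<forall>E\<in>set_pmf (p n). 2 * card E = (\<Sum>h\<in>X n. dg n h)) \<and>
      (\<forall>F\<subseteq>all_edges n. real (card F) \<le> 1 / 8 * real n \<longrightarrow> measure_pmf.prob (p n) {E. F \<subseteq> E} \<le> (?C / real n) ^ card F)) Fl"
    using p filter_leD[OF Fl eventually_ge_at_top[of "8 * (Suc D * D) + 1"]]
  proof eventually_elim
    case (elim n)
    then have n: "8 * (Suc D * D) \<le> n" "1 \<le> n" by auto
    from elim have e: "p n = realisation_pmf (X n) v (dg n)" "realisations (X n) v (dg n) \<noteq> {}" by auto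
    note r = realisation_pmf_props[OF X(1)[of n] X(2)[of n] D S n e(2)]
    show ?case unfolding e(1) using r by auto
  qed
  show "eventually (\<lambda>n. set_pmf (p n) \<subseteq> Pow (all_edges n)) Fl" using props by eventually_elim auto
  show "eventually (\<lambda>n. \<forall>F\<subseteq>all_edges n. real (card F) \<le> 1 / 8 * n \<longrightarrow>
      measure_pmf.prob (p n) {E. F \<subseteq> E} \<le> (?C / n) ^ card F) Fl" using props by eventually_elim auto
  fix \<epsilon> :: real assume \<epsilon>: "0 < \<epsilon>"
  have "eventually (\<lambda>n. \<rho> - 2 * \<epsilon> < real (\<Sum>h\<in>X n. dg n h) / real n) Fl"
    by (rule order_tendstoD(1)[OF dens]) (use \<epsilon> in simp)
  with props filter_leD[OF Fl eventually_ge_at_top[of 1]]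
  have "eventually (\<lambda>n. 1 - 0 \<le> measure_pmf.prob (p n) {E. (\<rho> / 2 - \<epsilon>) * n \<le> real (card E)}) Fl"
  proof eventually_elim
    case (elim n)
    have "(\<rho> / 2 - \<epsilon>) * n \<le> real (card E)" if "E \<in> set_pmf (p n)" for E
    proof -
      have "2 * card E = (\<Sum>h\<in>X n. dg n h)" using that elim(1) by blast
      then have "real (\<Sum>h\<in>X n. dg n h) = 2 * real (card E)" by (metis of_nat_mult of_nat_numeral)
      then have "\<rho> - 2 * \<epsilon> < 2 * real (card E) / n" using elim(3) by (simp only:)
      then show ?thesis using elim(2) by (simp add: field_simps)
    qed
    then have "measure_pmf.prob (p n) {E. (\<rho> / 2 - \<epsilon>) * n \<le> real (card E)} = 1"
      by (intro measure_pmf.prob_eq_1[THEN iffD2]) (auto simp: AE_measure_pmf_iff)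
    then show ?case by simp
  qed
  then show "((\<lambda>n. measure_pmf.prob (p n) {E. (\<rho> / 2 - \<epsilon>) * n \<le> real (card E)}) \<longlongrightarrow> 1) Fl"
    by (rule tendsto_prob_1) simp
qed

text \<open>Regular graphs are realisations with the vertices as points, and conditioned configuration graphs are
  realisations with the half-edges as points.  Realisations exist for all large \<open>n\<close> with an even sum of
  degrees.  In \<open>G(n, \<lambda>/n)\<close> the containment probabilities are powers of the edge probability.\<close>

theorem corollary2p8:
  fixes u :: real and \<theta> :: nat
  assumes "u \<in> {0..1}" and "\<theta> > 1"
  shows
    "(\<forall>d::nat. d \<ge> 3 \<longrightarrow> real d > 2 * c_const \<theta> u \<longrightarrow>
       (\<forall>\<delta>>0. \<exists>\<eta>>0. \<exists>c>0. \<forall>t \<ge> T_bound \<theta> u d + \<delta>.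
         ((\<lambda>n. measure_pmf.prob (random_regular d n)
             {E. large_loop_prob {1..n} E \<theta> t u \<eta> \<ge> c}) \<longlongrightarrow> 1)
           (inf sequentially (principal {n. even (n * d)})))) \<and>
     (\<forall>l::real. l > 0 \<longrightarrow> l > 2 * c_const \<theta> u \<longrightarrow>
       (\<forall>\<delta>>0. \<exists>\<eta>>0. \<exists>c>0. \<forall>t \<ge> T_bound \<theta> u l + \<delta>.
         (\<lambda>n. measure_pmf.prob (erdos_renyi n (l / n))
             {E. large_loop_prob {1..n} E \<theta> t u \<eta> \<ge> c}) \<longlonglongrightarrow> 1)) \<and>
     (\<forall>(d :: nat \<Rightarrow> nat \<Rightarrow> nat) (D::nat) (\<rho>::real).
       (\<forall>n. even (\<Sum>i=1..n. d n i)) \<longrightarrow>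
       (\<forall>n. \<forall>i\<in>{1..n}. 1 \<le> d n i \<and> d n i \<le> D) \<longrightarrow>
       (\<lambda>n. (\<Sum>i=1..n. real (d n i)) / real n) \<longlonglongrightarrow> \<rho> \<longrightarrow>
       \<rho> > 2 * c_const \<theta> u \<longrightarrow>
       (\<forall>\<delta>>0. \<exists>\<eta>>0. \<exists>c>0. \<forall>t \<ge> T_bound \<theta> u \<rho> + \<delta>.
         (\<lambda>n. measure_pmf.prob (simple_configuration_graph n (d n))
             {E. large_loop_prob {1..n} E \<theta> t u \<eta> \<ge> c}) \<longlonglongrightarrow> 1))"
proof (rule conjI[OF _ conjI])
  show "\<forall>d::nat. d \<ge> 3 \<longrightarrow> real d > 2 * c_const \<theta> u \<longrightarrow>
       (\<forall>\<delta>>0. \<exists>\<eta>>0. \<exists>c>0. \<forall>t \<ge> T_bound \<theta> u d + \<delta>.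
         ((\<lambda>n. measure_pmf.prob (random_regular d n)
             {E. large_loop_prob {1..n} E \<theta> t u \<eta> \<ge> c}) \<longlongrightarrow> 1)
           (inf sequentially (principal {n. even (n * d)})))"
  proof (intro allI impI)
    fix d :: nat and \<delta> :: real assume d: "3 \<le> d" and dc: "real d > 2 * c_const \<theta> u" and \<delta>: "0 < \<delta>"
    let ?Fl = "inf sequentially (principal {n. even (n * d)})"
    have ne: "eventually (\<lambda>n. random_regular d n = realisation_pmf {1..n} id (\<lambda>_. d) \<and>
        realisations {1..n} id (\<lambda>_. d) \<noteq> {}) ?Fl"
      unfolding eventually_inf_principal
      using eventually_gt_at_top[of "Suc (Suc d * d) + (Suc (Suc d) + Suc d) * d"]
    proof eventually_elim
      case (elim n)
      show ?case
      proof
        assume even: "n \<in> {n. even (n * d)}"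
        have "realisations (half_edges n (\<lambda>_. d)) fst (\<lambda>_. 1) \<noteq> {}"
          using even d elim by (intro half_edge_pairing_exists[of n _ d]) auto
        then obtain M where "M \<in> realisations (half_edges n (\<lambda>_. d)) fst (\<lambda>_. 1)" by blast
        from project_realisation[OF this] show "random_regular d n = realisation_pmf {1..n} id (\<lambda>_. d) \<and>
            realisations {1..n} id (\<lambda>_. d) \<noteq> {}" using regular_realisation by blast
      qed
    qed
    have dens: "((\<lambda>n. real (\<Sum>h\<in>{1..n}. d) / real n) \<longlongrightarrow> real d) ?Fl"
    proof (rule tendsto_mono[OF inf_le1])
      have "eventually (\<lambda>n. real d = real (\<Sum>h\<in>{1..n}. d) / real n) sequentially"
        using eventually_ge_at_top[of 1] by eventually_elim simp
      then show "(\<lambda>n. real (\<Sum>h\<in>{1..n}. d) / real n) \<longlonglongrightarrow> real d" by (rule tendsto_eventually[OF eventually_mono]) simp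
    qed
    have D: "(\<Sum>h\<in>{h\<in>{1..n}. id h = x}. d) \<le> d" for n x
    proof -
      have "card {h\<in>{1..n}. id h = x} \<le> card {x}" by (intro card_mono) auto
      then show ?thesis by simp
    qed
    have S: "n \<le> (\<Sum>h\<in>{1..n}. d)" for n using d by simp
    from realisation_large_loops[OF assms dc inf_le1 ne _ _ D S dens] \<delta>
    show "\<exists>\<eta>>0. \<exists>c>0. \<forall>t \<ge> T_bound \<theta> u d + \<delta>.
         ((\<lambda>n. measure_pmf.prob (random_regular d n)
             {E. large_loop_prob {1..n} E \<theta> t u \<eta> \<ge> c}) \<longlongrightarrow> 1) ?Fl" by auto
  qed
  show "\<forall>l::real. l > 0 \<longrightarrow> l > 2 * c_const \<theta> u \<longrightarrow>
       (\<forall>\<delta>>0. \<exists>\<eta>>0. \<exists>c>0. \<forall>t \<ge> T_bound \<theta> u l + \<delta>.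
         (\<lambda>n. measure_pmf.prob (erdos_renyi n (l / n))
             {E. large_loop_prob {1..n} E \<theta> t u \<eta> \<ge> c}) \<longlonglongrightarrow> 1)"
  proof (rule allI, rule impI, rule impI)
    fix l :: real assume l: "0 < l" "l > 2 * c_const \<theta> u"
    show "\<forall>\<delta>>0. \<exists>\<eta>>0. \<exists>c>0. \<forall>t \<ge> T_bound \<theta> u l + \<delta>.
         (\<lambda>n. measure_pmf.prob (erdos_renyi n (l / n))
             {E. large_loop_prob {1..n} E \<theta> t u \<eta> \<ge> c}) \<longlonglongrightarrow> 1"
    proof (rule random_graph_large_loops[OF assms l(2) order_refl])
      show "1 \<le> max 1 l" "0 < (1::real)" by auto
      show "\<forall>\<^sub>F n in sequentially. set_pmf (erdos_renyi n (l / real n)) \<subseteq> Pow (all_edges n)"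
        by (intro always_eventually allI set_pmf_erdos_renyi)
      show "\<forall>\<^sub>F n in sequentially. \<forall>F\<subseteq>all_edges n. real (card F) \<le> 1 * real n \<longrightarrow>
          measure_pmf.prob (erdos_renyi n (l / n)) {E. F \<subseteq> E} \<le> (max 1 l / n) ^ card F"
        using eventually_ge_at_top[of "nat \<lceil>l\<rceil> + 1"]
      proof eventually_elim
        case (elim n)
        have n: "l \<le> real n" "1 \<le> n" using elim by linarith+
        have p: "0 \<le> l / n" "l / n \<le> 1" using n l by (auto simp: field_simps)
        show ?case
        proof (intro allI impI)
          fix F assume "F \<subseteq> all_edges n"
          from erdos_renyi_contains[OF p this]
          show "measure_pmf.prob (erdos_renyi n (l / n)) {E. F \<subseteq> E} \<le> (max 1 l / n) ^ card F"
            using p by (simp only:) (intro power_mono divide_right_mono; simp)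
        qed
      qed
      show "(\<lambda>n. measure_pmf.prob (erdos_renyi n (l / n)) {E. (l / 2 - \<epsilon>) * n \<le> real (card E)}) \<longlonglongrightarrow> 1"
        if "0 < \<epsilon>" for \<epsilon> by (rule erdos_renyi_many_edges[OF l(1) that])
    qed
  qed
  show "\<forall>(d :: nat \<Rightarrow> nat \<Rightarrow> nat) (D::nat) (\<rho>::real).
       (\<forall>n. even (\<Sum>i=1..n. d n i)) \<longrightarrow>
       (\<forall>n. \<forall>i\<in>{1..n}. 1 \<le> d n i \<and> d n i \<le> D) \<longrightarrow>
       (\<lambda>n. (\<Sum>i=1..n. real (d n i)) / real n) \<longlonglongrightarrow> \<rho> \<longrightarrow>
       \<rho> > 2 * c_const \<theta> u \<longrightarrow>
       (\<forall>\<delta>>0. \<exists>\<eta>>0. \<exists>c>0. \<forall>t \<ge> T_bound \<theta> u \<rho> + \<delta>.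
         (\<lambda>n. measure_pmf.prob (simple_configuration_graph n (d n))
             {E. large_loop_prob {1..n} E \<theta> t u \<eta> \<ge> c}) \<longlonglongrightarrow> 1)"
  proof (rule allI, rule allI, rule allI, rule impI, rule impI, rule impI, rule impI)
    fix d :: "nat \<Rightarrow> nat \<Rightarrow> nat" and D :: nat and \<rho> :: real
    assume even: "\<forall>n. even (\<Sum>i=1..n. d n i)" and bnd: "\<forall>n. \<forall>i\<in>{1..n}. 1 \<le> d n i \<and> d n i \<le> D"
      and lim: "(\<lambda>n. (\<Sum>i=1..n. real (d n i)) / real n) \<longlonglongrightarrow> \<rho>" and \<rho>: "\<rho> > 2 * c_const \<theta> u"
    let ?X = "\<lambda>n. half_edges n (d n)"
    have sum: "(\<Sum>h\<in>?X n. 1) = (\<Sum>i=1..n. d n i)" for n using card_half_edges[of n "d n"] by simp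
    have S': "n \<le> (\<Sum>i=1..n. d n i)" for n
    proof -
      have "n = (\<Sum>i=1..n. 1)" by simp
      also have "\<dots> \<le> (\<Sum>i=1..n. d n i)" using bnd by (intro sum_mono) auto
      finally show ?thesis .
    qed
    have ne: "eventually (\<lambda>n. simple_configuration_graph n (d n) = realisation_pmf (?X n) fst (\<lambda>_. 1) \<and>
        realisations (?X n) fst (\<lambda>_. 1) \<noteq> {}) sequentially"
      using eventually_gt_at_top[of "Suc (Suc D * D) + (Suc (Suc D) + Suc D) * D"]
    proof eventually_elim
      case (elim n)
      have "realisations (?X n) fst (\<lambda>_. 1) \<noteq> {}"
        using even bnd S' elim by (intro half_edge_pairing_exists[of n _ D]) auto
      then show ?case using configuration_realisation by blast
    qed
    show "\<forall>\<delta>>0. \<exists>\<eta>>0. \<exists>c>0. \<forall>t \<ge> T_bound \<theta> u \<rho> + \<delta>.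
         (\<lambda>n. measure_pmf.prob (simple_configuration_graph n (d n))
             {E. large_loop_prob {1..n} E \<theta> t u \<eta> \<ge> c}) \<longlonglongrightarrow> 1"
    proof (rule realisation_large_loops[OF assms \<rho> order_refl ne])
      show "fst ` ?X n \<subseteq> {1..n}" for n by (auto simp: half_edges_def)
      show "(\<Sum>h\<in>{h\<in>?X n. fst h = x}. 1) \<le> D" for n x
        using bnd card_half_edges_at[of n "d n" x] by simp
      show "n \<le> (\<Sum>h\<in>?X n. 1)" for n unfolding sum by (rule S')
      show "(\<lambda>n. real (\<Sum>h\<in>?X n. 1) / real n) \<longlonglongrightarrow> \<rho>" unfolding sum using lim by simp
    qed (rule finite_half_edges)
  qed
qed

end
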